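(* Let $\mathscr L_1,\mathscr L_2,\mathscr L_3$ be complex separable Hilbert spaces. For functions $\Upsilon_{12}:\mathbb G_2\to\mathcal B(\mathscr L_1,\mathscr L_2)$ and $\Upsilon_{32}:\mathbb G_2\to\mathcal B(\mathscr L_3,\mathscr L_2)$, the following are equivalent: (1) there exists $\Upsilon_{31}\in H^\infty(\mathbb G_2,\mathcal B(\mathscr L_3,\mathscr L_1))$ with $\|\Upsilon_{31}\|_{\infty,\mathbb G_2}\le1$ such that $\Upsilon_{12}(z)\Upsilon_{31}(z)=\Upsilon_{32}(z)$ for every $z\in\mathbb G_2$; (2) for every finite subset $F=\{z_1,\dots,z_n\}\subset\mathbb P$ and for every $\mathcal B(\mathscr L_2)$-valued admissible kernel $k$ on $\mathbb P$, $$\Big[\Big(\Upsilon_{12}(z_i^{(2)},z_i^{(3)})\Upsilon_{12}(z_j^{(2)},z_j^{(3)})^*-\Upsilon_{32}(z_i^{(2)},z_i^{(3)})\Upsilon_{32}(z_j^{(2)},z_j^{(3)})^*\Big)\otimes k(z_i,z_j)\Big]_{i,j=1}^n\ge0;$$ (3) there exist completely positive kernels $\xi,\nabla:\mathbb P\times\mathbb P\to\mathcal B(C(\overline{\mathbb D}),\mathcal B(\mathscr L_2))$ and a weak kernel $\delta:\mathbb P\times\mathbb P\to\mathcal B(\mathscr L_2)$ such that for all $z,w\in\mathbb P$, $$\Upsilon_{12}(z^{(2)},z^{(3)})\Upsilon_{12}(w^{(2)},w^{(3)})^*-\Upsilon_{32}(z^{(2)},z^{(3)})\Upsilon_{32}(w^{(2)},w^{(3)})^*$$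 $$=\xi(z,w)\big(1-\mathrm J(z)\overline{\mathrm J(w)}\big)+\nabla(z,w)\big(1-\mathrm j(z)\overline{\mathrm j(w)}\big)+\Big(1-\frac{z^{(2)}\overline{w}^{(2)}}{4}\Big)\delta(z,w).$$
   Context: All Hilbert spaces are complex and separable; operators are bounded and linear; $\mathcal B(\mathcal X,\mathcal Y)$ denotes bounded linear maps from $\mathcal X$ to $\mathcal Y$ and $\mathcal B(\mathcal X)=\mathcal B(\mathcal X,\mathcal X)$. $\mathbb D$ is the open unit disc in $\mathbb C$, $\overline{\mathbb D}$ its closure, $C(\overline{\mathbb D})$ the space of continuous complex functions on $\overline{\mathbb D}$. The symmetrized bidisc is $\mathbb G_2=\{(\lambda_1+\lambda_2,\lambda_1\lambda_2):\lambda_1,\lambda_2\in\mathbb D\}\subset\mathbb C^2$. $H^\infty(\mathbb G_2,\mathcal B(\mathcal X,\mathcal Y))$ is the space of bounded $\mathcal B(\mathcal X,\mathcal Y)$-valued holomorphic functions on $\mathbb G_2$, with supremum norm $\|\cdot\|_{\infty,\mathbb G_2}$. The pentablock is $\mathbb P=\{(a_{21},\operatorname{tr}A,\det A)\in\mathbb C^3: A=[a_{ij}]\in M_2(\mathbb C),\ \|A\|<1\}$; points are written $z=(z^{(1)},z^{(2)},z^{(3)})$. If $z\in\mathbb P$ then $(z^{(2)},z^{(3)})\in\mathbb G_2$. For $\alpha\in\overline{\mathbb D}$ put $$\Phi_\alpha(z^{(2)},z^{(3)})=\frac{2\alpha z^{(3)}-z^{(2)}}{2-\alpha z^{(2)}},\qquad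 \psi_\alpha(z^{(1)},z^{(2)},z^{(3)})=\frac{(1-|\alpha|^2)z^{(1)}}{1-\alpha z^{(2)}+\alpha^2z^{(3)}}.$$ For $z\in\mathbb P$ define the continuous functions $\mathrm J(z),\mathrm j(z)\in C(\overline{\mathbb D})$ by $\mathrm J(z)(\alpha)=\psi_\alpha(z)$ and $\mathrm j(z)(\alpha)=\Phi_\alpha(z^{(2)},z^{(3)})$; both have supremum norm $<1$. For a Hilbert space $\mathscr L$, a function $k:\mathbb P\times\mathbb P\to\mathcal B(\mathscr L)$ is positive semi-definite (a $\mathcal B(\mathscr L)$-valued weak kernel) if $\sum_{i,j=1}^n\langle k(z_i,z_j)v_j,v_i\rangle\ge0$ for all $n$, $z_1,\dots,z_n\in\mathbb P$, $v_1,\dots,v_n\in\mathscr L$; it is a $\mathcal B(\mathscr L)$-valued kernel if moreover $k(z,z)\ne0$ for all $z\in\mathbb P$. A $\mathcal B(\mathscr L)$-valued kernel $k$ is admissible if for all $\alpha\in\overline{\mathbb D}$ the functions $(1-\tfrac{z^{(2)}\overline{w}^{(2)}}{4})k(z,w)$, $(1-\Phi_\alpha(z^{(2)},z^{(3)})\overline{\Phi_\alpha(w^{(2)},w^{(3)})})k(z,w)$ and $(1-\psi_\alpha(z)\overline{\psi_\alpha(w)})k(z,w)$ are positive semi-definite in $(z,w)$. A map $\xi:\mathbb P\times\mathbb P\to\mathcal B(C(\overline{\mathbb D}),\mathcal B(\mathscr L))$ is a completely positive kernel if $\sum_{i,j=1}^n\langle\xi(z_i,z_j)(h_i\overline{h_j})v_j,v_i\rangle\ge0$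 for all $n$, $z_i\in\mathbb P$, $h_i\in C(\overline{\mathbb D})$, $v_i\in\mathscr L$. *)

theory Defs
  imports "HOL-Analysis.Analysis"
begin

section \<open>Complex normed spaces and Hilbert spaces\<close>

class scaleC =
  fixes scaleC :: "complex \<Rightarrow> 'a \<Rightarrow> 'a"  (infixr \<open>*\<^sub>C\<close> 75)

class complex_vector = real_vector + scaleC +
  assumes scaleC_add_right: "a *\<^sub>C (x + y) = a *\<^sub>C x + a *\<^sub>C y"
    and scaleC_add_left: "(a + b) *\<^sub>C x = a *\<^sub>C x + b *\<^sub>C x"
    and scaleC_scaleC: "a *\<^sub>C (b *\<^sub>C x) = (a * b) *\<^sub>C x"
    and scaleC_one: "1 *\<^sub>C x = x"
    and scaleR_scaleC: "r *\<^sub>R x = complex_of_real r *\<^sub>C x"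

class complex_normed_vector = complex_vector + real_normed_vector +
  assumes norm_scaleC: "norm (a *\<^sub>C x) = cmod a * norm x"

text \<open>The inner product is linear in the first argument.\<close>

class complex_inner = complex_normed_vector +
  fixes cinner :: "'a \<Rightarrow> 'a \<Rightarrow> complex"
  assumes cinner_commute: "cinner x y = cnj (cinner y x)"
    and cinner_add_left: "cinner (x + y) z = cinner x z + cinner y z"
    and cinner_scaleC_left: "cinner (a *\<^sub>C x) y = a * cinner x y"
    and cinner_self: "cinner x x = complex_of_real ((norm x)\<^sup>2)"

class chilbert_space = complex_inner + banach

lemma scaleC_zero_left [simp]: "0 *\<^sub>C (x::'a::complex_vector) = 0"
  using scaleR_scaleC[of 0 x] by simp

lemma scaleC_zero_right [simp]: "a *\<^sub>C (0::'a::complex_vector) = 0"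
  using scaleC_add_right[of a 0 0] by simp

lemma scaleC_minus1: "(-1) *\<^sub>C (x::'a::complex_vector) = - x"
  using scaleR_scaleC[of "-1" x] by simp

lemma scaleC_minus_right: "a *\<^sub>C (- x::'a::complex_vector) = - (a *\<^sub>C x)"
  using scaleC_add_right[of a x "-x"] by (simp add: eq_neg_iff_add_eq_0 add.commute)

lemma scaleC_diff_right: "a *\<^sub>C (x - y::'a::complex_vector) = a *\<^sub>C x - a *\<^sub>C y"
  using scaleC_add_right[of a x "-y"] by (simp add: scaleC_minus_right)

lemma scaleC_scaleR_commute: "a *\<^sub>C (r *\<^sub>R x) = r *\<^sub>R (a *\<^sub>C (x::'a::complex_vector))"
  by (simp add: scaleR_scaleC scaleC_scaleC mult.commute)

lemma scaleC_sum_right: "a *\<^sub>C (\<Sum>i\<in>I. f i) = (\<Sum>i\<in>I. a *\<^sub>C (f i::'a::complex_vector))"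
  by (induction I rule: infinite_finite_induct) (auto simp: scaleC_add_right)

lemma cinner_add_right: "cinner x (y + z) = cinner x y + cinner x (z::'a::complex_inner)"
  by (metis cinner_add_left cinner_commute complex_cnj_add)

lemma cinner_scaleC_right: "cinner x (a *\<^sub>C y) = cnj a * cinner x (y::'a::complex_inner)"
  by (metis cinner_commute cinner_scaleC_left complex_cnj_mult)

lemma cinner_zero_left [simp]: "cinner 0 (x::'a::complex_inner) = 0"
  using cinner_scaleC_left[of 0 0 x] by simp

lemma cinner_zero_right [simp]: "cinner (x::'a::complex_inner) 0 = 0"
  using cinner_scaleC_right[of x 0 0] by simp

lemma cinner_minus_left: "cinner (- x) (y::'a::complex_inner) = - cinner x y"
  using cinner_scaleC_left[of "-1" x y] by (simp add: scaleC_minus1)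

lemma cinner_minus_right: "cinner x (- y::'a::complex_inner) = - cinner x y"
  using cinner_scaleC_right[of x "-1" y] by (simp add: scaleC_minus1)

lemma cinner_diff_left: "cinner (x - y) (z::'a::complex_inner) = cinner x z - cinner y z"
  using cinner_add_left[of x "-y" z] by (simp add: cinner_minus_left)

lemma cinner_diff_right: "cinner x (y - z::'a::complex_inner) = cinner x y - cinner x z"
  using cinner_add_right[of x y "-z"] by (simp add: cinner_minus_right)

lemma cinner_sum_left: "cinner (\<Sum>i\<in>I. f i) (y::'a::complex_inner) = (\<Sum>i\<in>I. cinner (f i) y)"
  by (induction I rule: infinite_finite_induct) (auto simp: cinner_add_left)

lemma cinner_sum_right: "cinner y (\<Sum>i\<in>I. f i) = (\<Sum>i\<in>I. cinner y (f i::'a::complex_inner))"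
  by (induction I rule: infinite_finite_induct) (auto simp: cinner_add_right)

lemma cinner_self_eq_0 [simp]: "cinner x x = 0 \<longleftrightarrow> x = (0::'a::complex_inner)"
  by (simp add: cinner_self)

lemma cinner_Cauchy_Schwarz: "cmod (cinner x y) \<le> norm x * norm (y::'a::complex_inner)"
proof (cases "y = 0")
  case False
  define a where "a = cinner x y"
  define n where "n = complex_of_real ((norm y)\<^sup>2)"
  have n0: "n \<noteq> 0" using False by (simp add: n_def)
  let ?w = "x - (a / n) *\<^sub>C y"
  have yx: "cinner y x = cnj a" by (metis a_def cinner_commute)
  have nn: "cnj n = n" by (simp add: n_def)
  have yy: "cinner y y = n" by (simp add: n_def cinner_self)
  have "cinner ?w ?w = cinner x x - a * cnj a / n"
    using n0 by (simp add: cinner_diff_left cinner_diff_right cinner_scaleC_left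
        cinner_scaleC_right yx nn yy flip: a_def)
  then have "complex_of_real ((norm ?w)\<^sup>2)
      = complex_of_real ((norm x)\<^sup>2 - (cmod a)\<^sup>2 / (norm y)\<^sup>2)"
    by (simp add: cinner_self n_def complex_norm_square[symmetric])
  then have "(norm ?w)\<^sup>2 = (norm x)\<^sup>2 - (cmod a)\<^sup>2 / (norm y)\<^sup>2"
    using of_real_eq_iff by blast
  then have "(cmod a)\<^sup>2 / (norm y)\<^sup>2 \<le> (norm x)\<^sup>2"
    by (metis diff_ge_0_iff_ge zero_le_power2)
  then have "(cmod a)\<^sup>2 \<le> (norm x * norm y)\<^sup>2"
    using False by (simp add: power_mult_distrib divide_le_eq)
  then show ?thesis
    by (metis a_def mult_nonneg_nonneg norm_ge_zero power2_le_imp_le)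
qed simp

lemma bounded_linear_cinner_left: "bounded_linear (\<lambda>x. cinner x (y::'a::complex_inner))"
  by (rule bounded_linear_intro[of _ "norm y"])
    (auto simp: cinner_add_left scaleR_scaleC cinner_scaleC_left scaleR_conv_of_real
      cinner_Cauchy_Schwarz)

lemma bounded_linear_cinner_right: "bounded_linear (\<lambda>y. cinner (x::'a::complex_inner) y)"
  by (rule bounded_linear_intro[of _ "norm x"])
    (auto simp: cinner_add_right scaleR_scaleC cinner_scaleC_right scaleR_conv_of_real
      cinner_Cauchy_Schwarz mult.commute[of _ "norm x"])

instantiation complex :: complex_normed_vector
begin
definition scaleC_complex :: "complex \<Rightarrow> complex \<Rightarrow> complex"
  where [simp]: "scaleC_complex a x = a * x"
instance
  by standard (auto simp: algebra_simps norm_mult scaleR_conv_of_real)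
end

instantiation prod :: (complex_vector, complex_vector) complex_vector
begin
definition scaleC_prod :: "complex \<Rightarrow> 'a \<times> 'b \<Rightarrow> 'a \<times> 'b"
  where "scaleC_prod a x = (a *\<^sub>C fst x, a *\<^sub>C snd x)"
instance
  by standard (auto simp: scaleC_prod_def scaleC_add_right scaleC_add_left scaleC_scaleC
      scaleC_one scaleR_scaleC prod_eq_iff)
end

lemma bounded_linear_scaleC_right: "bounded_linear (\<lambda>x::'a::complex_normed_vector. c *\<^sub>C x)"
  by (rule bounded_linear_intro[of _ "cmod c"])
    (auto simp: scaleC_add_right scaleC_scaleR_commute norm_scaleC)

instantiation blinfun :: (real_normed_vector, complex_normed_vector) complex_normed_vector
begin
lift_definition scaleC_blinfun :: "complex \<Rightarrow> ('a \<Rightarrow>\<^sub>L 'b) \<Rightarrow> ('a \<Rightarrow>\<^sub>L 'b)"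
  is "\<lambda>c f x. c *\<^sub>C f x"
  by (rule bounded_linear_compose[OF bounded_linear_scaleC_right])
instance
proof
  fix a :: complex and f :: "'a \<Rightarrow>\<^sub>L 'b"
  show "norm (a *\<^sub>C f) = cmod a * norm f"
  proof transfer
    fix a :: complex and f :: "'a \<Rightarrow> 'b"
    assume f: "bounded_linear f"
    have "onorm (\<lambda>x. a *\<^sub>C f x) = onorm (\<lambda>x. cmod a *\<^sub>R f x)"
      by (simp add: onorm_def norm_scaleC)
    then show "onorm (\<lambda>x. a *\<^sub>C f x) = cmod a * onorm f"
      using onorm_scaleR[OF f, of "cmod a"] by simp
  qed
qed (transfer, auto simp: scaleC_add_right scaleC_add_left scaleC_scaleC scaleC_one scaleR_scaleC)+
end

instantiation bcontfun :: (topological_space, complex_normed_vector) complex_normed_vector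
begin
definition scaleC_bcontfun :: "complex \<Rightarrow> ('a \<Rightarrow>\<^sub>C 'b) \<Rightarrow> ('a \<Rightarrow>\<^sub>C 'b)"
  where "scaleC_bcontfun c f = Bcontfun (\<lambda>x. c *\<^sub>C apply_bcontfun f x)"

lemma apply_bcontfun_scaleC:
  "apply_bcontfun (c *\<^sub>C f) x = c *\<^sub>C apply_bcontfun (f :: 'a \<Rightarrow>\<^sub>C 'b) x"
proof -
  have "bounded (range (\<lambda>x. c *\<^sub>C apply_bcontfun f x))"
    using bounded_linear_image[OF bounded_apply_bcontfun[of f] bounded_linear_scaleC_right[of c]]
    by (simp add: image_image)
  then have "(\<lambda>x. c *\<^sub>C apply_bcontfun f x) \<in> bcontfun"
    by (auto simp: bcontfun_def
        intro!: bounded_linear.continuous_on[OF bounded_linear_scaleC_right])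
  then show ?thesis by (simp add: scaleC_bcontfun_def Bcontfun_inverse)
qed

instance
proof
  fix a :: complex and f :: "'a \<Rightarrow>\<^sub>C 'b"
  have "norm (a *\<^sub>C f) = norm (cmod a *\<^sub>R f)"
    unfolding norm_bcontfun_def dist_bcontfun.rep_eq
    by (simp add: norm_scaleC apply_bcontfun_scaleC scaleR_bcontfun.rep_eq zero_bcontfun.rep_eq
        dist_norm)
  then show "norm (a *\<^sub>C f) = cmod a * norm f" by simp
qed (auto intro!: bcontfun_eqI simp: apply_bcontfun_scaleC scaleR_bcontfun.rep_eq
    plus_bcontfun.rep_eq scaleC_add_right scaleC_add_left scaleC_scaleC scaleC_one scaleR_scaleC)
end

section \<open>Bounded complex-linear operators and adjoints\<close>

text \<open>The type \<open>'a \<Rightarrow>\<^sub>L 'b\<close> consists of bounded real-linear maps; \<open>\<B>\<close> singles out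
  the complex-linear ones, as a subset carrying the operator norm.\<close>

definition cbounded :: "('a::complex_normed_vector \<Rightarrow>\<^sub>L 'b::complex_normed_vector) set"  (\<open>\<B>\<close>)
  where "\<B> = {T. \<forall>c x. blinfun_apply T (c *\<^sub>C x) = c *\<^sub>C blinfun_apply T x}"

definition cadjoint :: "('a::chilbert_space \<Rightarrow>\<^sub>L 'b::chilbert_space) \<Rightarrow> ('b \<Rightarrow>\<^sub>L 'a)"
  (\<open>(_\<^sup>\<star>)\<close> [1000] 999)
  where "T\<^sup>\<star> = (THE S. S \<in> \<B> \<and>
    (\<forall>x y. cinner (blinfun_apply T x) y = cinner x (blinfun_apply S y)))"

text \<open>Frechet differentiability with a complex-linear derivative, in the norm of \<open>'a\<close>
  (the operator norm for operator-valued functions).\<close>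

definition holomorphic_on_C2 ::
    "(complex \<times> complex \<Rightarrow> 'a::complex_normed_vector) \<Rightarrow> (complex \<times> complex) set \<Rightarrow> bool"
  where "holomorphic_on_C2 f S \<longleftrightarrow>
    (\<forall>z\<in>S. \<exists>D. (f has_derivative D) (at z) \<and> (\<forall>c h. D (c *\<^sub>C h) = c *\<^sub>C D h))"

definition Hinf :: "(complex \<times> complex) set \<Rightarrow>
    (complex \<times> complex \<Rightarrow> 'a::complex_normed_vector \<Rightarrow>\<^sub>L 'b::complex_normed_vector) set"
  where "Hinf S = {f. (\<forall>z\<in>S. f z \<in> \<B>) \<and> holomorphic_on_C2 f S \<and> bounded (f ` S)}"

definition sup_norm_on :: "'z set \<Rightarrow> ('z \<Rightarrow> 'a::real_normed_vector) \<Rightarrow> real"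
  where "sup_norm_on S f = (SUP z\<in>S. norm (f z))"

section \<open>Orthonormal bases\<close>

definition orthonormal :: "'a::complex_inner set \<Rightarrow> bool"
  where "orthonormal B \<longleftrightarrow> (\<forall>b\<in>B. norm b = 1) \<and> (\<forall>b\<in>B. \<forall>c\<in>B. b \<noteq> c \<longrightarrow> cinner b c = 0)"

definition is_onb :: "'a::complex_inner set \<Rightarrow> bool"
  where "is_onb B \<longleftrightarrow> orthonormal B \<and> (\<forall>x. (\<forall>b\<in>B. cinner x b = 0) \<longrightarrow> x = 0)"

definition onb :: "'a::chilbert_space set"
  where "onb = (SOME B. is_onb B)"

lemma is_onb_exists: "\<exists>B::'a::complex_inner set. is_onb B"
proof -
  have "\<exists>M\<in>Collect orthonormal. \<forall>X\<in>Collect orthonormal. M \<subseteq> X \<longrightarrow> X = (M::'a set)"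
  proof (rule subset_Zorn')
    fix C :: "'a set set"
    assume C: "subset.chain (Collect orthonormal) C"
    have "orthonormal (\<Union>C)"
      unfolding orthonormal_def
    proof (intro conjI ballI impI)
      fix b assume "b \<in> \<Union>C"
      then show "norm b = 1" using C by (auto simp: subset.chain_def orthonormal_def)
    next
      fix b c assume "b \<in> \<Union>C" "c \<in> \<Union>C" and ne: "b \<noteq> c"
      then obtain X Y where XY: "X \<in> C" "Y \<in> C" "b \<in> X" "c \<in> Y" by blast
      have "X \<subseteq> Y \<or> Y \<subseteq> X"
        using C XY(1,2) unfolding subset.chain_def by blast
      then obtain Z where "Z \<in> C" "b \<in> Z" "c \<in> Z" using XY by blast
      moreover from this have "orthonormal Z" using C by (auto simp: subset.chain_def)
      ultimately show "cinner b c = 0" using ne by (auto simp: orthonormal_def)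
    qed
    then show "\<Union>C \<in> Collect orthonormal" by simp
  qed
  then obtain M :: "'a set" where M: "orthonormal M" "\<And>X. orthonormal X \<Longrightarrow> M \<subseteq> X \<Longrightarrow> X = M"
    by blast
  have "x = 0" if x: "\<forall>b\<in>M. cinner x b = 0" for x
  proof (rule ccontr)
    assume "x \<noteq> 0"
    define y where "y = complex_of_real (inverse (norm x)) *\<^sub>C x"
    have y: "norm y = 1" using \<open>x \<noteq> 0\<close> by (simp add: y_def norm_scaleC norm_inverse)
    have yb: "cinner y b = 0" "cinner b y = 0" if "b \<in> M" for b
    proof -
      show "cinner y b = 0" using x that by (simp add: y_def cinner_scaleC_left)
      then show "cinner b y = 0" using cinner_commute[of b y] by simp
    qed
    have "orthonormal (insert y M)"
      using M(1) y yb by (auto simp: orthonormal_def)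
    then have "y \<in> M" using M(2) by blast
    then have "cinner y y = 0" using yb by blast
    then show False using y by auto
  qed
  with M(1) show ?thesis unfolding is_onb_def by blast
qed

lemma is_onb_onb: "is_onb (onb :: 'a::chilbert_space set)"
  unfolding onb_def by (rule someI_ex[OF is_onb_exists])

lemma orthonormal_onb: "orthonormal (onb :: 'a::chilbert_space set)"
  by (rule is_onb_onb[unfolded is_onb_def, THEN conjunct1])

lemma orthonormal_cinner:
  "orthonormal B \<Longrightarrow> b \<in> B \<Longrightarrow> c \<in> B \<Longrightarrow> cinner b c = (if b = c then 1 else 0)"
  by (auto simp: orthonormal_def cinner_self)

lemma orthonormal_cinner_sum:
  assumes "orthonormal B" "finite F" "F \<subseteq> B" "b \<in> B"
  shows "cinner (\<Sum>e\<in>F. c e *\<^sub>C e) b = (if b \<in> F then c b else 0)"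
proof -
  have "cinner (\<Sum>e\<in>F. c e *\<^sub>C e) b = (\<Sum>e\<in>F. if e = b then c e else 0)"
    unfolding cinner_sum_left cinner_scaleC_left
    using assms by (intro sum.cong) (auto simp: orthonormal_cinner subset_iff)
  then show ?thesis using assms(2) by simp
qed

lemma orthonormal_norm_sum:
  assumes "orthonormal B" "finite F" "F \<subseteq> B"
  shows "(norm (\<Sum>e\<in>F. c e *\<^sub>C e))\<^sup>2 = (\<Sum>e\<in>F. (cmod (c e))\<^sup>2)"
proof -
  let ?s = "\<Sum>e\<in>F. c e *\<^sub>C e"
  have "complex_of_real ((norm ?s)\<^sup>2) = cinner ?s ?s" by (simp add: cinner_self)
  also have "\<dots> = (\<Sum>e\<in>F. cnj (c e) * cinner ?s e)"
    by (subst cinner_sum_right) (simp add: cinner_scaleC_right)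
  also have "\<dots> = (\<Sum>e\<in>F. cnj (c e) * c e)"
    using assms by (intro sum.cong refl) (auto simp: orthonormal_cinner_sum subset_iff)
  also have "\<dots> = complex_of_real (\<Sum>e\<in>F. (cmod (c e))\<^sup>2)"
    unfolding of_real_sum by (simp only: complex_norm_square mult.commute)
  finally show ?thesis using of_real_eq_iff by blast
qed

lemma Bessel:
  assumes "orthonormal B" "finite F" "F \<subseteq> B"
  shows "(\<Sum>e\<in>F. (cmod (cinner x e))\<^sup>2) \<le> (norm x)\<^sup>2"
proof -
  let ?s = "\<Sum>e\<in>F. cinner x e *\<^sub>C e"
  have xs: "cinner x ?s = complex_of_real (\<Sum>e\<in>F. (cmod (cinner x e))\<^sup>2)"
    unfolding of_real_sum
    by (simp only: cinner_sum_right cinner_scaleC_right complex_norm_square mult.commute)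
  then have sx: "cinner ?s x = complex_of_real (\<Sum>e\<in>F. (cmod (cinner x e))\<^sup>2)"
    using cinner_commute[of ?s x] by (metis complex_cnj_complex_of_real)
  have ss: "cinner ?s ?s = complex_of_real (\<Sum>e\<in>F. (cmod (cinner x e))\<^sup>2)"
    by (simp only: cinner_self orthonormal_norm_sum[OF assms])
  have "complex_of_real ((norm (x - ?s))\<^sup>2) = cinner (x - ?s) (x - ?s)"
    by (simp add: cinner_self)
  also have "\<dots> = complex_of_real ((norm x)\<^sup>2 - (\<Sum>e\<in>F. (cmod (cinner x e))\<^sup>2))"
    by (simp only: cinner_diff_left cinner_diff_right xs sx ss cinner_self[of x]) simp
  finally have "(norm (x - ?s))\<^sup>2 = (norm x)\<^sup>2 - (\<Sum>e\<in>F. (cmod (cinner x e))\<^sup>2)"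
    using of_real_eq_iff by blast
  then show ?thesis by (metis diff_ge_0_iff_ge zero_le_power2)
qed

lemma orthonormal_summable_on:
  fixes B :: "'a::chilbert_space set"
  assumes B: "orthonormal B" and c: "(\<lambda>e. (cmod (c e))\<^sup>2) summable_on B"
  shows "(\<lambda>e. c e *\<^sub>C e) summable_on B"
proof -
  let ?f = "\<lambda>e. c e *\<^sub>C e" and ?g = "\<lambda>e. (cmod (c e))\<^sup>2"
  have "\<exists>P. eventually P (finite_subsets_at_top B) \<and>
      (\<forall>F F'. P F \<and> P F' \<longrightarrow> dist (sum ?f F) (sum ?f F') < e)" if "e > 0" for e
  proof -
    have e2: "(e/2)\<^sup>2 / 2 > 0" using that by simp
    obtain G where G: "finite G" "G \<subseteq> B" "dist (sum ?g G) (infsum ?g B) \<le> (e/2)\<^sup>2 / 2"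
      using infsum_finite_approximation[OF c e2] by blast
    define P where "P F \<longleftrightarrow> finite F \<and> G \<subseteq> F \<and> F \<subseteq> B" for F
    have "eventually P (finite_subsets_at_top B)"
      unfolding eventually_finite_subsets_at_top P_def using G by blast
    moreover have *: "dist (sum ?f F) (sum ?f G) < e/2" if "P F" for F
    proof -
      have F: "finite F" "G \<subseteq> F" "F \<subseteq> B" using that by (auto simp: P_def)
      have "(dist (sum ?f F) (sum ?f G))\<^sup>2 = (norm (sum ?f (F - G)))\<^sup>2"
        using F by (simp add: dist_norm sum_diff)
      also have "\<dots> = sum ?g (F - G)"
        by (rule orthonormal_norm_sum[OF B]) (use F in auto)
      also have "\<dots> = sum ?g F - sum ?g G" using F by (simp add: sum_diff)
      also have "\<dots> \<le> infsum ?g B - sum ?g G"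
        using finite_sum_le_infsum[OF c F(1,3)] by simp
      also have "\<dots> < (e/2)\<^sup>2" using G(3) e2 unfolding dist_real_def by linarith
      finally show ?thesis
        by (rule power_less_imp_less_base) (use \<open>e > 0\<close> in simp)
    qed
    have "dist (sum ?f F) (sum ?f F') < e" if "P F" "P F'" for F F'
      using *[OF that(1)] *[OF that(2)] dist_triangle_half_l by blast
    ultimately show ?thesis by blast
  qed
  then have "cauchy_filter (filtermap (sum ?f) (finite_subsets_at_top B))"
    by (simp add: cauchy_filter_metric_filtermap)
  moreover have "complete (UNIV::'a set)"
    by (meson Cauchy_convergent UNIV_I complete_def convergent_def)
  ultimately obtain L where "(sum ?f \<longlongrightarrow> L) (finite_subsets_at_top B)"
    using complete_uniform[where S=UNIV] by (force simp add: filterlim_def)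
  then show ?thesis using summable_on_def has_sum_def by blast
qed

lemma orthonormal_coeff_summable:
  assumes "orthonormal B"
  shows "(\<lambda>e. (cmod (cinner x e))\<^sup>2) summable_on B"
  by (rule nonneg_bdd_above_summable_on)
    (auto intro!: bdd_aboveI2[where M = "(norm x)\<^sup>2"] Bessel[OF assms])

lemma onb_has_sum:
  fixes B :: "'a::chilbert_space set"
  assumes "is_onb B"
  shows "((\<lambda>e. cinner x e *\<^sub>C e) has_sum x) B"
proof -
  have B: "orthonormal B" using assms by (simp add: is_onb_def)
  let ?f = "\<lambda>e. cinner x e *\<^sub>C e"
  have "?f summable_on B"
    by (rule orthonormal_summable_on[OF B orthonormal_coeff_summable[OF B]])
  then have s: "(?f has_sum infsum ?f B) B" by simp
  have "cinner (infsum ?f B) b = cinner x b" if b: "b \<in> B" for b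
  proof -
    have "((\<lambda>e. cinner (?f e) b) has_sum cinner (infsum ?f B) b) B"
      by (rule has_sum_bounded_linear[OF bounded_linear_cinner_left s])
    moreover have "((\<lambda>e. cinner (?f e) b) has_sum cinner x b) B"
      by (rule has_sum_finite_neutralI[of "{b}"])
        (use b B in \<open>auto simp: cinner_scaleC_left orthonormal_cinner\<close>)
    ultimately show ?thesis by (rule has_sum_unique)
  qed
  then have "\<forall>b\<in>B. cinner (x - infsum ?f B) b = 0"
    by (simp add: cinner_diff_left)
  then have "x - infsum ?f B = 0" using assms unfolding is_onb_def by blast
  with s show ?thesis by simp
qed

lemma Parseval:
  fixes B :: "'a::chilbert_space set"
  assumes "is_onb B"
  shows "((\<lambda>e. cinner x e * cnj (cinner y e)) has_sum cinner x y) B"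
  using has_sum_bounded_linear[OF bounded_linear_cinner_left[of y] onb_has_sum[OF assms, of x]]
  by (simp add: cinner_scaleC_left flip: cinner_commute)

section \<open>Hilbert space tensor product\<close>

text \<open>The Hilbert space tensor product of \<open>'a\<close> and \<open>'b\<close> is realised as the space of
  square-summable coefficient families with respect to the products of the basis vectors
  in \<open>onb\<close>. Lemmas \<open>cinner_otimes\<close> and \<open>closure_span_otimes\<close> below characterise it,
  together with the bilinear map \<open>otimes\<close>, up to a unique unitary.\<close>

typedef (overloaded) ('a::chilbert_space, 'b::chilbert_space) htensor =
  "{f :: 'a \<times> 'b \<Rightarrow> complex.
      (\<forall>i. i \<notin> onb \<times> onb \<longrightarrow> f i = 0) \<and> (\<lambda>i. (cmod (f i))\<^sup>2) summable_on UNIV}"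
  morphisms hcoeff Abs_htensor
  by (rule exI[of _ "\<lambda>_. 0"]) simp

setup_lifting type_definition_htensor

lemma hcoeff_outside: "i \<notin> onb \<times> onb \<Longrightarrow> hcoeff x i = 0"
  using hcoeff[of x] by blast

lemma hcoeff_nonzeroD: "hcoeff x (e, f) \<noteq> 0 \<Longrightarrow> e \<in> onb \<and> f \<in> onb"
  using hcoeff_outside[of "(e, f)" x] by auto

lemma hcoeff_sqsum: "(\<lambda>i. (cmod (hcoeff x i))\<^sup>2) summable_on UNIV"
  using hcoeff[of x] by blast

lemma sqsum_iff:
  "(\<lambda>i. (cmod (f i))\<^sup>2) summable_on UNIV
     \<longleftrightarrow> (\<exists>C. \<forall>F. finite F \<longrightarrow> L2_set (\<lambda>i. cmod (f i)) F \<le> C)"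
proof
  assume s: "(\<lambda>i. (cmod (f i))\<^sup>2) summable_on UNIV"
  show "\<exists>C. \<forall>F. finite F \<longrightarrow> L2_set (\<lambda>i. cmod (f i)) F \<le> C"
    by (rule exI[of _ "sqrt (infsum (\<lambda>i. (cmod (f i))\<^sup>2) UNIV)"])
      (auto simp: L2_set_def intro!: finite_sum_le_infsum[OF s])
next
  assume "\<exists>C. \<forall>F. finite F \<longrightarrow> L2_set (\<lambda>i. cmod (f i)) F \<le> C"
  then obtain C where C: "\<And>F. finite F \<Longrightarrow> L2_set (\<lambda>i. cmod (f i)) F \<le> C" by blast
  have "(\<Sum>i\<in>F. (cmod (f i))\<^sup>2) \<le> C\<^sup>2" if "finite F" for F
    using C[OF that] power_mono[of "L2_set (\<lambda>i. cmod (f i)) F" C 2]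
    by (simp add: L2_set_nonneg) (simp add: L2_set_def sum_nonneg)
  then show "(\<lambda>i. (cmod (f i))\<^sup>2) summable_on UNIV"
    by (intro nonneg_bdd_above_summable_on) (auto intro!: bdd_aboveI2[where M = "C\<^sup>2"])
qed

lemma L2_set_cmod_le:
  assumes "(\<lambda>i. (cmod (f i))\<^sup>2) summable_on UNIV" "finite F"
  shows "L2_set (\<lambda>i. cmod (f i)) F \<le> sqrt (infsum (\<lambda>i. (cmod (f i))\<^sup>2) UNIV)"
  by (auto simp: L2_set_def intro!: finite_sum_le_infsum assms)

lemma sqrt_infsum_le:
  assumes "(\<lambda>i. (cmod (f i))\<^sup>2) summable_on UNIV"
    and "\<And>F. finite F \<Longrightarrow> L2_set (\<lambda>i. cmod (f i)) F \<le> C"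
  shows "sqrt (infsum (\<lambda>i. (cmod (f i))\<^sup>2) UNIV) \<le> C"
proof -
  have C: "0 \<le> C" using assms(2)[of "{}"] by simp
  have "(\<Sum>i\<in>F. (cmod (f i))\<^sup>2) \<le> C\<^sup>2" if "finite F" for F
    using assms(2)[OF that] power_mono[of "L2_set (\<lambda>i. cmod (f i)) F" C 2]
    by (simp add: L2_set_nonneg) (simp add: L2_set_def sum_nonneg)
  then have "infsum (\<lambda>i. (cmod (f i))\<^sup>2) UNIV \<le> C\<^sup>2"
    by (intro infsum_le_finite_sums assms)
  then show ?thesis using C real_le_lsqrt by (simp add: real_sqrt_le_iff real_le_lsqrt infsum_nonneg)
qed

lemma L2_set_cmod_add:
  "L2_set (\<lambda>i. cmod (f i + g i)) F \<le> L2_set (\<lambda>i. cmod (f i)) F + L2_set (\<lambda>i. cmod (g i)) F"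
  by (rule order_trans[OF L2_set_mono L2_set_triangle_ineq]) (auto intro: norm_triangle_ineq)

lemma sqsum_add:
  assumes "(\<lambda>i. (cmod (f i))\<^sup>2) summable_on UNIV" "(\<lambda>i. (cmod (g i))\<^sup>2) summable_on UNIV"
  shows "(\<lambda>i. (cmod (f i + g i))\<^sup>2) summable_on UNIV"
proof -
  obtain C D where "\<And>F. finite F \<Longrightarrow> L2_set (\<lambda>i. cmod (f i)) F \<le> C"
    "\<And>F. finite F \<Longrightarrow> L2_set (\<lambda>i. cmod (g i)) F \<le> D"
    using assms unfolding sqsum_iff by blast
  then show ?thesis
    unfolding sqsum_iff
    by (intro exI[of _ "C + D"] allI impI order_trans[OF L2_set_cmod_add] add_mono)
qed

lemma sqsum_scale:
  assumes "(\<lambda>i. (cmod (f i))\<^sup>2) summable_on UNIV"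
  shows "(\<lambda>i. (cmod (c * f i))\<^sup>2) summable_on UNIV"
  using summable_on_cmult_right[OF assms, of "(cmod c)\<^sup>2"] by (simp add: norm_mult power_mult_distrib)

lemma sqsum_mult_summable:
  assumes "(\<lambda>i. (cmod (f i))\<^sup>2) summable_on A" "(\<lambda>i. (cmod (g i))\<^sup>2) summable_on A"
  shows "(\<lambda>i. f i * cnj (g i)) summable_on A"
proof (rule abs_summable_summable, rule Infinite_Sum.abs_summable_on_comparison_test)
  show "(\<lambda>i. norm ((cmod (f i))\<^sup>2 + (cmod (g i))\<^sup>2)) summable_on A"
    using summable_on_add[OF assms] by simp
  fix i
  have "cmod (f i) * cmod (g i) \<le> (cmod (f i))\<^sup>2 + (cmod (g i))\<^sup>2"
    using sum_squares_bound[of "cmod (f i)" "cmod (g i)"]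
      mult_nonneg_nonneg[of "cmod (f i)" "cmod (g i)"] norm_ge_zero[of "f i"] norm_ge_zero[of "g i"]
    by linarith
  then show "norm (f i * cnj (g i)) \<le> norm ((cmod (f i))\<^sup>2 + (cmod (g i))\<^sup>2)"
    by (simp add: norm_mult)
qed

instantiation htensor :: (chilbert_space, chilbert_space) complex_inner
begin

lift_definition zero_htensor :: "('a, 'b) htensor" is "\<lambda>_. 0" by simp
lift_definition plus_htensor :: "('a, 'b) htensor \<Rightarrow> ('a, 'b) htensor \<Rightarrow> ('a, 'b) htensor"
  is "\<lambda>f g i. f i + g i" by (simp add: sqsum_add)
lift_definition uminus_htensor :: "('a, 'b) htensor \<Rightarrow> ('a, 'b) htensor"
  is "\<lambda>f i. - f i" by simp
lift_definition minus_htensor :: "('a, 'b) htensor \<Rightarrow> ('a, 'b) htensor \<Rightarrow> ('a, 'b) htensor"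
  is "\<lambda>f g i. f i - g i"
  subgoal for f g using sqsum_add[of f "\<lambda>i. - g i"] by simp
  done
lift_definition scaleC_htensor :: "complex \<Rightarrow> ('a, 'b) htensor \<Rightarrow> ('a, 'b) htensor"
  is "\<lambda>c f i. c * f i" using sqsum_scale by auto
definition scaleR_htensor :: "real \<Rightarrow> ('a, 'b) htensor \<Rightarrow> ('a, 'b) htensor"
  where "scaleR_htensor r x = complex_of_real r *\<^sub>C x"
definition cinner_htensor :: "('a, 'b) htensor \<Rightarrow> ('a, 'b) htensor \<Rightarrow> complex"
  where "cinner_htensor x y = (\<Sum>\<^sub>\<infinity>i. hcoeff x i * cnj (hcoeff y i))"
definition norm_htensor :: "('a, 'b) htensor \<Rightarrow> real"
  where "norm_htensor x = sqrt (\<Sum>\<^sub>\<infinity>i. (cmod (hcoeff x i))\<^sup>2)"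
definition dist_htensor :: "('a, 'b) htensor \<Rightarrow> ('a, 'b) htensor \<Rightarrow> real"
  where "dist_htensor x y = norm (x - y)"
definition sgn_htensor :: "('a, 'b) htensor \<Rightarrow> ('a, 'b) htensor"
  where "sgn_htensor x = inverse (norm x) *\<^sub>R x"
definition uniformity_htensor :: "(('a, 'b) htensor \<times> ('a, 'b) htensor) filter"
  where "uniformity_htensor = (INF e\<in>{0 <..}. principal {(x, y). dist x y < e})"
definition open_htensor :: "('a, 'b) htensor set \<Rightarrow> bool"
  where "open_htensor S = (\<forall>x\<in>S. \<forall>\<^sub>F (x', y) in uniformity. x' = x \<longrightarrow> y \<in> S)"

instance
proof
  have sq: "(\<lambda>i. (cmod (hcoeff u i))\<^sup>2) summable_on UNIV" for u :: "('a, 'b) htensor"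
    using hcoeff[of u] by simp
  have ms: "(\<lambda>i. hcoeff u i * cnj (hcoeff v i)) summable_on UNIV" for u v :: "('a, 'b) htensor"
    by (rule sqsum_mult_summable[OF sq sq])
  have nsc: "norm (c *\<^sub>C u) = cmod c * norm u" for c and u :: "('a, 'b) htensor"
    by (simp add: norm_htensor_def scaleC_htensor.rep_eq norm_mult power_mult_distrib
        infsum_cmult_right' real_sqrt_mult)
  fix x y z :: "('a, 'b) htensor" and a b :: complex and r s :: real
  show "x + y + z = x + (y + z)" "x + y = y + x" "0 + x = x" "- x + x = 0" "x - y = x + - y"
    by (transfer, simp add: algebra_simps)+
  show "a *\<^sub>C (x + y) = a *\<^sub>C x + a *\<^sub>C y" "(a + b) *\<^sub>C x = a *\<^sub>C x + b *\<^sub>C x"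
    "a *\<^sub>C (b *\<^sub>C x) = (a * b) *\<^sub>C x" "1 *\<^sub>C x = x"
    by (transfer, simp add: algebra_simps)+
  show "r *\<^sub>R x = complex_of_real r *\<^sub>C x" by (simp add: scaleR_htensor_def)
  show "r *\<^sub>R (x + y) = r *\<^sub>R x + r *\<^sub>R y" "(r + s) *\<^sub>R x = r *\<^sub>R x + s *\<^sub>R x"
    "r *\<^sub>R s *\<^sub>R x = (r * s) *\<^sub>R x" "1 *\<^sub>R x = x"
    unfolding scaleR_htensor_def by (transfer, simp add: algebra_simps)+
  show "dist x y = norm (x - y)" "sgn x = inverse (norm x) *\<^sub>R x"
    "uniformity = (INF e\<in>{0 <..}. principal {(x, y::('a, 'b) htensor). dist x y < e})"
    by (simp_all add: dist_htensor_def sgn_htensor_def uniformity_htensor_def)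
  show "open U = (\<forall>x\<in>U. \<forall>\<^sub>F (x', y) in uniformity. x' = x \<longrightarrow> y \<in> U)"
    for U :: "('a, 'b) htensor set" by (simp add: open_htensor_def)
  show "(norm x = 0) = (x = 0)"
  proof
    assume "norm x = 0"
    then have "(\<Sum>\<^sub>\<infinity>i. (cmod (hcoeff x i))\<^sup>2) = 0" by (simp add: norm_htensor_def)
    then have "(cmod (hcoeff x i))\<^sup>2 = 0" for i
      using nonneg_infsum_le_0D[OF _ sq[of x], of i] by simp
    then show "x = 0" by transfer auto
  qed (simp add: norm_htensor_def zero_htensor.rep_eq)
  show "norm (x + y) \<le> norm x + norm y"
    unfolding norm_htensor_def
  proof (rule sqrt_infsum_le[OF sq])
    fix F :: "('a \<times> 'b) set" assume "finite F"
    then show "L2_set (\<lambda>i. cmod (hcoeff (x + y) i)) F \<le> sqrt (\<Sum>\<^sub>\<infinity>i. (cmod (hcoeff x i))\<^sup>2)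
        + sqrt (\<Sum>\<^sub>\<infinity>i. (cmod (hcoeff y i))\<^sup>2)"
      unfolding plus_htensor.rep_eq
      by (intro order_trans[OF L2_set_cmod_add] add_mono L2_set_cmod_le sq)
  qed
  show "norm (a *\<^sub>C x) = cmod a * norm x" by (rule nsc)
  show "norm (r *\<^sub>R x) = \<bar>r\<bar> * norm x" by (simp add: scaleR_htensor_def nsc)
  show "cinner x y = cnj (cinner y x)"
    unfolding cinner_htensor_def infsum_cnj[symmetric] by (simp add: mult.commute)
  show "cinner (x + y) z = cinner x z + cinner y z"
    unfolding cinner_htensor_def plus_htensor.rep_eq distrib_right by (rule infsum_add[OF ms ms])
  show "cinner (a *\<^sub>C x) y = a * cinner x y"
    by (simp add: cinner_htensor_def scaleC_htensor.rep_eq mult.assoc infsum_cmult_right')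
  have "((\<lambda>i. (cmod (hcoeff x i))\<^sup>2) has_sum (norm x)\<^sup>2) UNIV"
    using sq[of x] by (simp add: norm_htensor_def infsum_nonneg)
  then have "((\<lambda>i. complex_of_real ((cmod (hcoeff x i))\<^sup>2)) has_sum complex_of_real ((norm x)\<^sup>2)) UNIV"
    by (rule has_sum_of_real)
  then show "cinner x x = complex_of_real ((norm x)\<^sup>2)"
    unfolding cinner_htensor_def by (simp only: infsumI complex_norm_square)
qed

end

lemma htensor_L2_set_le:
  "finite F \<Longrightarrow> L2_set (\<lambda>i. cmod (hcoeff x i)) F \<le> norm x"
  unfolding norm_htensor_def using hcoeff[of x] by (auto intro!: L2_set_cmod_le)

instance htensor :: (chilbert_space, chilbert_space) chilbert_space
proof
  fix X :: "nat \<Rightarrow> ('a, 'b) htensor"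
  assume X: "Cauchy X"
  have "Cauchy (\<lambda>n. hcoeff (X n) i)" for i
  proof (rule CauchyI)
    fix e :: real assume "e > 0"
    then obtain M where M: "\<And>m n. m \<ge> M \<Longrightarrow> n \<ge> M \<Longrightarrow> norm (X m - X n) < e"
      using CauchyD[OF X] by blast
    have "norm (hcoeff (X m) i - hcoeff (X n) i) < e" if "m \<ge> M" "n \<ge> M" for m n
      using htensor_L2_set_le[of "{i}" "X m - X n"] M[OF that]
      by (simp add: minus_htensor.rep_eq)
    then show "\<exists>M. \<forall>m\<ge>M. \<forall>n\<ge>M. norm (hcoeff (X m) i - hcoeff (X n) i) < e" by blast
  qed
  then have "\<forall>i. \<exists>l. (\<lambda>n. hcoeff (X n) i) \<longlonglongrightarrow> l"
    using Cauchy_convergent convergent_def by blast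
  then obtain L where L: "\<And>i. (\<lambda>n. hcoeff (X n) i) \<longlonglongrightarrow> L i" by metis
  have close: "\<exists>M. \<forall>n\<ge>M. \<forall>F. finite F \<longrightarrow> L2_set (\<lambda>i. cmod (L i - hcoeff (X n) i)) F \<le> e"
    if "e > 0" for e
  proof -
    obtain M where M: "\<And>m n. m \<ge> M \<Longrightarrow> n \<ge> M \<Longrightarrow> norm (X m - X n) < e"
      using CauchyD[OF X \<open>e > 0\<close>] by blast
    have "L2_set (\<lambda>i. cmod (L i - hcoeff (X n) i)) F \<le> e" if "n \<ge> M" "finite F" for n F
    proof (rule tendsto_upperbound)
      show "(\<lambda>m. L2_set (\<lambda>i. cmod (hcoeff (X m) i - hcoeff (X n) i)) F)
          \<longlonglongrightarrow> L2_set (\<lambda>i. cmod (L i - hcoeff (X n) i)) F"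
        unfolding L2_set_def by (intro tendsto_intros L)
      have "L2_set (\<lambda>i. cmod (hcoeff (X m) i - hcoeff (X n) i)) F \<le> e" if "m \<ge> M" for m
        using htensor_L2_set_le[OF \<open>finite F\<close>, of "X m - X n"] M[OF that \<open>n \<ge> M\<close>]
        by (simp add: minus_htensor.rep_eq)
      then show "\<forall>\<^sub>F m in sequentially. L2_set (\<lambda>i. cmod (hcoeff (X m) i - hcoeff (X n) i)) F \<le> e"
        using eventually_sequentially by blast
    qed simp
    then show ?thesis by blast
  qed
  obtain N where N: "\<And>F. finite F \<Longrightarrow> L2_set (\<lambda>i. cmod (L i - hcoeff (X N) i)) F \<le> 1"
    using close[of 1] by auto
  have "(\<lambda>i. (cmod (L i - hcoeff (X N) i))\<^sup>2) summable_on UNIV"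
    unfolding sqsum_iff using N by blast
  moreover have "(\<lambda>i. (cmod (hcoeff (X N) i))\<^sup>2) summable_on UNIV" using hcoeff[of "X N"] by simp
  ultimately have "(\<lambda>i. (cmod (L i))\<^sup>2) summable_on UNIV"
    using sqsum_add[of "\<lambda>i. L i - hcoeff (X N) i" "hcoeff (X N)"] by simp
  moreover have "L i = 0" if "i \<notin> onb \<times> onb" for i
  proof -
    have "hcoeff (X n) i = 0" for n using that by (rule hcoeff_outside)
    then show ?thesis using L[of i] LIMSEQ_unique[OF _ tendsto_const] by simp
  qed
  ultimately obtain l where l: "hcoeff l = L" using Abs_htensor_inverse[of L] by auto
  have "X \<longlonglongrightarrow> l"
  proof (rule LIMSEQ_I)
    fix e :: real assume "e > 0"
    then obtain M where M: "\<And>n F. n \<ge> M \<Longrightarrow> finite F \<Longrightarrow>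
        L2_set (\<lambda>i. cmod (L i - hcoeff (X n) i)) F \<le> e/2"
      using close[of "e/2"] by auto
    have "norm (X n - l) < e" if "n \<ge> M" for n
    proof -
      have "norm (l - X n) \<le> e/2"
        unfolding norm_htensor_def
        by (rule sqrt_infsum_le)
          (use hcoeff[of "l - X n"] M[OF that] in \<open>auto simp: minus_htensor.rep_eq l\<close>)
      then show ?thesis using \<open>e > 0\<close> by (simp add: norm_minus_commute)
    qed
    then show "\<exists>M. \<forall>n\<ge>M. norm (X n - l) < e" by blast
  qed
  then show "convergent X" by (auto simp: convergent_def)
qed

lift_definition otimes :: "'a::chilbert_space \<Rightarrow> 'b::chilbert_space \<Rightarrow> ('a, 'b) htensor"
  (infixr \<open>\<otimes>\<^sub>h\<close> 70)
  is "\<lambda>u v (e, f). if e \<in> onb \<and> f \<in> onb then cinner u e * cinner v f else 0"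
proof -
  fix u :: 'a and v :: 'b
  have "(\<lambda>(e, f). (cmod (cinner u e))\<^sup>2 * (cmod (cinner v f))\<^sup>2) summable_on onb \<times> onb"
    by (rule summable_on_SigmaI[where g = "\<lambda>e. (cmod (cinner u e))\<^sup>2 *
            infsum (\<lambda>f. (cmod (cinner v f))\<^sup>2) onb"])
      (auto intro!: has_sum_cmult_right summable_on_cmult_left has_sum_infsum
        orthonormal_coeff_summable orthonormal_onb)
  then have "(\<lambda>i. (cmod (case i of (e, f) \<Rightarrow>
      if e \<in> onb \<and> f \<in> onb then cinner u e * cinner v f else 0))\<^sup>2) summable_on UNIV"
    by (rule summable_on_cong_neutral[THEN iffD1, rotated -1])
      (auto simp: norm_mult power_mult_distrib split: if_splits)
  then show "(\<forall>i. i \<notin> onb \<times> onb \<longrightarrow> (case i of (e, f) \<Rightarrow>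
      if e \<in> onb \<and> f \<in> onb then cinner u e * cinner v f else 0) = 0) \<and>
    (\<lambda>i. (cmod (case i of (e, f) \<Rightarrow>
      if e \<in> onb \<and> f \<in> onb then cinner u e * cinner v f else 0))\<^sup>2) summable_on UNIV"
    by auto
qed

lemma otimes_add_left: "(u + u') \<otimes>\<^sub>h v = u \<otimes>\<^sub>h v + u' \<otimes>\<^sub>h v"
  by transfer (auto simp: fun_eq_iff cinner_add_left algebra_simps)

lemma otimes_add_right: "u \<otimes>\<^sub>h (v + v') = u \<otimes>\<^sub>h v + u \<otimes>\<^sub>h v'"
  by transfer (auto simp: fun_eq_iff cinner_add_left algebra_simps)

lemma otimes_scaleC_left: "(c *\<^sub>C u) \<otimes>\<^sub>h v = c *\<^sub>C (u \<otimes>\<^sub>h v)"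
  by transfer (auto simp: fun_eq_iff cinner_scaleC_left)

lemma otimes_scaleC_right: "u \<otimes>\<^sub>h (c *\<^sub>C v) = c *\<^sub>C (u \<otimes>\<^sub>h v)"
  by transfer (auto simp: fun_eq_iff cinner_scaleC_left)

lemma cinner_otimes: "cinner (u \<otimes>\<^sub>h v) (u' \<otimes>\<^sub>h v') = cinner u u' * cinner v v'"
proof -
  let ?p = "\<lambda>i. hcoeff (u \<otimes>\<^sub>h v) i * cnj (hcoeff (u' \<otimes>\<^sub>h v') i)"
  have p: "?p (e, f) = (cinner u e * cnj (cinner u' e)) * (cinner v f * cnj (cinner v' f))"
    if "e \<in> onb" "f \<in> onb" for e f
    using that by (simp add: otimes.rep_eq)
  have s: "?p summable_on UNIV"
    by (rule sqsum_mult_summable) (use hcoeff in auto)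
  then have "(?p has_sum infsum ?p UNIV) UNIV" by simp
  have "?p summable_on onb \<times> onb" by (rule summable_on_subset[OF s]) simp
  then have "(?p has_sum cinner u u' * cinner v v') (onb \<times> onb)"
    by (intro has_sum_SigmaI[where g = "\<lambda>e. (cinner u e * cnj (cinner u' e)) * cinner v v'"]
        has_sum_cmult_left Parseval is_onb_onb)
      (auto simp: p is_onb_onb cong: has_sum_cong intro!: has_sum_cmult_right Parseval)
  moreover have "(?p has_sum cinner u u' * cinner v v') (onb \<times> onb)
      \<longleftrightarrow> (?p has_sum cinner u u' * cinner v v') UNIV"
    by (rule has_sum_cong_neutral) (auto simp: otimes.rep_eq split: if_splits)
  ultimately show ?thesis by (simp add: cinner_htensor_def infsumI)
qed

lemma norm_otimes: "norm (u \<otimes>\<^sub>h v) = norm u * norm v"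
proof -
  have "complex_of_real ((norm (u \<otimes>\<^sub>h v))\<^sup>2) = complex_of_real ((norm u * norm v)\<^sup>2)"
    using cinner_otimes[of u v u v] by (simp add: cinner_self power_mult_distrib)
  then have "(norm (u \<otimes>\<^sub>h v))\<^sup>2 = (norm u * norm v)\<^sup>2" using of_real_eq_iff by blast
  then show ?thesis by (simp add: power2_eq_iff_nonneg)
qed

lemma closure_span_otimes:
  "closure (span (range (\<lambda>(u, v). u \<otimes>\<^sub>h v))) = (UNIV :: ('a::chilbert_space, 'b::chilbert_space) htensor set)"
    (is "closure ?S = _")
proof -
  have basis: "hcoeff (e \<otimes>\<^sub>h f) i = (if i = (e, f) then 1 else 0)"
    if "e \<in> onb" "f \<in> onb" for e :: 'a and f :: 'b and i
    using that by (auto simp: otimes.rep_eq orthonormal_cinner[OF orthonormal_onb] split: prod.splits)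
  have "x \<in> closure ?S" for x :: "('a, 'b) htensor"
    unfolding closure_approachable
  proof (intro allI impI)
    fix \<epsilon> :: real assume "\<epsilon> > 0"
    let ?g = "\<lambda>i. (cmod (hcoeff x i))\<^sup>2"
    have sq: "?g summable_on UNIV" using hcoeff[of x] by simp
    obtain G where G: "finite G" "dist (sum ?g G) (infsum ?g UNIV) \<le> (\<epsilon>/2)\<^sup>2"
      using infsum_finite_approximation[OF sq, of "(\<epsilon>/2)\<^sup>2"] \<open>\<epsilon> > 0\<close> by auto
    define H where "H = G \<inter> onb \<times> onb"
    have H: "finite H" "sum ?g H = sum ?g G"
    proof -
      show "finite H" using G(1) by (simp add: H_def)
      have "?g i = 0" if "i \<in> G - H" for i
        using that hcoeff_outside[of i x] by (simp add: H_def del: mem_Sigma_iff)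
      then show "sum ?g H = sum ?g G"
        using G(1) by (intro sum.mono_neutral_left) (auto simp: H_def)
    qed
    define y where "y = (\<Sum>i\<in>H. hcoeff x i *\<^sub>C (fst i \<otimes>\<^sub>h snd i))"
    have "y \<in> ?S"
      unfolding y_def
    proof (rule span_sum)
      fix i
      have "hcoeff x i *\<^sub>C (fst i \<otimes>\<^sub>h snd i) = (hcoeff x i *\<^sub>C fst i) \<otimes>\<^sub>h snd i"
        by (simp add: otimes_scaleC_left)
      then show "hcoeff x i *\<^sub>C (fst i \<otimes>\<^sub>h snd i) \<in> ?S"
        by (auto intro!: span_base)
    qed
    have sum_rep: "hcoeff (\<Sum>i\<in>I. z i) j = (\<Sum>i\<in>I. hcoeff (z i) j)"
      if "finite I" for I :: "('a \<times> 'b) set" and z :: "_ \<Rightarrow> ('a, 'b) htensor" and j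
      using that by induction (auto simp: zero_htensor.rep_eq plus_htensor.rep_eq)
    have y: "hcoeff y j = (if j \<in> H then hcoeff x j else 0)" for j
    proof -
      have "hcoeff y j = (\<Sum>i\<in>H. if i = j then hcoeff x i else 0)"
        unfolding y_def sum_rep[OF H(1)] scaleC_htensor.rep_eq
        by (intro sum.cong) (auto simp: basis H_def)
      then show ?thesis using H(1) by simp
    qed
    have "norm (x - y) \<le> \<epsilon>/2"
      unfolding norm_htensor_def
    proof (rule sqrt_infsum_le)
      show "(\<lambda>i. (cmod (hcoeff (x - y) i))\<^sup>2) summable_on UNIV" using hcoeff[of "x - y"] by simp
      fix F :: "('a \<times> 'b) set" assume F: "finite F"
      have "(\<Sum>i\<in>F. (cmod (hcoeff (x - y) i))\<^sup>2) = (\<Sum>i\<in>F. if i \<in> F - H then ?g i else 0)"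
        by (intro sum.cong) (auto simp: minus_htensor.rep_eq y)
      also have "\<dots> = sum ?g (F - H)"
        using F by (simp add: sum.If_cases Diff_eq Compl_eq)
      also have "\<dots> = sum ?g (F \<union> H) - sum ?g H"
        using F H(1) by (simp add: sum_diff[of "F \<union> H" H, symmetric] Un_Diff)
      also have "\<dots> \<le> infsum ?g UNIV - sum ?g H"
        using finite_sum_le_infsum[OF sq, of "F \<union> H"] F H(1) by simp
      also have "\<dots> \<le> (\<epsilon>/2)\<^sup>2" using G(2) H(2) unfolding dist_real_def by linarith
      finally show "L2_set (\<lambda>i. cmod (hcoeff (x - y) i)) F \<le> \<epsilon>/2"
        unfolding L2_set_def using \<open>\<epsilon> > 0\<close> by (intro real_le_lsqrt) (auto simp: sum_nonneg)
    qed
    then show "\<exists>y\<in>?S. dist y x < \<epsilon>"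
      using \<open>y \<in> ?S\<close> \<open>\<epsilon> > 0\<close> by (intro bexI[of _ y]) (auto simp: dist_norm norm_minus_commute)
  qed
  then show ?thesis by blast
qed

lemma blinfun_cbounded_scaleC: "T \<in> \<B> \<Longrightarrow> blinfun_apply T (c *\<^sub>C x) = c *\<^sub>C blinfun_apply T x"
  by (simp add: cbounded_def)

lemma cinner_eqI: "(\<And>x. cinner x y = cinner x z) \<Longrightarrow> y = (z::'a::complex_inner)"
  using cinner_self_eq_0[of "y - z"] by (simp add: cinner_diff_right)

lemma is_onb_cinner_infsum:
  fixes B :: "'a::chilbert_space set"
  assumes B: "orthonormal B" and c: "(\<lambda>e. (cmod (c e))\<^sup>2) summable_on B" and b: "b \<in> B"
  shows "cinner (\<Sum>\<^sub>\<infinity>e\<in>B. c e *\<^sub>C e) b = c b"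
proof -
  let ?f = "\<lambda>e. c e *\<^sub>C e"
  have "((\<lambda>e. cinner (?f e) b) has_sum cinner (infsum ?f B) b) B"
    by (rule has_sum_bounded_linear[OF bounded_linear_cinner_left
          has_sum_infsum[OF orthonormal_summable_on[OF B c]]])
  moreover have "((\<lambda>e. cinner (?f e) b) has_sum c b) B"
    by (rule has_sum_finite_neutralI[of "{b}"])
      (use b B in \<open>auto simp: cinner_scaleC_left orthonormal_cinner\<close>)
  ultimately show ?thesis by (rule has_sum_unique)
qed

lemma onb_eqI:
  assumes "\<And>b. b \<in> onb \<Longrightarrow> cinner x b = cinner y b"
  shows "x = (y::'a::chilbert_space)"
proof -
  have "\<forall>b\<in>onb. cinner (x - y) b = 0" using assms by (simp add: cinner_diff_left)
  then have "x - y = 0"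
    using is_onb_onb[where 'a='a, unfolded is_onb_def] by blast
  then show ?thesis by simp
qed

lemma Parseval_norm:
  "((\<lambda>e. (cmod (cinner x e))\<^sup>2) has_sum (norm x)\<^sup>2) (onb :: 'a::chilbert_space set)"
proof -
  have "((\<lambda>e. complex_of_real ((cmod (cinner x e))\<^sup>2)) has_sum complex_of_real ((norm x)\<^sup>2)) onb"
    using Parseval[OF is_onb_onb, of x x] by (simp only: complex_norm_square cinner_self)
  from has_sum_Re[OF this] show ?thesis by simp
qed

lemma cadjoint_ex1:
  fixes T :: "'a::chilbert_space \<Rightarrow>\<^sub>L 'b::chilbert_space"
  assumes T: "T \<in> \<B>"
  shows "\<exists>!S. S \<in> \<B> \<and> (\<forall>x y. cinner (blinfun_apply T x) y = cinner x (blinfun_apply S y))"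
proof (rule ex_ex1I)
  have summ: "(\<lambda>e. (cmod (cinner y (T e)))\<^sup>2) summable_on onb" for y
  proof (rule nonneg_bdd_above_summable_on)
    have "(\<Sum>e\<in>F. (cmod (cinner y (T e)))\<^sup>2) \<le> (norm T * norm y)\<^sup>2"
      if F: "finite F" "F \<subseteq> onb" for F
    proof -
      define c s where "c e = cinner y (T e)" and "s = (\<Sum>e\<in>F. (cmod (cinner y (T e)))\<^sup>2)" for e
      define w where "w = (\<Sum>e\<in>F. c e *\<^sub>C e)"
      have s0: "s \<ge> 0" by (simp add: s_def sum_nonneg)
      have w: "(norm w)\<^sup>2 = s"
        unfolding w_def s_def c_def by (rule orthonormal_norm_sum[OF orthonormal_onb F])
      have "cinner (T w) y = (\<Sum>e\<in>F. c e * cnj (c e))"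
        by (simp add: w_def blinfun.sum_right cinner_sum_left blinfun_cbounded_scaleC[OF T]
            cinner_scaleC_left c_def flip: cinner_commute)
      also have "\<dots> = complex_of_real s"
        unfolding s_def c_def of_real_sum by (simp only: complex_norm_square)
      finally have "s = cmod (cinner (T w) y)" using s0 by simp
      also have "\<dots> \<le> norm (T w) * norm y" by (rule cinner_Cauchy_Schwarz)
      also have "\<dots> \<le> norm T * norm w * norm y" by (intro mult_right_mono norm_blinfun) simp
      finally have "(norm w)\<^sup>2 \<le> norm w * (norm T * norm y)" by (simp add: w mult_ac)
      then have "norm w \<le> norm T * norm y"
        by (cases "norm w = 0") (auto simp: power2_eq_square)
      then have "(norm w)\<^sup>2 \<le> (norm T * norm y)\<^sup>2" by (intro power_mono) auto
      then show ?thesis by (simp add: w s_def)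
    qed
    then show "bdd_above (sum (\<lambda>e. (cmod (cinner y (T e)))\<^sup>2) ` {F. F \<subseteq> onb \<and> finite F})"
      by (auto intro!: bdd_aboveI2)
  qed simp
  define S where "S y = (\<Sum>\<^sub>\<infinity>e\<in>onb. cinner y (T e) *\<^sub>C e)" for y
  have S: "cinner (T x) y = cinner x (S y)" for x y
  proof -
    have x: "((\<lambda>e. cinner x e *\<^sub>C e) has_sum x) onb" by (rule onb_has_sum[OF is_onb_onb])
    have "((\<lambda>e. cinner (T (cinner x e *\<^sub>C e)) y) has_sum cinner (T x) y) onb"
      by (rule has_sum_bounded_linear[OF bounded_linear_compose[OF bounded_linear_cinner_left
              blinfun.bounded_linear_right] x])
    moreover have "((\<lambda>e. cinner (cinner x e *\<^sub>C e) (S y)) has_sum cinner x (S y)) onb"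
      by (rule has_sum_bounded_linear[OF bounded_linear_cinner_left x])
    moreover have "cinner e (S y) = cinner (T e) y" if "e \<in> onb" for e
      using is_onb_cinner_infsum[OF orthonormal_onb summ that, of y]
      by (metis S_def cinner_commute)
    then have "cinner (T (cinner x e *\<^sub>C e)) y = cinner (cinner x e *\<^sub>C e) (S y)"
      if "e \<in> onb" for e
      using that by (simp add: blinfun_cbounded_scaleC[OF T] cinner_scaleC_left)
    ultimately show ?thesis using has_sum_unique has_sum_cong by (metis (no_types, lifting))
  qed
  have lin: "S (y + z) = S y + S z" "S (c *\<^sub>C y) = c *\<^sub>C S y" for y z c
    by (rule cinner_eqI, simp add: cinner_add_right cinner_scaleC_right flip: S)+
  have "norm (S y) \<le> norm y * norm T" for y
  proof -
    have "(norm (S y))\<^sup>2 = cmod (cinner (S y) (S y))"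
      by (simp only: cinner_self norm_of_real) simp
    also have "\<dots> = cmod (cinner (T (S y)) y)" by (simp add: S)
    also have "\<dots> \<le> norm (T (S y)) * norm y" by (rule cinner_Cauchy_Schwarz)
    also have "\<dots> \<le> norm T * norm (S y) * norm y" by (intro mult_right_mono norm_blinfun) simp
    finally have "(norm (S y))\<^sup>2 \<le> norm (S y) * (norm y * norm T)" by (simp add: mult_ac)
    then show ?thesis by (cases "norm (S y) = 0") (auto simp: power2_eq_square)
  qed
  then have "bounded_linear S"
    by (intro bounded_linear_intro[of _ "norm T"]) (auto simp: lin scaleR_scaleC)
  then show "\<exists>S. S \<in> \<B> \<and> (\<forall>x y. cinner (T x) y = cinner x (blinfun_apply S y))"
    by (intro exI[of _ "Blinfun S"]) (auto simp: cbounded_def bounded_linear_Blinfun_apply S lin)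
next
  fix S S' :: "'b \<Rightarrow>\<^sub>L 'a"
  assume "S \<in> \<B> \<and> (\<forall>x y. cinner (T x) y = cinner x (S y))"
    "S' \<in> \<B> \<and> (\<forall>x y. cinner (T x) y = cinner x (S' y))"
  then show "S = S'" by (intro blinfun_eqI cinner_eqI) metis
qed

lemma
  fixes T :: "'a::chilbert_space \<Rightarrow>\<^sub>L 'b::chilbert_space"
  assumes "T \<in> \<B>"
  shows cadjoint_cbounded: "T\<^sup>\<star> \<in> \<B>"
    and cinner_cadjoint: "cinner (blinfun_apply T x) y = cinner x (blinfun_apply (T\<^sup>\<star>) y)"
  using theI'[OF cadjoint_ex1[OF assms]] unfolding cadjoint_def by blast+

definition op_tensor :: "('a::chilbert_space \<Rightarrow>\<^sub>L 'c::chilbert_space) \<Rightarrow>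
    ('b::chilbert_space \<Rightarrow>\<^sub>L 'd::chilbert_space) \<Rightarrow>
    ('a, 'b) htensor \<Rightarrow>\<^sub>L ('c, 'd) htensor"  (infixr \<open>\<otimes>\<^sub>o\<close> 70)
  where "A \<otimes>\<^sub>o B = (THE T. T \<in> \<B> \<and> (\<forall>u v.
    blinfun_apply T (u \<otimes>\<^sub>h v) = blinfun_apply A u \<otimes>\<^sub>h blinfun_apply B v))"

lemma hcoeff_has_sum:
  "((\<lambda>i. (cmod (hcoeff x i))\<^sup>2) has_sum (norm x)\<^sup>2) (onb \<times> onb)"
proof -
  have "((\<lambda>i. (cmod (hcoeff x i))\<^sup>2) has_sum (norm x)\<^sup>2) UNIV"
    using hcoeff_sqsum[of x] by (simp add: norm_htensor_def infsum_nonneg)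
  moreover have "((\<lambda>i. (cmod (hcoeff x i))\<^sup>2) has_sum (norm x)\<^sup>2) UNIV \<longleftrightarrow>
      ((\<lambda>i. (cmod (hcoeff x i))\<^sup>2) has_sum (norm x)\<^sup>2) (onb \<times> onb)"
    by (rule has_sum_cong_neutral) (auto simp: hcoeff_outside simp del: mem_Sigma_iff)
  ultimately show ?thesis by simp
qed

lemma htensor_eqI:
  assumes "\<And>e f. e \<in> onb \<Longrightarrow> f \<in> onb \<Longrightarrow> hcoeff x (e, f) = hcoeff y (e, f)"
  shows "x = y"
proof -
  have "hcoeff x i = hcoeff y i" for i
    using assms hcoeff_outside[of i x] hcoeff_outside[of i y] by (cases i) fastforce
  then show ?thesis by (simp add: hcoeff_inject[symmetric] fun_eq_iff)
qed

lemma htensor_norm_eqI: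
  "((\<lambda>i. (cmod (hcoeff x i))\<^sup>2) has_sum r\<^sup>2) (onb \<times> onb) \<Longrightarrow> r \<ge> 0 \<Longrightarrow> norm x = r"
  using has_sum_unique[OF hcoeff_has_sum] by (metis norm_ge_zero power2_eq_iff_nonneg)

lemma op_swap_exists:
  "\<exists>T :: ('a::chilbert_space, 'b::chilbert_space) htensor \<Rightarrow>\<^sub>L ('b, 'a) htensor.
     T \<in> \<B> \<and> (\<forall>u v. blinfun_apply T (u \<otimes>\<^sub>h v) = v \<otimes>\<^sub>h u)"
proof -
  define S :: "('a, 'b) htensor \<Rightarrow> ('b, 'a) htensor"
    where "S x = Abs_htensor (\<lambda>(f, e). hcoeff x (e, f))" for x
  have sw: "prod.swap ` (onb \<times> onb :: ('b \<times> 'a) set) = onb \<times> onb" by auto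
  have hs: "((\<lambda>i. (cmod (case i of (f, e) \<Rightarrow> hcoeff x (e, f)))\<^sup>2) has_sum (norm x)\<^sup>2) (onb \<times> onb)"
    for x :: "('a, 'b) htensor"
    using hcoeff_has_sum[of x] has_sum_reindex[of prod.swap "onb \<times> onb :: ('b \<times> 'a) set"
        "\<lambda>i. (cmod (hcoeff x i))\<^sup>2" "(norm x)\<^sup>2"]
    unfolding sw by (simp add: o_def case_prod_unfold prod.swap_def)
  have "(\<lambda>i. (cmod (case i of (f, e) \<Rightarrow> hcoeff x (e, f)))\<^sup>2) summable_on UNIV"
    for x :: "('a, 'b) htensor"
    using has_sum_imp_summable[OF hs[of x]]
    by (rule summable_on_cong_neutral[THEN iffD1, rotated -1])
      (auto dest: hcoeff_nonzeroD)
  then have rep: "hcoeff (S x) = (\<lambda>(f, e). hcoeff x (e, f))" for x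
    unfolding S_def by (intro Abs_htensor_inverse) (auto simp: hcoeff_outside)
  have "norm (S x) = norm x" for x
    by (rule htensor_norm_eqI) (simp_all add: rep hs)
  moreover have lin: "S (x + y) = S x + S y" "S (c *\<^sub>C x) = c *\<^sub>C S x" for x y c
    by (simp_all add: hcoeff_inject[symmetric] rep plus_htensor.rep_eq scaleC_htensor.rep_eq fun_eq_iff)
  ultimately have "bounded_linear S"
    by (intro bounded_linear_intro[of _ 1]) (auto simp: scaleR_scaleC)
  moreover have "S (u \<otimes>\<^sub>h v) = v \<otimes>\<^sub>h u" for u v
    by (simp add: hcoeff_inject[symmetric] rep otimes.rep_eq fun_eq_iff mult.commute)
  ultimately show ?thesis
    by (intro exI[of _ "Blinfun S"]) (auto simp: bounded_linear_Blinfun_apply cbounded_def lin)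
qed

lemma op_right_exists:
  fixes B :: "'b::chilbert_space \<Rightarrow>\<^sub>L 'c::chilbert_space"
  assumes B: "B \<in> \<B>"
  shows "\<exists>T :: ('a::chilbert_space, 'b) htensor \<Rightarrow>\<^sub>L ('a, 'c) htensor.
     T \<in> \<B> \<and> (\<forall>u v. blinfun_apply T (u \<otimes>\<^sub>h v) = u \<otimes>\<^sub>h blinfun_apply B v)"
proof -
  define row :: "('a, 'b) htensor \<Rightarrow> 'a \<Rightarrow> 'b"
    where "row x e = (\<Sum>\<^sub>\<infinity>f\<in>onb. hcoeff x (e, f) *\<^sub>C f)" for x e
  have row: "cinner (row x e) f = hcoeff x (e, f)" if "f \<in> onb" for x e f
    unfolding row_def
  proof (rule is_onb_cinner_infsum[OF orthonormal_onb _ that])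
    have "(\<lambda>i. (cmod (hcoeff x i))\<^sup>2) summable_on Pair e ` onb"
      by (rule summable_on_subset[OF hcoeff_sqsum]) simp
    then show "(\<lambda>f. (cmod (hcoeff x (e, f)))\<^sup>2) summable_on onb"
      by (subst (asm) summable_on_reindex) (auto simp: o_def inj_on_def)
  qed
  have rowsum: "((\<lambda>e. (norm (row x e))\<^sup>2) has_sum (norm x)\<^sup>2) onb" for x
  proof (rule has_sum_SigmaD[OF hcoeff_has_sum])
    fix e :: 'a
    show "((\<lambda>f. (cmod (hcoeff x (e, f)))\<^sup>2) has_sum (norm (row x e))\<^sup>2) onb"
      using Parseval_norm[of "row x e"] by (rule has_sum_cong[THEN iffD1, rotated]) (simp add: row)
  qed
  define r where "r x = (\<lambda>(e, f). if e \<in> onb \<and> f \<in> onb then cinner (B (row x e)) f else 0)" for x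
  define S :: "('a, 'b) htensor \<Rightarrow> ('a, 'c) htensor" where "S x = Abs_htensor (r x)" for x
  have le: "(norm (B (row x e)))\<^sup>2 \<le> (norm B)\<^sup>2 * (norm (row x e))\<^sup>2" for x e
    using power_mono[OF norm_blinfun[of B "row x e"], of 2] by (simp add: power_mult_distrib)
  have summ: "(\<lambda>e. (norm (B (row x e)))\<^sup>2) summable_on onb" for x
    by (rule summable_on_comparison_test[OF summable_on_cmult_right[OF
            has_sum_imp_summable[OF rowsum[of x]], of "(norm B)\<^sup>2"]]) (auto simp: le)
  have rr: "((\<lambda>f. (cmod (r x (e, f)))\<^sup>2) has_sum (norm (B (row x e)))\<^sup>2) onb" if "e \<in> onb" for x e
    using Parseval_norm[of "B (row x e)"]
    by (rule has_sum_cong[THEN iffD1, rotated]) (simp add: r_def that)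
  have rsum: "(\<lambda>i. (cmod (r x i))\<^sup>2) summable_on onb \<times> onb" for x
    by (rule summable_on_SigmaI[OF rr summ]) auto
  have "(\<lambda>i. (cmod (r x i))\<^sup>2) summable_on UNIV" for x
    using rsum[of x]
    by (rule summable_on_cong_neutral[THEN iffD1, rotated -1]) (auto simp: r_def split: if_splits)
  then have rep: "hcoeff (S x) = r x" for x
    unfolding S_def by (intro Abs_htensor_inverse) (auto simp: r_def)
  have lin: "S (x + y) = S x + S y" "S (c *\<^sub>C x) = c *\<^sub>C S x" for x y c
  proof -
    have "row (x + y) e = row x e + row y e" "row (c *\<^sub>C x) e = c *\<^sub>C row x e" for e
      by (rule onb_eqI, simp add: row cinner_add_left cinner_scaleC_left plus_htensor.rep_eq
          scaleC_htensor.rep_eq)+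
    then show "S (x + y) = S x + S y" "S (c *\<^sub>C x) = c *\<^sub>C S x"
      by (simp_all add: hcoeff_inject[symmetric] rep plus_htensor.rep_eq scaleC_htensor.rep_eq
          fun_eq_iff r_def blinfun.add_right cinner_add_left blinfun_cbounded_scaleC[OF B]
          cinner_scaleC_left)
  qed
  have "norm (S x) \<le> norm x * norm B" for x
  proof -
    have "((\<lambda>e. (norm (B (row x e)))\<^sup>2) has_sum (norm (S x))\<^sup>2) onb"
      by (rule has_sum_SigmaD[OF hcoeff_has_sum]) (simp add: rep rr)
    then have "(norm (S x))\<^sup>2 \<le> (norm B)\<^sup>2 * (norm x)\<^sup>2"
      by (rule has_sum_mono[OF _ has_sum_cmult_right[OF rowsum]]) (rule le)
    then have "(norm (S x))\<^sup>2 \<le> (norm x * norm B)\<^sup>2" by (simp add: power_mult_distrib mult.commute)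
    then show ?thesis by (rule power2_le_imp_le) simp
  qed
  then have "bounded_linear S"
    by (intro bounded_linear_intro[of _ "norm B"]) (auto simp: lin scaleR_scaleC)
  moreover have "S (u \<otimes>\<^sub>h v) = u \<otimes>\<^sub>h B v" for u v
  proof (rule htensor_eqI)
    fix e :: 'a and f :: 'c
    assume ef: "e \<in> onb" "f \<in> onb"
    have "row (u \<otimes>\<^sub>h v) e = cinner u e *\<^sub>C v"
      by (rule onb_eqI) (simp add: row otimes.rep_eq ef cinner_scaleC_left)
    then show "hcoeff (S (u \<otimes>\<^sub>h v)) (e, f) = hcoeff (u \<otimes>\<^sub>h B v) (e, f)"
      using ef by (simp add: rep r_def otimes.rep_eq blinfun_cbounded_scaleC[OF B] cinner_scaleC_left)
  qed
  ultimately show ?thesis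
    by (intro exI[of _ "Blinfun S"]) (auto simp: bounded_linear_Blinfun_apply cbounded_def lin)
qed

lemma op_tensor_ex1:
  fixes A :: "'a::chilbert_space \<Rightarrow>\<^sub>L 'c::chilbert_space"
    and B :: "'b::chilbert_space \<Rightarrow>\<^sub>L 'd::chilbert_space"
  assumes A: "A \<in> \<B>" and B: "B \<in> \<B>"
  shows "\<exists>!T :: ('a, 'b) htensor \<Rightarrow>\<^sub>L ('c, 'd) htensor. T \<in> \<B> \<and> (\<forall>u v.
    blinfun_apply T (u \<otimes>\<^sub>h v) = blinfun_apply A u \<otimes>\<^sub>h blinfun_apply B v)"
proof (rule ex_ex1I)
  obtain R :: "('a, 'b) htensor \<Rightarrow>\<^sub>L ('a, 'd) htensor"
    where R: "R \<in> \<B>" "\<And>u v. R (u \<otimes>\<^sub>h v) = u \<otimes>\<^sub>h B v"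
    using op_right_exists[OF B] by blast
  obtain S :: "('a, 'd) htensor \<Rightarrow>\<^sub>L ('d, 'a) htensor"
    where S: "S \<in> \<B>" "\<And>u v. S (u \<otimes>\<^sub>h v) = v \<otimes>\<^sub>h u"
    using op_swap_exists by blast
  obtain L :: "('d, 'a) htensor \<Rightarrow>\<^sub>L ('d, 'c) htensor"
    where L: "L \<in> \<B>" "\<And>u v. L (u \<otimes>\<^sub>h v) = u \<otimes>\<^sub>h A v"
    using op_right_exists[OF A] by blast
  obtain S' :: "('d, 'c) htensor \<Rightarrow>\<^sub>L ('c, 'd) htensor"
    where S': "S' \<in> \<B>" "\<And>u v. S' (u \<otimes>\<^sub>h v) = v \<otimes>\<^sub>h u"
    using op_swap_exists by blast
  show "\<exists>T. T \<in> \<B> \<and> (\<forall>u v. blinfun_apply T (u \<otimes>\<^sub>h v) = A u \<otimes>\<^sub>h B v)"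
    by (rule exI[of _ "S' o\<^sub>L L o\<^sub>L S o\<^sub>L R"])
      (use R S L S' in \<open>auto simp: cbounded_def\<close>)
next
  fix T T' :: "('a, 'b) htensor \<Rightarrow>\<^sub>L ('c, 'd) htensor"
  assume *: "T \<in> \<B> \<and> (\<forall>u v. T (u \<otimes>\<^sub>h v) = A u \<otimes>\<^sub>h B v)"
    "T' \<in> \<B> \<and> (\<forall>u v. T' (u \<otimes>\<^sub>h v) = A u \<otimes>\<^sub>h B v)"
  have "T x = T' x" if "x \<in> span (range (\<lambda>(u, v). u \<otimes>\<^sub>h v))" for x
    using that by (rule linear_eq_on[rotated 2])
      (use * in \<open>auto intro: bounded_linear.linear blinfun.bounded_linear_right\<close>)
  then have "closure (span (range (\<lambda>(u, v). u \<otimes>\<^sub>h v))) \<subseteq> {x. blinfun_apply T x = blinfun_apply T' x}"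
    by (intro closure_minimal closed_Collect_eq continuous_intros) auto
  then show "T = T'" by (intro blinfun_eqI) (auto simp: closure_span_otimes)
qed

lemma
  assumes "A \<in> \<B>" and "B \<in> \<B>"
  shows op_tensor_cbounded: "A \<otimes>\<^sub>o B \<in> \<B>"
    and op_tensor_otimes:
      "blinfun_apply (A \<otimes>\<^sub>o B) (u \<otimes>\<^sub>h v) = blinfun_apply A u \<otimes>\<^sub>h blinfun_apply B v"
  using theI'[OF op_tensor_ex1[OF assms]] unfolding op_tensor_def by blast+

section \<open>The symmetrized bidisc and the pentablock\<close>

definition G2 :: "(complex \<times> complex) set"
  where "G2 = {(l1 + l2, l1 * l2) | l1 l2. cmod l1 < 1 \<and> cmod l2 < 1}"

text \<open>The library norm on \<open>complex^2^2\<close> is the Frobenius norm, so the operator norm is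
  written as \<open>onorm\<close>. A point \<open>z = (z1, z2, z3)\<close> has \<open>snd z = (z2, z3)\<close>.\<close>

definition pentablock :: "(complex \<times> complex \<times> complex) set"
  where "pentablock = {(A $ 2 $ 1, trace A, det A) | A :: complex^2^2. onorm ((*v) A) < 1}"

definition Phi :: "complex \<Rightarrow> complex \<times> complex \<Rightarrow> complex"
  where "Phi \<alpha> = (\<lambda>(s, p). (2 * \<alpha> * p - s) / (2 - \<alpha> * s))"

definition psi :: "complex \<Rightarrow> complex \<times> complex \<times> complex \<Rightarrow> complex"
  where "psi \<alpha> = (\<lambda>(a, s, p).
    (1 - complex_of_real ((cmod \<alpha>)\<^sup>2)) * a / (1 - \<alpha> * s + \<alpha>\<^sup>2 * p))"

text \<open>The closed unit disc as a type, so that the library type \<open>cdisc \<Rightarrow>\<^sub>C complex\<close> with its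
  supremum norm is the space of continuous functions on the closed disc.\<close>

typedef cdisc = "cball (0::complex) 1"
  morphisms of_cdisc Abs_cdisc
  by (rule exI[of _ 0]) simp

instantiation cdisc :: metric_space
begin
definition dist_cdisc :: "cdisc \<Rightarrow> cdisc \<Rightarrow> real"
  where "dist_cdisc a b = dist (of_cdisc a) (of_cdisc b)"
definition uniformity_cdisc :: "(cdisc \<times> cdisc) filter"
  where "uniformity_cdisc = (INF e\<in>{0 <..}. principal {(x, y). dist x y < e})"
definition open_cdisc :: "cdisc set \<Rightarrow> bool"
  where "open_cdisc S = (\<forall>x\<in>S. \<forall>\<^sub>F (x', y) in uniformity. x' = x \<longrightarrow> y \<in> S)"
instance
  by standard (auto simp: dist_cdisc_def uniformity_cdisc_def open_cdisc_def of_cdisc_inject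
      intro: dist_triangle2)
end

lemma range_of_cdisc: "range of_cdisc = cball 0 1"
  by (metis type_definition.Rep_range type_definition_cdisc)

lemma continuous_on_of_cdisc: "continuous_on UNIV of_cdisc"
  by (auto simp: continuous_on_iff dist_cdisc_def)

lemma bcontfun_of_cdisc:
  fixes f :: "complex \<Rightarrow> complex"
  assumes "continuous_on (cball 0 1) f"
  shows "(\<lambda>\<alpha>. f (of_cdisc \<alpha>)) \<in> bcontfun"
proof -
  have "continuous_on UNIV (\<lambda>\<alpha>. f (of_cdisc \<alpha>))"
    by (rule continuous_on_compose2[OF assms continuous_on_of_cdisc]) (simp add: range_of_cdisc)
  moreover have "range (\<lambda>\<alpha>. f (of_cdisc \<alpha>)) = f ` cball 0 1"
    by (simp add: range_of_cdisc[symmetric] image_image)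
  moreover have "bounded (f ` cball 0 1)"
    by (intro compact_imp_bounded compact_continuous_image assms compact_cball)
  ultimately show ?thesis by (simp add: bcontfun_def)
qed

definition bigJ :: "complex \<times> complex \<times> complex \<Rightarrow> cdisc \<Rightarrow>\<^sub>C complex"
  where "bigJ z = Bcontfun (\<lambda>\<alpha>. psi (of_cdisc \<alpha>) z)"

definition smallj :: "complex \<times> complex \<times> complex \<Rightarrow> cdisc \<Rightarrow>\<^sub>C complex"
  where "smallj z = Bcontfun (\<lambda>\<alpha>. Phi (of_cdisc \<alpha>) (snd z))"

definition times_cnj :: "('a::topological_space \<Rightarrow>\<^sub>C complex) \<Rightarrow> ('a \<Rightarrow>\<^sub>C complex) \<Rightarrow> 'a \<Rightarrow>\<^sub>C complex"
  where "times_cnj g h = Bcontfun (\<lambda>x. apply_bcontfun g x * cnj (apply_bcontfun h x))"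

lemma apply_times_cnj:
  "apply_bcontfun (times_cnj g h) x = apply_bcontfun g x * cnj (apply_bcontfun h x)"
proof -
  obtain M N where "\<And>x. norm (apply_bcontfun g x) \<le> M" "\<And>x. norm (apply_bcontfun h x) \<le> N"
    using bounded_apply_bcontfun[of g] bounded_apply_bcontfun[of h]
    unfolding bounded_iff by auto
  then have "norm (apply_bcontfun g x * cnj (apply_bcontfun h x)) \<le> M * N" for x
    by (simp add: norm_mult) (meson mult_mono norm_ge_zero order_trans)
  then have "bounded (range (\<lambda>x. apply_bcontfun g x * cnj (apply_bcontfun h x)))"
    by (intro boundedI[of _ "M * N"]) auto
  then show ?thesis
    unfolding times_cnj_def by (subst Bcontfun_inverse) (auto simp: bcontfun_def intro!: continuous_intros)
qed

lemma bounded_linear_matrix_vector: "bounded_linear ((*v) (A :: complex^'n^'m))"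
proof -
  have "linear ((*v) A)"
    by (rule linearI)
      (auto simp: matrix_vector_mult_def vec_eq_iff sum.distrib algebra_simps scaleR_sum_right)
  then show ?thesis by (rule linear_conv_bounded_linear[THEN iffD1])
qed

lemma snd_pentablock: "z \<in> pentablock \<Longrightarrow> snd z \<in> G2"
proof -
  assume "z \<in> pentablock"
  then obtain A :: "complex^2^2" where z: "z = (A $ 2 $ 1, trace A, det A)"
    and A: "onorm ((*v) A) < 1" by (auto simp: pentablock_def)
  define d where "d = csqrt ((trace A)\<^sup>2 - 4 * det A)"
  have d: "d * d = (trace A)\<^sup>2 - 4 * det A" by (simp add: d_def flip: power2_eq_square)
  have eig: "cmod l < 1" if l: "l\<^sup>2 - trace A * l + det A = 0" for l
  proof -
    have "det (A - mat l) = 0"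
      using l by (simp add: det_2 trace_def sum_2 mat_def algebra_simps power2_eq_square)
    then have "\<not> invertible (A - mat l)" by (simp add: invertible_det_nz)
    then obtain v where v: "v \<noteq> 0" "(A - mat l) *v v = 0"
      unfolding invertible_left_inverse matrix_left_invertible_ker by blast
    have "A *v v = (\<chi> i. l * v $ i)"
      using v(2) by (simp add: vec_eq_iff matrix_vector_mult_def mat_def sum_2 forall_2 algebra_simps)
    then have "norm (A *v v) = cmod l * norm v"
      by (simp add: norm_vec_def norm_mult L2_set_right_distrib)
    moreover have "norm (A *v v) \<le> onorm ((*v) A) * norm v"
      by (rule onorm[OF bounded_linear_matrix_vector])
    ultimately have "cmod l \<le> onorm ((*v) A)" using v(1) by simp
    then show ?thesis using A by simp
  qed
  have root: "((t + e) / 2)\<^sup>2 - t * ((t + e) / 2) + D = (e * e - (t\<^sup>2 - 4 * D)) / 4"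
    for t e D :: complex
    by (simp add: field_simps power2_eq_square)
  have "cmod ((trace A + d) / 2) < 1" "cmod ((trace A - d) / 2) < 1"
    by (rule eig, use root[of "trace A" d "det A"] root[of "trace A" "- d" "det A"] d in simp)+
  moreover have "trace A = (trace A + d) / 2 + (trace A - d) / 2"
    "det A = (trace A + d) / 2 * ((trace A - d) / 2)"
    using d by (auto simp: field_simps power2_eq_square)
  ultimately show ?thesis unfolding z G2_def snd_conv by blast
qed

lemma G2_denominators:
  assumes "(s, p) \<in> G2" "cmod \<alpha> \<le> 1"
  shows "1 - \<alpha> * s + \<alpha>\<^sup>2 * p \<noteq> 0" "2 - \<alpha> * s \<noteq> 0"
proof -
  obtain l1 l2 where l: "s = l1 + l2" "p = l1 * l2" "cmod l1 < 1" "cmod l2 < 1"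
    using assms(1) by (auto simp: G2_def)
  have *: "cmod (\<alpha> * l) < 1" if "cmod l < 1" for l
    using assms(2) that mult_left_le_one_le[of "cmod l" "cmod \<alpha>"] by (simp add: norm_mult)
  have "1 - \<alpha> * s + \<alpha>\<^sup>2 * p = (1 - \<alpha> * l1) * (1 - \<alpha> * l2)"
    by (simp add: l algebra_simps power2_eq_square)
  then show "1 - \<alpha> * s + \<alpha>\<^sup>2 * p \<noteq> 0"
    using *[OF l(3)] *[OF l(4)] by auto
  have "cmod (\<alpha> * s) < 2"
    using norm_triangle_ineq[of "\<alpha> * l1" "\<alpha> * l2"] *[OF l(3)] *[OF l(4)]
    by (simp add: l algebra_simps)
  then show "2 - \<alpha> * s \<noteq> 0" by auto
qed

lemma apply_bigJ: "z \<in> pentablock \<Longrightarrow> apply_bcontfun (bigJ z) \<alpha> = psi (of_cdisc \<alpha>) z"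
proof -
  assume z: "z \<in> pentablock"
  obtain a s p where "z = (a, s, p)" by (cases z)
  moreover from this z have "(s, p) \<in> G2" using snd_pentablock by fastforce
  ultimately have "continuous_on (cball 0 1) (\<lambda>\<alpha>. psi \<alpha> z)"
    unfolding psi_def by (auto intro!: continuous_intros dest: G2_denominators)
  then show ?thesis
    unfolding bigJ_def by (subst Bcontfun_inverse) (auto intro: bcontfun_of_cdisc)
qed

lemma apply_smallj: "z \<in> pentablock \<Longrightarrow> apply_bcontfun (smallj z) \<alpha> = Phi (of_cdisc \<alpha>) (snd z)"
proof -
  assume z: "z \<in> pentablock"
  obtain a s p where "z = (a, s, p)" by (cases z)
  moreover from this z have "(s, p) \<in> G2" using snd_pentablock by fastforce
  ultimately have "continuous_on (cball 0 1) (\<lambda>\<alpha>. Phi \<alpha> (snd z))"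
    unfolding Phi_def by (auto intro!: continuous_intros dest: G2_denominators)
  then show ?thesis
    unfolding smallj_def by (subst Bcontfun_inverse) (auto intro: bcontfun_of_cdisc)
qed

section \<open>Kernels\<close>

text \<open>For complex \<open>c\<close>, \<open>0 \<le> c\<close> means that \<open>c\<close> is real and nonnegative. The values of the
  functions below at points outside the set \<open>S\<close> are irrelevant.\<close>

definition psd_on :: "'z set \<Rightarrow> ('z \<Rightarrow> 'z \<Rightarrow> 'l::chilbert_space \<Rightarrow>\<^sub>L 'l) \<Rightarrow> bool"
  where "psd_on S k \<longleftrightarrow> (\<forall>(n::nat) z v. (\<forall>i<n. z i \<in> S) \<longrightarrow>
    0 \<le> (\<Sum>i<n. \<Sum>j<n. cinner (blinfun_apply (k (z i) (z j)) (v j)) (v i)))"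

definition weak_kernel :: "'z set \<Rightarrow> ('z \<Rightarrow> 'z \<Rightarrow> 'l::chilbert_space \<Rightarrow>\<^sub>L 'l) \<Rightarrow> bool"
  where "weak_kernel S k \<longleftrightarrow> (\<forall>z\<in>S. \<forall>w\<in>S. k z w \<in> \<B>) \<and> psd_on S k"

definition op_kernel :: "'z set \<Rightarrow> ('z \<Rightarrow> 'z \<Rightarrow> 'l::chilbert_space \<Rightarrow>\<^sub>L 'l) \<Rightarrow> bool"
  where "op_kernel S k \<longleftrightarrow> weak_kernel S k \<and> (\<forall>z\<in>S. k z z \<noteq> 0)"

definition admissible_kernel ::
    "(complex \<times> complex \<times> complex \<Rightarrow> complex \<times> complex \<times> complex \<Rightarrow> 'l::chilbert_space \<Rightarrow>\<^sub>L 'l) \<Rightarrow> bool"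
  where "admissible_kernel k \<longleftrightarrow> op_kernel pentablock k \<and> (\<forall>\<alpha>\<in>cball 0 1.
    psd_on pentablock (\<lambda>z w. (1 - fst (snd z) * cnj (fst (snd w)) / 4) *\<^sub>C k z w) \<and>
    psd_on pentablock (\<lambda>z w. (1 - Phi \<alpha> (snd z) * cnj (Phi \<alpha> (snd w))) *\<^sub>C k z w) \<and>
    psd_on pentablock (\<lambda>z w. (1 - psi \<alpha> z * cnj (psi \<alpha> w)) *\<^sub>C k z w))"

definition cp_kernel ::
    "'z set \<Rightarrow> ('z \<Rightarrow> 'z \<Rightarrow> (cdisc \<Rightarrow>\<^sub>C complex) \<Rightarrow>\<^sub>L ('l::chilbert_space \<Rightarrow>\<^sub>L 'l)) \<Rightarrow> bool"
  where "cp_kernel S \<xi> \<longleftrightarrow>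
    (\<forall>z\<in>S. \<forall>w\<in>S. \<xi> z w \<in> \<B> \<and> (\<forall>h. blinfun_apply (\<xi> z w) h \<in> \<B>)) \<and>
    (\<forall>(n::nat) z h v. (\<forall>i<n. z i \<in> S) \<longrightarrow>
      0 \<le> (\<Sum>i<n. \<Sum>j<n. cinner
        (blinfun_apply (blinfun_apply (\<xi> (z i) (z j)) (times_cnj (h i) (h j))) (v j)) (v i)))"

text \<open>Positivity of the block operator \<open>[M z w]\<close>, \<open>z, w \<in> F\<close>, acting on the direct sum of
  copies of \<open>'l\<close> indexed by the finite set \<open>F\<close>.\<close>

definition block_psd :: "'z set \<Rightarrow> ('z \<Rightarrow> 'z \<Rightarrow> 'l::chilbert_space \<Rightarrow>\<^sub>L 'l) \<Rightarrow> bool"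
  where "block_psd F M \<longleftrightarrow>
    (\<forall>x. 0 \<le> (\<Sum>z\<in>F. \<Sum>w\<in>F. cinner (blinfun_apply (M z w) (x w)) (x z)))"

end

theory Submission
  imports Defs "HOL-Complex_Analysis.Cauchy_Integral_Formula" "HOL-Computational_Algebra.Fundamental_Theorem_Algebra"
begin

text \<open>The cycle (1) to (2) to (3) to (1).

  From (1) to (2): on finitely many points the Gram vectors of an admissible kernel carry a commuting pair of
  operators with spectral set the closed symmetrized bidisc. Its fundamental operator has numerical radius at
  most 1, so at each point of the unit circle the pair is replaced by a hermitian matrix with spectrum in
  \<open>[-2, 2]\<close>; diagonalizing it and applying Cauchy's formula gives the von Neumann inequality for polynomials in
  \<open>(s, p)\<close>, hence for \<open>\<Upsilon>31\<close> by its weighted homogeneous expansion.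

  From (2) to (3): on finitely many points and basis vectors, a functional separating the left-hand side
  from the cone of all \<open>\<mu>(z,w)(1 - j(z) conj j(w))\<close> is a kernel that, placed on the points \<open>(0, s, p)\<close>, where
  \<open>\<psi>\<close> vanishes, and perturbed by a small multiple of the identity kernel, is admissible and contradicts (2).
  Tychonoff's theorem yields an exact completely positive form. As \<open>j\<close> and the left-hand side depend on
  \<open>(s, p)\<close> only, \<open>\<xi>\<close> and \<open>\<delta>\<close> can be taken to be 0.

  From (3) to (1): restricted to \<open>z1 = 0\<close> the identity equates two Gram matrices up to a positive one, so a
  contraction \<open>W\<close> (lurking isometry) and the contraction \<open>T\<close> of multiplication by the coordinate give \<open>\<Upsilon>31\<close> as a
  transfer function.\<close>

section \<open>Hilbert space preliminaries\<close>

text \<open>Two facts about \<Phi> are used throughout. As \<open>Phi 0 (s, p) = - s / 2\<close>,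
  the factor of the weak kernel is the value at \<alpha> = 0 of \<open>1 - j(z) conj j(w)\<close>,
  so a weak kernel acts as a point mass at 0. And j(z) has supremum norm strictly below 1, so the
  value of a positive functional on the defect \<open>1 - |j(z)|^2\<close> controls its total mass;
  this gives the bounds behind compactness and the passage from forms to operators. Operator-valued
  positivity is traded for positivity of a scalar kernel whose points carry the vectors, and this
  kernel is factored through \<open>'x ell2\<close>. Operators are then described by their pairings
  with the Gram vectors. These may be linearly dependent, so every construction has to respect their
  linear relations. In the first implication \<open>\<Upsilon>31\<close> lives on the open domain,
  while the spectra on the circle reach the boundary. Hence the dilation (r s, r^2 p), whose Taylor
  coefficients in r are polynomials in s and p; r tends to 1 only after the inequality has been
  proved.\<close>

instantiation complex :: chilbert_space
begin
definition cinner_complex :: "complex \<Rightarrow> complex \<Rightarrow> complex"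
  where "cinner_complex x y = x * cnj y"
instance
  by standard (auto simp: cinner_complex_def algebra_simps complex_norm_square[symmetric])
end

instance prod :: (complex_normed_vector, complex_normed_vector) complex_normed_vector
  by standard (auto simp: scaleC_prod_def norm_prod_def norm_scaleC power_mult_distrib
      real_sqrt_mult simp flip: distrib_left)

instantiation prod :: (chilbert_space, chilbert_space) chilbert_space
begin
definition cinner_prod :: "'a \<times> 'b \<Rightarrow> 'a \<times> 'b \<Rightarrow> complex"
  where "cinner_prod x y = cinner (fst x) (fst y) + cinner (snd x) (snd y)"
instance
proof
  fix x y z :: "'a \<times> 'b" and a :: complex
  show "cinner x y = cnj (cinner y x)"
    by (simp add: cinner_prod_def flip: cinner_commute)
  show "cinner (x + y) z = cinner x z + cinner y z"
    by (simp add: cinner_prod_def cinner_add_left)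
  show "cinner (a *\<^sub>C x) y = a * cinner x y"
    by (simp add: cinner_prod_def cinner_scaleC_left scaleC_prod_def algebra_simps)
  show "cinner x x = complex_of_real ((norm x)\<^sup>2)"
    by (simp add: cinner_prod_def cinner_self norm_prod_def)
qed
end

text \<open>The index type is arbitrary: a kernel on points of type \<open>'x\<close> is factored
  through this space with the points themselves as coordinates, also when there are uncountably many
  of them.\<close>

typedef 'x ell2 = "{f :: 'x \<Rightarrow> complex. (\<lambda>i. (cmod (f i))\<^sup>2) summable_on UNIV}"
  morphisms ecoeff Abs_ell2
  by (rule exI[of _ "\<lambda>_. 0"]) simp

setup_lifting type_definition_ell2

lemma ecoeff_sqsum: "(\<lambda>i. (cmod (ecoeff x i))\<^sup>2) summable_on UNIV"
  using ecoeff[of x] by blast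

instantiation ell2 :: (type) complex_inner
begin

lift_definition zero_ell2 :: "'a ell2" is "\<lambda>_. 0" by simp
lift_definition plus_ell2 :: "'a ell2 \<Rightarrow> 'a ell2 \<Rightarrow> 'a ell2"
  is "\<lambda>f g i. f i + g i" by (simp add: sqsum_add)
lift_definition uminus_ell2 :: "'a ell2 \<Rightarrow> 'a ell2"
  is "\<lambda>f i. - f i" by simp
lift_definition minus_ell2 :: "'a ell2 \<Rightarrow> 'a ell2 \<Rightarrow> 'a ell2"
  is "\<lambda>f g i. f i - g i"
  subgoal for f g using sqsum_add[of f "\<lambda>i. - g i"] by simp
  done
lift_definition scaleC_ell2 :: "complex \<Rightarrow> 'a ell2 \<Rightarrow> 'a ell2"
  is "\<lambda>c f i. c * f i" by (rule sqsum_scale)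
definition scaleR_ell2 :: "real \<Rightarrow> 'a ell2 \<Rightarrow> 'a ell2"
  where "scaleR_ell2 r x = complex_of_real r *\<^sub>C x"
definition cinner_ell2 :: "'a ell2 \<Rightarrow> 'a ell2 \<Rightarrow> complex"
  where "cinner_ell2 x y = (\<Sum>\<^sub>\<infinity>i. ecoeff x i * cnj (ecoeff y i))"
definition norm_ell2 :: "'a ell2 \<Rightarrow> real"
  where "norm_ell2 x = sqrt (\<Sum>\<^sub>\<infinity>i. (cmod (ecoeff x i))\<^sup>2)"
definition dist_ell2 :: "'a ell2 \<Rightarrow> 'a ell2 \<Rightarrow> real"
  where "dist_ell2 x y = norm (x - y)"
definition sgn_ell2 :: "'a ell2 \<Rightarrow> 'a ell2"
  where "sgn_ell2 x = inverse (norm x) *\<^sub>R x"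
definition uniformity_ell2 :: "('a ell2 \<times> 'a ell2) filter"
  where "uniformity_ell2 = (INF e\<in>{0 <..}. principal {(x, y). dist x y < e})"
definition open_ell2 :: "'a ell2 set \<Rightarrow> bool"
  where "open_ell2 S = (\<forall>x\<in>S. \<forall>\<^sub>F (x', y) in uniformity. x' = x \<longrightarrow> y \<in> S)"

instance
proof
  have ms: "(\<lambda>i. ecoeff u i * cnj (ecoeff v i)) summable_on UNIV" for u v :: "'a ell2"
    by (rule sqsum_mult_summable[OF ecoeff_sqsum ecoeff_sqsum])
  have nsc: "norm (c *\<^sub>C u) = cmod c * norm u" for c and u :: "'a ell2"
    by (simp add: norm_ell2_def scaleC_ell2.rep_eq norm_mult power_mult_distrib
        infsum_cmult_right' real_sqrt_mult)
  fix x y z :: "'a ell2" and a b :: complex and r s :: real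
  show "x + y + z = x + (y + z)" "x + y = y + x" "0 + x = x" "- x + x = 0" "x - y = x + - y"
    by (transfer, simp add: algebra_simps)+
  show "a *\<^sub>C (x + y) = a *\<^sub>C x + a *\<^sub>C y" "(a + b) *\<^sub>C x = a *\<^sub>C x + b *\<^sub>C x"
    "a *\<^sub>C (b *\<^sub>C x) = (a * b) *\<^sub>C x" "1 *\<^sub>C x = x"
    by (transfer, simp add: algebra_simps)+
  show "r *\<^sub>R x = complex_of_real r *\<^sub>C x" by (simp add: scaleR_ell2_def)
  show "r *\<^sub>R (x + y) = r *\<^sub>R x + r *\<^sub>R y" "(r + s) *\<^sub>R x = r *\<^sub>R x + s *\<^sub>R x"
    "r *\<^sub>R s *\<^sub>R x = (r * s) *\<^sub>R x" "1 *\<^sub>R x = x"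
    unfolding scaleR_ell2_def by (transfer, simp add: algebra_simps)+
  show "dist x y = norm (x - y)" "sgn x = inverse (norm x) *\<^sub>R x"
    "uniformity = (INF e\<in>{0 <..}. principal {(x, y::'a ell2). dist x y < e})"
    by (simp_all add: dist_ell2_def sgn_ell2_def uniformity_ell2_def)
  show "open U = (\<forall>x\<in>U. \<forall>\<^sub>F (x', y) in uniformity. x' = x \<longrightarrow> y \<in> U)"
    for U :: "'a ell2 set" by (simp add: open_ell2_def)
  show "(norm x = 0) = (x = 0)"
  proof
    assume "norm x = 0"
    then have "(\<Sum>\<^sub>\<infinity>i. (cmod (ecoeff x i))\<^sup>2) = 0" by (simp add: norm_ell2_def)
    then have "(cmod (ecoeff x i))\<^sup>2 = 0" for i
      using nonneg_infsum_le_0D[OF _ ecoeff_sqsum[of x], of i] by simp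
    then show "x = 0" by transfer auto
  qed (simp add: norm_ell2_def zero_ell2.rep_eq)
  show "norm (x + y) \<le> norm x + norm y"
    unfolding norm_ell2_def
  proof (rule sqrt_infsum_le[OF ecoeff_sqsum])
    fix F :: "'a set" assume "finite F"
    then show "L2_set (\<lambda>i. cmod (ecoeff (x + y) i)) F \<le> sqrt (\<Sum>\<^sub>\<infinity>i. (cmod (ecoeff x i))\<^sup>2)
        + sqrt (\<Sum>\<^sub>\<infinity>i. (cmod (ecoeff y i))\<^sup>2)"
      unfolding plus_ell2.rep_eq
      by (intro order_trans[OF L2_set_cmod_add] add_mono L2_set_cmod_le ecoeff_sqsum)
  qed
  show "norm (a *\<^sub>C x) = cmod a * norm x" by (rule nsc)
  show "norm (r *\<^sub>R x) = \<bar>r\<bar> * norm x" by (simp add: scaleR_ell2_def nsc)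
  show "cinner x y = cnj (cinner y x)"
    unfolding cinner_ell2_def infsum_cnj[symmetric] by (simp add: mult.commute)
  show "cinner (x + y) z = cinner x z + cinner y z"
    unfolding cinner_ell2_def plus_ell2.rep_eq distrib_right by (rule infsum_add[OF ms ms])
  show "cinner (a *\<^sub>C x) y = a * cinner x y"
    by (simp add: cinner_ell2_def scaleC_ell2.rep_eq mult.assoc infsum_cmult_right')
  have "((\<lambda>i. (cmod (ecoeff x i))\<^sup>2) has_sum (norm x)\<^sup>2) UNIV"
    using ecoeff_sqsum[of x] by (simp add: norm_ell2_def infsum_nonneg)
  then have "((\<lambda>i. complex_of_real ((cmod (ecoeff x i))\<^sup>2)) has_sum complex_of_real ((norm x)\<^sup>2)) UNIV"
    by (rule has_sum_of_real)
  then show "cinner x x = complex_of_real ((norm x)\<^sup>2)"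
    unfolding cinner_ell2_def by (simp only: infsumI complex_norm_square)
qed

end

lemma ell2_L2_set_le: "finite F \<Longrightarrow> L2_set (\<lambda>i. cmod (ecoeff x i)) F \<le> norm x"
  unfolding norm_ell2_def by (rule L2_set_cmod_le[OF ecoeff_sqsum])

lemma cmod_ecoeff_le: "cmod (ecoeff x i) \<le> norm x"
  using ell2_L2_set_le[of "{i}" x] by simp

lemma bounded_linear_ecoeff: "bounded_linear (\<lambda>x. ecoeff x i)"
  by (rule bounded_linear_intro[of _ 1])
    (auto simp: plus_ell2.rep_eq scaleR_ell2_def scaleC_ell2.rep_eq scaleR_conv_of_real
      cmod_ecoeff_le)

instance ell2 :: (type) chilbert_space
proof
  fix X :: "nat \<Rightarrow> 'a ell2"
  assume X: "Cauchy X"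
  have "Cauchy (\<lambda>n. ecoeff (X n) i)" for i
    by (rule bounded_linear.Cauchy[OF bounded_linear_ecoeff X])
  then obtain L where L: "\<And>i. (\<lambda>n. ecoeff (X n) i) \<longlonglongrightarrow> L i"
    unfolding Cauchy_convergent_iff convergent_def by metis
  have close: "\<exists>M. \<forall>n\<ge>M. \<forall>F. finite F \<longrightarrow> L2_set (\<lambda>i. cmod (L i - ecoeff (X n) i)) F \<le> e"
    if "e > 0" for e
  proof -
    obtain M where M: "\<And>m n. m \<ge> M \<Longrightarrow> n \<ge> M \<Longrightarrow> norm (X m - X n) < e"
      using CauchyD[OF X \<open>e > 0\<close>] by blast
    have "L2_set (\<lambda>i. cmod (L i - ecoeff (X n) i)) F \<le> e" if "n \<ge> M" "finite F" for n F
    proof (rule tendsto_upperbound)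
      show "(\<lambda>m. L2_set (\<lambda>i. cmod (ecoeff (X m) i - ecoeff (X n) i)) F)
          \<longlonglongrightarrow> L2_set (\<lambda>i. cmod (L i - ecoeff (X n) i)) F"
        unfolding L2_set_def by (intro tendsto_intros L)
      have "L2_set (\<lambda>i. cmod (ecoeff (X m) i - ecoeff (X n) i)) F \<le> e" if "m \<ge> M" for m
        using ell2_L2_set_le[OF \<open>finite F\<close>, of "X m - X n"] M[OF that \<open>n \<ge> M\<close>]
        by (simp add: minus_ell2.rep_eq)
      then show "\<forall>\<^sub>F m in sequentially. L2_set (\<lambda>i. cmod (ecoeff (X m) i - ecoeff (X n) i)) F \<le> e"
        using eventually_sequentially by blast
    qed simp
    then show ?thesis by blast
  qed
  obtain N where "\<And>F. finite F \<Longrightarrow> L2_set (\<lambda>i. cmod (L i - ecoeff (X N) i)) F \<le> 1"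
    using close[of 1] by auto
  then have "(\<lambda>i. (cmod (L i - ecoeff (X N) i))\<^sup>2) summable_on UNIV"
    unfolding sqsum_iff by blast
  from sqsum_add[OF this ecoeff_sqsum[of "X N"]] have "(\<lambda>i. (cmod (L i))\<^sup>2) summable_on UNIV"
    by simp
  then obtain l where l: "ecoeff l = L" using Abs_ell2_inverse[of L] by auto
  have "X \<longlonglongrightarrow> l"
  proof (rule LIMSEQ_I)
    fix e :: real assume "e > 0"
    then obtain M where M: "\<And>n F. n \<ge> M \<Longrightarrow> finite F \<Longrightarrow>
        L2_set (\<lambda>i. cmod (L i - ecoeff (X n) i)) F \<le> e/2"
      using close[of "e/2"] by auto
    have "norm (X n - l) < e" if "n \<ge> M" for n
    proof -
      have "norm (l - X n) \<le> e/2"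
        unfolding norm_ell2_def
        by (rule sqrt_infsum_le[OF ecoeff_sqsum]) (use M[OF that] in \<open>auto simp: minus_ell2.rep_eq l\<close>)
      then show ?thesis using \<open>e > 0\<close> by (simp add: norm_minus_commute)
    qed
    then show "\<exists>M. \<forall>n\<ge>M. norm (X n - l) < e" by blast
  qed
  then show "convergent X" by (auto simp: convergent_def)
qed

lift_definition edelta :: "'x \<Rightarrow> 'x ell2" is "\<lambda>i j. if j = i then 1 else 0"
proof -
  fix i :: 'x
  show "(\<lambda>j. (cmod (if j = i then 1 else 0))\<^sup>2) summable_on UNIV"
    by (rule finite_nonzero_values_imp_summable_on) simp
qed

lemma cinner_edelta: "cinner x (edelta i) = ecoeff x i"
proof -
  have "((\<lambda>j. ecoeff x j * cnj (ecoeff (edelta i) j)) has_sum ecoeff x i) UNIV"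
    by (rule has_sum_finite_neutralI[of "{i}"]) (auto simp: edelta.rep_eq)
  then show ?thesis by (simp add: cinner_ell2_def infsumI)
qed

lemma cinner_edelta_left: "cinner (edelta i) x = cnj (ecoeff x i)"
  by (metis cinner_commute cinner_edelta)

section \<open>Complex linear spans, norm identities and limits of inner products\<close>

interpretation cvec: vector_space "scaleC :: complex \<Rightarrow> 'a \<Rightarrow> 'a::complex_vector"
  by standard (auto simp: scaleC_add_right scaleC_add_left scaleC_scaleC scaleC_one)

lemma norm_add_sq: "(norm (x + y))\<^sup>2 = (norm x)\<^sup>2 + 2 * Re (cinner x y) + (norm (y::'a::complex_inner))\<^sup>2"
proof -
  have "complex_of_real ((norm (x + y))\<^sup>2) = cinner (x + y) (x + y)"
    by (simp add: cinner_self)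
  also have "\<dots> = cinner x x + (cinner x y + cnj (cinner x y)) + cinner y y"
    by (simp add: cinner_add_left cinner_add_right flip: cinner_commute)
  also have "\<dots> = complex_of_real ((norm x)\<^sup>2 + 2 * Re (cinner x y) + (norm y)\<^sup>2)"
    by (simp add: cinner_self complex_add_cnj)
  finally show ?thesis using of_real_eq_iff by blast
qed

lemma norm_diff_sq: "(norm (x - y))\<^sup>2 = (norm x)\<^sup>2 - 2 * Re (cinner x y) + (norm (y::'a::complex_inner))\<^sup>2"
  using norm_add_sq[of x "- y"] by (simp add: cinner_minus_right)

lemma Re_cinner_self: "Re (cinner x x) = (norm (x::'a::complex_inner))\<^sup>2"
  by (simp add: cinner_self)

lemma tendsto_cinner:
  "(f \<longlongrightarrow> a) F \<Longrightarrow> (g \<longlongrightarrow> b) F \<Longrightarrow> ((\<lambda>x. cinner (f x) (g x :: 'a::complex_inner)) \<longlongrightarrow> cinner a b) F"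
proof -
  assume f: "(f \<longlongrightarrow> a) F" and g: "(g \<longlongrightarrow> b) F"
  have "bounded_bilinear (\<lambda>(x::'a) y. cinner x y)"
    by (rule bounded_bilinear.intro)
      (auto simp: cinner_add_left cinner_add_right scaleR_scaleC cinner_scaleC_left
        cinner_scaleC_right scaleR_conv_of_real intro!: exI[of _ 1] cinner_Cauchy_Schwarz)
  from bounded_bilinear.tendsto[OF this f g] show ?thesis .
qed

text \<open>Tailored to minimizing sequences whose n-th value exceeds the infimum by less than
  \<open>1 / Suc n\<close>; the parallelogram law gives an estimate of exactly this shape.\<close>

lemma Cauchy_sq_dist:
  fixes X :: "nat \<Rightarrow> 'a::real_normed_vector"
  assumes "\<And>m n. (norm (X m - X n))\<^sup>2 \<le> c * (1 / Suc m + 1 / Suc n)" and "c > 0"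
  shows "Cauchy X"
proof (rule CauchyI)
  fix e :: real assume "e > 0"
  then have "e\<^sup>2 / (2 * c) > 0" using assms(2) by simp
  then obtain M where M: "1 / Suc M < e\<^sup>2 / (2 * c)"
    using nat_approx_posE by auto
  have *: "1 / real (Suc n) < e\<^sup>2 / (2 * c)" if "n \<ge> M" for n
    by (rule le_less_trans[OF _ M]) (use that in \<open>simp add: frac_le\<close>)
  have "norm (X m - X n) < e" if "m \<ge> M" "n \<ge> M" for m n
  proof -
    have "(norm (X m - X n))\<^sup>2 \<le> c * (1 / Suc m + 1 / Suc n)" by (rule assms)
    also have "\<dots> < c * (e\<^sup>2 / (2 * c) + e\<^sup>2 / (2 * c))"
      using *[OF that(1)] *[OF that(2)] assms(2)
      by (intro mult_strict_left_mono add_strict_mono) auto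
    also have "\<dots> = e\<^sup>2" using assms(2) by (simp add: field_simps)
    finally show ?thesis using \<open>e > 0\<close> power_less_imp_less_base by fastforce
  qed
  then show "\<exists>M. \<forall>m\<ge>M. \<forall>n\<ge>M. norm (X m - X n) < e" by blast
qed

text \<open>First-order condition at a minimum, with a complex step t: for t = - r conj z the linear
  term is - 2 r |z|^2, which dominates the quadratic one when r is small.\<close>

lemma nonneg_affine_imp_zero:
  fixes z :: complex
  assumes "\<And>t. 0 \<le> 2 * Re (t * z) + (cmod t)\<^sup>2 * N"
  shows "z = 0"
proof (rule ccontr)
  assume z: "z \<noteq> 0"
  \<comment> \<open>This r satisfies r N <= 1, so the quadratic term is at most r |z|^2, half of the
    linear loss; the absolute value covers negative N.\<close>
  define r where "r = 1 / (\<bar>N\<bar> + 1)"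
  have r: "0 < r" by (auto simp: r_def)
  have "r * \<bar>N\<bar> \<le> 1" by (simp add: r_def)
  then have rN: "r * N \<le> 1" using r by (smt (verit) mult_left_mono)
  have "0 \<le> 2 * Re ((- complex_of_real r * cnj z) * z) + (cmod (- complex_of_real r * cnj z))\<^sup>2 * N"
    by (rule assms)
  also have "Re ((- complex_of_real r * cnj z) * z) = - r * (cmod z)\<^sup>2"
    by (simp add: cmod_def power2_eq_square algebra_simps)
  finally have "0 \<le> - (2 * r * (cmod z)\<^sup>2) + r * (r * N) * (cmod z)\<^sup>2"
    by (simp add: norm_mult power_mult_distrib power2_eq_square algebra_simps)
  also have "\<dots> \<le> - (2 * r * (cmod z)\<^sup>2) + r * 1 * (cmod z)\<^sup>2"
    using r rN by (intro add_left_mono mult_right_mono mult_left_mono) auto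
  finally show False using r z by (simp add: zero_le_mult_iff mult_le_0_iff) 
qed

text \<open>Parallelogram law for two near-minimizers u, v of |v|^2 - 2 l(v), as pure arithmetic:
  \<open>a\<close>, \<open>b\<close>, \<open>c\<close> are the squared norms of u, v, u + v,
  \<open>R\<close> is the real part of their inner product, \<open>x\<close> and \<open>y\<close>
  are the values of l, and \<open>e\<close>, \<open>f\<close> the excesses over the infimum
  \<open>m\<close>.\<close>

lemma parallelogram_arith:
  fixes a b c R e f x y m :: real
  assumes "m \<le> c / 4 - x - y" "c = a + 2 * R + b" "a - 2 * x < m + e" "b - 2 * y < m + f"
  shows "a - 2 * R + b \<le> 2 * (e + f)"
  using assms unfolding distrib_left by linarith

text \<open>\<open>G\<close> is the graph of a functional, so the functional itself never has to be
  defined: the bound makes the graph single-valued. The representing vector is the limit of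
  near-minimizers of |v|^2 - 2 Re b over the graph, without projection onto a closed subspace. The
  last conclusion places w in the closure of the domain.\<close>

lemma riesz_subspace:
  fixes G :: "('h::chilbert_space \<times> complex) set"
  assumes sub: "cvec.subspace G" and bd: "\<And>v b. (v, b) \<in> G \<Longrightarrow> cmod b \<le> C * norm v" and C: "0 \<le> C"
  shows "\<exists>w. (\<forall>v b. (v, b) \<in> G \<longrightarrow> cinner v w = b) \<and> norm w \<le> C \<and>
    (\<forall>y. (\<forall>v b. (v, b) \<in> G \<longrightarrow> cinner v y = 0) \<longrightarrow> cinner w y = 0)"
proof -
  \<comment> \<open>For a representing vector w this is |v - w|^2 - |w|^2, so minimizing it means
    approaching w.\<close>
  define J where "J p = (norm (fst p))\<^sup>2 - 2 * Re (snd p)" for p :: "'h \<times> complex"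
  have low: "- C\<^sup>2 \<le> J p" if "p \<in> G" for p
  proof -
    have "Re (snd p) \<le> C * norm (fst p)"
      using bd[of "fst p" "snd p"] that complex_Re_le_cmod[of "snd p"] by simp
    moreover have "0 \<le> (norm (fst p) - C)\<^sup>2" by simp
    ultimately show ?thesis by (simp add: J_def power2_eq_square algebra_simps)
  qed
  have G0: "0 \<in> G" using sub by (simp add: cvec.subspace_def)
  define m where "m = Inf (J ` G)"
  have bb: "bdd_below (J ` G)" using low by (auto intro!: bdd_belowI2)
  have m_le: "m \<le> J p" if "p \<in> G" for p
    unfolding m_def using that bb by (intro cInf_lower) auto
  have "\<exists>p\<in>G. J p < m + 1 / Suc n" for n
  proof -
    have "m < m + 1 / Suc n" by simp
    then show ?thesis unfolding m_def using G0 bb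
      by (subst (asm) cInf_less_iff) auto
  qed
  then obtain p where p: "\<And>n. p n \<in> G" "\<And>n. J (p n) < m + 1 / Suc n" by metis
  define v b where "v n = fst (p n)" and "b n = snd (p n)" for n
  have Gadd: "\<And>x y. x \<in> G \<Longrightarrow> y \<in> G \<Longrightarrow> x + y \<in> G" "\<And>c x. x \<in> G \<Longrightarrow> c *\<^sub>C x \<in> G"
    using sub by (auto simp: cvec.subspace_def)
  have par: "(norm (v k - v n))\<^sup>2 \<le> 2 * (1 / Suc k + 1 / Suc n)" for k n
  proof -
    have "m \<le> J ((1/2) *\<^sub>C (p k + p n))" by (intro m_le Gadd p)
    also have "\<dots> = (norm (v k + v n))\<^sup>2 / 4 - Re (b k) - Re (b n)"
      by (simp add: J_def scaleC_prod_def norm_scaleC v_def b_def power_divide) (simp add: field_simps)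
    finally have "m \<le> (norm (v k + v n))\<^sup>2 / 4 - Re (b k) - Re (b n)" .
    moreover note norm_add_sq[of "v k" "v n"]
    moreover have "(norm (v k))\<^sup>2 - 2 * Re (b k) < m + 1 / Suc k" "(norm (v n))\<^sup>2 - 2 * Re (b n) < m + 1 / Suc n"
      using p(2)[of k] p(2)[of n] by (simp_all add: J_def v_def b_def)
    ultimately show ?thesis
      unfolding norm_diff_sq by (rule parallelogram_arith)
  qed
  have "Cauchy v" by (rule Cauchy_sq_dist[OF par]) simp
  then obtain w where w: "v \<longlonglongrightarrow> w" using Cauchy_convergent_iff convergent_def by blast
  have pair: "cinner x w = y" if xy: "(x, y) \<in> G" for x y
  proof -
    have "0 \<le> 2 * Re (t * (cinner x w - y)) + (cmod t)\<^sup>2 * (norm x)\<^sup>2" for t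
    proof -
      have "- (1 / Suc n) \<le> 2 * Re (t * cinner x (v n) - t * y) + (cmod t)\<^sup>2 * (norm x)\<^sup>2" for n
      proof -
        have "m \<le> J (p n + t *\<^sub>C (x, y))" by (intro m_le Gadd p xy)
        also have "\<dots> = J (p n) + 2 * Re (cinner (v n) (t *\<^sub>C x)) - 2 * Re (t * y) + (cmod t)\<^sup>2 * (norm x)\<^sup>2"
          by (simp add: J_def scaleC_prod_def v_def b_def norm_add_sq norm_scaleC power_mult_distrib)
        also have "Re (cinner (v n) (t *\<^sub>C x)) = Re (t * cinner x (v n))"
        proof -
          have "cinner (v n) (t *\<^sub>C x) = cnj (t * cinner x (v n))"
            using cinner_commute[of "v n" "t *\<^sub>C x"] by (simp only: cinner_scaleC_left)
          then show ?thesis by (simp only: cnj.simps(1))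
        qed
        finally show ?thesis using p(2)[of n] unfolding minus_complex.sel right_diff_distrib by linarith
      qed
      moreover have "(\<lambda>n. 2 * Re (t * cinner x (v n) - t * y) + (cmod t)\<^sup>2 * (norm x)\<^sup>2)
          \<longlonglongrightarrow> 2 * Re (t * cinner x w - t * y) + (cmod t)\<^sup>2 * (norm x)\<^sup>2"
        by (intro tendsto_intros tendsto_cinner w)
      moreover have "(\<lambda>n. - (1 / real (Suc n))) \<longlonglongrightarrow> - 0"
        by (intro tendsto_minus LIMSEQ_Suc lim_1_over_n)
      ultimately have "- 0 \<le> 2 * Re (t * cinner x w - t * y) + (cmod t)\<^sup>2 * (norm x)\<^sup>2"
        by (meson LIMSEQ_le)
      then show ?thesis by (simp add: algebra_simps)
    qed
    then have "cinner x w - y = 0" by (rule nonneg_affine_imp_zero)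
    then show ?thesis by simp
  qed
  have "norm w \<le> C"
  proof -
    have "cmod (cinner (v n) w) \<le> C * norm (v n)" for n
      using pair[of "v n" "b n"] bd[of "v n" "b n"] p(1)[of n] by (simp add: v_def b_def)
    moreover have "(\<lambda>n. cmod (cinner (v n) w)) \<longlonglongrightarrow> cmod (cinner w w)" "(\<lambda>n. C * norm (v n)) \<longlonglongrightarrow> C * norm w"
      by (intro tendsto_intros tendsto_cinner w)+
    ultimately have "cmod (cinner w w) \<le> C * norm w" by (meson LIMSEQ_le)
    then have "norm w * norm w \<le> C * norm w"
      by (simp add: cinner_self power2_eq_square norm_mult)
    then show ?thesis using C by (cases "norm w = 0") auto
  qed
  moreover have "cinner w y = 0" if y: "\<forall>v b. (v, b) \<in> G \<longrightarrow> cinner v y = 0" for y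
  proof -
    have "cinner (v n) y = 0" for n
      using y[rule_format, of "fst (p n)" "snd (p n)"] p(1)[of n] by (simp add: v_def)
    moreover have "(\<lambda>n. cinner (v n) y) \<longlonglongrightarrow> cinner w y" by (intro tendsto_cinner w tendsto_const)
    ultimately show ?thesis by (simp add: LIMSEQ_const_iff)
  qed
  ultimately show ?thesis using pair by blast
qed

lemma cspan_image_explicit:
  assumes "p \<in> cvec.span (f ` S)"
  obtains F c where "finite F" "F \<subseteq> S" "p = (\<Sum>x\<in>F. c x *\<^sub>C f x)"
proof -
  obtain t r where t: "finite t" "t \<subseteq> f ` S" "p = (\<Sum>q\<in>t. r q *\<^sub>C q)"
    using assms unfolding cvec.span_explicit by blast
  obtain F where F: "F \<subseteq> S" "inj_on f F" "t = f ` F"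
    using t(2) by (meson subset_image_inj)
  then have "p = (\<Sum>x\<in>F. r (f x) *\<^sub>C f x)"
    using t(3) by (simp add: sum.reindex o_def)
  moreover have "finite F" using F t(1) finite_image_iff by blast
  ultimately show ?thesis using that[of F "\<lambda>x. r (f x)"] F by blast
qed

lemma fst_sum_scaleC_Pair:
  "(\<Sum>x\<in>F. c x *\<^sub>C (a x, b x)) = (\<Sum>x\<in>F. c x *\<^sub>C a x, \<Sum>x\<in>F. c x *\<^sub>C b x)"
  by (induction F rule: infinite_finite_induct) (auto simp: scaleC_prod_def zero_prod_def)

text \<open>Riesz representation for a functional known only through its values \<beta> on the
  vectors \<open>a x\<close>. The bound on finite combinations expresses both consistency and
  continuity, and the last conclusion makes w unique.\<close>

lemma riesz_family:
  fixes a :: "'i \<Rightarrow> 'h::chilbert_space"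
  assumes "0 \<le> C"
    and bd: "\<And>F c. finite F \<Longrightarrow> F \<subseteq> S \<Longrightarrow> cmod (\<Sum>x\<in>F. c x * \<beta> x) \<le> C * norm (\<Sum>x\<in>F. c x *\<^sub>C a x)"
  shows "\<exists>w. (\<forall>x\<in>S. cinner (a x) w = \<beta> x) \<and> norm w \<le> C \<and>
    (\<forall>y. (\<forall>x\<in>S. cinner (a x) y = 0) \<longrightarrow> cinner w y = 0)"
proof -
  let ?G = "cvec.span ((\<lambda>x. (a x, \<beta> x)) ` S)"
  have G: "\<exists>F c. finite F \<and> F \<subseteq> S \<and> v = (\<Sum>x\<in>F. c x *\<^sub>C a x) \<and> b = (\<Sum>x\<in>F. c x * \<beta> x)"
    if vb: "(v, b) \<in> ?G" for v b
  proof -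
    obtain F c where "finite F" "F \<subseteq> S" "(v, b) = (\<Sum>x\<in>F. c x *\<^sub>C (a x, \<beta> x))"
      by (rule cspan_image_explicit[OF vb])
    then show ?thesis unfolding fst_sum_scaleC_Pair by auto
  qed
  have "cmod b \<le> C * norm v" if "(v, b) \<in> ?G" for v b
    using G[OF that] bd by blast
  then obtain w where w: "\<And>v b. (v, b) \<in> ?G \<Longrightarrow> cinner v w = b" "norm w \<le> C"
      "\<And>y. (\<forall>v b. (v, b) \<in> ?G \<longrightarrow> cinner v y = 0) \<Longrightarrow> cinner w y = 0"
    using riesz_subspace[of ?G C] cvec.subspace_span assms(1) by blast
  have "cinner (a x) w = \<beta> x" if "x \<in> S" for x
    using that by (intro w(1) cvec.span_base) auto
  moreover have "cinner w y = 0" if y: "\<forall>x\<in>S. cinner (a x) y = 0" for y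
  proof (rule w(3), intro allI impI)
    fix v b assume "(v, b) \<in> ?G"
    from G[OF this] obtain F c where "finite F" "F \<subseteq> S" "v = (\<Sum>x\<in>F. c x *\<^sub>C a x)" by blast
    then show "cinner v y = 0"
      using y by (auto simp: cinner_sum_left cinner_scaleC_left subset_iff intro!: sum.neutral)
  qed
  ultimately show ?thesis using w(2) by blast
qed

text \<open>T is the adjoint of the map a x -> b x, which by hypothesis is a well-defined
  contraction on the span. Building the adjoint directly, one vector T y at a time, avoids extending
  that map to a closure.\<close>

lemma contraction_pairing:
  fixes a :: "'i \<Rightarrow> 'h::chilbert_space" and b :: "'i \<Rightarrow> 'k::chilbert_space"
  assumes ab: "\<And>F c. finite F \<Longrightarrow> F \<subseteq> S \<Longrightarrow> norm (\<Sum>x\<in>F. c x *\<^sub>C b x) \<le> norm (\<Sum>x\<in>F. c x *\<^sub>C a x)"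
  obtains T :: "'k \<Rightarrow>\<^sub>L 'h" where "T \<in> \<B>" "norm T \<le> 1"
    "\<And>x y. x \<in> S \<Longrightarrow> cinner (blinfun_apply T y) (a x) = cinner y (b x)"
proof -
  have "\<exists>w. (\<forall>x\<in>S. cinner (a x) w = cinner (b x) y) \<and> norm w \<le> norm y \<and>
    (\<forall>u. (\<forall>x\<in>S. cinner (a x) u = 0) \<longrightarrow> cinner w u = 0)" for y
  proof (rule riesz_family)
    fix F c assume F: "finite F" "F \<subseteq> S"
    have "cmod (\<Sum>x\<in>F. c x * cinner (b x) y) = cmod (cinner (\<Sum>x\<in>F. c x *\<^sub>C b x) y)"
      by (simp add: cinner_sum_left cinner_scaleC_left)
    also have "\<dots> \<le> norm (\<Sum>x\<in>F. c x *\<^sub>C b x) * norm y" by (rule cinner_Cauchy_Schwarz)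
    also have "\<dots> \<le> norm (\<Sum>x\<in>F. c x *\<^sub>C a x) * norm y" by (intro mult_right_mono ab F) auto
    finally show "cmod (\<Sum>x\<in>F. c x * cinner (b x) y) \<le> norm y * norm (\<Sum>x\<in>F. c x *\<^sub>C a x)"
      by (simp add: mult.commute)
  qed simp
  then obtain T where T: "\<And>x y. x \<in> S \<Longrightarrow> cinner (a x) (T y) = cinner (b x) y" "\<And>y. norm (T y) \<le> norm y"
      and perp: "\<And>y u. \<forall>x\<in>S. cinner (a x) u = 0 \<Longrightarrow> cinner (T y) u = 0"
    by metis
  \<comment> \<open>Linearity of T rests on this: the difference of the two sides is orthogonal to
    all \<open>a x\<close> and lies in their closed span, hence is 0.\<close>
  have uniq: "u = 0" if "\<forall>x\<in>S. cinner (a x) u = 0" "\<And>z. (\<forall>x\<in>S. cinner (a x) z = 0) \<Longrightarrow> cinner u z = 0" for u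
    using that(2)[OF that(1)] by simp
  have add: "T (y + z) = T y + T z" for y z
  proof -
    have "T (y + z) - (T y + T z) = 0"
      by (rule uniq) (auto simp: T(1) perp cinner_diff_right cinner_add_right cinner_diff_left cinner_add_left)
    then show ?thesis by simp
  qed
  have scale: "T (c *\<^sub>C y) = c *\<^sub>C T y" for c y
  proof -
    have "T (c *\<^sub>C y) - c *\<^sub>C T y = 0"
      by (rule uniq) (auto simp: T(1) perp cinner_diff_right cinner_diff_left cinner_scaleC_left cinner_scaleC_right)
    then show ?thesis by simp
  qed
  have bl: "bounded_linear T"
    by (rule bounded_linear_intro[of _ 1]) (auto simp: add scale scaleR_scaleC T(2))
  show ?thesis
  proof
    show "Blinfun T \<in> \<B>" by (simp add: cbounded_def bounded_linear_Blinfun_apply[OF bl] scale)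
    show "norm (Blinfun T) \<le> 1"
      by (rule norm_blinfun_bound) (auto simp: bounded_linear_Blinfun_apply[OF bl] T(2))
    show "cinner (blinfun_apply (Blinfun T) y) (a x) = cinner y (b x)" if "x \<in> S" for x y
      using T(1)[OF that, of y] by (metis bounded_linear_Blinfun_apply[OF bl] cinner_commute)
  qed
qed

text \<open>For fixed v the functional u -> conj (m v u) is linear and bounded; its Riesz vector is
  T v.\<close>

lemma form_operator:
  fixes m :: "'a::chilbert_space \<Rightarrow> 'b::chilbert_space \<Rightarrow> complex"
  assumes C: "0 \<le> C" "\<And>v u. cmod (m v u) \<le> C * norm v * norm u"
    and add1: "\<And>v v' u. m (v + v') u = m v u + m v' u" and sc1: "\<And>c v u. m (c *\<^sub>C v) u = c * m v u"
    and add2: "\<And>v u u'. m v (u + u') = m v u + m v u'" and sc2: "\<And>c v u. m v (c *\<^sub>C u) = cnj c * m v u"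
  obtains T :: "'a \<Rightarrow>\<^sub>L 'b" where "T \<in> \<B>" "norm T \<le> C" "\<And>v u. cinner (blinfun_apply T v) u = m v u"
proof -
  have m0: "m v 0 = 0" for v using sc2[of v 0 0] by simp
  have msum: "m v (\<Sum>x\<in>F. c x *\<^sub>C x) = (\<Sum>x\<in>F. cnj (c x) * m v x)" for v F c
    by (induction F rule: infinite_finite_induct) (auto simp: add2 sc2 m0)
  have "\<exists>w. (\<forall>u\<in>UNIV. cinner u w = cnj (m v u)) \<and> norm w \<le> C * norm v \<and>
      (\<forall>y. (\<forall>u\<in>UNIV. cinner u y = 0) \<longrightarrow> cinner w y = 0)" for v
  proof (rule riesz_family)
    fix F and c :: "'b \<Rightarrow> complex"
    have "(\<Sum>x\<in>F. c x * cnj (m v x)) = cnj (m v (\<Sum>x\<in>F. c x *\<^sub>C x))" by (simp add: msum)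
    then show "cmod (\<Sum>x\<in>F. c x * cnj (m v x)) \<le> C * norm v * norm (\<Sum>x\<in>F. c x *\<^sub>C x)"
      using C(2)[of v "\<Sum>x\<in>F. c x *\<^sub>C x"] by simp
  qed (use C in simp)
  then obtain T where T': "\<And>v u. cinner u (T v) = cnj (m v u)" "\<And>v. norm (T v) \<le> C * norm v" by (metis UNIV_I[of "_ :: 'b"])
  have T: "cinner (T v) u = m v u" for v u using T'(1)[of u v] by (metis cinner_commute complex_cnj_cnj)
  have lin: "T (y + z) = T y + T z" "T (c *\<^sub>C y) = c *\<^sub>C T y" for y z c
    by (rule cinner_eqI, simp add: T'(1) cinner_add_right cinner_scaleC_right add1 sc1)+
  have bl: "bounded_linear T"
    by (rule bounded_linear_intro[of _ C]) (use T'(2) in \<open>auto simp: lin scaleR_scaleC mult.commute\<close>)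
  show ?thesis
  proof
    show "Blinfun T \<in> \<B>" by (simp add: cbounded_def bounded_linear_Blinfun_apply[OF bl] lin)
    show "norm (Blinfun T) \<le> C"
      by (rule norm_blinfun_bound) (use C T'(2) in \<open>auto simp: bounded_linear_Blinfun_apply[OF bl]\<close>)
    show "cinner (blinfun_apply (Blinfun T) v) u = m v u" for v u
      by (simp add: bounded_linear_Blinfun_apply[OF bl] T)
  qed
qed

text \<open>k points from D to the nearest point p in the closure of C. The positive distance d
  takes the place of closedness of C.\<close>

lemma cone_separation:
  fixes C :: "'h::chilbert_space set"
  assumes add: "\<And>x y. x \<in> C \<Longrightarrow> y \<in> C \<Longrightarrow> x + y \<in> C"
    and sc: "\<And>r x. 0 \<le> r \<Longrightarrow> x \<in> C \<Longrightarrow> r *\<^sub>R x \<in> C" and ne: "0 \<in> C"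
    and d: "d > 0" and far: "\<And>x. x \<in> C \<Longrightarrow> d \<le> norm (D - x)"
  obtains k where "\<And>x. x \<in> C \<Longrightarrow> 0 \<le> Re (cinner x k)" "Re (cinner D k) < 0"
proof -
  define J where "J x = (norm (D - x))\<^sup>2" for x
  define m where "m = Inf (J ` C)"
  have bb: "bdd_below (J ` C)" by (auto simp: J_def intro!: bdd_belowI2[of _ 0])
  have m_le: "m \<le> J p" if "p \<in> C" for p
    unfolding m_def using that bb by (intro cInf_lower) auto
  have "\<exists>p\<in>C. J p < m + 1 / Suc n" for n
  proof -
    have "m < m + 1 / Suc n" by simp
    then show ?thesis unfolding m_def using ne bb
      by (subst (asm) cInf_less_iff) auto
  qed
  then obtain v where v: "\<And>n. v n \<in> C" "\<And>n. J (v n) < m + 1 / Suc n" by metis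
  have par: "(norm (v k - v n))\<^sup>2 \<le> 2 * (1 / Suc k + 1 / Suc n)" for k n
  proof -
    have "m \<le> J ((1/2) *\<^sub>R (v k + v n))" by (intro m_le add sc v) simp
    also have "D - (1/2) *\<^sub>R (v k + v n) = (1/2) *\<^sub>R ((D - v k) + (D - v n))"
      by (simp add: algebra_simps flip: scaleR_add_left)
    then have "J ((1/2) *\<^sub>R (v k + v n)) = (norm ((D - v k) + (D - v n)))\<^sup>2 / 4"
      by (simp add: J_def power_divide)
    finally have "m \<le> (norm ((D - v k) + (D - v n)))\<^sup>2 / 4" .
    then have "m \<le> (norm ((D - v k) + (D - v n)))\<^sup>2 / 4 - 0 - 0" by simp
    moreover note norm_add_sq[of "D - v k" "D - v n"]
    moreover have "(norm (D - v k))\<^sup>2 - 2 * 0 < m + 1 / Suc k" "(norm (D - v n))\<^sup>2 - 2 * 0 < m + 1 / Suc n"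
      using v(2)[of k] v(2)[of n] by (simp_all add: J_def)
    ultimately have "(norm (D - v k))\<^sup>2 - 2 * Re (cinner (D - v k) (D - v n)) + (norm (D - v n))\<^sup>2
        \<le> 2 * (1 / Suc k + 1 / Suc n)"
      by (rule parallelogram_arith)
    moreover have "norm (v k - v n) = norm ((D - v k) - (D - v n))"
      by (simp add: norm_minus_commute)
    ultimately show ?thesis by (simp only: norm_diff_sq)
  qed
  have "Cauchy v" by (rule Cauchy_sq_dist[OF par]) simp
  then obtain p where p: "v \<longlonglongrightarrow> p" using Cauchy_convergent_iff convergent_def by blast
  define k where "k = p - D"
  \<comment> \<open>The variation starts at the approximants v n, which lie in C, since the limit p
    may lie outside; N bounds the squared lengths of the moving directions X n.\<close>
  have var: "0 \<le> 2 * t * Re (cinner x k) + t\<^sup>2 * N"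
    if x: "X \<longlonglongrightarrow> x" and X: "\<And>n. v n + t *\<^sub>R X n \<in> C" "\<And>n. (norm (X n))\<^sup>2 \<le> N" for X x t N
  proof -
    have "- (1 / Suc n) \<le> 2 * t * Re (cinner (X n) (v n - D)) + t\<^sup>2 * N" for n
    proof -
      have "m \<le> J (v n + t *\<^sub>R X n)" by (intro m_le X)
      also have "\<dots> = (norm ((v n - D) + t *\<^sub>R X n))\<^sup>2"
        by (simp add: J_def norm_minus_commute algebra_simps)
      also have "\<dots> = J (v n) + 2 * t * Re (cinner (v n - D) (X n)) + t\<^sup>2 * (norm (X n))\<^sup>2"
        unfolding norm_add_sq J_def
        by (simp add: scaleR_scaleC cinner_scaleC_right norm_scaleC power_mult_distrib norm_minus_commute)
      also have "\<dots> \<le> J (v n) + 2 * t * Re (cinner (v n - D) (X n)) + t\<^sup>2 * N"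
        by (intro add_left_mono mult_left_mono X) auto
      also have "Re (cinner (v n - D) (X n)) = Re (cinner (X n) (v n - D))"
        by (metis cinner_commute cnj.simps(1))
      finally show ?thesis using v(2)[of n] by simp
    qed
    moreover have "(\<lambda>n. 2 * t * Re (cinner (X n) (v n - D)) + t\<^sup>2 * N) \<longlonglongrightarrow> 2 * t * Re (cinner x k) + t\<^sup>2 * N"
      unfolding k_def by (intro tendsto_intros tendsto_cinner p x)
    moreover have "(\<lambda>n. - (1 / real (Suc n))) \<longlonglongrightarrow> - 0"
      by (intro tendsto_minus LIMSEQ_Suc lim_1_over_n)
    ultimately have "- 0 \<le> 2 * t * Re (cinner x k) + t\<^sup>2 * N"
      by (intro LIMSEQ_le[where X = "\<lambda>n. - (1 / real (Suc n))"]) auto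
    then show ?thesis by simp
  qed
  \<comment> \<open>Divide by 2 t and let t tend to 0 from the right.\<close>
  have pos: "0 \<le> a" if "\<And>t. 0 < t \<Longrightarrow> t < 1 \<Longrightarrow> 0 \<le> 2 * t * a + t\<^sup>2 * N" for a N :: real
  proof (rule tendsto_lowerbound)
    show "((\<lambda>t. a + t * N / 2) \<longlongrightarrow> a) (at_right 0)"
      by (auto intro!: tendsto_eq_intros)
    have "0 \<le> a + t * N / 2" if "0 < t" "t < 1" for t
    proof -
      have "0 \<le> 2 * t * (a + t * N / 2)"
        using \<open>\<And>t. 0 < t \<Longrightarrow> t < 1 \<Longrightarrow> 0 \<le> 2 * t * a + t\<^sup>2 * N\<close>[OF that]
        by (simp add: power2_eq_square algebra_simps)
      then show ?thesis using that by (simp add: zero_le_mult_iff)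
    qed
    then show "\<forall>\<^sub>F t in at_right 0. 0 \<le> a + t * N / 2"
      by (intro eventually_at_rightI[of 0 1]) auto
  qed simp
  have "0 \<le> Re (cinner x k)" if "x \<in> C" for x
  proof (rule pos)
    fix t :: real assume "0 < t"
    then show "0 \<le> 2 * t * Re (cinner x k) + t\<^sup>2 * (norm x)\<^sup>2"
      by (intro var[of "\<lambda>_. x"] add v sc that) auto
  qed
  moreover have "Re (cinner D k) < 0"
  proof -
    have "Bseq v" using p convergentI convergent_imp_Bseq by blast
    then obtain N where N: "\<And>n. norm (v n) \<le> N" unfolding Bseq_def by blast
    have N': "(norm (- v n))\<^sup>2 \<le> N\<^sup>2" for n using N[of n] by (simp add: power_mono)
    \<comment> \<open>Shrinking towards the apex stays in the cone for t < 1. It gives Re <p, k> <=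
      0, and D = p - k then makes Re <D, k> at most - |k|^2.\<close>
    have "0 \<le> Re (cinner (- p) k)"
    proof (rule pos)
      fix t :: real assume t: "0 < t" "t < 1"
      have "v n + t *\<^sub>R (- v n) = (1 - t) *\<^sub>R v n" for n by (simp add: algebra_simps)
      then show "0 \<le> 2 * t * Re (cinner (- p) k) + t\<^sup>2 * N\<^sup>2"
        using t by (intro var[of "\<lambda>n. - v n"] tendsto_minus p N') (auto intro!: sc v)
    qed
    then have "Re (cinner p k) \<le> 0" by (simp add: cinner_minus_left)
    moreover have "Re (cinner D k) = Re (cinner p k) - (norm k)\<^sup>2"
      by (simp add: k_def cinner_diff_left cinner_diff_right flip: Re_cinner_self)
    moreover have "d \<le> norm k"
    proof -
      have "(\<lambda>n. norm (D - v n)) \<longlonglongrightarrow> norm (D - p)" by (intro tendsto_intros p)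
      then have "d \<le> norm (D - p)" by (rule LIMSEQ_le_const) (use far v in auto)
      then show ?thesis by (simp add: k_def norm_minus_commute)
    qed
    then have "0 < (norm k)\<^sup>2" using d by (intro zero_less_power) linarith
    ultimately show ?thesis by linarith
  qed
  ultimately show ?thesis using that by blast
qed

section \<open>Scalar kernels\<close>

text \<open>The points of F are distinct; repetitions are recovered in \<open>pos_on_family\<close>.
  The conjugate sits on the first argument, so that the Gram kernel
  \<open>cinner (e y) (e x)\<close> yields the squared norm of the sum of the vectors c x e
  x.\<close>

definition pos_on :: "'x set \<Rightarrow> ('x \<Rightarrow> 'x \<Rightarrow> complex) \<Rightarrow> bool"
  where "pos_on S K \<longleftrightarrow> (\<forall>F c. finite F \<and> F \<subseteq> S \<longrightarrow>
    0 \<le> (\<Sum>x\<in>F. \<Sum>y\<in>F. cnj (c x) * c y * K x y))"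

lemma pos_onD: "pos_on S K \<Longrightarrow> finite F \<Longrightarrow> F \<subseteq> S \<Longrightarrow>
    0 \<le> (\<Sum>x\<in>F. \<Sum>y\<in>F. cnj (c x) * c y * K x y)"
  by (simp add: pos_on_def)

lemma norm_sum_scaleC_sq:
  "(\<Sum>x\<in>F. \<Sum>y\<in>F. cnj (c x) * c y * cinner (e y) (e x)) = complex_of_real ((norm (\<Sum>x\<in>F. c x *\<^sub>C (e x :: 'a::complex_inner)))\<^sup>2)"
proof -
  have "(\<Sum>x\<in>F. \<Sum>y\<in>F. cnj (c x) * c y * cinner (e y) (e x)) = cinner (\<Sum>x\<in>F. c x *\<^sub>C e x) (\<Sum>x\<in>F. c x *\<^sub>C e x)"
    by (simp add: cinner_sum_left cinner_sum_right cinner_scaleC_left cinner_scaleC_right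
        sum_distrib_left mult_ac)
  then show ?thesis by (simp add: cinner_self)
qed

lemma pos_on_diag: "pos_on S K \<Longrightarrow> x \<in> S \<Longrightarrow> 0 \<le> K x x"
  using pos_onD[of S K "{x}" "\<lambda>_. 1"] by simp

lemma pos_on_hermitian:
  assumes K: "pos_on S K" and xy: "x \<in> S" "y \<in> S"
  shows "K y x = cnj (K x y)"
proof (cases "x = y")
  case True
  then show ?thesis using pos_on_diag[OF K xy(1)] by (simp add: less_eq_complex_def complex_eq_iff)
next
  case False
  have d: "Im (K x x) = 0" "Im (K y y) = 0"
    using pos_on_diag[OF K xy(1)] pos_on_diag[OF K xy(2)] by (auto simp: less_eq_complex_def)
  have "0 \<le> (\<Sum>u\<in>{x,y}. \<Sum>v\<in>{x,y}. cnj (c u) * c v * K u v)" for c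
    by (rule pos_onD[OF K]) (use xy in auto)
  \<comment> \<open>Coefficients (1, 1) give opposite imaginary parts, coefficients (1, \<i>) equal
    real parts.\<close>
  from this[of "\<lambda>_. 1"] this[of "\<lambda>u. if u = x then 1 else \<i>"] show ?thesis
    using False d by (simp add: less_eq_complex_def complex_eq_iff)
qed

text \<open>Discriminant inequality for a nonnegative quadratic in a complex variable, whose minimum
  is at t = - conj B / A; for A = 0 a large negative multiple of conj B forces B = 0.\<close>

lemma complex_sq_le:
  fixes B :: complex and A N :: real
  assumes "\<And>t. 0 \<le> (cmod t)\<^sup>2 * A + 2 * Re (t * B) + N" and A: "0 \<le> A" and N: "0 \<le> N"
  shows "(cmod B)\<^sup>2 \<le> A * N"
proof (cases "A = 0")
  case True
  have "B = 0"
  proof (rule ccontr)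
    assume "B \<noteq> 0"
    define r where "r = (N + 1) / (cmod B)\<^sup>2"
    have "0 \<le> 2 * Re ((- complex_of_real r * cnj B) * B) + N"
      using assms(1)[of "- complex_of_real r * cnj B"] True by simp
    also have "(- complex_of_real r * cnj B) * B = - complex_of_real (r * (cmod B)\<^sup>2)"
      by (simp only: of_real_mult complex_norm_square mult_ac) simp
    finally show False using N \<open>B \<noteq> 0\<close> by (simp add: r_def)
  qed
  then show ?thesis using True by simp
next
  case False
  then have A: "A > 0" using A by simp
  define r where "r = 1 / A"
  have "0 \<le> (cmod (- complex_of_real r * cnj B))\<^sup>2 * A + 2 * Re ((- complex_of_real r * cnj B) * B) + N"
    by (rule assms)
  also have "(- complex_of_real r * cnj B) * B = - complex_of_real (r * (cmod B)\<^sup>2)"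
    by (simp only: of_real_mult complex_norm_square mult_ac) simp
  also have "(cmod (- complex_of_real r * cnj B))\<^sup>2 * A = r * (cmod B)\<^sup>2"
    using A by (simp add: r_def norm_mult power_mult_distrib norm_divide power2_eq_square)
  finally have "r * (cmod B)\<^sup>2 \<le> N" by simp
  then show ?thesis using A by (simp add: r_def field_simps)
qed

text \<open>Transfinite Gram-Schmidt along a well-order of the points: the vector at x is a vector
  in the closed span of the earlier ones plus a multiple of the new coordinate vector
  \<open>edelta x\<close>. The factorization is triangular, as in a Cholesky decomposition, and is
  built without quotient or completion.\<close>

lemma kolmogorov_UNIV:
  fixes K :: "'x \<Rightarrow> 'x \<Rightarrow> complex"
  assumes K: "pos_on UNIV K"
  shows "\<exists>e :: 'x \<Rightarrow> 'x ell2. \<forall>x y. K x y = cinner (e y) (e x)"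
proof -
  obtain r :: "'x rel" where r: "well_order_on UNIV r" using well_order_on by blast
  define R where "R = r - Id"
  have wfR: "wf R" using r by (simp add: R_def well_order_on_def)
  have tot: "(x, y) \<in> R \<or> x = y \<or> (y, x) \<in> R" for x y
    using r by (auto simp: R_def well_order_on_def linear_order_on_def total_on_def)
  have tr: "(x, y) \<in> R \<Longrightarrow> (y, z) \<in> R \<Longrightarrow> (x, z) \<in> R" for x y z
    using r unfolding R_def well_order_on_def linear_order_on_def partial_order_on_def
        preorder_on_def by (blast dest: transD antisymD)
  have irr: "(x, x) \<notin> R" for x by (simp add: R_def)
  have her: "K y x = cnj (K x y)" for x y by (rule pos_on_hermitian[OF K]) auto
  \<comment> \<open>Conditions on the vector q at stage x, given the earlier ones: inner products,
    norm, and support in the coordinates up to x. The support condition keeps coordinate x free for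
    this stage.\<close>
  define P where "P f x q \<longleftrightarrow> (\<forall>y. (y, x) \<in> R \<longrightarrow> K x y = cinner (f y) q) \<and> K x x = cinner q q \<and>
      (\<forall>z. ecoeff q z \<noteq> 0 \<longrightarrow> (z, x) \<in> R \<or> z = x)" for f :: "'x \<Rightarrow> 'x ell2" and x q
  have "\<exists>f. \<forall>x. P f x (f x)"
  proof (rule dependent_wf_choice[OF wfR])
    fix f g :: "'x \<Rightarrow> 'x ell2" and x q
    assume "\<And>z. (z, x) \<in> R \<Longrightarrow> f z = g z"
    then show "P f x q = P g x q" by (auto simp: P_def)
  next
    fix x and f :: "'x \<Rightarrow> 'x ell2"
    assume IH: "\<And>y. (y, x) \<in> R \<Longrightarrow> P f y (f y)"
    define Y where "Y = {y. (y, x) \<in> R}"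
    have gram: "K y z = cinner (f z) (f y)" if yz: "y \<in> Y" "z \<in> Y" for y z
    proof -
      consider "(z, y) \<in> R" | "y = z" | "(y, z) \<in> R" using tot by blast
      then show ?thesis
      proof cases
        case 1 then show ?thesis using IH[of y] yz by (simp add: P_def Y_def)
      next
        case 2 then show ?thesis using IH[of y] yz by (simp add: P_def Y_def)
      next
        case 3
        have "K z y = cinner (f y) (f z)" using 3 IH[of z] yz by (simp add: P_def Y_def)
        have "K y z = cnj (K z y)" by (rule her)
        also have "\<dots> = cinner (f z) (f y)"
          unfolding \<open>K z y = cinner (f y) (f z)\<close> by (rule cinner_commute[symmetric])
        finally show ?thesis .
      qed
    qed
    define k where "k = Re (K x x)"
    have k: "0 \<le> k" "K x x = complex_of_real k"
      using pos_on_diag[OF K, of x] by (auto simp: k_def less_eq_complex_def complex_eq_iff)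
    \<comment> \<open>w is the part of the new vector in the closed span of the earlier ones. The
      required bound is Cauchy-Schwarz for K on \<open>insert x F\<close>, in quadratic form with a
      free coefficient at x.\<close>
    have "\<exists>w. (\<forall>y\<in>Y. cinner (f y) w = K x y) \<and> norm w \<le> sqrt k \<and>
      (\<forall>u. (\<forall>y\<in>Y. cinner (f y) u = 0) \<longrightarrow> cinner w u = 0)"
    proof (rule riesz_family)
      fix F c assume F: "finite F" "F \<subseteq> Y"
      define B where "B = (\<Sum>y\<in>F. c y * K x y)"
      define N where "N = (norm (\<Sum>y\<in>F. c y *\<^sub>C f y))\<^sup>2"
      have xF: "x \<notin> F" using F irr by (auto simp: Y_def)
      have NF: "(\<Sum>y\<in>F. \<Sum>z\<in>F. cnj (c y) * c z * K y z) = complex_of_real N"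
        unfolding N_def norm_sum_scaleC_sq[symmetric]
        using F gram by (intro sum.cong) auto
      have "0 \<le> (cmod t)\<^sup>2 * k + 2 * Re (t * B) + N" for t
      proof -
        \<comment> \<open>The conjugate compensates for the one on the first index, so that t itself
          multiplies B.\<close>
        define d where "d y = (if y = x then cnj t else c y)" for y
        have "0 \<le> (\<Sum>y\<in>insert x F. \<Sum>z\<in>insert x F. cnj (d y) * d z * K y z)"
          by (rule pos_onD[OF K]) (use F in auto)
        also have "\<dots> = cnj (d x) * d x * K x x + (\<Sum>z\<in>F. cnj (d x) * d z * K x z)
            + ((\<Sum>y\<in>F. cnj (d y) * d x * K y x) + (\<Sum>y\<in>F. \<Sum>z\<in>F. cnj (d y) * d z * K y z))"
          using F(1) xF by (simp add: sum.distrib)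
        also have "(\<Sum>z\<in>F. cnj (d x) * d z * K x z) = t * B"
          unfolding B_def sum_distrib_left using xF by (intro sum.cong) (auto simp: d_def)
        also have "(\<Sum>y\<in>F. cnj (d y) * d x * K y x) = cnj (t * B)"
          unfolding B_def sum_distrib_left cnj_sum
        proof (intro sum.cong refl)
          fix y assume "y \<in> F"
          then have "y \<noteq> x" using xF by auto
          have "K y x = cnj (K x y)" by (rule her)
          then show "cnj (d y) * d x * K y x = cnj (t * (c y * K x y))"
            using \<open>y \<noteq> x\<close> by (simp add: d_def)
        qed
        also have "(\<Sum>y\<in>F. \<Sum>z\<in>F. cnj (d y) * d z * K y z) = complex_of_real N"
          unfolding NF[symmetric] using xF by (intro sum.cong) (auto simp: d_def)
        also have "cnj (d x) * d x * K x x = complex_of_real ((cmod t)\<^sup>2 * k)"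
          by (simp add: d_def k(2) complex_norm_square[symmetric])
        finally have "0 \<le> Re (complex_of_real ((cmod t)\<^sup>2 * k) + t * B + (cnj (t * B) + complex_of_real N))"
          by (simp add: less_eq_complex_def)
        then show ?thesis by (simp only: plus_complex.sel Re_complex_of_real cnj.sel) 
      qed
      then have "(cmod B)\<^sup>2 \<le> k * N" by (rule complex_sq_le) (auto simp: k N_def)
      then have "cmod B \<le> sqrt (k * N)" by (rule real_le_rsqrt)
      then show "cmod (\<Sum>y\<in>F. c y * K x y) \<le> sqrt k * norm (\<Sum>y\<in>F. c y *\<^sub>C f y)"
        by (simp add: B_def N_def real_sqrt_mult)
    qed (use k in simp)
    then obtain w where w: "\<And>y. y \<in> Y \<Longrightarrow> cinner (f y) w = K x y" "norm w \<le> sqrt k"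
        "\<And>u. (\<forall>y\<in>Y. cinner (f y) u = 0) \<Longrightarrow> cinner w u = 0" by blast
    have supp: "ecoeff (f y) z = 0" if "y \<in> Y" "z \<notin> Y" for y z
    proof -
      have "ecoeff (f y) z \<noteq> 0 \<longrightarrow> (z, y) \<in> R \<or> z = y" using IH[of y] that(1) unfolding P_def Y_def by blast
      then show ?thesis using tr[of z y x] that unfolding Y_def by blast
    qed
    \<comment> \<open>w lies in the closed span of vectors that all vanish at coordinate z, so it
      vanishes there too.\<close>
    have wz: "ecoeff w z = 0" if "z \<notin> Y" for z
      using w(3)[of "edelta z"] supp that by (simp add: cinner_edelta)
    have xY: "x \<notin> Y" using irr by (simp add: Y_def)
    \<comment> \<open>The missing squared norm K x x - |w|^2 is put into coordinate x.\<close>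
    define q where "q = w + complex_of_real (sqrt (k - (norm w)\<^sup>2)) *\<^sub>C edelta x"
    have wk: "(norm w)\<^sup>2 \<le> k" using power_mono[OF w(2), of 2] k by simp
    have "P f x q"
      unfolding P_def
    proof (intro conjI allI impI)
      fix y assume "(y, x) \<in> R"
      then have y: "y \<in> Y" by (simp add: Y_def)
      show "K x y = cinner (f y) q"
        using w(1)[OF y] supp[OF y xY] by (simp add: q_def cinner_add_right cinner_scaleC_right cinner_edelta)
    next
      have "complex_of_real (sqrt (k - (norm w)\<^sup>2)) * complex_of_real (sqrt (k - (norm w)\<^sup>2)) = complex_of_real (k - (norm w)\<^sup>2)"
        using wk by (simp flip: of_real_mult)
      moreover have "cinner q q = cinner w w + complex_of_real (sqrt (k - (norm w)\<^sup>2)) * complex_of_real (sqrt (k - (norm w)\<^sup>2))"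
        by (simp add: q_def cinner_add_right cinner_add_left cinner_scaleC_right cinner_scaleC_left
            cinner_edelta cinner_edelta_left wz[OF xY] edelta.rep_eq
            plus_ell2.rep_eq scaleC_ell2.rep_eq)
      ultimately show "K x x = cinner q q" by (simp add: k(2) cinner_self[of w])
    next
      fix z assume "ecoeff q z \<noteq> 0"
      then have "ecoeff w z \<noteq> 0 \<or> z = x"
        by (auto simp: q_def plus_ell2.rep_eq scaleC_ell2.rep_eq edelta.rep_eq split: if_splits)
      then show "(z, x) \<in> R \<or> z = x" using wz[of z] unfolding Y_def by blast
    qed
    then show "\<exists>q. P f x q" by blast
  qed
  then obtain f where f: "\<And>x. P f x (f x)" by blast
  have "K x y = cinner (f y) (f x)" for x y
  proof -
    consider "(y, x) \<in> R" | "y = x" | "(x, y) \<in> R" using tot by blast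
    then show ?thesis
    proof cases
      case 3
      have "K y x = cinner (f x) (f y)" using 3 f[of y] by (simp add: P_def)
      have "K x y = cnj (K y x)" by (rule her)
      also have "\<dots> = cinner (f y) (f x)"
        unfolding \<open>K y x = cinner (f x) (f y)\<close> by (rule cinner_commute[symmetric])
      finally show ?thesis .
    qed (use f[of x] in \<open>auto simp: P_def\<close>)
  qed
  then show ?thesis by blast
qed

text \<open>Extending K by 0 off S preserves positivity.\<close>

lemma kolmogorov:
  fixes K :: "'x \<Rightarrow> 'x \<Rightarrow> complex"
  assumes K: "pos_on S K"
  obtains e :: "'x \<Rightarrow> 'x ell2" where "\<And>x y. x \<in> S \<Longrightarrow> y \<in> S \<Longrightarrow> K x y = cinner (e y) (e x)"
proof -
  define L where "L x y = (if x \<in> S \<and> y \<in> S then K x y else 0)" for x y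
  have "pos_on UNIV L"
    unfolding pos_on_def
  proof (intro allI impI)
    fix F :: "'x set" and c assume F: "finite F \<and> F \<subseteq> UNIV"
    have "(\<Sum>x\<in>F. \<Sum>y\<in>F. cnj (c x) * c y * L x y) = (\<Sum>x\<in>F \<inter> S. \<Sum>y\<in>F \<inter> S. cnj (c x) * c y * K x y)"
      using F by (intro sum.mono_neutral_cong_right) (auto simp: L_def intro!: sum.mono_neutral_cong_right sum.neutral)
    also have "0 \<le> \<dots>" by (rule pos_onD[OF K]) (use F in auto)
    finally show "0 \<le> (\<Sum>x\<in>F. \<Sum>y\<in>F. cnj (c x) * c y * L x y)" .
  qed
  from kolmogorov_UNIV[OF this] show ?thesis using that unfolding L_def by metis
qed

lemma pos_on_gram: "pos_on S (\<lambda>x y. cinner (e y) (e x :: 'a::complex_inner))"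
  unfolding pos_on_def norm_sum_scaleC_sq by (simp add: less_eq_complex_def)

lemma pos_on_cong: "(\<And>x y. x \<in> S \<Longrightarrow> y \<in> S \<Longrightarrow> K x y = L x y) \<Longrightarrow> pos_on S K \<Longrightarrow> pos_on S L"
proof -
  assume eq: "\<And>x y. x \<in> S \<Longrightarrow> y \<in> S \<Longrightarrow> K x y = L x y" and K: "pos_on S K"
  show "pos_on S L"
    unfolding pos_on_def
  proof (intro allI impI, elim conjE)
    fix F c assume F: "finite F" "F \<subseteq> S"
    have "(\<Sum>x\<in>F. \<Sum>y\<in>F. cnj (c x) * c y * K x y) = (\<Sum>x\<in>F. \<Sum>y\<in>F. cnj (c x) * c y * L x y)"
      using F(2) by (intro sum.cong refl) (simp add: eq subset_iff)
    then show "0 \<le> (\<Sum>x\<in>F. \<Sum>y\<in>F. cnj (c x) * c y * L x y)" using pos_onD[OF K F, of c] by simp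
  qed
qed

text \<open>Points may repeat among the \<phi> i; with Gram vectors the sum is still a squared
  norm.\<close>

lemma pos_on_family:
  fixes K :: "'x \<Rightarrow> 'x \<Rightarrow> complex"
  assumes K: "pos_on S K" and "\<And>i. i \<in> A \<Longrightarrow> \<phi> i \<in> S"
  shows "0 \<le> (\<Sum>i\<in>A. \<Sum>j\<in>A. cnj (c i) * c j * K (\<phi> i) (\<phi> j))"
proof -
  obtain e :: "'x \<Rightarrow> 'x ell2" where e: "\<And>x y. x \<in> S \<Longrightarrow> y \<in> S \<Longrightarrow> K x y = cinner (e y) (e x)"
    using kolmogorov[OF K] by blast
  have "(\<Sum>i\<in>A. \<Sum>j\<in>A. cnj (c i) * c j * K (\<phi> i) (\<phi> j)) = (\<Sum>i\<in>A. \<Sum>j\<in>A. cnj (c i) * c j * cinner (e (\<phi> j)) (e (\<phi> i)))"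
    by (intro sum.cong) (auto simp: e assms(2))
  then show ?thesis by (simp add: norm_sum_scaleC_sq[of c "\<lambda>i. e (\<phi> i)"] less_eq_complex_def)
qed

lemma pos_on_reindex:
  "pos_on S K \<Longrightarrow> (\<And>i. i \<in> A \<Longrightarrow> \<phi> i \<in> S) \<Longrightarrow> pos_on A (\<lambda>i j. K (\<phi> i) (\<phi> j))"
  unfolding pos_on_def[of A] by (auto intro!: pos_on_family)

lemma pos_on_congruence:
  fixes K :: "'x \<Rightarrow> 'x \<Rightarrow> complex"
  assumes K: "pos_on S K"
  shows "pos_on S (\<lambda>x y. f x * cnj (f y) * K x y)"
proof -
  obtain e :: "'x \<Rightarrow> 'x ell2" where e: "\<And>x y. x \<in> S \<Longrightarrow> y \<in> S \<Longrightarrow> K x y = cinner (e y) (e x)"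
    using kolmogorov[OF K] by blast
  show ?thesis
    by (rule pos_on_cong[OF _ pos_on_gram[of S "\<lambda>x. cnj (f x) *\<^sub>C e x"]])
      (auto simp: e cinner_scaleC_left cinner_scaleC_right)
qed

lemma pos_on_add: "pos_on S K \<Longrightarrow> pos_on S L \<Longrightarrow> pos_on S (\<lambda>x y. K x y + L x y)"
  unfolding pos_on_def by (auto simp: distrib_left sum.distrib)

lemma pos_on_scaleR: "pos_on S K \<Longrightarrow> 0 \<le> r \<Longrightarrow> pos_on S (\<lambda>x y. complex_of_real r * K x y)"
proof -
  assume K: "pos_on S K" and r: "0 \<le> r"
  show ?thesis
    by (rule pos_on_cong[OF _ pos_on_congruence[OF K, of "\<lambda>_. complex_of_real (sqrt r)"]])
      (use r in \<open>simp flip: of_real_mult\<close>)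
qed

lemma pos_on_subset: "pos_on S K \<Longrightarrow> T \<subseteq> S \<Longrightarrow> pos_on T K"
  unfolding pos_on_def by blast

lemma pos_on_limit:
  assumes "\<And>n. pos_on S (K n)" "\<And>x y. x \<in> S \<Longrightarrow> y \<in> S \<Longrightarrow> (\<lambda>n::nat. K n x y) \<longlonglongrightarrow> L x y"
  shows "pos_on S L"
  unfolding pos_on_def
proof (intro allI impI)
  fix F c assume F: "finite F \<and> F \<subseteq> S"
  have lim: "(\<lambda>n. \<Sum>x\<in>F. \<Sum>y\<in>F. cnj (c x) * c y * K n x y) \<longlonglongrightarrow> (\<Sum>x\<in>F. \<Sum>y\<in>F. cnj (c x) * c y * L x y)"
    using F assms(2) by (intro tendsto_intros) auto
  have "0 \<le> (\<Sum>x\<in>F. \<Sum>y\<in>F. cnj (c x) * c y * K n x y)" for n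
    by (rule pos_onD[OF assms(1)]) (use F in auto)
  then have pos: "\<And>n. 0 \<le> Re (\<Sum>x\<in>F. \<Sum>y\<in>F. cnj (c x) * c y * K n x y)"
      "\<And>n. Im (\<Sum>x\<in>F. \<Sum>y\<in>F. cnj (c x) * c y * K n x y) = 0" unfolding less_eq_complex_def by auto
  have "0 \<le> Re (\<Sum>x\<in>F. \<Sum>y\<in>F. cnj (c x) * c y * L x y)"
    by (rule LIMSEQ_le_const[OF tendsto_Re[OF lim]]) (use pos in blast)
  moreover have "Im (\<Sum>x\<in>F. \<Sum>y\<in>F. cnj (c x) * c y * L x y) = 0"
    using tendsto_Im[OF lim] unfolding pos(2) by (simp add: LIMSEQ_const_iff)
  ultimately show "0 \<le> (\<Sum>x\<in>F. \<Sum>y\<in>F. cnj (c x) * c y * L x y)" by (simp add: less_eq_complex_def)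
qed

text \<open>Division by \<open>1 - f x * cnj (f y)\<close> is a geometric series of congruences.\<close>

lemma pos_on_divide:
  assumes K: "pos_on S K" and f: "\<And>x. x \<in> S \<Longrightarrow> cmod (f x) < 1"
  shows "pos_on S (\<lambda>x y. K x y / (1 - f x * cnj (f y)))"
proof (rule pos_on_limit)
  show "pos_on S (\<lambda>x y. \<Sum>k<n. f x ^ k * cnj (f y ^ k) * K x y)" for n
  proof (induction n)
    case (Suc n)
    from pos_on_add[OF Suc pos_on_congruence[OF K, of "\<lambda>x. f x ^ n"]] show ?case by simp
  qed (simp add: pos_on_def)
  fix x y assume xy: "x \<in> S" "y \<in> S"
  have "cmod (f x) * cmod (f y) < 1 * 1"
    using f[OF xy(1)] f[OF xy(2)] by (intro mult_strict_mono') auto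
  then have "norm (f x * cnj (f y)) < 1" by (simp add: norm_mult)
  then have "(\<lambda>k. (f x * cnj (f y)) ^ k) sums (1 / (1 - f x * cnj (f y)))" by (rule geometric_sums)
  from sums_mult2[OF this, of "K x y"]
  show "(\<lambda>n. \<Sum>k<n. f x ^ k * cnj (f y ^ k) * K x y) \<longlonglongrightarrow> K x y / (1 - f x * cnj (f y))"
    by (simp add: sums_def power_mult_distrib)
qed

section \<open>Spectral theorem in finite dimension\<close>

text \<open>Minimal polynomial of v instead of a determinant: if p has least degree with p(A) v = 0
  and l is a root, then p = (X - l) q and q(A) v is an eigenvector. It stays in V since A preserves
  V.\<close>

lemma eigenvector_exists:
  fixes A :: "'h::complex_vector \<Rightarrow> 'h"
  assumes T: "finite T" "V \<subseteq> cvec.span T" and V: "cvec.subspace V"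
    and A: "\<And>x y. A (x + y) = A x + A y" "\<And>c x. A (c *\<^sub>C x) = c *\<^sub>C A x" "\<And>x. x \<in> V \<Longrightarrow> A x \<in> V"
    and v: "v \<in> V" "v \<noteq> 0"
  shows "\<exists>u\<in>V. u \<noteq> 0 \<and> (\<exists>l. A u = l *\<^sub>C u)"
proof -
  have A0: "A 0 = 0" using A(2)[of 0 0] by simp
  have Asum: "A (\<Sum>i\<in>I. g i) = (\<Sum>i\<in>I. A (g i))" for I :: "nat set" and g
    by (induction I rule: infinite_finite_induct) (auto simp: A0 A(1))
  define w where "w i = (A ^^ i) v" for i
  have wV: "w i \<in> V" for i by (induction i) (auto simp: w_def v A(3))
  have wS: "A (w i) = w (Suc i)" for i by (simp add: w_def)
  \<comment> \<open>\<open>ev p\<close> is p(A) v.\<close>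
  define ev where "ev p = (\<Sum>i\<le>degree p. coeff p i *\<^sub>C w i)" for p
  have ev_ge: "ev p = (\<Sum>i\<le>n. coeff p i *\<^sub>C w i)" if "degree p \<le> n" for p n
    unfolding ev_def using that
    by (intro sum.mono_neutral_left) (auto simp: coeff_eq_0)
  have ev_add: "ev (p + q) = ev p + ev q" for p q
    using ev_ge[of p "max (degree p) (degree q)"] ev_ge[of q "max (degree p) (degree q)"]
      ev_ge[of "p + q" "max (degree p) (degree q)"]
    by (simp add: degree_add_le scaleC_add_left sum.distrib)
  have ev_smult: "ev (smult c p) = c *\<^sub>C ev p" for c p
    using ev_ge[of "smult c p" "degree p"] ev_ge[of p "degree p"]
    by (simp add: scaleC_sum_right scaleC_scaleC)
  have ev_pCons: "ev (pCons 0 p) = A (ev p)" for p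
  proof -
    have "ev (pCons 0 p) = (\<Sum>i\<le>Suc (degree p). coeff (pCons 0 p) i *\<^sub>C w i)"
      by (rule ev_ge) (simp add: degree_pCons_le)
    also have "\<dots> = (\<Sum>i\<le>degree p. coeff p i *\<^sub>C w (Suc i))"
      by (subst sum.atMost_Suc_shift) simp
    also have "\<dots> = A (ev p)" by (simp add: ev_def Asum A(2) wS)
    finally show ?thesis .
  qed
  have ev_monom: "ev (monom c n) = c *\<^sub>C w n" for c n
  proof -
    have "ev (monom c n) = (\<Sum>i\<le>n. coeff (monom c n) i *\<^sub>C w i)"
      by (rule ev_ge) (simp add: degree_monom_le)
    also have "\<dots> = (\<Sum>i\<le>n. if i = n then c *\<^sub>C w i else 0)"
      by (intro sum.cong) auto
    also have "\<dots> = c *\<^sub>C w n" by simp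
    finally show ?thesis .
  qed
  have ev_sum: "ev (\<Sum>i\<in>I. g i) = (\<Sum>i\<in>I. ev (g i))" for I :: "nat set" and g
  proof (induction I rule: infinite_finite_induct)
    case empty
    show ?case using ev_monom[of 0 0] by simp
  qed (use ev_monom[of 0 0] in \<open>auto simp: ev_add\<close>)
  have evV: "ev p \<in> V" for p
    unfolding ev_def using V wV by (intro cvec.subspace_sum cvec.subspace_scale) auto
  define n where "n = card T"
  have "\<exists>p. p \<noteq> 0 \<and> ev p = 0"
  \<comment> \<open>Linear dependence is a property of sets, so a repetition among the n + 1 vectors
    is treated apart, by the polynomial X^j - X^i.\<close>
  proof (cases "inj_on w {..n}")
    case False
    then obtain i j where ij: "i < j" "w i = w j" unfolding inj_on_def by (metis linorder_neqE_nat)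
    have "ev (monom 1 j + smult (-1) (monom 1 i)) = 0"
      by (simp only: ev_add ev_smult ev_monom) (simp add: ij scaleC_minus1 scaleC_one)
    moreover have "coeff (monom 1 j + smult (-1) (monom 1 i)) j \<noteq> (0::complex)" using ij by simp
    then have "monom 1 j + smult (-1) (monom 1 i) \<noteq> (0 :: complex poly)"
      by (metis coeff_0)
    ultimately show ?thesis by blast
  next
    case True
    then have "card (w ` {..n}) = Suc n" by (simp add: card_image)
    moreover have "w ` {..n} \<subseteq> cvec.span T" using wV T(2) by blast
    ultimately have "cvec.dependent (w ` {..n})"
      using cvec.independent_span_bound[OF T(1), of "w ` {..n}"] by (auto simp: n_def)
    then obtain u where u: "(\<Sum>x\<in>w ` {..n}. u x *\<^sub>C x) = 0" "\<exists>x\<in>w ` {..n}. u x \<noteq> 0"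
      using cvec.dependent_finite[of "w ` {..n}"] by auto
    have "(\<Sum>i\<le>n. u (w i) *\<^sub>C w i) = 0" using u(1) True by (simp add: sum.reindex o_def)
    then have "ev (\<Sum>i\<le>n. monom (u (w i)) i) = 0" by (simp add: ev_sum ev_monom)
    moreover obtain i where i: "i \<le> n" "u (w i) \<noteq> 0" using u(2) by auto
    have "coeff (\<Sum>i\<le>n. monom (u (w i)) i) i \<noteq> 0" using i by (simp add: coeff_sum)
    then have "(\<Sum>i\<le>n. monom (u (w i)) i) \<noteq> 0" by (metis coeff_0)
    ultimately show ?thesis by blast
  qed
  then obtain p where p: "p \<noteq> 0" "ev p = 0" and min: "\<And>q. q \<noteq> 0 \<Longrightarrow> ev q = 0 \<Longrightarrow> degree p \<le> degree q"
    using exists_least_lemma ex_has_least_nat[of "\<lambda>p. p \<noteq> 0 \<and> ev p = 0" _ degree] by metis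
  have "degree p \<noteq> 0"
  proof
    assume "degree p = 0"
    then obtain c where "p = [:c:]" by (metis degree_eq_zeroE)
    then have "c \<noteq> 0" "c *\<^sub>C v = 0" using p by (auto simp: ev_def w_def)
    then have "(1 / c) *\<^sub>C (c *\<^sub>C v) = 0" by simp
    then have "v = 0" using \<open>c \<noteq> 0\<close> unfolding scaleC_scaleC by (simp add: scaleC_one)
    then show False using v by simp
  qed
  then have "\<not> constant (poly p)" by (simp add: constant_degree)
  then obtain l where "poly p l = 0" using fundamental_theorem_of_algebra by blast
  then obtain q where q: "p = [:- l, 1:] * q" using poly_eq_0_iff_dvd dvdE by blast
  have "q \<noteq> 0" using p q by auto
  moreover have "degree q < degree p" using \<open>q \<noteq> 0\<close> unfolding q by (subst degree_mult_eq) auto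
  ultimately have "ev q \<noteq> 0" using min[of q] by linarith
  moreover have "A (ev q) = l *\<^sub>C ev q"
  proof -
    have "p = smult (- l) q + pCons 0 q" by (simp add: q)
    then have "0 = (- l) *\<^sub>C ev q + A (ev q)" using p(2) ev_add ev_smult ev_pCons by metis
    moreover have "(- l) *\<^sub>C ev q = - (l *\<^sub>C ev q)"
      using scaleC_scaleC[of "-1" l "ev q"] by (simp add: scaleC_minus1)
    ultimately show ?thesis by simp
  qed
  ultimately show ?thesis using evV by blast
qed

text \<open>Induction on the size of a spanning set: a unit eigenvector e is split off, and its
  complement W in V has a basis B with fewer elements, because \<open>insert e B\<close> is
  independent inside the span of T.\<close>

lemma spectral_subspace:
  fixes A :: "'h::chilbert_space \<Rightarrow> 'h"
  assumes "finite T" "V \<subseteq> cvec.span T" "cvec.subspace V"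
    and A: "\<And>x y. A (x + y) = A x + A y" "\<And>c x. A (c *\<^sub>C x) = c *\<^sub>C A x"
    and "\<And>x. x \<in> V \<Longrightarrow> A x \<in> V"
    and "\<And>x y. x \<in> V \<Longrightarrow> y \<in> V \<Longrightarrow> cinner (A x) y = cinner x (A y)"
  shows "\<exists>E t. finite E \<and> E \<subseteq> V \<and> orthonormal E \<and>
    (\<forall>e\<in>E. A e = complex_of_real (t e) *\<^sub>C e) \<and> (\<forall>x\<in>V. x = (\<Sum>e\<in>E. cinner x e *\<^sub>C e))"
  using assms(1-3,6-7)
proof (induction "card T" arbitrary: T V rule: less_induct)
  case less
  note T = less.prems(1,2) and V = less.prems(3) and AV = less.prems(4) and sym = less.prems(5)
  show ?case
  proof (cases "V = {0}")
    case True
    then show ?thesis by (intro exI[of _ "{}"]) (auto simp: orthonormal_def)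
  next
    case False
    then obtain v where "v \<in> V" "v \<noteq> 0" using cvec.subspace_0[OF V] by blast
    from eigenvector_exists[OF T V A AV this] obtain u l where u: "u \<in> V" "u \<noteq> 0" "A u = l *\<^sub>C u" by blast
    define e where "e = complex_of_real (inverse (norm u)) *\<^sub>C u"
    have e1: "norm e = 1" using u(2) by (simp add: e_def norm_scaleC norm_inverse)
    have eV: "e \<in> V" unfolding e_def by (rule cvec.subspace_scale[OF V u(1)])
    have Ae: "A e = l *\<^sub>C e" by (simp add: e_def A u(3) scaleC_scaleC mult.commute)
    have ee: "cinner e e = 1" by (simp add: cinner_self e1)
    have "l = cnj l" using sym[OF eV eV] by (simp add: Ae cinner_scaleC_left cinner_scaleC_right ee)
    then have l: "l = complex_of_real (Re l)" by (simp add: complex_eq_iff)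
    define W where "W = {x \<in> V. cinner x e = 0}"
    have W: "cvec.subspace W"
      using V unfolding W_def cvec.subspace_def by (auto simp: cinner_add_left cinner_scaleC_left)
    obtain B where B: "B \<subseteq> W" "cvec.independent B" "W \<subseteq> cvec.span B"
      using cvec.basis_exists[of W] by metis
    have spW: "cvec.span B \<subseteq> W" using B(1) W by (rule cvec.span_minimal)
    have "e \<notin> cvec.span B" using spW ee by (auto simp: W_def)
    then have "cvec.independent (insert e B)" using B(2) by (simp add: cvec.independent_insert)
    moreover have "insert e B \<subseteq> cvec.span T" using T(2) eV B(1) by (auto simp: W_def)
    ultimately have fB: "finite (insert e B) \<and> card (insert e B) \<le> card T"
      by (rule cvec.independent_span_bound[OF T(1)])
    have "e \<notin> B" using \<open>e \<notin> cvec.span B\<close> cvec.span_base by blast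
    then have card: "card B < card T" using fB by auto
    have AW: "A x \<in> W" if "x \<in> W" for x
      using that AV sym[OF _ eV] by (auto simp: W_def Ae cinner_scaleC_right)
    have "\<exists>E t. finite E \<and> E \<subseteq> W \<and> orthonormal E \<and>
        (\<forall>e\<in>E. A e = complex_of_real (t e) *\<^sub>C e) \<and> (\<forall>x\<in>W. x = (\<Sum>e\<in>E. cinner x e *\<^sub>C e))"
      by (rule less.hyps[OF card _ B(3) W AW]) (use fB sym in \<open>auto simp: W_def\<close>)
    then obtain E t where E: "finite E" "E \<subseteq> W" "orthonormal E"
        "\<forall>e\<in>E. A e = complex_of_real (t e) *\<^sub>C e" "\<forall>x\<in>W. x = (\<Sum>e\<in>E. cinner x e *\<^sub>C e)" by blast
    have Ee: "cinner d e = 0" "cinner e d = 0" if "d \<in> E" for d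
    proof -
      show "cinner d e = 0" using E(2) that by (auto simp: W_def)
      then show "cinner e d = 0" using cinner_commute[of e d] by simp
    qed
    have neE: "e \<notin> E" using Ee ee by force
    define t' where "t' d = (if d = e then Re l else t d)" for d
    show ?thesis
    proof (intro exI conjI)
      show "finite (insert e E)" "insert e E \<subseteq> V" using E eV by (auto simp: W_def)
      show "orthonormal (insert e E)" using E(3) Ee e1 by (auto simp: orthonormal_def)
      show "\<forall>d\<in>insert e E. A d = complex_of_real (t' d) *\<^sub>C d"
        using E(4) neE Ae l by (auto simp: t'_def)
      show "\<forall>x\<in>V. x = (\<Sum>d\<in>insert e E. cinner x d *\<^sub>C d)"
      proof
        fix x assume x: "x \<in> V"
        define y where "y = x - cinner x e *\<^sub>C e"
        have "y \<in> W" unfolding W_def y_def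
          using x eV V by (auto simp: cvec.subspace_diff cvec.subspace_scale cinner_diff_left cinner_scaleC_left ee)
        then have "y = (\<Sum>d\<in>E. cinner y d *\<^sub>C d)" using E(5) by blast
        also have "\<dots> = (\<Sum>d\<in>E. cinner x d *\<^sub>C d)"
          by (intro sum.cong) (auto simp: y_def cinner_diff_left cinner_scaleC_left Ee)
        finally show "x = (\<Sum>d\<in>insert e E. cinner x d *\<^sub>C d)"
          using E(1) neE by (simp add: y_def algebra_simps)
      qed
    qed
  qed
qed

section \<open>The symmetrized bidisc and the pentablock\<close>

lemma norm_comb_sq:
  "(norm (a *\<^sub>C y + b *\<^sub>C (x::'a::complex_inner)))\<^sup>2
    = (cmod a)\<^sup>2 * (norm y)\<^sup>2 + 2 * Re (a * cnj b * cinner y x) + (cmod b)\<^sup>2 * (norm x)\<^sup>2"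
  by (simp add: norm_add_sq cinner_scaleC_left cinner_scaleC_right norm_scaleC power_mult_distrib algebra_simps)

text \<open>With y = 1 and x = \<alpha> the left side is the difference of the squared moduli of
  denominator and numerator of \<open>Phi\<close>; with x = T y it is the operator version. Every
  term on the right is nonnegative if |a|, |b| <= 1 and |x| <= |y|.\<close>

lemma Phi_identity:
  fixes x y :: "'a::complex_inner"
  shows "(norm (2 *\<^sub>C y - (a + b) *\<^sub>C x))\<^sup>2 - (norm ((2 * a * b) *\<^sub>C x - (a + b) *\<^sub>C y))\<^sup>2
    = 2 * (1 - (cmod a)\<^sup>2) * (norm (y - b *\<^sub>C x))\<^sup>2 + 2 * (1 - (cmod b)\<^sup>2) * (norm (y - a *\<^sub>C x))\<^sup>2
      + (cmod (a - b))\<^sup>2 * ((norm y)\<^sup>2 - (norm x)\<^sup>2)"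
proof -
  have m: "(- c) *\<^sub>C u = - (c *\<^sub>C u)" for c and u :: 'a
    using scaleC_scaleC[of "-1" c u] by (simp add: scaleC_minus1)
  have 1: "2 *\<^sub>C y - (a + b) *\<^sub>C x = 2 *\<^sub>C y + (- (a + b)) *\<^sub>C x" by (simp only: m) simp
  have 2: "(2 * a * b) *\<^sub>C x - (a + b) *\<^sub>C y = (- (a + b)) *\<^sub>C y + (2 * a * b) *\<^sub>C x" by (simp only: m) simp
  have 3: "y - c *\<^sub>C x = 1 *\<^sub>C y + (- c) *\<^sub>C x" for c by (simp only: m) (simp add: scaleC_one)
  show ?thesis
    unfolding 1 2 3 norm_comb_sq cmod_power2
    by (simp add: power2_eq_square algebra_simps)
qed

text \<open>The losses 1 - |a|^2 and 1 - |b|^2 are at least 1 - m^2, and y - a x and y - b x add up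
  to the denominator; the parallelogram law thus turns the first two terms of
  \<open>Phi_identity\<close> into a share 1 - m^2 of its squared norm. A factor m < 1 gives strict
  bounds and invertibility later.\<close>

lemma Phi_vector_bound:
  fixes x y :: "'a::complex_inner"
  assumes ab: "cmod a \<le> m" "cmod b \<le> m" "m \<le> 1" and xy: "norm x \<le> norm y"
  shows "norm ((2 * a * b) *\<^sub>C x - (a + b) *\<^sub>C y) \<le> m * norm (2 *\<^sub>C y - (a + b) *\<^sub>C x)"
proof -
  have m0: "0 \<le> m" using ab(1) norm_ge_zero order_trans by blast
  define p q where "p = y - a *\<^sub>C x" and "q = y - b *\<^sub>C x"
  have pq: "2 *\<^sub>C y - (a + b) *\<^sub>C x = p + q"
    using scaleC_add_left[of 1 1 y] by (simp add: p_def q_def scaleC_add_left scaleC_one)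
  have "(cmod a)\<^sup>2 \<le> m\<^sup>2" "(cmod b)\<^sup>2 \<le> m\<^sup>2" using ab by (auto intro!: power_mono)
  then have "2 * (1 - m\<^sup>2) * (norm q)\<^sup>2 \<le> 2 * (1 - (cmod a)\<^sup>2) * (norm q)\<^sup>2"
    "2 * (1 - m\<^sup>2) * (norm p)\<^sup>2 \<le> 2 * (1 - (cmod b)\<^sup>2) * (norm p)\<^sup>2"
    by (intro mult_right_mono; simp)+
  moreover have "0 \<le> (cmod (a - b))\<^sup>2 * ((norm y)\<^sup>2 - (norm x)\<^sup>2)"
    using xy by (intro mult_nonneg_nonneg) (auto simp: power_mono)
  moreover have "(1 - m\<^sup>2) * (norm (p + q))\<^sup>2 \<le> (1 - m\<^sup>2) * (2 * (norm p)\<^sup>2 + 2 * (norm q)\<^sup>2)"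
  proof (rule mult_left_mono)
    have "(norm (p + q))\<^sup>2 + (norm (p - q))\<^sup>2 = 2 * (norm p)\<^sup>2 + 2 * (norm q)\<^sup>2"
      unfolding norm_add_sq norm_diff_sq by simp
    then show "(norm (p + q))\<^sup>2 \<le> 2 * (norm p)\<^sup>2 + 2 * (norm q)\<^sup>2"
      using zero_le_power2[of "norm (p - q)"] by linarith
    show "0 \<le> 1 - m\<^sup>2" using ab(3) m0 by (simp add: power_le_one)
  qed
  moreover note Phi_identity[of y a b x, folded p_def q_def, unfolded pq]
  ultimately have "(norm ((2 * a * b) *\<^sub>C x - (a + b) *\<^sub>C y))\<^sup>2 \<le> m\<^sup>2 * (norm (p + q))\<^sup>2"
    by (simp add: algebra_simps)
  then have "(norm ((2 * a * b) *\<^sub>C x - (a + b) *\<^sub>C y))\<^sup>2 \<le> (m * norm (p + q))\<^sup>2"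
    by (simp add: power_mult_distrib)
  then show ?thesis unfolding pq by (rule power2_le_imp_le) (use m0 in simp)
qed

lemma G2_E:
  assumes "z \<in> G2"
  obtains l1 l2 m where "fst z = l1 + l2" "snd z = l1 * l2" "cmod l1 \<le> m" "cmod l2 \<le> m" "0 \<le> m" "m < 1"
proof -
  obtain l1 l2 where l: "z = (l1 + l2, l1 * l2)" "cmod l1 < 1" "cmod l2 < 1"
    using assms by (auto simp: G2_def)
  show ?thesis by (rule that[of l1 l2 "max (cmod l1) (cmod l2)"]) (use l in \<open>auto simp: le_max_iff_disj\<close>)
qed

lemma cmod_Phi_le:
  assumes l: "cmod l1 \<le> m" "cmod l2 \<le> m" "m < 1" and \<alpha>: "cmod \<alpha> \<le> 1"
  shows "cmod (Phi \<alpha> (l1 + l2, l1 * l2)) \<le> m"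
proof -
  have "(l1 + l2, l1 * l2) \<in> G2" using l unfolding G2_def by fastforce
  then have "2 - \<alpha> * (l1 + l2) \<noteq> 0" using G2_denominators(2) \<alpha> by blast
  moreover have "norm ((2 * l1 * l2) *\<^sub>C \<alpha> - (l1 + l2) *\<^sub>C (1::complex)) \<le> m * norm (2 *\<^sub>C (1::complex) - (l1 + l2) *\<^sub>C \<alpha>)"
    by (rule Phi_vector_bound) (use l \<alpha> in auto)
  ultimately show ?thesis
    by (simp add: Phi_def norm_divide divide_le_eq mult_ac)
qed

lemma cmod_Phi_less_1: "z \<in> G2 \<Longrightarrow> cmod \<alpha> \<le> 1 \<Longrightarrow> cmod (Phi \<alpha> z) < 1"
  by (metis G2_E cmod_Phi_le le_less_trans prod.collapse)

lemma Phi_0: "Phi 0 z = - fst z / 2"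
  by (simp add: Phi_def case_prod_unfold)

text \<open>The value of \<psi> is the (2, 1) entry of the Moebius transform (A - conj \<alpha>) (1
  - \<alpha> A)^(-1), a contraction since A is one. The proof clears the denominator det (1 -
  \<alpha> A).\<close>

lemma cmod_psi_le_1:
  assumes z: "z \<in> pentablock" and \<alpha>: "cmod \<alpha> \<le> 1"
  shows "cmod (psi \<alpha> z) \<le> 1"
proof -
  obtain A :: "complex^2^2" where zA: "z = (A $ 2 $ 1, trace A, det A)" and A: "onorm ((*v) A) < 1"
    using z by (auto simp: pentablock_def)
  have den: "1 - \<alpha> * trace A + \<alpha>\<^sup>2 * det A \<noteq> 0"
    using G2_denominators(1)[of "trace A" "det A" \<alpha>] snd_pentablock[OF z] \<alpha> by (simp add: zA)
  define a b c d where "a = A $ 1 $ 1" and "b = A $ 1 $ 2" and "c = A $ 2 $ 1" and "d = A $ 2 $ 2"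
  \<comment> \<open>The first column of the adjugate of 1 - \<alpha> A, that is, det (1 - \<alpha>
    A) times (1 - \<alpha> A)^(-1) applied to the first unit vector. So y - \<alpha> A y is that
    determinant times the unit vector.\<close>
  define y :: "complex^2" where "y = (\<chi> i. if i = 1 then 1 - \<alpha> * d else \<alpha> * c)"
  define w :: "complex^2" where "w = A *v y"
  have "norm w \<le> onorm ((*v) A) * norm y" unfolding w_def by (rule onorm[OF bounded_linear_matrix_vector])
  also have "\<dots> \<le> 1 * norm y" using A by (intro mult_right_mono) auto
  finally have "(norm w)\<^sup>2 \<le> (norm y)\<^sup>2" by (simp add: power_mono)
  then have wy: "(cmod (w $ 1))\<^sup>2 + (cmod (w $ 2))\<^sup>2 \<le> (cmod (y $ 1))\<^sup>2 + (cmod (y $ 2))\<^sup>2"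
    by (simp add: norm_vec_def L2_set_def sum_2)
  have w1: "w $ 1 = a * (1 - \<alpha> * d) + b * (\<alpha> * c)" and w2: "w $ 2 = c * (1 - \<alpha> * d) + d * (\<alpha> * c)"
    by (simp_all add: w_def y_def matrix_vector_mult_def sum_2 a_def b_def c_def d_def)
  have y1: "y $ 1 = 1 - \<alpha> * d" and y2: "y $ 2 = \<alpha> * c" by (simp_all add: y_def)
  have id: "(cmod (u - \<alpha> * v))\<^sup>2 - (cmod (v - cnj \<alpha> * u))\<^sup>2 = (1 - (cmod \<alpha>)\<^sup>2) * ((cmod u)\<^sup>2 - (cmod v)\<^sup>2)" for u v
    unfolding cmod_power2 by (simp add: power2_eq_square algebra_simps)
  have "0 \<le> (1 - (cmod \<alpha>)\<^sup>2) * (((cmod (y $ 1))\<^sup>2 + (cmod (y $ 2))\<^sup>2) - ((cmod (w $ 1))\<^sup>2 + (cmod (w $ 2))\<^sup>2))"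
    using wy \<alpha> by (intro mult_nonneg_nonneg) (auto simp: power_le_one)
  also have "\<dots> = (cmod (y $ 1 - \<alpha> * w $ 1))\<^sup>2 - (cmod (w $ 1 - cnj \<alpha> * y $ 1))\<^sup>2
      + ((cmod (y $ 2 - \<alpha> * w $ 2))\<^sup>2 - (cmod (w $ 2 - cnj \<alpha> * y $ 2))\<^sup>2)"
    unfolding id by (simp add: algebra_simps)
  also have "y $ 2 - \<alpha> * w $ 2 = 0" by (simp add: w2 y2 algebra_simps)
  also have "y $ 1 - \<alpha> * w $ 1 = 1 - \<alpha> * trace A + \<alpha>\<^sup>2 * det A"
    by (simp add: w1 y1 trace_def sum_2 det_2 a_def b_def c_def d_def power2_eq_square algebra_simps)
  also have "w $ 2 - cnj \<alpha> * y $ 2 = (1 - complex_of_real ((cmod \<alpha>)\<^sup>2)) * c"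
    unfolding complex_norm_square by (simp add: w2 y2 algebra_simps)
  finally have "(cmod ((1 - complex_of_real ((cmod \<alpha>)\<^sup>2)) * c))\<^sup>2 - (cmod (0::complex))\<^sup>2
      \<le> (cmod (1 - \<alpha> * trace A + \<alpha>\<^sup>2 * det A))\<^sup>2 - (cmod (w $ 1 - cnj \<alpha> * y $ 1))\<^sup>2"
    by linarith
  moreover have "(cmod (0::complex))\<^sup>2 = 0" by simp
  ultimately have "(cmod ((1 - complex_of_real ((cmod \<alpha>)\<^sup>2)) * c))\<^sup>2 \<le> (cmod (1 - \<alpha> * trace A + \<alpha>\<^sup>2 * det A))\<^sup>2"
    using zero_le_power2[of "cmod (w $ 1 - cnj \<alpha> * y $ 1)"] by linarith
  then have "cmod ((1 - complex_of_real ((cmod \<alpha>)\<^sup>2)) * c) \<le> cmod (1 - \<alpha> * trace A + \<alpha>\<^sup>2 * det A)"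
    by (rule power2_le_imp_le) simp
  then show ?thesis using den by (simp add: zA psi_def norm_divide c_def)
qed

lemma zero_in_pentablock:
  assumes "(s, p) \<in> G2"
  shows "(0, s, p) \<in> pentablock"
proof -
  obtain l1 l2 m where l: "s = l1 + l2" "p = l1 * l2" "cmod l1 \<le> m" "cmod l2 \<le> m" "0 \<le> m" "m < 1"
    using G2_E[OF assms] by auto
  define A :: "complex^2^2" where "A = (\<chi> i j. if i = j then (if i = 1 then l1 else l2) else 0)"
  have "norm (A *v x) \<le> m * norm x" for x
  proof -
    have "(A *v x) $ 1 = l1 * x $ 1" "(A *v x) $ 2 = l2 * x $ 2"
      by (simp_all add: A_def matrix_vector_mult_def sum_2)
    then have "(norm (A *v x))\<^sup>2 = (cmod l1)\<^sup>2 * (cmod (x $ 1))\<^sup>2 + (cmod l2)\<^sup>2 * (cmod (x $ 2))\<^sup>2"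
      by (simp add: norm_vec_def L2_set_def sum_2 norm_mult power_mult_distrib)
    also have "\<dots> \<le> m\<^sup>2 * (cmod (x $ 1))\<^sup>2 + m\<^sup>2 * (cmod (x $ 2))\<^sup>2"
      using l by (intro add_mono mult_right_mono power_mono) auto
    also have "\<dots> = (m * norm x)\<^sup>2"
      by (simp add: norm_vec_def L2_set_def sum_2 power_mult_distrib algebra_simps)
    finally show ?thesis by (rule power2_le_imp_le) (use l in simp)
  qed
  then have "onorm ((*v) A) \<le> m" using l(5) by (intro onorm_le) (auto simp: mult.commute)
  then have "onorm ((*v) A) < 1" using l(6) by simp
  moreover have "A $ 2 $ 1 = 0" "trace A = s" "det A = p"
    by (simp_all add: A_def trace_def sum_2 det_2 l)
  ultimately show ?thesis unfolding pentablock_def by force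
qed

lemma psi_zero: "psi \<alpha> (0, w) = 0"
  by (simp add: psi_def case_prod_unfold)

section \<open>Weighted homogeneous expansion on the symmetrized bidisc\<close>

lemma holomorphic_on_C2_slice:
  fixes f :: "complex \<times> complex \<Rightarrow> complex"
  assumes f: "holomorphic_on_C2 f S" and g: "g1 holomorphic_on U" "g2 holomorphic_on U"
    and U: "open U" "\<And>t. t \<in> U \<Longrightarrow> (g1 t, g2 t) \<in> S"
  shows "(\<lambda>t. f (g1 t, g2 t)) holomorphic_on U"
  unfolding holomorphic_on_open[OF U(1)]
proof
  fix t assume t: "t \<in> U"
  obtain D where D: "(f has_derivative D) (at (g1 t, g2 t))" "\<And>c h. D (c *\<^sub>C h) = c *\<^sub>C D h"
    using f U(2)[OF t] unfolding holomorphic_on_C2_def by blast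
  obtain a b where "(g1 has_field_derivative a) (at t)" "(g2 has_field_derivative b) (at t)"
    using g t unfolding holomorphic_on_open[OF U(1)] by blast
  then have "((\<lambda>t. (g1 t, g2 t)) has_derivative (\<lambda>h. (a * h, b * h))) (at t)"
    unfolding has_field_derivative_def by (intro has_derivative_Pair)
  from has_derivative_compose[OF this D(1)]
  have "((\<lambda>t. f (g1 t, g2 t)) has_derivative (\<lambda>h. D (a * h, b * h))) (at t)" .
  moreover have "D (a * h, b * h) = D (a, b) * h" for h
    using D(2)[of h "(a, b)"] by (simp add: scaleC_prod_def mult.commute)
  ultimately show "\<exists>f'. ((\<lambda>t. f (g1 t, g2 t)) has_field_derivative f') (at t)"
    unfolding has_field_derivative_def by auto
qed

lemma G2_scale:
  assumes "(s, p) \<in> G2" "cmod r \<le> 1"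
  shows "(r * s, r\<^sup>2 * p) \<in> G2"
proof -
  obtain l1 l2 where l: "s = l1 + l2" "p = l1 * l2" "cmod l1 < 1" "cmod l2 < 1"
    using assms(1) by (auto simp: G2_def)
  have "cmod (r * l) < 1" if "cmod l < 1" for l
    using assms(2) that mult_left_le_one_le[of "cmod l" "cmod r"] by (simp add: norm_mult)
  moreover have "r * s = r * l1 + r * l2" "r\<^sup>2 * p = (r * l1) * (r * l2)"
    by (simp_all add: l algebra_simps power2_eq_square)
  ultimately show ?thesis using l unfolding G2_def by blast
qed

text \<open>A product neighbourhood of the origin inside \<open>G2\<close>, in which s and p vary
  independently. The square root d of the discriminant has modulus at most 5/4, so each root of X^2
  - s X + p has modulus at most (1/2 + 5/4) / 2 < 1.\<close>

lemma G2_box: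
  assumes "cmod s \<le> 1/2" "cmod p \<le> 1/4"
  shows "(s, p) \<in> G2"
proof -
  define d where "d = csqrt (s\<^sup>2 - 4 * p)"
  have d: "d * d = s\<^sup>2 - 4 * p" by (simp add: d_def flip: power2_eq_square)
  have "cmod (d * d) \<le> (1/2)\<^sup>2 + 4 * (1/4)"
    unfolding d using assms
    by (intro order_trans[OF norm_triangle_ineq4] add_mono) (auto simp: norm_mult norm_power power_mono)
  then have "(cmod d)\<^sup>2 \<le> (1.25)\<^sup>2" by (simp add: norm_mult power2_eq_square)
  then have "cmod d \<le> 1.25" by (rule power2_le_imp_le) simp
  then have "cmod (s + d) < 2" "cmod (s - d) < 2"
    using assms(1) norm_triangle_ineq[of s d] norm_triangle_ineq4[of s d] by simp_all
  then have "cmod ((s + d) / 2) < 1" "cmod ((s - d) / 2) < 1" by simp_all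
  moreover have "s = (s + d) / 2 + (s - d) / 2" "p = (s + d) / 2 * ((s - d) / 2)"
    using d by (auto simp: field_simps power2_eq_square)
  ultimately show ?thesis unfolding G2_def by blast
qed

text \<open>The weighted homogeneous component of degree N, where s has weight 1 and p weight 2, as
  a Taylor coefficient at 0 of the dilation r -> f (r s, r^2 p).\<close>

definition radial_coeff :: "(complex \<times> complex \<Rightarrow> complex) \<Rightarrow> nat \<Rightarrow> complex \<Rightarrow> complex \<Rightarrow> complex"
  where "radial_coeff f N s p = (deriv ^^ N) (\<lambda>r. f (r * s, r\<^sup>2 * p)) 0 / fact N"

context
  fixes f :: "complex \<times> complex \<Rightarrow> complex" and C :: real
  assumes f: "holomorphic_on_C2 f G2" and C: "\<And>z. z \<in> G2 \<Longrightarrow> cmod (f z) \<le> C"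
begin

lemma C_nonneg: "0 \<le> C"
proof -
  have "(0, 0) \<in> G2" by (rule G2_box) auto
  from C[OF this] show ?thesis using norm_ge_zero[of "f (0, 0)"] by linarith
qed

lemma radial_holomorphic:
  assumes "(s, p) \<in> G2"
  shows "(\<lambda>r. f (r * s, r\<^sup>2 * p)) holomorphic_on ball 0 1"
  by (rule holomorphic_on_C2_slice[OF f])
    (use G2_scale[OF assms] in \<open>auto intro!: holomorphic_intros\<close>)

lemma radial_coeff_sums:
  assumes "(s, p) \<in> G2" "cmod r < 1"
  shows "(\<lambda>N. radial_coeff f N s p * r ^ N) sums f (r * s, r\<^sup>2 * p)"
  using holomorphic_power_series[OF radial_holomorphic[OF assms(1)], of r] assms(2)
  by (simp add: radial_coeff_def)

text \<open>Cauchy's inequality on circles of radius r < 1, followed by r -> 1.\<close>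

lemma radial_coeff_bound:
  assumes z: "(s, p) \<in> G2"
  shows "cmod (radial_coeff f N s p) \<le> C"
proof -
  have *: "cmod (radial_coeff f N s p) * r ^ N \<le> C" if r: "0 < r" "r < 1" for r :: real
  proof -
    have hol: "(\<lambda>r. f (r * s, r\<^sup>2 * p)) holomorphic_on cball 0 r"
      by (rule holomorphic_on_subset[OF radial_holomorphic[OF z]]) (use r in auto)
    have "cmod ((deriv ^^ N) (\<lambda>r. f (r * s, r\<^sup>2 * p)) 0) \<le> fact N * C / r ^ N"
    proof (rule Cauchy_inequality)
      show "(\<lambda>r. f (r * s, r\<^sup>2 * p)) holomorphic_on ball 0 r"
        by (rule holomorphic_on_subset[OF hol]) auto
      show "continuous_on (cball 0 r) (\<lambda>r. f (r * s, r\<^sup>2 * p))"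
        by (rule holomorphic_on_imp_continuous_on[OF hol])
      show "cmod (f (x * s, x\<^sup>2 * p)) \<le> C" if "cmod (0 - x) = r" for x
        using that r by (intro C G2_scale z) simp
    qed (use r in simp)
    then show ?thesis using r by (simp add: radial_coeff_def norm_divide field_simps)
  qed
  define r where "r n = 1 - 1 / real (Suc (Suc n))" for n
  have "(\<lambda>n. 1 - 1 / real (Suc (Suc n))) \<longlonglongrightarrow> 1 - 0"
    by (intro tendsto_intros LIMSEQ_Suc lim_1_over_n)
  then have "(\<lambda>n. cmod (radial_coeff f N s p) * r n ^ N) \<longlonglongrightarrow> cmod (radial_coeff f N s p) * 1 ^ N"
    unfolding r_def by (intro tendsto_intros) simp
  moreover have "cmod (radial_coeff f N s p) * r n ^ N \<le> C" for n
    by (rule *) (auto simp: r_def field_simps)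
  ultimately show ?thesis using LIMSEQ_le_const2 by fastforce
qed

lemma radial_coeff_remainder:
  assumes z: "(s, p) \<in> G2" and r: "cmod r < 1"
  shows "cmod (f (r * s, r\<^sup>2 * p) - (\<Sum>N<M. radial_coeff f N s p * r ^ N)) \<le> C * cmod r ^ M / (1 - cmod r)"
proof (rule norm_sums_le)
  show "(\<lambda>N. radial_coeff f (N + M) s p * r ^ (N + M)) sums (f (r * s, r\<^sup>2 * p) - (\<Sum>N<M. radial_coeff f N s p * r ^ N))"
    by (rule sums_split_initial_segment[OF radial_coeff_sums[OF z r]])
  have "(\<lambda>N. C * cmod r ^ M * cmod r ^ N) sums (C * cmod r ^ M * (1 / (1 - cmod r)))"
    by (intro sums_mult geometric_sums) (use r in simp)
  then show "(\<lambda>N. C * cmod r ^ M * cmod r ^ N) sums (C * cmod r ^ M / (1 - cmod r))" by simp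
  show "cmod (radial_coeff f (N + M) s p * r ^ (N + M)) \<le> C * cmod r ^ M * cmod r ^ N" for N
    using mult_right_mono[OF radial_coeff_bound[OF z, of "N + M"], of "cmod r ^ (N + M)"]
    by (simp add: norm_mult norm_power power_add mult_ac)
qed

lemma radial_coeff_scale:
  assumes z: "(s, p) \<in> G2" and u: "cmod u \<le> 1"
  shows "radial_coeff f N (u * s) (u\<^sup>2 * p) = u ^ N * radial_coeff f N s p"
proof -
  have "(deriv ^^ N) (\<lambda>w. (\<lambda>r. f (r * s, r\<^sup>2 * p)) (u * w)) 0 = u ^ N * (deriv ^^ N) (\<lambda>r. f (r * s, r\<^sup>2 * p)) (u * 0)"
  proof (rule higher_deriv_compose_linear[OF radial_holomorphic[OF z], of "ball 0 1"])
    fix w :: complex assume "w \<in> ball 0 1"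
    then show "u * w \<in> ball 0 1"
      using u mult_left_le_one_le[of "cmod w" "cmod u"] by (simp add: norm_mult)
  qed auto
  moreover have "(\<lambda>w. (\<lambda>r. f (r * s, r\<^sup>2 * p)) (u * w)) = (\<lambda>r. f (r * (u * s), r\<^sup>2 * (u\<^sup>2 * p)))"
    by (simp add: fun_eq_iff power_mult_distrib mult_ac)
  ultimately show ?thesis by (simp add: radial_coeff_def)
qed

text \<open>Holomorphy is obtained from divided remainders: subtract the lower components of the
  dilation by \<open>r n\<close> and divide by \<open>r n ^ N\<close>. The result differs from the
  N-th component by O(\<open>r n\<close>), uniformly on U because f is bounded.\<close>

lemma radial_coeff_slice_holomorphic:
  assumes g: "g1 holomorphic_on U" "g2 holomorphic_on U"
    and U: "open U" "\<And>t. t \<in> U \<Longrightarrow> (g1 t, g2 t) \<in> G2"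
  shows "(\<lambda>t. radial_coeff f N (g1 t) (g2 t)) holomorphic_on U"
proof (induction N rule: less_induct)
  case (less N)
  define r where "r n = complex_of_real (1 / real (Suc (Suc n)))" for n
  have r: "r n \<noteq> 0" "cmod (r n) \<le> 1/2" for n
    by (simp_all add: r_def norm_divide field_simps del: of_nat_Suc)
  define h where "h n t = (f (r n * g1 t, (r n)\<^sup>2 * g2 t) - (\<Sum>k<N. radial_coeff f k (g1 t) (g2 t) * r n ^ k)) / r n ^ N" for n t
  show ?case
  proof (rule holomorphic_uniform_sequence[OF U(1), of h])
    show "h n holomorphic_on U" for n
    proof -
      have "(\<lambda>t. f (r n * g1 t, (r n)\<^sup>2 * g2 t)) holomorphic_on U"
        by (rule holomorphic_on_C2_slice[OF f])
          (use U g r(2)[of n] G2_scale in \<open>auto intro!: holomorphic_intros G2_scale\<close>)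
      then show ?thesis unfolding h_def using less.IH r(1) by (intro holomorphic_intros) auto
    qed
    fix x assume "x \<in> U"
    then obtain d where d: "d > 0" "cball x d \<subseteq> U" using U(1) open_contains_cball by blast
    have "uniform_limit U h (\<lambda>t. radial_coeff f N (g1 t) (g2 t)) sequentially"
    proof (rule uniform_limitI)
      fix e :: real assume "e > 0"
      have est: "dist (h n t) (radial_coeff f N (g1 t) (g2 t)) \<le> 2 * C * cmod (r n)" if t: "t \<in> U" for n t
      proof -
        have rn: "cmod (r n) < 1" using r(2)[of n] by simp
        have "h n t - radial_coeff f N (g1 t) (g2 t) = (f (r n * g1 t, (r n)\<^sup>2 * g2 t) - (\<Sum>k<Suc N. radial_coeff f k (g1 t) (g2 t) * r n ^ k)) / r n ^ N"
          using r(1)[of n] by (simp add: h_def field_simps)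
        then have "cmod (h n t - radial_coeff f N (g1 t) (g2 t))
            = cmod (f (r n * g1 t, (r n)\<^sup>2 * g2 t) - (\<Sum>k<Suc N. radial_coeff f k (g1 t) (g2 t) * r n ^ k)) / cmod (r n) ^ N"
          by (simp only: norm_divide norm_power)
        also have "\<dots> \<le> (C * cmod (r n) ^ Suc N / (1 - cmod (r n))) / cmod (r n) ^ N"
          by (intro divide_right_mono radial_coeff_remainder U t rn) simp
        also have "\<dots> = C * cmod (r n) / (1 - cmod (r n))" using r(1)[of n] by simp
        also have "\<dots> \<le> C * cmod (r n) / (1/2)"
          using r(2)[of n] C_nonneg by (intro divide_left_mono) auto
        finally show ?thesis by (simp add: dist_norm)
      qed
      have "(\<lambda>n. 2 * C * (1 / real (Suc (Suc n)))) \<longlonglongrightarrow> 2 * C * 0"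
        by (intro tendsto_intros LIMSEQ_Suc lim_1_over_n)
      then have "\<forall>\<^sub>F n in sequentially. 2 * C * (1 / real (Suc (Suc n))) < e"
        using \<open>e > 0\<close> by (intro order_tendstoD(2)) auto
      then show "\<forall>\<^sub>F n in sequentially. \<forall>t\<in>U. dist (h n t) (radial_coeff f N (g1 t) (g2 t)) < e"
      proof eventually_elim
        case (elim n)
        have "cmod (r n) = 1 / real (Suc (Suc n))" by (simp add: r_def norm_divide del: of_nat_Suc)
        then show ?case using elim est[of _ n] by fastforce
      qed
    qed
    then show "\<exists>d>0. cball x d \<subseteq> U \<and> uniform_limit (cball x d) h (\<lambda>t. radial_coeff f N (g1 t) (g2 t)) sequentially"
      using d uniform_limit_on_subset by blast
  qed
qed

text \<open>By homogeneity the component is s^N h(p / s^2) with h entire. Growth of order N / 2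
  makes h a polynomial by Liouville's theorem. The exponent there is an integer, so N / 2 is rounded
  up; for odd N this leaves one term too many, and the extra factor s keeps its power of s
  nonnegative.\<close>

lemma radial_coeff_polynomial_box:
  obtains a where "\<And>s p. s \<noteq> 0 \<Longrightarrow> cmod s \<le> 1/2 \<Longrightarrow> cmod p \<le> 1/4 \<Longrightarrow>
    s * radial_coeff f N s p = (\<Sum>k\<le>(N + 1) div 2. a k * s ^ (N + 1 - 2 * k) * p ^ k)"
proof -
  \<comment> \<open>A value of s for which (s, s^2 \<tau>) with |\<tau>| = t stays in the box of
    \<open>G2_box\<close>.\<close>
  define \<rho> where "\<rho> t = 1 / (2 * sqrt (1 + t))" for t :: real
  have \<rho>: "0 < \<rho> t" "\<rho> t \<le> 1/2" "(\<rho> t)\<^sup>2 * t \<le> 1/4" if "0 \<le> t" for t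
    using that by (auto simp: \<rho>_def power_divide power_mult_distrib field_simps)
  define h where "h \<tau> = radial_coeff f N (complex_of_real (\<rho> (cmod \<tau>))) ((complex_of_real (\<rho> (cmod \<tau>)))\<^sup>2 * \<tau>)
      / complex_of_real (\<rho> (cmod \<tau>)) ^ N" for \<tau>
  \<comment> \<open>The quotient by s^N depends on \<tau> only: two values of s differ by a factor,
    and homogeneity is applied from the larger modulus to the smaller.\<close>
  have indep: "radial_coeff f N s (s\<^sup>2 * \<tau>) = s ^ N * h \<tau>"
    if s: "s \<noteq> 0" "cmod s \<le> 1/2" "(cmod s)\<^sup>2 * cmod \<tau> \<le> 1/4" for s \<tau>
  proof -
    define q where "q = complex_of_real (\<rho> (cmod \<tau>))"
    have q: "q \<noteq> 0" "cmod q \<le> 1/2" "(cmod q)\<^sup>2 * cmod \<tau> \<le> 1/4"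
      using \<rho>[of "cmod \<tau>"] by (auto simp: q_def)
    have key: "radial_coeff f N u (u\<^sup>2 * \<tau>) / u ^ N = radial_coeff f N w (w\<^sup>2 * \<tau>) / w ^ N"
      if "u \<noteq> 0" "w \<noteq> 0" "cmod u \<le> cmod w" "cmod w \<le> 1/2" "(cmod w)\<^sup>2 * cmod \<tau> \<le> 1/4" for u w
    proof -
      have "(w, w\<^sup>2 * \<tau>) \<in> G2" using that by (intro G2_box) (auto simp: norm_mult norm_power)
      then have "radial_coeff f N (u / w * w) ((u / w)\<^sup>2 * (w\<^sup>2 * \<tau>)) = (u / w) ^ N * radial_coeff f N w (w\<^sup>2 * \<tau>)"
        using that by (intro radial_coeff_scale) (auto simp: norm_divide)
      then show ?thesis using that by (simp add: power_divide field_simps)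
    qed
    have "radial_coeff f N s (s\<^sup>2 * \<tau>) / s ^ N = radial_coeff f N q (q\<^sup>2 * \<tau>) / q ^ N"
      using key[of s q] key[of q s] s q by (cases "cmod s \<le> cmod q") auto
    then show ?thesis using s by (simp add: h_def q_def field_simps)
  qed
  have "h holomorphic_on UNIV"
  proof -
    \<comment> \<open>On a disc of radius R one value q of s serves all \<tau>, so there h is a
      slice of the component.\<close>
    have "h holomorphic_on ball 0 (real R)" for R :: nat
    proof -
      define q where "q = complex_of_real (\<rho> (real R))"
      have q: "q \<noteq> 0" "cmod q \<le> 1/2" "(cmod q)\<^sup>2 * real R \<le> 1/4"
        using \<rho>[of "real R"] by (auto simp: q_def)
      have le: "(cmod q)\<^sup>2 * cmod \<tau> \<le> 1/4" if "\<tau> \<in> ball 0 (real R)" for \<tau>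
        by (rule order_trans[OF _ q(3)], rule mult_left_mono) (use that in auto)
      have "(\<lambda>\<tau>. radial_coeff f N q (q\<^sup>2 * \<tau>) / q ^ N) holomorphic_on ball 0 (real R)"
        using q le
        by (intro holomorphic_on_divide radial_coeff_slice_holomorphic holomorphic_intros G2_box)
          (auto simp: norm_mult norm_power)
      then show ?thesis
        by (rule holomorphic_transform) (use q le in \<open>simp add: indep\<close>)
    qed
    moreover have "\<exists>R. t \<in> ball 0 (real R)" for t :: complex
      using reals_Archimedean2[of "cmod t"] by auto
    ultimately show ?thesis
      unfolding holomorphic_on_open[OF open_UNIV] by (metis holomorphic_on_open open_ball)
  qed
  moreover have "cmod (h \<tau>) \<le> (C * 2 ^ N * 2 ^ ((N + 1) div 2)) * cmod \<tau> ^ ((N + 1) div 2)" if \<tau>: "1 \<le> cmod \<tau>" for \<tau>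
  proof -
    let ?t = "cmod \<tau>"
    have "(complex_of_real (\<rho> ?t), (complex_of_real (\<rho> ?t))\<^sup>2 * \<tau>) \<in> G2"
      using \<rho>[of ?t] by (intro G2_box) (auto simp: norm_mult norm_power)
    from radial_coeff_bound[OF this, of N] have "cmod (h \<tau>) \<le> C / \<rho> ?t ^ N"
      using \<rho>(1)[of ?t] by (simp add: h_def norm_divide norm_power divide_right_mono)
    also have "\<dots> = C * 2 ^ N * sqrt (1 + ?t) ^ N" by (simp add: \<rho>_def power_divide power_mult_distrib)
    also have "\<dots> \<le> C * 2 ^ N * sqrt (1 + ?t) ^ (2 * ((N + 1) div 2))"
      using C_nonneg by (intro mult_left_mono power_increasing) auto
    also have "sqrt (1 + ?t) ^ (2 * ((N + 1) div 2)) = (1 + ?t) ^ ((N + 1) div 2)"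
      by (simp add: power_mult)
    also have "C * 2 ^ N * (1 + ?t) ^ ((N + 1) div 2) \<le> C * 2 ^ N * (2 * ?t) ^ ((N + 1) div 2)"
      using C_nonneg \<tau> by (intro mult_left_mono power_mono) auto
    finally show ?thesis by (simp add: power_mult_distrib mult_ac)
  qed
  ultimately have liou: "h \<tau> = (\<Sum>k\<le>(N + 1) div 2. (deriv ^^ k) h 0 / fact k * \<tau> ^ k)" for \<tau>
    by (rule Liouville_polynomial)
  define a where "a k = (deriv ^^ k) h 0 / fact k" for k
  have h: "h \<tau> = (\<Sum>k\<le>(N + 1) div 2. a k * \<tau> ^ k)" for \<tau>
    unfolding a_def by (rule liou)
  show ?thesis
  proof (rule that)
    fix s p assume s: "s \<noteq> 0" "cmod s \<le> 1/2" "cmod p \<le> 1/4"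
    have "s * radial_coeff f N s p = s * (s ^ N * h (p / s\<^sup>2))"
      using indep[of s "p / s\<^sup>2"] s by (simp add: norm_divide norm_power)
    also have "\<dots> = (\<Sum>k\<le>(N + 1) div 2. s * (s ^ N * (a k * (p / s\<^sup>2) ^ k)))"
      by (simp only: h sum_distrib_left)
    also have "\<dots> = (\<Sum>k\<le>(N + 1) div 2. a k * s ^ (N + 1 - 2 * k) * p ^ k)"
    proof (intro sum.cong refl)
      fix k assume "k \<in> {..(N + 1) div 2}"
      then have "s ^ (N + 1) = s ^ (N + 1 - 2 * k) * s ^ (2 * k)"
        by (simp flip: power_add)
      then have "s * s ^ N * (p / s\<^sup>2) ^ k = s ^ (N + 1 - 2 * k) * p ^ k"
        using s(1) by (simp add: power_divide flip: power_mult)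
      then show "s * (s ^ N * (a k * (p / s\<^sup>2) ^ k)) = a k * s ^ (N + 1 - 2 * k) * p ^ k"
        by (metis (no_types, lifting) mult.assoc mult.commute)
    qed
    finally show "s * radial_coeff f N s p = (\<Sum>k\<le>(N + 1) div 2. a k * s ^ (N + 1 - 2 * k) * p ^ k)" .
  qed
qed

text \<open>The surplus top coefficient for odd N is removed by letting s tend to 0; the case s = 0
  follows by continuity, and the rest of \<open>G2\<close> by scaling into the box.\<close>

lemma radial_coeff_polynomial:
  obtains a where "\<And>s p. (s, p) \<in> G2 \<Longrightarrow> radial_coeff f N s p = (\<Sum>k\<le>N div 2. a k * s ^ (N - 2 * k) * p ^ k)"
proof -
  obtain a where a: "\<And>s p. s \<noteq> 0 \<Longrightarrow> cmod s \<le> 1/2 \<Longrightarrow> cmod p \<le> 1/4 \<Longrightarrow>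
    s * radial_coeff f N s p = (\<Sum>k\<le>(N + 1) div 2. a k * s ^ (N + 1 - 2 * k) * p ^ k)"
    using radial_coeff_polynomial_box by blast
  define P where "P s p = (\<Sum>k\<le>N div 2. a k * s ^ (N - 2 * k) * p ^ k)" for s p
  have cont: "isCont (\<lambda>s. radial_coeff f N s p) 0" if "cmod p \<le> 1/4" for p
  proof -
    have "(\<lambda>s. radial_coeff f N s p) holomorphic_on ball 0 (1/2)"
      by (rule radial_coeff_slice_holomorphic) (use that in \<open>auto intro!: G2_box holomorphic_intros\<close>)
    then have "continuous_on (ball 0 (1/2)) (\<lambda>s. radial_coeff f N s p)" by (rule holomorphic_on_imp_continuous_on)
    then show ?thesis by (rule continuous_on_interior) simp
  qed
  define r where "r n = complex_of_real (1 / real (Suc (Suc n)))" for n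
  have r: "r n \<noteq> 0" "cmod (r n) \<le> 1/2" for n
    by (simp_all add: r_def norm_divide field_simps del: of_nat_Suc)
  have "(\<lambda>n. complex_of_real (1 / real (Suc (Suc n)))) \<longlonglongrightarrow> complex_of_real 0"
    by (intro tendsto_of_real LIMSEQ_Suc lim_1_over_n)
  then have rl: "r \<longlonglongrightarrow> 0" unfolding r_def by (simp only: of_real_0)
  \<comment> \<open>At p = 1/4 and s tending to 0 only the term with exponent 0 of s survives, while
    the left side tends to 0.\<close>
  have odd: "a ((N + 1) div 2) = 0" if "odd N"
  proof -
    have "(\<lambda>n. r n * radial_coeff f N (r n) (1/4)) \<longlonglongrightarrow> 0 * radial_coeff f N 0 (1/4)"
      using isCont_tendsto_compose[OF cont[of "1/4"] rl] by (intro tendsto_mult rl) (auto simp: norm_divide)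
    moreover have "(\<lambda>n. \<Sum>k\<le>(N + 1) div 2. a k * r n ^ (N + 1 - 2 * k) * (1/4) ^ k)
        \<longlonglongrightarrow> (\<Sum>k\<le>(N + 1) div 2. a k * 0 ^ (N + 1 - 2 * k) * (1/4) ^ k)"
      by (intro tendsto_intros rl)
    moreover have "r n * radial_coeff f N (r n) (1/4) = (\<Sum>k\<le>(N + 1) div 2. a k * r n ^ (N + 1 - 2 * k) * (1/4) ^ k)" for n
      by (rule a) (use r[of n] in \<open>auto simp: norm_divide\<close>)
    ultimately have "(\<Sum>k\<le>(N + 1) div 2. a k * 0 ^ (N + 1 - 2 * k) * (1/4) ^ k) = 0"
      using LIMSEQ_unique by simp
    also have "(\<Sum>k\<le>(N + 1) div 2. a k * 0 ^ (N + 1 - 2 * k) * (1/4) ^ k)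
        = (\<Sum>k\<le>(N + 1) div 2. if k = (N + 1) div 2 then a k * (1/4) ^ k else 0)"
      using that by (intro sum.cong refl) (auto elim!: oddE)
    finally show ?thesis by simp
  qed
  have ne0: "radial_coeff f N s p = P s p" if s: "s \<noteq> 0" "cmod s \<le> 1/2" "cmod p \<le> 1/4" for s p
  proof -
    have "s * radial_coeff f N s p = (\<Sum>k\<le>(N + 1) div 2. a k * s ^ (N + 1 - 2 * k) * p ^ k)" by (rule a[OF s])
    also have "\<dots> = (\<Sum>k\<le>N div 2. a k * s ^ (N + 1 - 2 * k) * p ^ k)"
    proof (cases "odd N")
      case True
      then have "(N + 1) div 2 = Suc (N div 2)" by (auto elim!: oddE)
      then show ?thesis using odd[OF True] by simp
    next
      case False
      then have "(N + 1) div 2 = N div 2" by (auto elim!: evenE)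
      then show ?thesis by simp
    qed
    also have "\<dots> = (\<Sum>k\<le>N div 2. s * (a k * s ^ (N - 2 * k) * p ^ k))"
      by (intro sum.cong refl) (auto simp: Suc_diff_le)
    also have "\<dots> = s * P s p" by (simp add: P_def sum_distrib_left)
    finally show ?thesis using s(1) by simp
  qed
  have box: "radial_coeff f N s p = P s p" if s: "cmod s \<le> 1/2" "cmod p \<le> 1/4" for s p
  proof (cases "s = 0")
    case True
    have "(\<lambda>n. radial_coeff f N (r n) p) \<longlonglongrightarrow> radial_coeff f N 0 p" by (rule isCont_tendsto_compose[OF cont[OF s(2)] rl])
    moreover have "(\<lambda>n. P (r n) p) \<longlonglongrightarrow> P 0 p" unfolding P_def by (intro tendsto_intros rl)
    moreover have "radial_coeff f N (r n) p = P (r n) p" for n by (rule ne0[OF r s(2)])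
    ultimately show ?thesis using True LIMSEQ_unique by simp
  qed (use ne0 s in blast)
  show ?thesis
  proof (rule that)
    fix s p assume z: "(s, p) \<in> G2"
    then obtain l1 l2 where l: "s = l1 + l2" "p = l1 * l2" "cmod l1 < 1" "cmod l2 < 1" by (auto simp: G2_def)
    have "cmod s \<le> 1 + 1" unfolding l by (rule order_trans[OF norm_triangle_ineq add_mono]) (use l in auto)
    moreover have "cmod p \<le> 1 * 1" unfolding l norm_mult by (rule mult_mono) (use l in auto)
    \<comment> \<open>On \<open>G2\<close> |s| <= 2 and |p| <= 1, so the dilation by 1/4 leads into
      the box.\<close>
    ultimately have b: "cmod (1/4 * s) \<le> 1/2" "cmod ((1/4)\<^sup>2 * p) \<le> 1/4"
      by (simp_all add: norm_mult norm_divide norm_power power2_eq_square)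
    have "(1/4) ^ N * radial_coeff f N s p = radial_coeff f N (1/4 * s) ((1/4)\<^sup>2 * p)"
      by (rule radial_coeff_scale[OF z, symmetric]) (simp add: norm_divide)
    also have "\<dots> = P (1/4 * s) ((1/4)\<^sup>2 * p)" by (rule box[OF b])
    also have "\<dots> = (1/4) ^ N * P s p"
      unfolding P_def sum_distrib_left
    proof (intro sum.cong refl)
      fix k assume "k \<in> {..N div 2}"
      then have "(1/4::complex) ^ N = (1/4) ^ (N - 2 * k) * ((1/4)\<^sup>2) ^ k"
        by (simp only: power_mult[symmetric] power_add[symmetric]) simp
      then show "a k * (1/4 * s) ^ (N - 2 * k) * ((1/4)\<^sup>2 * p) ^ k = (1/4) ^ N * (a k * s ^ (N - 2 * k) * p ^ k)"
        by (simp only: power_mult_distrib mult_ac)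
    qed
    finally show "radial_coeff f N s p = (\<Sum>k\<le>N div 2. a k * s ^ (N - 2 * k) * p ^ k)" by (simp add: P_def)
  qed
qed

text \<open>Splitting the dilation \<open>r\<close> into two factors \<open>sqrt r\<close> leaves one of them for convergence of the
  expansion at points of the closure.\<close>

lemma polynomial_approximation:
  assumes r: "0 < r" "r < 1" and \<epsilon>: "\<epsilon> > 0"
  obtains M a where "\<And>l1 l2. cmod l1 \<le> 1 \<Longrightarrow> cmod l2 \<le> 1 \<Longrightarrow>
    cmod (f (complex_of_real r * (l1 + l2), (complex_of_real r)\<^sup>2 * (l1 * l2))
      - (\<Sum>N<M. \<Sum>k\<le>N div 2. a N k * (l1 + l2) ^ (N - 2 * k) * (l1 * l2) ^ k)) \<le> \<epsilon>"
proof -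
  define q where "q = sqrt r"
  have q: "0 < q" "q < 1" "q * q = r" using r by (auto simp: q_def)
  have "(\<lambda>M. C * q ^ M / (1 - q)) \<longlonglongrightarrow> C * 0 / (1 - q)"
    using q by (intro tendsto_intros LIMSEQ_realpow_zero) auto
  then have "\<forall>\<^sub>F M in sequentially. C * q ^ M / (1 - q) < \<epsilon>"
    using \<epsilon> by (intro order_tendstoD(2)) auto
  then obtain M where M: "C * q ^ M / (1 - q) < \<epsilon>" by (auto simp: eventually_sequentially)
  have "\<exists>b. \<forall>s p. (s, p) \<in> G2 \<longrightarrow> radial_coeff f N s p = (\<Sum>k\<le>N div 2. b k * s ^ (N - 2 * k) * p ^ k)" for N
    using radial_coeff_polynomial by metis
  then obtain b where b: "\<And>N s p. (s, p) \<in> G2 \<Longrightarrow> radial_coeff f N s p = (\<Sum>k\<le>N div 2. b N k * s ^ (N - 2 * k) * p ^ k)"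
    by metis
  let ?q = "complex_of_real q"
  show ?thesis
  proof (rule that)
    fix l1 l2 assume l: "cmod l1 \<le> 1" "cmod l2 \<le> 1"
    define s p where "s = l1 + l2" and "p = l1 * l2"
    have "cmod (?q * l) < 1" if "cmod l \<le> 1" for l
    proof -
      have "cmod (?q * l) = q * cmod l" using q by (simp add: norm_mult)
      moreover have "q * cmod l \<le> q * 1" using that q by (intro mult_left_mono) auto
      ultimately show ?thesis using q by linarith
    qed
    moreover have "?q * s = ?q * l1 + ?q * l2" "?q\<^sup>2 * p = (?q * l1) * (?q * l2)"
      by (simp_all add: s_def p_def algebra_simps power2_eq_square)
    ultimately have z: "(?q * s, ?q\<^sup>2 * p) \<in> G2" using l unfolding G2_def by blast
    have "cmod (f (?q * (?q * s), ?q\<^sup>2 * (?q\<^sup>2 * p)) - (\<Sum>N<M. radial_coeff f N (?q * s) (?q\<^sup>2 * p) * ?q ^ N)) \<le> C * q ^ M / (1 - q)"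
      using radial_coeff_remainder[OF z, of ?q M] q by simp
    also have "(?q * (?q * s), ?q\<^sup>2 * (?q\<^sup>2 * p)) = (complex_of_real r * s, (complex_of_real r)\<^sup>2 * p)"
      unfolding q(3)[symmetric] by (simp add: power2_eq_square mult_ac)
    also have "(\<Sum>N<M. radial_coeff f N (?q * s) (?q\<^sup>2 * p) * ?q ^ N)
        = (\<Sum>N<M. \<Sum>k\<le>N div 2. (b N k * complex_of_real r ^ N) * s ^ (N - 2 * k) * p ^ k)"
    proof (intro sum.cong refl)
      fix N
      show "radial_coeff f N (?q * s) (?q\<^sup>2 * p) * ?q ^ N = (\<Sum>k\<le>N div 2. (b N k * complex_of_real r ^ N) * s ^ (N - 2 * k) * p ^ k)"
        unfolding b[OF z] sum_distrib_right
      proof (intro sum.cong refl)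
        fix k assume "k \<in> {..N div 2}"
        then have "?q ^ N = ?q ^ (N - 2 * k) * (?q\<^sup>2) ^ k"
          by (simp only: power_mult[symmetric] power_add[symmetric]) simp
        moreover have "complex_of_real r ^ N = ?q ^ N * ?q ^ N"
          unfolding q(3)[symmetric] by (simp add: power_mult_distrib)
        ultimately show "b N k * (?q * s) ^ (N - 2 * k) * (?q\<^sup>2 * p) ^ k * ?q ^ N = b N k * complex_of_real r ^ N * s ^ (N - 2 * k) * p ^ k"
          by (simp only: power_mult_distrib mult_ac)
      qed
    qed
    finally show "cmod (f (complex_of_real r * (l1 + l2), (complex_of_real r)\<^sup>2 * (l1 * l2))
      - (\<Sum>N<M. \<Sum>k\<le>N div 2. (b N k * complex_of_real r ^ N) * (l1 + l2) ^ (N - 2 * k) * (l1 * l2) ^ k)) \<le> \<epsilon>"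
      using M by (simp add: s_def p_def)
  qed
qed

end

section \<open>The von Neumann inequality on the symmetrized bidisc\<close>

lemma pos_on_null:
  fixes K :: "'x \<Rightarrow> 'x \<Rightarrow> complex"
  assumes K: "pos_on I K" and I: "finite I" and c: "(\<Sum>i\<in>I. \<Sum>j\<in>I. cnj (c i) * c j * K i j) = 0" and i: "i \<in> I"
  shows "(\<Sum>j\<in>I. c j * K i j) = 0"
proof -
  obtain e :: "'x \<Rightarrow> 'x ell2" where e: "\<And>x y. x \<in> I \<Longrightarrow> y \<in> I \<Longrightarrow> K x y = cinner (e y) (e x)"
    using kolmogorov[OF K] by blast
  have "(\<Sum>i\<in>I. \<Sum>j\<in>I. cnj (c i) * c j * K i j) = (\<Sum>i\<in>I. \<Sum>j\<in>I. cnj (c i) * c j * cinner (e j) (e i))"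
    by (intro sum.cong refl) (simp add: e)
  then have "(\<Sum>j\<in>I. c j *\<^sub>C e j) = 0" using c by (simp add: norm_sum_scaleC_sq)
  then have "cinner (\<Sum>j\<in>I. c j *\<^sub>C e j) (e i) = 0" by simp
  then show ?thesis using i by (simp add: cinner_sum_left cinner_scaleC_left e)
qed

lemma span_finite_coeff:
  assumes "finite I" "x \<in> cvec.span (d ` I)"
  obtains c where "x = (\<Sum>i\<in>I. c i *\<^sub>C d i)"
proof -
  obtain F c where F: "finite F" "F \<subseteq> I" "x = (\<Sum>i\<in>F. c i *\<^sub>C d i)" by (rule cspan_image_explicit[OF assms(2)])
  have "x = (\<Sum>i\<in>I. (if i \<in> F then c i else 0) *\<^sub>C d i)"
    unfolding F(3) using F assms(1) by (intro sum.mono_neutral_cong_left) auto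
  then show ?thesis by (rule that)
qed

text \<open>The spectral theorem applied to the zero operator.\<close>

lemma orthonormal_basis_span:
  fixes d :: "'i \<Rightarrow> 'h::chilbert_space"
  assumes "finite I"
  obtains E where "finite E" "E \<subseteq> cvec.span (d ` I)" "orthonormal E"
    "\<And>x. x \<in> cvec.span (d ` I) \<Longrightarrow> x = (\<Sum>e\<in>E. cinner x e *\<^sub>C e)"
proof -
  have "\<exists>E t. finite E \<and> E \<subseteq> cvec.span (d ` I) \<and> orthonormal E \<and>
    (\<forall>e\<in>E. (\<lambda>_. 0) e = complex_of_real (t e) *\<^sub>C e) \<and> (\<forall>x\<in>cvec.span (d ` I). x = (\<Sum>e\<in>E. cinner x e *\<^sub>C e))"
    by (rule spectral_subspace[of "d ` I"]) (use assms cvec.span_zero in auto)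
  then show ?thesis using that by blast
qed

text \<open>The vectors \<open>d i\<close> may be dependent, so a matrix B is the form of an
  operator on their span only if it annihilates every null relation, in rows and in columns; this is
  what \<open>null\<close> demands.\<close>

lemma span_operator:
  fixes d :: "'i \<Rightarrow> 'h::chilbert_space"
  assumes I: "finite I"
    and null: "\<And>c i. (\<Sum>i\<in>I. c i *\<^sub>C d i) = 0 \<Longrightarrow> i \<in> I \<Longrightarrow> (\<Sum>j\<in>I. c j * B i j) = 0"
      "\<And>c j. (\<Sum>i\<in>I. c i *\<^sub>C d i) = 0 \<Longrightarrow> j \<in> I \<Longrightarrow> (\<Sum>i\<in>I. cnj (c i) * B i j) = 0"
  obtains X where "\<And>x y. X (x + y) = X x + X y" "\<And>c x. X (c *\<^sub>C x) = c *\<^sub>C X x"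
    "\<And>x. X x \<in> cvec.span (d ` I)" "\<And>i j. i \<in> I \<Longrightarrow> j \<in> I \<Longrightarrow> cinner (X (d j)) (d i) = B i j"
proof -
  let ?V = "cvec.span (d ` I)"
  obtain E where E: "finite E" "E \<subseteq> ?V" "\<And>x. x \<in> ?V \<Longrightarrow> x = (\<Sum>e\<in>E. cinner x e *\<^sub>C e)"
    by (rule orthonormal_basis_span[OF I, of d]) blast
  have "\<exists>c. e = (\<Sum>i\<in>I. c i *\<^sub>C d i)" if "e \<in> E" for e
    using span_finite_coeff[OF I, of e d] E(2) that by blast
  then obtain \<gamma> where \<gamma>: "\<And>e. e \<in> E \<Longrightarrow> e = (\<Sum>i\<in>I. \<gamma> e i *\<^sub>C d i)" by metis
  \<comment> \<open>\<open>coef i\<close> writes d i once more in terms of the d k, through the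
    orthonormal basis. It differs from the unit row by a null relation, so B does not see the
    difference.\<close>
  define coef where "coef i k = (\<Sum>e\<in>E. cinner (d i) e * \<gamma> e k)" for i k
  have dV: "d i \<in> ?V" if "i \<in> I" for i using that by (intro cvec.span_base) auto
  have coef: "(\<Sum>k\<in>I. (coef i k - (if k = i then 1 else 0)) *\<^sub>C d k) = 0" if i: "i \<in> I" for i
  proof -
    have "(\<Sum>k\<in>I. coef i k *\<^sub>C d k) = (\<Sum>k\<in>I. \<Sum>e\<in>E. cinner (d i) e *\<^sub>C (\<gamma> e k *\<^sub>C d k))"
      by (simp add: coef_def cvec.scale_sum_left scaleC_scaleC)
    also have "\<dots> = (\<Sum>e\<in>E. cinner (d i) e *\<^sub>C (\<Sum>k\<in>I. \<gamma> e k *\<^sub>C d k))"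
      by (subst sum.swap) (simp add: scaleC_sum_right)
    also have "\<dots> = (\<Sum>e\<in>E. cinner (d i) e *\<^sub>C e)"
      by (intro sum.cong refl) (simp flip: \<gamma>)
    also have "\<dots> = d i" using E(3)[OF dV[OF i]] by simp
    finally have "(\<Sum>k\<in>I. coef i k *\<^sub>C d k) = d i" .
    moreover have "(\<Sum>k\<in>I. (if k = i then 1 else 0) *\<^sub>C d k) = (\<Sum>k\<in>I. if k = i then d k else 0)"
      by (intro sum.cong refl) (auto simp: scaleC_one)
    ultimately show ?thesis using I i by (simp add: cvec.scale_left_diff_distrib sum_subtractf)
  qed
  have delta: "(\<Sum>k\<in>I. (if k = i then 1 else 0) * g k) = g i" if "i \<in> I" for i and g :: "'i \<Rightarrow> complex"
  proof -
    have "(\<Sum>k\<in>I. (if k = i then 1 else 0) * g k) = (\<Sum>k\<in>I. if k = i then g k else 0)"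
      by (intro sum.cong refl) auto
    then show ?thesis using I that by simp
  qed
  have c1: "(\<Sum>k\<in>I. coef j k * B i k) = B i j" if "i \<in> I" "j \<in> I" for i j
    using null(1)[OF coef[OF that(2)] that(1)] delta[OF that(2)] by (simp add: left_diff_distrib sum_subtractf)
  have c2: "(\<Sum>k\<in>I. cnj (coef i k) * B k j) = B i j" if "i \<in> I" "j \<in> I" for i j
  proof -
    have "(\<Sum>k\<in>I. cnj (coef i k) * B k j - (if k = i then 1 else 0) * B k j) = 0"
      using null(2)[OF coef[OF that(1)] that(2)] by (simp add: left_diff_distrib if_distrib[of cnj] cong: if_cong)
    then show ?thesis using delta[OF that(1)] by (simp add: sum_subtractf)
  qed
  \<comment> \<open>The vector of the span whose inner products with the d i form column j of
    B.\<close>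
  define w where "w j = (\<Sum>f\<in>E. (\<Sum>k\<in>I. cnj (\<gamma> f k) * B k j) *\<^sub>C f)" for j
  have w: "cinner (w j) (d i) = B i j" if ij: "i \<in> I" "j \<in> I" for i j
  proof -
    have "cinner (w j) (d i) = (\<Sum>f\<in>E. \<Sum>k\<in>I. cnj (cinner (d i) f * \<gamma> f k) * B k j)"
      by (simp add: w_def cinner_sum_left cinner_scaleC_left sum_distrib_right sum_distrib_left mult_ac flip: cinner_commute)
    also have "\<dots> = (\<Sum>k\<in>I. cnj (coef i k) * B k j)"
      by (subst sum.swap) (simp add: coef_def sum_distrib_right)
    finally show ?thesis using c2[OF ij] by simp
  qed
  have wV: "w j \<in> ?V" for j
    unfolding w_def using E(2) by (intro cvec.span_sum cvec.span_scale) auto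
  define X where "X v = (\<Sum>e\<in>E. cinner v e *\<^sub>C (\<Sum>k\<in>I. \<gamma> e k *\<^sub>C w k))" for v
  show ?thesis
  proof (rule that)
    show "X (x + y) = X x + X y" for x y
      by (simp add: X_def cinner_add_left scaleC_add_left sum.distrib)
    show "X (c *\<^sub>C x) = c *\<^sub>C X x" for c x
      by (simp add: X_def cinner_scaleC_left scaleC_sum_right scaleC_scaleC mult.assoc)
    show "X x \<in> ?V" for x
      unfolding X_def by (intro cvec.span_sum cvec.span_scale wV)
    fix i j assume ij: "i \<in> I" "j \<in> I"
    have "cinner (X (d j)) (d i) = (\<Sum>e\<in>E. \<Sum>k\<in>I. cinner (d j) e * \<gamma> e k * cinner (w k) (d i))"
      by (simp add: X_def cinner_sum_left cinner_scaleC_left sum_distrib_left mult_ac)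
    also have "\<dots> = (\<Sum>k\<in>I. coef j k * B i k)"
      by (subst sum.swap) (simp add: coef_def sum_distrib_right w ij(1))
    finally show "cinner (X (d j)) (d i) = B i j" using c1[OF ij] by simp
  qed
qed

text \<open>For |\<alpha>| = 1 the terms with s conj t cancel. What remains is affine in \<alpha>
  and its conjugate, the shape of a numerical radius condition.\<close>

lemma Phi_kernel_expand:
  assumes "cmod \<alpha> = 1" "2 - \<alpha> * s \<noteq> 0" "2 - \<alpha> * t \<noteq> 0"
  shows "(2 - \<alpha> * s) * cnj (2 - \<alpha> * t) * (1 - Phi \<alpha> (s, p) * cnj (Phi \<alpha> (t, q)))
    = 4 - 4 * p * cnj q - 2 * \<alpha> * (s - p * cnj t) - 2 * cnj \<alpha> * (cnj t - s * cnj q)"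
proof -
  have 1: "\<alpha> * cnj \<alpha> = 1" using assms(1) by (simp flip: complex_norm_square)
  have nt: "2 - cnj \<alpha> * cnj t \<noteq> 0" using assms(3) by (metis complex_cnj_cnj complex_cnj_diff complex_cnj_mult complex_cnj_numeral complex_cnj_zero)
  have gen: "u * w * (1 - (n / u) * (m / w)) = u * w - n * m" if "u \<noteq> 0" "w \<noteq> 0" for u w n m :: complex
    using that by (simp add: field_simps)
  have "cnj (2 - \<alpha> * t) \<noteq> 0" using nt by simp
  from gen[OF assms(2) this, of "2 * \<alpha> * p - s" "cnj (2 * \<alpha> * q - t)"]
  have "(2 - \<alpha> * s) * cnj (2 - \<alpha> * t) * (1 - Phi \<alpha> (s, p) * cnj (Phi \<alpha> (t, q)))
     = (2 - \<alpha> * s) * cnj (2 - \<alpha> * t) - (2 * \<alpha> * p - s) * cnj (2 * \<alpha> * q - t)"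
    by (simp only: Phi_def prod.case complex_cnj_divide)
  also have "\<dots> = 4 - 2 * \<alpha> * s - 2 * cnj \<alpha> * cnj t + (\<alpha> * cnj \<alpha>) * (s * cnj t)
      - (4 * (\<alpha> * cnj \<alpha>) * (p * cnj q) - 2 * \<alpha> * p * cnj t - 2 * cnj \<alpha> * s * cnj q + s * cnj t)"
    by (simp add: algebra_simps)
  also have "\<dots> = 4 - 4 * p * cnj q - 2 * \<alpha> * (s - p * cnj t) - 2 * cnj \<alpha> * (cnj t - s * cnj q)"
    unfolding 1 by (simp add: algebra_simps)
  finally show ?thesis .
qed

text \<open>With \<open>D = (1 - p p*) \<kappa>\<close> and \<open>B = (s - p s*) \<kappa>\<close> the hypothesis says that \<open>B\<close> has numerical
  radius at most 1 relative to \<open>D\<close>; \<open>X\<close> is the fundamental operator.\<close>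

lemma Gamma_model:
  fixes \<kappa> :: "'i \<Rightarrow> 'i \<Rightarrow> complex" and s p :: "'i \<Rightarrow> complex"
  assumes I: "finite I" and G: "\<And>i. i \<in> I \<Longrightarrow> (s i, p i) \<in> G2"
    and pos: "\<And>\<alpha>. cmod \<alpha> = 1 \<Longrightarrow>
      pos_on I (\<lambda>i j. (1 - Phi \<alpha> (s i, p i) * cnj (Phi \<alpha> (s j, p j))) * \<kappa> i j)"
  obtains d :: "'i \<Rightarrow> 'i ell2" and X X' where
    "\<And>x y. X (x + y) = X x + X y" "\<And>c x. X (c *\<^sub>C x) = c *\<^sub>C X x" "\<And>x. X x \<in> cvec.span (d ` I)"
    "\<And>x y. X' (x + y) = X' x + X' y" "\<And>c x. X' (c *\<^sub>C x) = c *\<^sub>C X' x" "\<And>x. X' x \<in> cvec.span (d ` I)"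
    "\<And>i j. i \<in> I \<Longrightarrow> j \<in> I \<Longrightarrow> cinner (d j) (d i) = (1 - p i * cnj (p j)) * \<kappa> i j"
    "\<And>i j. i \<in> I \<Longrightarrow> j \<in> I \<Longrightarrow> cinner (X (d j)) (d i) = (s i - p i * cnj (s j)) * \<kappa> i j"
    "\<And>i j. i \<in> I \<Longrightarrow> j \<in> I \<Longrightarrow> cinner (X' (d j)) (d i) = (cnj (s j) - s i * cnj (p j)) * \<kappa> i j"
    "\<And>x y. x \<in> cvec.span (d ` I) \<Longrightarrow> y \<in> cvec.span (d ` I) \<Longrightarrow> cinner (X x) y = cinner x (X' y)"
    "\<And>\<alpha> x. cmod \<alpha> = 1 \<Longrightarrow> x \<in> cvec.span (d ` I) \<Longrightarrow> Re (\<alpha> * cinner (X x) x) \<le> (norm x)\<^sup>2"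
proof -
  define D where "D i j = (1 - p i * cnj (p j)) * \<kappa> i j" for i j
  define B where "B i j = (s i - p i * cnj (s j)) * \<kappa> i j" for i j
  define B' where "B' i j = (cnj (s j) - s i * cnj (p j)) * \<kappa> i j" for i j
  \<comment> \<open>Half of the expression in \<open>Phi_kernel_expand\<close>, times
    \<kappa>.\<close>
  define L where "L \<alpha> i j = 2 * D i j - \<alpha> * B i j - cnj \<alpha> * B' i j" for \<alpha> i j
  have p1: "cmod (p i) < 1" if i: "i \<in> I" for i
  proof -
    obtain l1 l2 where "p i = l1 * l2" "cmod l1 < 1" "cmod l2 < 1" using G[OF i] by (auto simp: G2_def)
    moreover from this have "cmod l1 * cmod l2 < 1 * 1" by (intro mult_strict_mono') auto
    ultimately show ?thesis by (simp add: norm_mult)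
  qed
  have L: "pos_on I (L \<alpha>)" if \<alpha>: "cmod \<alpha> = 1" for \<alpha>
  proof -
    have "pos_on I (\<lambda>i j. complex_of_real (1/2) * ((2 - \<alpha> * s i) * cnj (2 - \<alpha> * s j) *
        ((1 - Phi \<alpha> (s i, p i) * cnj (Phi \<alpha> (s j, p j))) * \<kappa> i j)))"
      by (intro pos_on_scaleR pos_on_congruence pos \<alpha>) simp
    then show ?thesis
    proof (rule pos_on_cong[rotated])
      fix i j assume ij: "i \<in> I" "j \<in> I"
      have eq: "(2 - \<alpha> * s i) * cnj (2 - \<alpha> * s j) * (1 - Phi \<alpha> (s i, p i) * cnj (Phi \<alpha> (s j, p j)))
        = 4 - 4 * p i * cnj (p j) - 2 * \<alpha> * (s i - p i * cnj (s j)) - 2 * cnj \<alpha> * (cnj (s j) - s i * cnj (p j))"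
        by (rule Phi_kernel_expand[OF \<alpha>]) (use G2_denominators(2)[OF G] ij \<alpha> in auto)
      have eq2: "(2 - \<alpha> * s i) * cnj (2 - \<alpha> * s j) * ((1 - Phi \<alpha> (s i, p i) * cnj (Phi \<alpha> (s j, p j))) * \<kappa> i j)
        = (2 - \<alpha> * s i) * cnj (2 - \<alpha> * s j) * (1 - Phi \<alpha> (s i, p i) * cnj (Phi \<alpha> (s j, p j))) * \<kappa> i j"
        by (simp only: mult.assoc)
      show "complex_of_real (1/2) * ((2 - \<alpha> * s i) * cnj (2 - \<alpha> * s j) *
        ((1 - Phi \<alpha> (s i, p i) * cnj (Phi \<alpha> (s j, p j))) * \<kappa> i j)) = L \<alpha> i j"
        unfolding eq2 eq by (simp add: L_def D_def B_def B'_def algebra_simps)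
    qed
  qed
  \<comment> \<open>The sum of the conditions at \<alpha> = 1 and \<alpha> = -1 is 4 D.\<close>
  have D: "pos_on I D"
    by (rule pos_on_cong[OF _ pos_on_scaleR[OF pos_on_add[OF L[of 1] L[of "-1"]], of "1/4"]])
      (auto simp: L_def)
  have pp: "p i * cnj (p j) \<noteq> 1" if "i \<in> I" "j \<in> I" for i j
  proof -
    have "cmod (p i) * cmod (p j) < 1 * 1" using p1 that by (intro mult_strict_mono') auto
    then have "cmod (p i * cnj (p j)) < 1" by (simp add: norm_mult)
    then show ?thesis by auto
  qed
  \<comment> \<open>Positivity of \<kappa> is recovered by dividing out 1 - p conj p.\<close>
  have \<kappa>: "pos_on I \<kappa>"
    by (rule pos_on_cong[OF _ pos_on_divide[OF D p1]]) (simp_all add: D_def pp)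
  have BB': "B' i j = cnj (B j i)" if "i \<in> I" "j \<in> I" for i j
    using pos_on_hermitian[OF \<kappa> that(2,1)] by (simp add: B_def B'_def)
  obtain d :: "'i \<Rightarrow> 'i ell2" where d: "\<And>x y. x \<in> I \<Longrightarrow> y \<in> I \<Longrightarrow> D x y = cinner (d y) (d x)"
    using kolmogorov[OF D] by blast
  \<comment> \<open>A null relation of D is one of each \<open>L \<alpha>\<close>, because
    \<open>L \<alpha>\<close> and \<open>L (- \<alpha>)\<close> are positive with sum 4 D; \<alpha>
    = 1 and \<alpha> = \<i> then separate B from B'.\<close>
  have null: "(\<Sum>j\<in>I. c j * B i j) = 0" "(\<Sum>j\<in>I. c j * B' i j) = 0"
    if c: "(\<Sum>i\<in>I. c i *\<^sub>C d i) = 0" and i: "i \<in> I" for c i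
  proof -
    have D0: "(\<Sum>j\<in>I. c j * D i j) = 0" if "i \<in> I" for i
    proof -
      have "cinner (\<Sum>i\<in>I. c i *\<^sub>C d i) (d i) = 0" using c by simp
      then show ?thesis using that by (simp add: cinner_sum_left cinner_scaleC_left d)
    qed
    have f0: "(\<Sum>i\<in>I. \<Sum>j\<in>I. cnj (c i) * c j * D i j) = 0"
    proof -
      have "(\<Sum>i\<in>I. \<Sum>j\<in>I. cnj (c i) * c j * D i j) = (\<Sum>i\<in>I. cnj (c i) * (\<Sum>j\<in>I. c j * D i j))"
        by (simp add: sum_distrib_left mult.assoc)
      then show ?thesis using D0 by simp
    qed
    have LL: "(\<Sum>j\<in>I. c j * L \<alpha> i j) = 0" if \<alpha>: "cmod \<alpha> = 1" for \<alpha>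
    proof (rule pos_on_null[OF L[OF \<alpha>] I _ i])
      let ?q = "\<lambda>\<alpha>. (\<Sum>i\<in>I. \<Sum>j\<in>I. cnj (c i) * c j * L \<alpha> i j)"
      have "?q \<alpha> + ?q (- \<alpha>) = 4 * (\<Sum>i\<in>I. \<Sum>j\<in>I. cnj (c i) * c j * D i j)"
        unfolding sum_distrib_left sum.distrib[symmetric]
        by (intro sum.cong refl) (simp add: L_def algebra_simps)
      then have "?q \<alpha> + ?q (- \<alpha>) = 0" using f0 by simp
      moreover have "0 \<le> ?q \<alpha>" "0 \<le> ?q (- \<alpha>)"
        by (rule pos_onD[OF L I]; use \<alpha> in simp)+
      ultimately show "?q \<alpha> = 0" by (simp add: add_nonneg_eq_0_iff)
    qed
    have e: "\<alpha> * (\<Sum>j\<in>I. c j * B i j) + cnj \<alpha> * (\<Sum>j\<in>I. c j * B' i j) = 0" if \<alpha>: "cmod \<alpha> = 1" for \<alpha>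
    proof -
      have "(\<Sum>j\<in>I. c j * L \<alpha> i j) = 2 * (\<Sum>j\<in>I. c j * D i j) - \<alpha> * (\<Sum>j\<in>I. c j * B i j) - cnj \<alpha> * (\<Sum>j\<in>I. c j * B' i j)"
        by (simp add: L_def sum_distrib_left sum_subtractf algebra_simps sum.distrib)
      then show ?thesis using LL[OF \<alpha>] D0[OF i] by (simp add: algebra_simps)
    qed
    have e1: "(\<Sum>j\<in>I. c j * B i j) + (\<Sum>j\<in>I. c j * B' i j) = 0" using e[of 1] by simp
    have "\<i> * ((\<Sum>j\<in>I. c j * B i j) - (\<Sum>j\<in>I. c j * B' i j)) = 0" using e[of \<i>] by (simp add: algebra_simps)
    then have e2: "(\<Sum>j\<in>I. c j * B i j) = (\<Sum>j\<in>I. c j * B' i j)" by simp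
    then show "(\<Sum>j\<in>I. c j * B' i j) = 0" using e1 by simp
    then show "(\<Sum>j\<in>I. c j * B i j) = 0" using e2 by simp
  qed
  have cn: "(\<Sum>i\<in>I. cnj (c i) * B i j) = cnj (\<Sum>i\<in>I. c i * B' j i)" "(\<Sum>i\<in>I. cnj (c i) * B' i j) = cnj (\<Sum>i\<in>I. c i * B j i)"
    if "j \<in> I" for c j
    unfolding cnj_sum by (intro sum.cong refl; simp add: BB' that)+
  obtain X where X: "\<And>x y. X (x + y) = X x + X y" "\<And>c x. X (c *\<^sub>C x) = c *\<^sub>C X x"
    "\<And>x. X x \<in> cvec.span (d ` I)" "\<And>i j. i \<in> I \<Longrightarrow> j \<in> I \<Longrightarrow> cinner (X (d j)) (d i) = B i j"
    by (rule span_operator[OF I, of d B]) (auto simp: null cn)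
  obtain X' where X': "\<And>x y. X' (x + y) = X' x + X' y" "\<And>c x. X' (c *\<^sub>C x) = c *\<^sub>C X' x"
    "\<And>x. X' x \<in> cvec.span (d ` I)" "\<And>i j. i \<in> I \<Longrightarrow> j \<in> I \<Longrightarrow> cinner (X' (d j)) (d i) = B' i j"
    by (rule span_operator[OF I, of d B']) (auto simp: null cn)
  have X0: "X 0 = 0" "X' 0 = 0" using X(2)[of 0 0] X'(2)[of 0 0] by auto
  have Xsum: "X (\<Sum>i\<in>F. c i *\<^sub>C d i) = (\<Sum>i\<in>F. c i *\<^sub>C X (d i))" "X' (\<Sum>i\<in>F. c i *\<^sub>C d i) = (\<Sum>i\<in>F. c i *\<^sub>C X' (d i))" for F c
    by (induction F rule: infinite_finite_induct; simp add: X0 X X')+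
  have Xd: "cinner (X (\<Sum>j\<in>I. c j *\<^sub>C d j)) (\<Sum>i\<in>I. b i *\<^sub>C d i) = (\<Sum>i\<in>I. \<Sum>j\<in>I. cnj (b i) * c j * B i j)" for c b
    by (simp add: Xsum cinner_sum_left cinner_sum_right cinner_scaleC_left cinner_scaleC_right X sum_distrib_left mult_ac)
  have sym: "cinner (X x) y = cinner x (X' y)" if xy: "x \<in> cvec.span (d ` I)" "y \<in> cvec.span (d ` I)" for x y
  proof -
    obtain c where c: "x = (\<Sum>i\<in>I. c i *\<^sub>C d i)" using span_finite_coeff[OF I xy(1)] .
    obtain b where b: "y = (\<Sum>i\<in>I. b i *\<^sub>C d i)" using span_finite_coeff[OF I xy(2)] .
    have "cinner (d i) (X' (d j)) = B j i" if "i \<in> I" "j \<in> I" for i j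
      using X'(4)[OF that] BB'[OF that] by (metis cinner_commute complex_cnj_cnj)
    then have "cinner x (X' y) = (\<Sum>i\<in>I. \<Sum>j\<in>I. cnj (b i) * c j * B i j)"
      unfolding c b
      by (simp add: Xsum cinner_sum_left cinner_sum_right cinner_scaleC_left cinner_scaleC_right sum_distrib_left mult_ac)
    then show ?thesis unfolding c b Xd by simp
  qed
  have num: "Re (\<alpha> * cinner (X x) x) \<le> (norm x)\<^sup>2" if \<alpha>: "cmod \<alpha> = 1" and x: "x \<in> cvec.span (d ` I)" for \<alpha> x
  proof -
    obtain c where c: "x = (\<Sum>i\<in>I. c i *\<^sub>C d i)" using span_finite_coeff[OF I x] .
    have D': "(\<Sum>i\<in>I. \<Sum>j\<in>I. cnj (c i) * c j * D i j) = complex_of_real ((norm x)\<^sup>2)"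
      unfolding c norm_sum_scaleC_sq[symmetric] by (intro sum.cong refl) (simp add: d)
    have B0: "(\<Sum>i\<in>I. \<Sum>j\<in>I. cnj (c i) * c j * B i j) = cinner (X x) x" unfolding c Xd ..
    have B'0: "(\<Sum>i\<in>I. \<Sum>j\<in>I. cnj (c i) * c j * B' i j) = cnj (cinner (X x) x)"
      unfolding B0[symmetric] cnj_sum
      by (subst sum.swap) (intro sum.cong refl, simp add: BB' mult_ac)
    have "0 \<le> (\<Sum>i\<in>I. \<Sum>j\<in>I. cnj (c i) * c j * L \<alpha> i j)" by (rule pos_onD[OF L[OF \<alpha>] I]) simp
    also have "\<dots> = 2 * (\<Sum>i\<in>I. \<Sum>j\<in>I. cnj (c i) * c j * D i j)
        - \<alpha> * (\<Sum>i\<in>I. \<Sum>j\<in>I. cnj (c i) * c j * B i j) - cnj \<alpha> * (\<Sum>i\<in>I. \<Sum>j\<in>I. cnj (c i) * c j * B' i j)"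
      unfolding sum_distrib_left sum_subtractf[symmetric]
      by (intro sum.cong refl) (simp add: L_def algebra_simps)
    also have "\<dots> = 2 * complex_of_real ((norm x)\<^sup>2) - \<alpha> * cinner (X x) x - cnj (\<alpha> * cinner (X x) x)"
      unfolding D' B0 B'0 by simp
    finally have "0 \<le> Re (2 * complex_of_real ((norm x)\<^sup>2) - \<alpha> * cinner (X x) x - cnj (\<alpha> * cinner (X x) x))"
      unfolding less_eq_complex_def by simp
    then show ?thesis by simp
  qed
  show ?thesis
    by (rule that[OF X(1-3) X'(1-3) _ _ _ sym num])
      (use d X(4) X'(4) in \<open>auto simp: D_def B_def B'_def\<close>)
qed

section \<open>Cauchy's formula on the circle and points of the distinguished boundary\<close>

definition circ :: "real \<Rightarrow> complex"
  where "circ t = exp (2 * complex_of_real pi * \<i> * complex_of_real t)"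

lemma cmod_circ [simp]: "cmod (circ t) = 1"
  by (simp add: circ_def)

text \<open>Cauchy's formula as the reproducing property of the Szego kernel: on the unit circle du
  / (2 pi \<i> (u - w)) is the conjugate kernel times normalized arc length. In this form the
  conjugated factor of a quadratic form stays visible.\<close>

lemma Cauchy_circ:
  assumes "\<phi> holomorphic_on cball 0 1" "cmod w < 1"
  shows "((\<lambda>t. \<phi> (circ t) * cnj (1 / (1 - cnj w * circ t))) has_integral \<phi> w) {0..1}"
proof -
  have "((\<lambda>u. \<phi> u / (u - w)) has_contour_integral (2 * of_real pi * \<i> * \<phi> w)) (circlepath 0 1)"
    by (rule Cauchy_integral_circlepath_simple) (use assms in auto)
  then have "((\<lambda>t. \<phi> (circlepath 0 1 t) / (circlepath 0 1 t - w) * vector_derivative (circlepath 0 1) (at t within {0..1}))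
      has_integral (2 * of_real pi * \<i> * \<phi> w)) {0..1}"
    unfolding has_contour_integral_def .
  from has_integral_mult_right[OF this, of "1 / (2 * of_real pi * \<i>)"]
  have I: "((\<lambda>t. 1 / (2 * of_real pi * \<i>) * (\<phi> (circlepath 0 1 t) / (circlepath 0 1 t - w) * vector_derivative (circlepath 0 1) (at t within {0..1})))
      has_integral \<phi> w) {0..1}" by simp
  show ?thesis
  proof (rule has_integral_eq[OF _ I])
    fix t :: real assume t: "t \<in> {0..1}"
    have c: "circlepath 0 1 t = circ t" by (simp add: circlepath circ_def)
    have v: "vector_derivative (circlepath 0 1) (at t within {0..1}) = 2 * of_real pi * \<i> * circ t"
      using t by (subst vector_derivative_circlepath01) (auto simp: circ_def)
    have cc: "circ t * cnj (circ t) = 1" by (simp flip: complex_norm_square)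
    have nz: "circ t \<noteq> 0" "circ t \<noteq> w" using cmod_circ[of t] assms(2) by (auto simp del: cmod_circ)
    have "circ t * (1 - w * cnj (circ t)) = circ t - w"
      using cc by (simp add: algebra_simps)
    then have "1 / (1 - w * cnj (circ t)) = circ t / (circ t - w)" using nz
      by (metis divide_divide_eq_right mult.right_neutral nonzero_mult_divide_mult_cancel_left)
    have cancel: "1 / (2 * of_real pi * \<i>) * (x / y * (2 * of_real pi * \<i> * z)) = x * (z / y)" for x y z :: complex
      by (simp add: field_simps)
    note \<open>1 / (1 - w * cnj (circ t)) = circ t / (circ t - w)\<close>
    then show "1 / (2 * of_real pi * \<i>) * (\<phi> (circlepath 0 1 t) / (circlepath 0 1 t - w) * vector_derivative (circlepath 0 1) (at t within {0..1}))
      = \<phi> (circ t) * cnj (1 / (1 - cnj w * circ t))"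
      unfolding c v by (simp only: complex_cnj_divide complex_cnj_diff complex_cnj_mult complex_cnj_one complex_cnj_cnj cancel)
  qed
qed

text \<open>A real t in [-2, 2] is u + conj u with |u| = 1. Hence (\<eta> t, \<eta>^2) is the image
  of the point (\<eta> u, \<eta> conj u) of the torus, a point of the distinguished
  boundary.\<close>

lemma split_root:
  fixes t :: real and \<eta> :: complex
  assumes "\<bar>t\<bar> \<le> 2" "cmod \<eta> = 1"
  obtains l1 l2 where "cmod l1 \<le> 1" "cmod l2 \<le> 1" "l1 + l2 = \<eta> * complex_of_real t" "l1 * l2 = \<eta>\<^sup>2"
proof -
  define u where "u = Complex (t / 2) (sqrt (1 - (t / 2)\<^sup>2))"
  have "(t / 2)\<^sup>2 \<le> 1" using assms(1) by (simp add: abs_square_le_1)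
  then have u: "cmod u = 1" by (simp add: u_def cmod_def)
  have uu: "u * cnj u = 1" using u by (simp flip: complex_norm_square)
  have uc: "u + cnj u = complex_of_real t" by (simp add: complex_add_cnj u_def)
  show ?thesis
  proof (rule that[of "\<eta> * u" "\<eta> * cnj u"])
    show "\<eta> * u + \<eta> * cnj u = \<eta> * complex_of_real t" by (simp only: distrib_left[symmetric] uc)
    have "\<eta> * u * (\<eta> * cnj u) = \<eta>\<^sup>2 * (u * cnj u)" by (simp add: power2_eq_square mult_ac)
    then show "\<eta> * u * (\<eta> * cnj u) = \<eta>\<^sup>2" by (simp add: uu)
  qed (use u assms in \<open>auto simp: norm_mult\<close>)
qed

lemma Re_le_half_sum_squares:
  "Re (cinner x y) \<le> ((norm x)\<^sup>2 + (norm (y::'a::complex_inner))\<^sup>2) / 2"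
  using norm_diff_sq[of x y] zero_le_power2[of "norm (x - y)"] by simp

section \<open>The pencil of the fundamental operator and its values on the circle\<close>

context
  fixes I :: "'i set" and s p :: "'i \<Rightarrow> complex" and \<kappa> :: "'i \<Rightarrow> 'i \<Rightarrow> complex"
    and d :: "'i \<Rightarrow> 'h::chilbert_space" and X X' :: "'h \<Rightarrow> 'h"
  assumes I: "finite I" and G: "\<And>i. i \<in> I \<Longrightarrow> (s i, p i) \<in> G2"
    and X: "\<And>x y. X (x + y) = X x + X y" "\<And>c x. X (c *\<^sub>C x) = c *\<^sub>C X x" "\<And>x. X x \<in> cvec.span (d ` I)"
    and X': "\<And>x y. X' (x + y) = X' x + X' y" "\<And>c x. X' (c *\<^sub>C x) = c *\<^sub>C X' x" "\<And>x. X' x \<in> cvec.span (d ` I)"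
    and D: "\<And>i j. i \<in> I \<Longrightarrow> j \<in> I \<Longrightarrow> cinner (d j) (d i) = (1 - p i * cnj (p j)) * \<kappa> i j"
    and B: "\<And>i j. i \<in> I \<Longrightarrow> j \<in> I \<Longrightarrow> cinner (X (d j)) (d i) = (s i - p i * cnj (s j)) * \<kappa> i j"
    and B': "\<And>i j. i \<in> I \<Longrightarrow> j \<in> I \<Longrightarrow> cinner (X' (d j)) (d i) = (cnj (s j) - s i * cnj (p j)) * \<kappa> i j"
    and sym: "\<And>x y. x \<in> cvec.span (d ` I) \<Longrightarrow> y \<in> cvec.span (d ` I) \<Longrightarrow> cinner (X x) y = cinner x (X' y)"
    and num: "\<And>\<alpha> x. cmod \<alpha> = 1 \<Longrightarrow> x \<in> cvec.span (d ` I) \<Longrightarrow> Re (\<alpha> * cinner (X x) x) \<le> (norm x)\<^sup>2"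
begin

text \<open>The symbol of the Toeplitz operator that models s when p is multiplication by the
  coordinate \<zeta>; X' is the adjoint of X on the span.\<close>

definition pencil :: "complex \<Rightarrow> 'h \<Rightarrow> 'h"
  where "pencil \<zeta> x = X x + \<zeta> *\<^sub>C X' x"

lemma span_V: "cvec.subspace (cvec.span (d ` I))"
  by (rule cvec.subspace_span)

lemma pencil_lin: "pencil \<zeta> (c *\<^sub>C x + y) = c *\<^sub>C pencil \<zeta> x + pencil \<zeta> y"
  by (simp add: pencil_def X X' scaleC_add_right scaleC_scaleC mult.commute)

lemma pencil_pow_in: "j \<in> I \<Longrightarrow> (pencil \<zeta> ^^ n) (d j) \<in> cvec.span (d ` I)"
proof (induction n)
  case 0
  then show ?case by (auto intro: cvec.span_base)
next
  case (Suc n)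
  then show ?case by (simp add: pencil_def cvec.span_add cvec.span_scale X X')
qed

text \<open>The entries are polynomials in \<zeta>; the induction expands the previous power in an
  orthonormal basis of the span.\<close>

lemma pencil_holomorphic:
  assumes j: "j \<in> I"
  shows "(\<lambda>\<zeta>. cinner ((pencil \<zeta> ^^ n) (d j)) u) holomorphic_on A"
proof (induction n arbitrary: u)
  case (Suc n)
  obtain E where E: "finite E" "\<And>x. x \<in> cvec.span (d ` I) \<Longrightarrow> x = (\<Sum>e\<in>E. cinner x e *\<^sub>C e)"
    by (rule orthonormal_basis_span[OF I, of d]) blast
  have X0: "X 0 = 0" "X' 0 = 0" using X(2)[of 0 0] X'(2)[of 0 0] by auto
  have Xs: "X (\<Sum>e\<in>E. c e *\<^sub>C e) = (\<Sum>e\<in>E. c e *\<^sub>C X e)" "X' (\<Sum>e\<in>E. c e *\<^sub>C e) = (\<Sum>e\<in>E. c e *\<^sub>C X' e)" for c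
    by (induction E rule: infinite_finite_induct; simp add: X0 X X')+
  have "cinner ((pencil \<zeta> ^^ Suc n) (d j)) u =
      (\<Sum>e\<in>E. cinner ((pencil \<zeta> ^^ n) (d j)) e * cinner (X e) u) + \<zeta> * (\<Sum>e\<in>E. cinner ((pencil \<zeta> ^^ n) (d j)) e * cinner (X' e) u)" for \<zeta>
  proof -
    have e: "(pencil \<zeta> ^^ n) (d j) = (\<Sum>e\<in>E. cinner ((pencil \<zeta> ^^ n) (d j)) e *\<^sub>C e)"
      by (rule E(2)[OF pencil_pow_in[OF j]])
    have "cinner ((pencil \<zeta> ^^ Suc n) (d j)) u = cinner (X ((pencil \<zeta> ^^ n) (d j))) u + \<zeta> * cinner (X' ((pencil \<zeta> ^^ n) (d j))) u"
      by (simp add: pencil_def cinner_add_left cinner_scaleC_left)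
    then show ?thesis by (subst (asm) (1 2) e) (simp add: Xs cinner_sum_left cinner_scaleC_left)
  qed
  then show ?case using Suc.IH by (simp only: ) (intro holomorphic_intros)
qed simp

text \<open>The Gram matrices satisfy B i j + p i B' i j = s i D i j: at \<zeta> = p i the vector d
  i is an eigenvector of the adjoint of the pencil on the span, with eigenvalue conj (s i).\<close>

lemma pencil_value:
  assumes i: "i \<in> I" and j: "j \<in> I"
  shows "cinner ((pencil (p i) ^^ n) (d j)) (d i) = s i ^ n * ((1 - p i * cnj (p j)) * \<kappa> i j)"
proof -
  have step: "cinner (pencil (p i) y) (d i) = s i * cinner y (d i)" if y: "y \<in> cvec.span (d ` I)" for y
    using y
  proof (induction rule: cvec.span_induct_alt)
    case base
    have "X 0 = 0" "X' 0 = 0" using X(2)[of 0 0] X'(2)[of 0 0] by auto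
    then show ?case by (simp add: pencil_def)
  next
    case (step c x y)
    then obtain k where k: "k \<in> I" "x = d k" by blast
    have "cinner (pencil (p i) (d k)) (d i) = s i * cinner (d k) (d i)"
      using i k(1) by (simp add: pencil_def cinner_add_left cinner_scaleC_left B B' D algebra_simps)
    then show ?case using step(2) k(2)
      by (simp add: pencil_lin cinner_add_left cinner_scaleC_left distrib_left)
  qed
  show ?thesis
  proof (induction n)
    case (Suc n)
    then show ?case using step[OF pencil_pow_in[OF j, where \<zeta> = "p i" and n = n]] by simp
  qed (simp add: D i j)
qed

text \<open>With \<zeta> = \<eta>^2 the pencil is \<eta> times the self-adjoint operator conj \<eta>
  X + \<eta> X'. Its eigenvalue at a unit vector e is twice the real part of conj \<eta> <X e, e>,
  so \<open>num\<close>, used at conj \<eta> and - conj \<eta>, bounds it by 2.\<close>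

lemma pencil_spectral:
  assumes \<eta>: "cmod \<eta> = 1"
  obtains E t where "finite E" "orthonormal E" "\<And>e. e \<in> E \<Longrightarrow> \<bar>t e\<bar> \<le> (2::real)"
    "\<And>i j n. i \<in> I \<Longrightarrow> j \<in> I \<Longrightarrow> cinner ((pencil (\<eta>\<^sup>2) ^^ n) (d j)) (d i)
      = (\<Sum>e\<in>E. cinner (d j) e * cinner e (d i) * (\<eta> * complex_of_real (t e)) ^ n)"
proof -
  define A where "A x = cnj \<eta> *\<^sub>C X x + \<eta> *\<^sub>C X' x" for x
  have ee: "\<eta> * cnj \<eta> = 1" using \<eta> by (simp flip: complex_norm_square)
  have Alin: "A (x + y) = A x + A y" "A (c *\<^sub>C x) = c *\<^sub>C A x" for x y c
    by (simp_all add: A_def X X' scaleC_add_right scaleC_scaleC mult.commute)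
  have sym': "cinner (X' x) y = cinner x (X y)" if "x \<in> cvec.span (d ` I)" "y \<in> cvec.span (d ` I)" for x y
    using sym[OF that(2,1)] by (metis cinner_commute)
  have AV: "A x \<in> cvec.span (d ` I)" for x unfolding A_def by (intro cvec.span_add cvec.span_scale X X')
  have Asym: "cinner (A x) y = cinner x (A y)" if "x \<in> cvec.span (d ` I)" "y \<in> cvec.span (d ` I)" for x y
    by (simp add: A_def cinner_add_left cinner_add_right cinner_scaleC_left cinner_scaleC_right sym[OF that] sym'[OF that])
  have "\<exists>E t. finite E \<and> E \<subseteq> cvec.span (d ` I) \<and> orthonormal E \<and>
    (\<forall>e\<in>E. A e = complex_of_real (t e) *\<^sub>C e) \<and> (\<forall>x\<in>cvec.span (d ` I). x = (\<Sum>e\<in>E. cinner x e *\<^sub>C e))"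
    by (rule spectral_subspace[of "d ` I"]) (simp_all add: I AV Alin Asym span_V)
  then obtain E t where E: "finite E" "E \<subseteq> cvec.span (d ` I)" "orthonormal E"
      "\<And>e. e \<in> E \<Longrightarrow> A e = complex_of_real (t e) *\<^sub>C e"
      "\<And>x. x \<in> cvec.span (d ` I) \<Longrightarrow> x = (\<Sum>e\<in>E. cinner x e *\<^sub>C e)" by blast
  have pA: "pencil (\<eta>\<^sup>2) x = \<eta> *\<^sub>C A x" for x
    by (simp add: pencil_def A_def scaleC_add_right scaleC_scaleC ee scaleC_one power2_eq_square)
  have t2: "\<bar>t e\<bar> \<le> 2" if e: "e \<in> E" for e
  proof -
    have eV: "e \<in> cvec.span (d ` I)" using E(2) e by blast
    have n1: "norm e = 1" using E(3) e by (auto simp: orthonormal_def)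
    have "complex_of_real (t e) = cinner (A e) e" by (simp add: E(4)[OF e] cinner_scaleC_left cinner_self n1)
    also have "\<dots> = cnj \<eta> * cinner (X e) e + \<eta> * cinner e (X e)"
      by (simp add: A_def cinner_add_left cinner_scaleC_left sym'[OF eV eV])
    also have "cinner e (X e) = cnj (cinner (X e) e)" by (rule cinner_commute)
    finally have "complex_of_real (t e) = cnj \<eta> * cinner (X e) e + cnj (cnj \<eta> * cinner (X e) e)" by simp
    then have "t e = 2 * Re (cnj \<eta> * cinner (X e) e)" unfolding complex_add_cnj of_real_eq_iff .
    moreover have "Re (cnj \<eta> * cinner (X e) e) \<le> 1" using num[of "cnj \<eta>" e] \<eta> eV n1 by simp
    moreover have "Re ((- cnj \<eta>) * cinner (X e) e) \<le> 1" using num[of "- cnj \<eta>" e] \<eta> eV n1 by simp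
    ultimately show ?thesis by simp
  qed
  have A0: "A 0 = 0" using Alin(2)[of 0 0] by simp
  have As: "A (\<Sum>e\<in>F. c e *\<^sub>C e) = (\<Sum>e\<in>F. c e *\<^sub>C A e)" for c F
    by (induction F rule: infinite_finite_induct) (simp_all add: A0 Alin)
  have pow: "(pencil (\<eta>\<^sup>2) ^^ n) (d j) = (\<Sum>e\<in>E. (cinner (d j) e * (\<eta> * complex_of_real (t e)) ^ n) *\<^sub>C e)" if j: "j \<in> I" for j n
  proof (induction n)
    case 0
    have "d j \<in> cvec.span (d ` I)" using j by (auto intro: cvec.span_base)
    from E(5)[OF this] show ?case by simp
  next
    case (Suc n)
    then show ?case
      by (simp add: pA As scaleC_sum_right E(4) scaleC_scaleC mult_ac cong: sum.cong)
  qed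
  show ?thesis
  proof (rule that[OF E(1,3) t2])
    fix i j n assume "i \<in> I" "j \<in> I"
    then show "cinner ((pencil (\<eta>\<^sup>2) ^^ n) (d j)) (d i)
      = (\<Sum>e\<in>E. cinner (d j) e * cinner e (d i) * (\<eta> * complex_of_real (t e)) ^ n)"
      by (simp add: pow cinner_sum_left cinner_scaleC_left mult_ac)
  qed
qed

lemma orthonormal_abs_sum:
  assumes "orthonormal E" "finite E"
  shows "(\<Sum>e\<in>E. cmod (cinner (x::'h) e) * cmod (cinner e y)) \<le> norm x * norm y"
proof -
  have "(\<Sum>e\<in>E. cmod (cinner x e) * cmod (cinner e y)) \<le> L2_set (\<lambda>e. cmod (cinner x e)) E * L2_set (\<lambda>e. cmod (cinner e y)) E"
    by (rule order_trans[OF _ L2_set_mult_ineq]) simp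
  also have "\<dots> \<le> norm x * norm y"
  proof (intro mult_mono)
    have B: "L2_set (\<lambda>e. cmod (cinner z e)) E \<le> norm z" for z :: 'h
      unfolding L2_set_def by (rule real_le_lsqrt) (use Bessel[OF assms(1,2) order_refl, of z] in \<open>auto simp: sum_nonneg\<close>)
    show "L2_set (\<lambda>e. cmod (cinner x e)) E \<le> norm x" by (rule B)
    have "cmod (cinner e y) = cmod (cinner y e)" for e by (metis cinner_commute complex_mod_cnj)
    then show "L2_set (\<lambda>e. cmod (cinner e y)) E \<le> norm y" using B[of y] by simp
  qed (auto simp: L2_set_nonneg)
  finally show ?thesis .
qed

text \<open>The left side is linear in F, with v and a independent of each other, so F can be
  replaced by polynomials entry by entry. Szego kernels at the points p j write both sides as circle
  averages; on the circle the pencil is diagonal, and F is evaluated at single boundary points,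
  moved inside by r.\<close>

lemma von_Neumann_dilated:
  fixes F :: "complex \<times> complex \<Rightarrow> ('c::chilbert_space \<Rightarrow>\<^sub>L 'a::chilbert_space)"
    and v :: "'i \<Rightarrow> 'c" and a :: "'i \<Rightarrow> 'a" and r :: real
  assumes hol: "\<And>u w. holomorphic_on_C2 (\<lambda>z. cinner (blinfun_apply (F z) u) w) G2"
    and cB: "\<And>z. z \<in> G2 \<Longrightarrow> F z \<in> \<B>"
    and contr: "\<And>z. z \<in> G2 \<Longrightarrow> norm (F z) \<le> 1" and r: "0 < r" "r < 1"
  shows "Re (\<Sum>i\<in>I. \<Sum>j\<in>I. \<kappa> i j * cinner (blinfun_apply (F (complex_of_real r * s i, (complex_of_real r)\<^sup>2 * p i)) (v j)) (a i))
    \<le> Re (\<Sum>i\<in>I. \<Sum>j\<in>I. \<kappa> i j * (cinner (v j) (v i) + cinner (a j) (a i))) / 2"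
proof -
  define FF where "FF x y = F (complex_of_real r * x, (complex_of_real r)\<^sup>2 * y)" for x y
  define w where "w i j = cinner (v j) (v i) + cinner (a j) (a i)" for i j
  \<comment> \<open>The Szego kernel at \<open>p j\<close>; its value \<open>k j (p i)\<close> is
    the factor that turns the Gram matrix of the d i back into \<kappa>.\<close>
  define k where "k j \<zeta> = 1 / (1 - cnj (p j) * \<zeta>)" for j and \<zeta> :: complex
  have p1: "cmod (p i) < 1" if i: "i \<in> I" for i
  proof -
    obtain l1 l2 where "p i = l1 * l2" "cmod l1 < 1" "cmod l2 < 1" using G[OF i] by (auto simp: G2_def)
    moreover from this have "cmod l1 * cmod l2 < 1 * 1" by (intro mult_strict_mono') auto
    ultimately show ?thesis by (simp add: norm_mult)
  qed
  have den: "1 - cnj (p j) * \<zeta> \<noteq> 0" if "j \<in> I" "cmod \<zeta> \<le> 1" for j \<zeta>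
  proof -
    have "cmod (p j) * cmod \<zeta> \<le> cmod (p j) * 1" using that(2) by (intro mult_left_mono) auto
    then have "cmod (cnj (p j) * \<zeta>) < 1" using p1[OF that(1)] by (simp add: norm_mult)
    then show ?thesis by auto
  qed
  have kb: "cmod (k j \<zeta>) \<le> 1 / (1 - cmod (p j))" if "j \<in> I" "cmod \<zeta> = 1" for j \<zeta>
  proof -
    have "1 - cmod (p j) \<le> cmod (1 - cnj (p j) * \<zeta>)"
      using norm_triangle_ineq2[of 1 "cnj (p j) * \<zeta>"] that(2) by (simp add: norm_mult)
    then show ?thesis using p1[OF that(1)] by (simp add: k_def norm_divide frac_le)
  qed
  have khol: "k j holomorphic_on cball 0 1" if "j \<in> I" for j
    unfolding k_def using den[OF that] by (intro holomorphic_intros) auto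
  \<comment> \<open>Constants for the two approximation errors: K for the error at each point of the
    circle, K' for the error at the points (s i, p i).\<close>
  define K where "K = (\<Sum>i\<in>I. \<Sum>j\<in>I. 1 / (1 - cmod (p i)) * (1 / (1 - cmod (p j))) * (norm (d j) * norm (d i)))"
  define K' where "K' = (\<Sum>i\<in>I. \<Sum>j\<in>I. cmod (\<kappa> i j))"
  let ?L = "Re (\<Sum>i\<in>I. \<Sum>j\<in>I. \<kappa> i j * cinner (blinfun_apply (FF (s i) (p i)) (v j)) (a i))"
  let ?R = "Re (\<Sum>i\<in>I. \<Sum>j\<in>I. \<kappa> i j * w i j) / 2"
  have main: "?L \<le> ?R + \<epsilon> * (K + K')" if \<epsilon>: "\<epsilon> > 0" for \<epsilon>
  proof -
    \<comment> \<open>Degree bound and coefficients of an approximating polynomial are packed into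
      one pair x, to be chosen for each (i, j).\<close>
    define R where "R i j x \<longleftrightarrow> (\<forall>l1 l2. cmod l1 \<le> 1 \<longrightarrow> cmod l2 \<le> 1 \<longrightarrow>
      cmod (cinner (blinfun_apply (FF (l1 + l2) (l1 * l2)) (v j)) (a i)
        - (\<Sum>N<fst x. \<Sum>m\<le>N div 2. snd x N m * (l1 + l2) ^ (N - 2 * m) * (l1 * l2) ^ m)) \<le> \<epsilon>)"
      for i j and x :: "nat \<times> (nat \<Rightarrow> nat \<Rightarrow> complex)"
    have R: "\<exists>x. R i j x" for i j
    proof -
      have bd: "cmod (cinner (blinfun_apply (F z) (v j)) (a i)) \<le> norm (v j) * norm (a i)" if "z \<in> G2" for z
      proof -
        have "norm (blinfun_apply (F z) (v j)) \<le> 1 * norm (v j)"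
          by (rule order_trans[OF norm_blinfun mult_right_mono]) (use contr[OF that] in auto)
        then show ?thesis
          by (intro order_trans[OF cinner_Cauchy_Schwarz] mult_right_mono) auto
      qed
      obtain M c where "\<And>l1 l2. cmod l1 \<le> 1 \<Longrightarrow> cmod l2 \<le> 1 \<Longrightarrow>
        cmod (cinner (blinfun_apply (F (complex_of_real r * (l1 + l2), (complex_of_real r)\<^sup>2 * (l1 * l2))) (v j)) (a i)
        - (\<Sum>N<M. \<Sum>m\<le>N div 2. c N m * (l1 + l2) ^ (N - 2 * m) * (l1 * l2) ^ m)) \<le> \<epsilon>"
        by (rule polynomial_approximation[OF hol bd r \<epsilon>]) blast+
      then have "R i j (M, c)" by (simp add: R_def FF_def)
      then show ?thesis by blast
    qed
    define M c where "M i j = fst (SOME x. R i j x)" and "c i j = snd (SOME x. R i j x)" for i j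
    have approx: "cmod (cinner (blinfun_apply (FF (l1 + l2) (l1 * l2)) (v j)) (a i)
        - (\<Sum>N<M i j. \<Sum>m\<le>N div 2. c i j N m * (l1 + l2) ^ (N - 2 * m) * (l1 * l2) ^ m)) \<le> \<epsilon>"
      if "cmod l1 \<le> 1" "cmod l2 \<le> 1" for i j l1 l2
      using someI_ex[OF R[of i j]] that unfolding R_def[of i j "SOME x. R i j x"] M_def c_def by blast
    \<comment> \<open>q is the polynomial for the pair (i, j); Q below is q with the pencil in place
      of s and \<zeta> in place of p, taken between the Gram vectors.\<close>
    define q where "q i j x y = (\<Sum>N<M i j. \<Sum>m\<le>N div 2. c i j N m * x ^ (N - 2 * m) * y ^ m)" for i j x y
    define Q where "Q i j \<zeta> = (\<Sum>N<M i j. \<Sum>m\<le>N div 2. c i j N m * cinner ((pencil \<zeta> ^^ (N - 2 * m)) (d j)) (d i) * \<zeta> ^ m)" for i j \<zeta>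
    have Qhol: "Q i j holomorphic_on cball 0 1" if "j \<in> I" for i j
      unfolding Q_def by (intro holomorphic_intros pencil_holomorphic that)
    have Qval: "Q i j (p i) = q i j (s i) (p i) * ((1 - p i * cnj (p j)) * \<kappa> i j)" if "i \<in> I" "j \<in> I" for i j
      unfolding Q_def q_def pencil_value[OF that] sum_distrib_right
      by (intro sum.cong refl) (simp add: mult_ac)
    have int1: "((\<lambda>t. \<Sum>i\<in>I. \<Sum>j\<in>I. (k j (circ t) * Q i j (circ t)) * cnj (k i (circ t))) has_integral
        (\<Sum>i\<in>I. \<Sum>j\<in>I. k j (p i) * Q i j (p i))) {0..1}"
      unfolding k_def[of "_" "circ _", THEN arg_cong[of _ _ cnj]]
      by (intro has_integral_sum I Cauchy_circ[of "\<lambda>\<zeta>. k _ \<zeta> * Q _ _ \<zeta>"] holomorphic_on_mult khol Qhol p1) auto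
    have int2: "((\<lambda>t. \<Sum>i\<in>I. \<Sum>j\<in>I. (k j (circ t) * (cinner (d j) (d i) * w i j)) * cnj (k i (circ t))) has_integral
        (\<Sum>i\<in>I. \<Sum>j\<in>I. k j (p i) * (cinner (d j) (d i) * w i j))) {0..1}"
      unfolding k_def[of "_" "circ _", THEN arg_cong[of _ _ cnj]]
      by (intro has_integral_sum I Cauchy_circ[of "\<lambda>\<zeta>. k _ \<zeta> * (_ * w _ _)"] holomorphic_on_mult khol holomorphic_on_const p1) auto
    have pw: "Re (\<Sum>i\<in>I. \<Sum>j\<in>I. (k j \<zeta> * Q i j \<zeta>) * cnj (k i \<zeta>))
        \<le> Re (\<Sum>i\<in>I. \<Sum>j\<in>I. (k j \<zeta> * (cinner (d j) (d i) * w i j)) * cnj (k i \<zeta>)) / 2 + \<epsilon> * K"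
      if \<zeta>: "cmod \<zeta> = 1" for \<zeta>
    proof -
      \<comment> \<open>A square root of \<zeta>, the rotation that makes the pencil
        self-adjoint.\<close>
      define \<eta> where "\<eta> = csqrt \<zeta>"
      have \<eta>: "cmod \<eta> = 1" "\<eta>\<^sup>2 = \<zeta>" using \<zeta> by (auto simp: \<eta>_def norm_csqrt)
      obtain E t where E: "finite E" "orthonormal E" "\<And>e. e \<in> E \<Longrightarrow> \<bar>t e\<bar> \<le> 2"
        and Ep: "\<And>i j n. i \<in> I \<Longrightarrow> j \<in> I \<Longrightarrow> cinner ((pencil (\<eta>\<^sup>2) ^^ n) (d j)) (d i)
          = (\<Sum>e\<in>E. cinner (d j) e * cinner e (d i) * (\<eta> * complex_of_real (t e)) ^ n)"
        by (rule pencil_spectral[OF \<eta>(1)]) blast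
      define Fe where "Fe e = FF (\<eta> * complex_of_real (t e)) (\<eta>\<^sup>2)" for e
      have root: "\<exists>l1 l2. cmod l1 \<le> 1 \<and> cmod l2 \<le> 1 \<and> l1 + l2 = \<eta> * complex_of_real (t e) \<and> l1 * l2 = \<eta>\<^sup>2" if "e \<in> E" for e
        using split_root[OF E(3)[OF that] \<eta>(1)] by metis
      have Fe1: "norm (Fe e) \<le> 1" "Fe e \<in> \<B>" if e: "e \<in> E" for e
      proof -
        obtain l1 l2 where l: "cmod l1 \<le> 1" "cmod l2 \<le> 1" "l1 + l2 = \<eta> * complex_of_real (t e)" "l1 * l2 = \<eta>\<^sup>2"
          using root[OF e] by blast
        have sc: "cmod (complex_of_real r * l) < 1" if "cmod l \<le> 1" for l
        proof -
          have "cmod (complex_of_real r * l) = r * cmod l" using r by (simp add: norm_mult)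
          moreover have "r * cmod l \<le> r * 1" using that r by (intro mult_left_mono) auto
          ultimately show ?thesis using r by linarith
        qed
        have "(complex_of_real r * l1 + complex_of_real r * l2, (complex_of_real r * l1) * (complex_of_real r * l2)) \<in> G2"
          using sc[OF l(1)] sc[OF l(2)] unfolding G2_def by blast
        also have "(complex_of_real r * l1 + complex_of_real r * l2, (complex_of_real r * l1) * (complex_of_real r * l2))
          = (complex_of_real r * (\<eta> * complex_of_real (t e)), (complex_of_real r)\<^sup>2 * \<eta>\<^sup>2)"
          unfolding l(3,4)[symmetric] by (simp add: algebra_simps power2_eq_square)
        finally have "(complex_of_real r * (\<eta> * complex_of_real (t e)), (complex_of_real r)\<^sup>2 * \<eta>\<^sup>2) \<in> G2" .
        then show "norm (Fe e) \<le> 1" "Fe e \<in> \<B>" unfolding Fe_def FF_def by (rule contr, rule cB)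
      qed
      have Qq: "Q i j \<zeta> = (\<Sum>e\<in>E. cinner (d j) e * cinner e (d i) * q i j (\<eta> * complex_of_real (t e)) (\<eta>\<^sup>2))" if "i \<in> I" "j \<in> I" for i j
      proof -
        have "Q i j \<zeta> = (\<Sum>N<M i j. \<Sum>m\<le>N div 2. \<Sum>e\<in>E. cinner (d j) e * cinner e (d i) *
            (c i j N m * (\<eta> * complex_of_real (t e)) ^ (N - 2 * m) * (\<eta>\<^sup>2) ^ m))"
          unfolding Q_def \<eta>(2)[symmetric] Ep[OF that] sum_distrib_left sum_distrib_right
          by (intro sum.cong refl) (simp add: mult_ac)
        also have "\<dots> = (\<Sum>N<M i j. \<Sum>e\<in>E. \<Sum>m\<le>N div 2. cinner (d j) e * cinner e (d i) *
            (c i j N m * (\<eta> * complex_of_real (t e)) ^ (N - 2 * m) * (\<eta>\<^sup>2) ^ m))"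
          by (intro sum.cong refl sum.swap)
        also have "\<dots> = (\<Sum>e\<in>E. \<Sum>N<M i j. \<Sum>m\<le>N div 2. cinner (d j) e * cinner e (d i) *
            (c i j N m * (\<eta> * complex_of_real (t e)) ^ (N - 2 * m) * (\<eta>\<^sup>2) ^ m))"
          by (rule sum.swap)
        finally show ?thesis by (simp add: q_def sum_distrib_left)
      qed
      \<comment> \<open>Q with the polynomial replaced by the dilated F at the spectral points;
        these lie in the closed symmetrized bidisc, where the approximation is uniform.\<close>
      define P where "P i j = (\<Sum>e\<in>E. cinner (d j) e * cinner e (d i) * cinner (blinfun_apply (Fe e) (v j)) (a i))" for i j
      have QP: "cmod (Q i j \<zeta> - P i j) \<le> \<epsilon> * (norm (d j) * norm (d i))" if ij: "i \<in> I" "j \<in> I" for i j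
      proof -
        have "cmod (Q i j \<zeta> - P i j) = cmod (\<Sum>e\<in>E. cinner (d j) e * cinner e (d i) *
            (q i j (\<eta> * complex_of_real (t e)) (\<eta>\<^sup>2) - cinner (blinfun_apply (Fe e) (v j)) (a i)))"
          by (simp add: Qq[OF ij] P_def sum_subtractf right_diff_distrib)
        also have "\<dots> \<le> (\<Sum>e\<in>E. cmod (cinner (d j) e) * cmod (cinner e (d i)) * \<epsilon>)"
        proof (intro sum_norm_le)
          fix e assume "e \<in> E"
          from root[OF this] obtain l1 l2 where l: "cmod l1 \<le> 1" "cmod l2 \<le> 1" "l1 + l2 = \<eta> * complex_of_real (t e)" "l1 * l2 = \<eta>\<^sup>2"
            by blast
          have "cmod (q i j (\<eta> * complex_of_real (t e)) (\<eta>\<^sup>2) - cinner (blinfun_apply (Fe e) (v j)) (a i)) \<le> \<epsilon>"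
            using approx[OF l(1,2), of j i] unfolding l(3,4) Fe_def q_def by (simp only: norm_minus_commute)
          then show "cmod (cinner (d j) e * cinner e (d i) *
            (q i j (\<eta> * complex_of_real (t e)) (\<eta>\<^sup>2) - cinner (blinfun_apply (Fe e) (v j)) (a i))) \<le> cmod (cinner (d j) e) * cmod (cinner e (d i)) * \<epsilon>"
            by (simp only: norm_mult) (intro mult_left_mono mult_nonneg_nonneg norm_ge_zero)
        qed
        also have "\<dots> = \<epsilon> * (\<Sum>e\<in>E. cmod (cinner (d j) e) * cmod (cinner e (d i)))"
          by (simp add: sum_distrib_left mult_ac)
        also have "\<dots> \<le> \<epsilon> * (norm (d j) * norm (d i))"
          using \<epsilon> by (intro mult_left_mono orthonormal_abs_sum E) auto
        finally show ?thesis .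
      qed
      define S where "S = (\<Sum>i\<in>I. \<Sum>j\<in>I. (k j \<zeta> * P i j) * cnj (k i \<zeta>))"
      have err: "cmod ((\<Sum>i\<in>I. \<Sum>j\<in>I. (k j \<zeta> * Q i j \<zeta>) * cnj (k i \<zeta>)) - S) \<le> \<epsilon> * K"
      proof -
        have "(\<Sum>i\<in>I. \<Sum>j\<in>I. (k j \<zeta> * Q i j \<zeta>) * cnj (k i \<zeta>)) - S = (\<Sum>i\<in>I. \<Sum>j\<in>I. (k j \<zeta> * (Q i j \<zeta> - P i j)) * cnj (k i \<zeta>))"
          by (simp add: S_def sum_subtractf algebra_simps)
        also have "cmod \<dots> \<le> (\<Sum>i\<in>I. \<Sum>j\<in>I. 1 / (1 - cmod (p j)) * (\<epsilon> * (norm (d j) * norm (d i))) * (1 / (1 - cmod (p i))))"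
        proof (intro sum_norm_le)
          fix i j assume ij: "i \<in> I" "j \<in> I"
          show "cmod ((k j \<zeta> * (Q i j \<zeta> - P i j)) * cnj (k i \<zeta>)) \<le> 1 / (1 - cmod (p j)) * (\<epsilon> * (norm (d j) * norm (d i))) * (1 / (1 - cmod (p i)))"
            unfolding norm_mult complex_mod_cnj using p1 ij \<epsilon>
            by (intro mult_mono kb QP \<zeta> mult_nonneg_nonneg) (auto simp: less_imp_le)
        qed
        also have "\<dots> = \<epsilon> * K" by (simp add: K_def sum_distrib_left mult_ac)
        finally show ?thesis .
      qed
      \<comment> \<open>Collecting the coefficients with respect to e decouples the double sum: one
        contraction \<open>Fe e\<close> acts between \<open>Y e\<close> and
        \<open>Z e\<close>.\<close>
      define Y Z where "Y e = (\<Sum>j\<in>I. (k j \<zeta> * cinner (d j) e) *\<^sub>C v j)" and "Z e = (\<Sum>i\<in>I. (k i \<zeta> * cinner (d i) e) *\<^sub>C a i)" for e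
      have SYZ: "S = (\<Sum>e\<in>E. cinner (blinfun_apply (Fe e) (Y e)) (Z e))"
      proof -
        have "S = (\<Sum>i\<in>I. \<Sum>j\<in>I. \<Sum>e\<in>E. (k j \<zeta> * cinner (d j) e) * (cnj (k i \<zeta> * cinner (d i) e) * cinner (blinfun_apply (Fe e) (v j)) (a i)))"
          unfolding S_def P_def sum_distrib_left sum_distrib_right
          by (intro sum.cong refl) (simp add: mult_ac flip: cinner_commute)
        also have "\<dots> = (\<Sum>i\<in>I. \<Sum>e\<in>E. \<Sum>j\<in>I. (k j \<zeta> * cinner (d j) e) * (cnj (k i \<zeta> * cinner (d i) e) * cinner (blinfun_apply (Fe e) (v j)) (a i)))"
          by (intro sum.cong refl sum.swap)
        also have "\<dots> = (\<Sum>e\<in>E. \<Sum>i\<in>I. \<Sum>j\<in>I. (k j \<zeta> * cinner (d j) e) * (cnj (k i \<zeta> * cinner (d i) e) * cinner (blinfun_apply (Fe e) (v j)) (a i)))"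
          by (rule sum.swap)
        also have "\<dots> = (\<Sum>e\<in>E. cinner (blinfun_apply (Fe e) (Y e)) (Z e))"
        proof (intro sum.cong refl)
          fix e assume "e \<in> E"
          have FY: "blinfun_apply (Fe e) (Y e) = (\<Sum>j\<in>I. (k j \<zeta> * cinner (d j) e) *\<^sub>C blinfun_apply (Fe e) (v j))"
            by (simp add: Y_def blinfun.sum_right blinfun_cbounded_scaleC[OF Fe1(2)[OF \<open>e \<in> E\<close>]])
          show "(\<Sum>i\<in>I. \<Sum>j\<in>I. (k j \<zeta> * cinner (d j) e) * (cnj (k i \<zeta> * cinner (d i) e) * cinner (blinfun_apply (Fe e) (v j)) (a i)))
              = cinner (blinfun_apply (Fe e) (Y e)) (Z e)"
            unfolding FY Z_def cinner_sum_left cinner_sum_right cinner_scaleC_left cinner_scaleC_right sum_distrib_left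
            by (intro sum.cong refl mult.left_commute)
        qed
        finally show ?thesis .
      qed
      \<comment> \<open>2 Re <F Y, Z> <= |Y|^2 + |Z|^2 for a contraction F.\<close>
      have "Re S \<le> (\<Sum>e\<in>E. ((norm (Y e))\<^sup>2 + (norm (Z e))\<^sup>2) / 2)"
        unfolding SYZ Re_sum
      proof (rule sum_mono)
        fix e assume e: "e \<in> E"
        have "norm (blinfun_apply (Fe e) (Y e)) \<le> 1 * norm (Y e)"
          by (rule order_trans[OF norm_blinfun mult_right_mono]) (use Fe1[OF e] in auto)
        then have "(norm (blinfun_apply (Fe e) (Y e)))\<^sup>2 \<le> (norm (Y e))\<^sup>2" by (simp add: power_mono)
        then show "Re (cinner (blinfun_apply (Fe e) (Y e)) (Z e)) \<le> ((norm (Y e))\<^sup>2 + (norm (Z e))\<^sup>2) / 2"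
          by (intro order_trans[OF Re_le_half_sum_squares] divide_right_mono add_right_mono) auto
      qed
      also have "\<dots> = Re (\<Sum>i\<in>I. \<Sum>j\<in>I. (k j \<zeta> * (cinner (d j) (d i) * w i j)) * cnj (k i \<zeta>)) / 2"
      proof -
        have "complex_of_real (\<Sum>e\<in>E. (norm (Y e))\<^sup>2 + (norm (Z e))\<^sup>2)
          = (\<Sum>e\<in>E. \<Sum>i\<in>I. \<Sum>j\<in>I. cnj (k i \<zeta> * cinner (d i) e) * (k j \<zeta> * cinner (d j) e) * w i j)"
          unfolding of_real_sum of_real_add Y_def Z_def norm_sum_scaleC_sq[symmetric] sum.distrib[symmetric] w_def
          by (intro sum.cong refl) (simp add: algebra_simps)
        also have "\<dots> = (\<Sum>i\<in>I. \<Sum>e\<in>E. \<Sum>j\<in>I. cnj (k i \<zeta> * cinner (d i) e) * (k j \<zeta> * cinner (d j) e) * w i j)"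
          by (rule sum.swap)
        also have "\<dots> = (\<Sum>i\<in>I. \<Sum>j\<in>I. \<Sum>e\<in>E. cnj (k i \<zeta> * cinner (d i) e) * (k j \<zeta> * cinner (d j) e) * w i j)"
          by (intro sum.cong refl sum.swap)
        also have "\<dots> = (\<Sum>i\<in>I. \<Sum>j\<in>I. (k j \<zeta> * (cinner (d j) (d i) * w i j)) * cnj (k i \<zeta>))"
        proof (intro sum.cong refl)
          fix i j assume ij: "i \<in> I" "j \<in> I"
          have "cinner (d j) (d i) = (\<Sum>e\<in>E. cinner (d j) e * cinner e (d i))" using Ep[OF ij, of 0] by simp
          then show "(\<Sum>e\<in>E. cnj (k i \<zeta> * cinner (d i) e) * (k j \<zeta> * cinner (d j) e) * w i j) = (k j \<zeta> * (cinner (d j) (d i) * w i j)) * cnj (k i \<zeta>)"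
            by (simp add: sum_distrib_left sum_distrib_right mult_ac flip: cinner_commute)
        qed
        finally have "(\<Sum>e\<in>E. (norm (Y e))\<^sup>2 + (norm (Z e))\<^sup>2) = Re (\<Sum>i\<in>I. \<Sum>j\<in>I. (k j \<zeta> * (cinner (d j) (d i) * w i j)) * cnj (k i \<zeta>))"
          by (metis Re_complex_of_real)
        then show ?thesis by (simp only: sum_divide_distrib[symmetric])
      qed
      finally have "Re S \<le> Re (\<Sum>i\<in>I. \<Sum>j\<in>I. (k j \<zeta> * (cinner (d j) (d i) * w i j)) * cnj (k i \<zeta>)) / 2" .
      moreover have "Re ((\<Sum>i\<in>I. \<Sum>j\<in>I. (k j \<zeta> * Q i j \<zeta>) * cnj (k i \<zeta>)) - S) \<le> \<epsilon> * K"
        by (rule order_trans[OF complex_Re_le_cmod err])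
      ultimately show ?thesis unfolding minus_complex.sel by linarith
    qed
    have kp: "k j (p i) * ((1 - p i * cnj (p j)) * \<kappa> i j) = \<kappa> i j" if "i \<in> I" "j \<in> I" for i j
      using den[OF that(2), of "p i"] p1[OF that(1)] by (simp add: k_def mult.commute)
    have i1: "(\<Sum>i\<in>I. \<Sum>j\<in>I. k j (p i) * Q i j (p i)) = (\<Sum>i\<in>I. \<Sum>j\<in>I. \<kappa> i j * q i j (s i) (p i))"
    proof (intro sum.cong refl)
      fix i j assume ij: "i \<in> I" "j \<in> I"
      show "k j (p i) * Q i j (p i) = \<kappa> i j * q i j (s i) (p i)"
        unfolding Qval[OF ij] using kp[OF ij] by (metis mult.commute mult.left_commute)
    qed
    have i2: "(\<Sum>i\<in>I. \<Sum>j\<in>I. k j (p i) * (cinner (d j) (d i) * w i j)) = (\<Sum>i\<in>I. \<Sum>j\<in>I. \<kappa> i j * w i j)"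
    proof (intro sum.cong refl)
      fix i j assume ij: "i \<in> I" "j \<in> I"
      show "k j (p i) * (cinner (d j) (d i) * w i j) = \<kappa> i j * w i j"
        unfolding D[OF ij] using kp[OF ij] by (metis mult.assoc)
    qed
    \<comment> \<open>Integrating \<open>pw\<close> over the circle returns the values at the points
      p i on both sides.\<close>
    have "Re (\<Sum>i\<in>I. \<Sum>j\<in>I. \<kappa> i j * q i j (s i) (p i)) \<le> ?R + \<epsilon> * K"
    proof (rule has_integral_le)
      show "((\<lambda>t. Re (\<Sum>i\<in>I. \<Sum>j\<in>I. (k j (circ t) * Q i j (circ t)) * cnj (k i (circ t)))) has_integral
          Re (\<Sum>i\<in>I. \<Sum>j\<in>I. \<kappa> i j * q i j (s i) (p i))) {0..1}"
        using has_integral_linear[OF int1 bounded_linear_Re] by (simp only: i1 o_def)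
      have "((\<lambda>t. Re (\<Sum>i\<in>I. \<Sum>j\<in>I. (k j (circ t) * (cinner (d j) (d i) * w i j)) * cnj (k i (circ t)))) has_integral
          Re (\<Sum>i\<in>I. \<Sum>j\<in>I. \<kappa> i j * w i j)) {0..1}"
        using has_integral_linear[OF int2 bounded_linear_Re] by (simp only: i2 o_def)
      from has_integral_add[OF has_integral_divide[OF this, of 2] has_integral_const_real[of "\<epsilon> * K" 0 1]]
      show "((\<lambda>t. Re (\<Sum>i\<in>I. \<Sum>j\<in>I. (k j (circ t) * (cinner (d j) (d i) * w i j)) * cnj (k i (circ t))) / 2 + \<epsilon> * K)
          has_integral ?R + \<epsilon> * K) {0..1}" by simp
      show "Re (\<Sum>i\<in>I. \<Sum>j\<in>I. (k j (circ t) * Q i j (circ t)) * cnj (k i (circ t)))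
        \<le> Re (\<Sum>i\<in>I. \<Sum>j\<in>I. (k j (circ t) * (cinner (d j) (d i) * w i j)) * cnj (k i (circ t))) / 2 + \<epsilon> * K" for t
        by (rule pw) simp
    qed
    moreover have "Re ((\<Sum>i\<in>I. \<Sum>j\<in>I. \<kappa> i j * cinner (blinfun_apply (FF (s i) (p i)) (v j)) (a i)) - (\<Sum>i\<in>I. \<Sum>j\<in>I. \<kappa> i j * q i j (s i) (p i))) \<le> \<epsilon> * K'"
    proof (rule order_trans[OF complex_Re_le_cmod])
      have "(\<Sum>i\<in>I. \<Sum>j\<in>I. \<kappa> i j * cinner (blinfun_apply (FF (s i) (p i)) (v j)) (a i)) - (\<Sum>i\<in>I. \<Sum>j\<in>I. \<kappa> i j * q i j (s i) (p i))
        = (\<Sum>i\<in>I. \<Sum>j\<in>I. \<kappa> i j * (cinner (blinfun_apply (FF (s i) (p i)) (v j)) (a i) - q i j (s i) (p i)))"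
        by (simp add: sum_subtractf right_diff_distrib)
      also have "cmod \<dots> \<le> (\<Sum>i\<in>I. \<Sum>j\<in>I. cmod (\<kappa> i j) * \<epsilon>)"
      proof (intro sum_norm_le)
        fix i j assume ij: "i \<in> I" "j \<in> I"
        obtain l1 l2 where l: "s i = l1 + l2" "p i = l1 * l2" "cmod l1 < 1" "cmod l2 < 1"
          using G[OF ij(1)] by (auto simp: G2_def)
        have "cmod (cinner (blinfun_apply (FF (s i) (p i)) (v j)) (a i) - q i j (s i) (p i)) \<le> \<epsilon>"
          using approx[of l1 l2 j i] l unfolding q_def by simp
        then show "cmod (\<kappa> i j * (cinner (blinfun_apply (FF (s i) (p i)) (v j)) (a i) - q i j (s i) (p i))) \<le> cmod (\<kappa> i j) * \<epsilon>"
          by (simp only: norm_mult) (intro mult_left_mono norm_ge_zero)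
      qed
      also have "\<dots> = \<epsilon> * K'" by (simp add: K'_def sum_distrib_left mult.commute)
      finally show "cmod ((\<Sum>i\<in>I. \<Sum>j\<in>I. \<kappa> i j * cinner (blinfun_apply (FF (s i) (p i)) (v j)) (a i)) - (\<Sum>i\<in>I. \<Sum>j\<in>I. \<kappa> i j * q i j (s i) (p i))) \<le> \<epsilon> * K'" .
    qed
    ultimately show ?thesis unfolding minus_complex.sel distrib_left by linarith
  qed
  have "0 \<le> K" unfolding K_def using p1 by (intro sum_nonneg mult_nonneg_nonneg) (auto simp: less_imp_le)
  moreover have "0 \<le> K'" unfolding K'_def by (intro sum_nonneg) simp
  ultimately have KK: "0 \<le> K + K'" by simp
  have "?L \<le> ?R"
  proof (rule field_le_epsilon)
    fix e :: real assume "e > 0"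
    then have "?L \<le> ?R + e / (K + K' + 1) * (K + K')" using KK by (intro main) auto
    also have "e / (K + K' + 1) * (K + K') \<le> e"
      using KK \<open>e > 0\<close> by (simp add: field_simps)
    finally show "?L \<le> ?R + e" by simp
  qed
  then show ?thesis by (simp only: FF_def w_def)
qed

end

lemma complex_nonneg_limit:
  fixes f :: "nat \<Rightarrow> complex"
  assumes "f \<longlonglongrightarrow> L" "\<And>n. 0 \<le> f n"
  shows "0 \<le> L"
proof -
  have "0 \<le> Re L" by (rule LIMSEQ_le_const[OF tendsto_Re[OF assms(1)]]) (use assms(2) in \<open>auto simp: less_eq_complex_def\<close>)
  moreover have "Im (f n) = 0" for n using assms(2)[of n] by (simp add: less_eq_complex_def)
  then have "Im L = 0" using tendsto_Im[OF assms(1)] by (simp add: LIMSEQ_const_iff)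
  ultimately show ?thesis by (simp add: less_eq_complex_def)
qed

lemma holomorphic_on_C2_cinner:
  fixes F :: "complex \<times> complex \<Rightarrow> ('c::chilbert_space \<Rightarrow>\<^sub>L 'a::chilbert_space)"
  assumes "holomorphic_on_C2 F S"
  shows "holomorphic_on_C2 (\<lambda>z. cinner (blinfun_apply (F z) u) w) S"
  unfolding holomorphic_on_C2_def
proof
  fix z assume "z \<in> S"
  then obtain D where D: "(F has_derivative D) (at z)" "\<And>c h. D (c *\<^sub>C h) = c *\<^sub>C D h"
    using assms unfolding holomorphic_on_C2_def by blast
  have "bounded_linear (\<lambda>T. cinner (blinfun_apply T u) w)"
    by (rule bounded_linear_compose[OF bounded_linear_cinner_left blinfun.bounded_linear_left])
  from bounded_linear.has_derivative[OF this D(1)]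
  show "\<exists>D. ((\<lambda>z. cinner (blinfun_apply (F z) u) w) has_derivative D) (at z) \<and> (\<forall>c h. D (c *\<^sub>C h) = c *\<^sub>C D h)"
    by (intro exI[of _ "\<lambda>h. cinner (blinfun_apply (D h) u) w"])
      (simp add: D(2) scaleC_blinfun.rep_eq cinner_scaleC_left)
qed

text \<open>Let v i be the adjoint of F at point i applied to a i. After r has tended to 1, the
  mixed sum equals V, the sum of \<kappa> i j <v j, v i>, and the dilated inequality reads 2 V <= V
  + A with A the same sum for a.\<close>

lemma von_Neumann:
  fixes F :: "complex \<times> complex \<Rightarrow> ('c::chilbert_space \<Rightarrow>\<^sub>L 'a::chilbert_space)"
    and s p :: "'i \<Rightarrow> complex" and \<kappa> :: "'i \<Rightarrow> 'i \<Rightarrow> complex"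
  assumes hol: "holomorphic_on_C2 F G2" and cB: "\<And>z. z \<in> G2 \<Longrightarrow> F z \<in> \<B>"
    and contr: "\<And>z. z \<in> G2 \<Longrightarrow> norm (F z) \<le> 1"
    and I: "finite I" and G: "\<And>i. i \<in> I \<Longrightarrow> (s i, p i) \<in> G2" and \<kappa>: "pos_on I \<kappa>"
    and pos: "\<And>\<alpha>. cmod \<alpha> = 1 \<Longrightarrow>
      pos_on I (\<lambda>i j. (1 - Phi \<alpha> (s i, p i) * cnj (Phi \<alpha> (s j, p j))) * \<kappa> i j)"
  shows "0 \<le> (\<Sum>i\<in>I. \<Sum>j\<in>I. (cinner (a j) (a i) - cinner (blinfun_apply ((F (s j, p j))\<^sup>\<star>) (a j)) (blinfun_apply ((F (s i, p i))\<^sup>\<star>) (a i))) * \<kappa> i j)"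
proof -
  define v where "v i = blinfun_apply ((F (s i, p i))\<^sup>\<star>) (a i)" for i
  define r where "r n = 1 - 1 / real (Suc (Suc n))" for n
  have r: "0 < r n" "r n < 1" for n by (simp_all add: r_def field_simps)
  have "(\<lambda>n. 1 - 1 / real (Suc (Suc n))) \<longlonglongrightarrow> 1 - 0"
    by (intro tendsto_intros LIMSEQ_Suc lim_1_over_n)
  then have "r \<longlonglongrightarrow> 1" unfolding r_def by simp
  then have rl: "(\<lambda>n. complex_of_real (r n)) \<longlonglongrightarrow> 1" using tendsto_of_real by fastforce
  have cont: "(\<lambda>n. F (complex_of_real (r n) * s i, (complex_of_real (r n))\<^sup>2 * p i)) \<longlonglongrightarrow> F (s i, p i)" if i: "i \<in> I" for i
  proof -
    obtain D where "(F has_derivative D) (at (s i, p i))" using hol G[OF i] unfolding holomorphic_on_C2_def by blast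
    then have "isCont F (s i, p i)" by (rule has_derivative_continuous)
    moreover have "(\<lambda>n. (complex_of_real (r n) * s i, (complex_of_real (r n))\<^sup>2 * p i)) \<longlonglongrightarrow> (1 * s i, 1\<^sup>2 * p i)"
      by (intro tendsto_intros rl)
    ultimately show ?thesis by (intro isCont_tendsto_compose[of _ F]) auto
  qed
  have dil: "Re (\<Sum>i\<in>I. \<Sum>j\<in>I. \<kappa> i j * cinner (blinfun_apply (F (complex_of_real (r n) * s i, (complex_of_real (r n))\<^sup>2 * p i)) (v j)) (a i))
    \<le> Re (\<Sum>i\<in>I. \<Sum>j\<in>I. \<kappa> i j * (cinner (v j) (v i) + cinner (a j) (a i))) / 2" for n
  proof (rule Gamma_model[OF I G pos])
    fix d :: "'i \<Rightarrow> 'i ell2" and X X'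
    assume m: "\<And>x y. X (x + y) = X x + X y" "\<And>c x. X (c *\<^sub>C x) = c *\<^sub>C X x" "\<And>x. X x \<in> cvec.span (d ` I)"
      "\<And>x y. X' (x + y) = X' x + X' y" "\<And>c x. X' (c *\<^sub>C x) = c *\<^sub>C X' x" "\<And>x. X' x \<in> cvec.span (d ` I)"
      "\<And>i j. i \<in> I \<Longrightarrow> j \<in> I \<Longrightarrow> cinner (d j) (d i) = (1 - p i * cnj (p j)) * \<kappa> i j"
      "\<And>i j. i \<in> I \<Longrightarrow> j \<in> I \<Longrightarrow> cinner (X (d j)) (d i) = (s i - p i * cnj (s j)) * \<kappa> i j"
      "\<And>i j. i \<in> I \<Longrightarrow> j \<in> I \<Longrightarrow> cinner (X' (d j)) (d i) = (cnj (s j) - s i * cnj (p j)) * \<kappa> i j"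
      "\<And>x y. x \<in> cvec.span (d ` I) \<Longrightarrow> y \<in> cvec.span (d ` I) \<Longrightarrow> cinner (X x) y = cinner x (X' y)"
      "\<And>\<alpha> x. cmod \<alpha> = 1 \<Longrightarrow> x \<in> cvec.span (d ` I) \<Longrightarrow> Re (\<alpha> * cinner (X x) x) \<le> (norm x)\<^sup>2"
    show "Re (\<Sum>i\<in>I. \<Sum>j\<in>I. \<kappa> i j * cinner (blinfun_apply (F (complex_of_real (r n) * s i, (complex_of_real (r n))\<^sup>2 * p i)) (v j)) (a i))
      \<le> Re (\<Sum>i\<in>I. \<Sum>j\<in>I. \<kappa> i j * (cinner (v j) (v i) + cinner (a j) (a i))) / 2"
      by (rule von_Neumann_dilated[OF I G m holomorphic_on_C2_cinner[OF hol] cB contr r])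
  qed
  have lim: "(\<lambda>n. Re (\<Sum>i\<in>I. \<Sum>j\<in>I. \<kappa> i j * cinner (blinfun_apply (F (complex_of_real (r n) * s i, (complex_of_real (r n))\<^sup>2 * p i)) (v j)) (a i)))
    \<longlonglongrightarrow> Re (\<Sum>i\<in>I. \<Sum>j\<in>I. \<kappa> i j * cinner (blinfun_apply (F (s i, p i)) (v j)) (a i))"
    by (intro tendsto_Re tendsto_sum tendsto_mult tendsto_const tendsto_cinner blinfun.tendsto cont)
  have "Re (\<Sum>i\<in>I. \<Sum>j\<in>I. \<kappa> i j * cinner (blinfun_apply (F (s i, p i)) (v j)) (a i))
    \<le> Re (\<Sum>i\<in>I. \<Sum>j\<in>I. \<kappa> i j * (cinner (v j) (v i) + cinner (a j) (a i))) / 2"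
    by (rule LIMSEQ_le_const2[OF lim]) (use dil in blast)
  also have "(\<Sum>i\<in>I. \<Sum>j\<in>I. \<kappa> i j * cinner (blinfun_apply (F (s i, p i)) (v j)) (a i)) = (\<Sum>i\<in>I. \<Sum>j\<in>I. \<kappa> i j * cinner (v j) (v i))"
    by (intro sum.cong refl) (simp add: v_def[of "_ :: 'i"] cinner_cadjoint[OF cB[OF G]])
  finally have le: "2 * Re (\<Sum>i\<in>I. \<Sum>j\<in>I. \<kappa> i j * cinner (v j) (v i)) \<le> Re (\<Sum>i\<in>I. \<Sum>j\<in>I. \<kappa> i j * (cinner (v j) (v i) + cinner (a j) (a i)))"
    by simp
  define S where "S = (\<Sum>i\<in>I. \<Sum>j\<in>I. (cinner (a j) (a i) - cinner (v j) (v i)) * \<kappa> i j)"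
  have "Re S = Re (\<Sum>i\<in>I. \<Sum>j\<in>I. \<kappa> i j * (cinner (v j) (v i) + cinner (a j) (a i))) - 2 * Re (\<Sum>i\<in>I. \<Sum>j\<in>I. \<kappa> i j * cinner (v j) (v i))"
  proof -
    have "S = (\<Sum>i\<in>I. \<Sum>j\<in>I. \<kappa> i j * (cinner (v j) (v i) + cinner (a j) (a i))) - 2 * (\<Sum>i\<in>I. \<Sum>j\<in>I. \<kappa> i j * cinner (v j) (v i))"
      unfolding S_def sum_distrib_left sum_subtractf[symmetric] by (intro sum.cong refl) (simp add: algebra_simps)
    then show ?thesis by simp
  qed
  then have "0 \<le> Re S" using le by simp
  \<comment> \<open>The order on complex numbers also demands a vanishing imaginary part, which
    comes from hermitian symmetry.\<close>
  moreover have "cnj S = S"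
  proof -
    have "cnj S = (\<Sum>i\<in>I. \<Sum>j\<in>I. (cinner (a i) (a j) - cinner (v i) (v j)) * \<kappa> j i)"
      unfolding S_def cnj_sum
    proof (intro sum.cong refl)
      fix i j assume "i \<in> I" "j \<in> I"
      then have "\<kappa> j i = cnj (\<kappa> i j)" by (rule pos_on_hermitian[OF \<kappa>])
      then show "cnj ((cinner (a j) (a i) - cinner (v j) (v i)) * \<kappa> i j) = (cinner (a i) (a j) - cinner (v i) (v j)) * \<kappa> j i"
        by (simp flip: cinner_commute)
    qed
    also have "\<dots> = S" unfolding S_def by (rule sum.swap)
    finally show ?thesis .
  qed
  then have "Im S = 0" by (simp add: complex_eq_iff)
  ultimately show ?thesis unfolding S_def v_def less_eq_complex_def by simp
qed

section \<open>From scalar kernels to block operators\<close>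

lemma pos_onI_nat:
  assumes "\<And>n (x :: nat \<Rightarrow> 'x) c. (\<And>i. i < n \<Longrightarrow> x i \<in> S) \<Longrightarrow>
    0 \<le> (\<Sum>i<n. \<Sum>j<n. cnj (c i) * c j * K (x i) (x j))"
  shows "pos_on S K"
  unfolding pos_on_def
proof (intro allI impI, elim conjE)
  fix F :: "'x set" and c assume F: "finite F" "F \<subseteq> S"
  obtain h where h: "bij_betw h {..<card F} F" using ex_bij_betw_nat_finite[OF F(1)] by (auto simp: atLeast0LessThan)
  have hF: "h i \<in> S" if "i < card F" for i using h that F(2) by (auto simp: bij_betw_def)
  have "0 \<le> (\<Sum>i<card F. \<Sum>j<card F. cnj (c (h i)) * c (h j) * K (h i) (h j))"
    by (rule assms) (rule hF)
  also have "\<dots> = (\<Sum>x\<in>F. \<Sum>j<card F. cnj (c x) * c (h j) * K x (h j))"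
    by (rule sum.reindex_bij_betw[OF h])
  also have "\<dots> = (\<Sum>x\<in>F. \<Sum>y\<in>F. cnj (c x) * c y * K x y)"
    by (intro sum.cong refl sum.reindex_bij_betw[OF h])
  finally show "0 \<le> (\<Sum>x\<in>F. \<Sum>y\<in>F. cnj (c x) * c y * K x y)" .
qed

lemma psd_onD:
  assumes "psd_on S k" "\<And>i. i < (n::nat) \<Longrightarrow> z i \<in> S"
  shows "0 \<le> (\<Sum>i<n. \<Sum>j<n. cinner (blinfun_apply (k (z i) (z j)) (v j)) (v i))"
  using assms unfolding psd_on_def by blast

text \<open>The vectors move into the index set; complex linearity of k z w absorbs the scalar
  coefficients into them.\<close>

lemma psd_on_pos_on:
  fixes k :: "'z \<Rightarrow> 'z \<Rightarrow> ('l::chilbert_space \<Rightarrow>\<^sub>L 'l)"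
  assumes k: "psd_on S k" and B: "\<And>z w. z \<in> S \<Longrightarrow> w \<in> S \<Longrightarrow> k z w \<in> \<B>"
  shows "pos_on (S \<times> UNIV) (\<lambda>x y. cinner (blinfun_apply (k (fst x) (fst y)) (snd y)) (snd x))"
proof (rule pos_onI_nat)
  fix n and x :: "nat \<Rightarrow> 'z \<times> 'l" and c assume "\<And>i. i < n \<Longrightarrow> x i \<in> S \<times> UNIV"
  then have x: "fst (x i) \<in> S" if "i < n" for i using that by (auto simp: mem_Times_iff)
  have "0 \<le> (\<Sum>i<n. \<Sum>j<n. cinner (blinfun_apply (k (fst (x i)) (fst (x j))) (c j *\<^sub>C snd (x j))) (c i *\<^sub>C snd (x i)))"
    by (rule psd_onD[OF k x])
  also have "\<dots> = (\<Sum>i<n. \<Sum>j<n. cnj (c i) * c j * cinner (blinfun_apply (k (fst (x i)) (fst (x j))) (snd (x j))) (snd (x i)))"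
    by (intro sum.cong refl) (simp add: blinfun_cbounded_scaleC[OF B] x cinner_scaleC_left cinner_scaleC_right)
  finally show "0 \<le> (\<Sum>i<n. \<Sum>j<n. cnj (c i) * c j * cinner (blinfun_apply (k (fst (x i)) (fst (x j))) (snd (x j))) (snd (x i)))" .
qed

lemma scaleC_in_B: "T \<in> \<B> \<Longrightarrow> c *\<^sub>C T \<in> \<B>"
  by (simp add: cbounded_def scaleC_blinfun.rep_eq scaleC_scaleC mult.commute)

lemma compose_in_B: "S \<in> \<B> \<Longrightarrow> T \<in> \<B> \<Longrightarrow> S o\<^sub>L T \<in> \<B>"
  by (simp add: cbounded_def)

lemma add_in_B: "S \<in> \<B> \<Longrightarrow> T \<in> \<B> \<Longrightarrow> S + T \<in> \<B>"
  by (simp add: cbounded_def blinfun.add_left scaleC_add_right)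

lemma diff_in_B: "S \<in> \<B> \<Longrightarrow> T \<in> \<B> \<Longrightarrow> S - T \<in> \<B>"
  by (simp add: cbounded_def blinfun.diff_left scaleC_diff_right)

lemma cinner_cadjoint': "T \<in> \<B> \<Longrightarrow> cinner (blinfun_apply (T\<^sup>\<star>) y) x = cinner y (blinfun_apply T x)"
  using cinner_cadjoint[of T x y] by (metis cinner_commute)

lemma cinner_defect:
  assumes "A \<in> \<B>" "A' \<in> \<B>" "B \<in> \<B>" "B' \<in> \<B>"
  shows "cinner (blinfun_apply ((A o\<^sub>L A'\<^sup>\<star>) - (B o\<^sub>L B'\<^sup>\<star>)) u') u
    = cinner (blinfun_apply (A'\<^sup>\<star>) u') (blinfun_apply (A\<^sup>\<star>) u) - cinner (blinfun_apply (B'\<^sup>\<star>) u') (blinfun_apply (B\<^sup>\<star>) u)"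
  using assms by (simp add: blinfun.diff_left cinner_diff_left cinner_cadjoint)

text \<open>On finite sums of elementary tensors the block form is the scalar sum of
  \<open>von_Neumann\<close>: the indices are pairs of a point and a summand, \<kappa> comes from k,
  and a is the adjoint of \<open>\<Upsilon>12\<close> applied to the first tensor factor. Density of
  these sums gives the rest.\<close>

lemma factorization_imp_positivity:
  fixes \<Upsilon>12 :: "complex \<times> complex \<Rightarrow> ('l1::chilbert_space \<Rightarrow>\<^sub>L 'l2::chilbert_space)"
    and \<Upsilon>32 :: "complex \<times> complex \<Rightarrow> ('l3::chilbert_space \<Rightarrow>\<^sub>L 'l2)"
    and \<Upsilon>31 :: "complex \<times> complex \<Rightarrow> ('l3 \<Rightarrow>\<^sub>L 'l1)"
    and k :: "complex \<times> complex \<times> complex \<Rightarrow> complex \<times> complex \<times> complex \<Rightarrow> ('m::chilbert_space \<Rightarrow>\<^sub>L 'm)"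
  assumes \<Upsilon>12: "\<forall>z\<in>G2. \<Upsilon>12 z \<in> \<B>" and \<Upsilon>32: "\<forall>z\<in>G2. \<Upsilon>32 z \<in> \<B>"
    and H: "\<Upsilon>31 \<in> Hinf G2" and contr: "\<And>z. z \<in> G2 \<Longrightarrow> norm (\<Upsilon>31 z) \<le> 1"
    and fac: "\<forall>z\<in>G2. \<Upsilon>12 z o\<^sub>L \<Upsilon>31 z = \<Upsilon>32 z"
    and F: "finite F" "F \<subseteq> pentablock" and k: "admissible_kernel k"
  shows "block_psd F (\<lambda>z w.
    ((\<Upsilon>12 (snd z) o\<^sub>L (\<Upsilon>12 (snd w))\<^sup>\<star>) - (\<Upsilon>32 (snd z) o\<^sub>L (\<Upsilon>32 (snd w))\<^sup>\<star>)) \<otimes>\<^sub>o k z w)"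
proof -
  define M where "M z w = (\<Upsilon>12 (snd z) o\<^sub>L (\<Upsilon>12 (snd w))\<^sup>\<star>) - (\<Upsilon>32 (snd z) o\<^sub>L (\<Upsilon>32 (snd w))\<^sup>\<star>)" for z w :: "complex \<times> complex \<times> complex"
  have B31: "\<Upsilon>31 z \<in> \<B>" if "z \<in> G2" for z using H that by (simp add: Hinf_def)
  have hol: "holomorphic_on_C2 \<Upsilon>31 G2" using H by (simp add: Hinf_def)
  have FG: "snd z \<in> G2" if "z \<in> F" for z using F(2) that snd_pentablock by blast
  have kB: "k z w \<in> \<B>" if "z \<in> pentablock" "w \<in> pentablock" for z w
    using k that by (simp add: admissible_kernel_def op_kernel_def weak_kernel_def)
  have MB: "M z w \<in> \<B>" if "z \<in> F" "w \<in> F" for z w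
    unfolding M_def using \<Upsilon>12 \<Upsilon>32 FG that by (intro diff_in_B compose_in_B cadjoint_cbounded) auto
  have adj: "blinfun_apply ((\<Upsilon>32 z)\<^sup>\<star>) u = blinfun_apply ((\<Upsilon>31 z)\<^sup>\<star>) (blinfun_apply ((\<Upsilon>12 z)\<^sup>\<star>) u)" if z: "z \<in> G2" for z u
  proof (rule cinner_eqI)
    fix x
    have "blinfun_apply (\<Upsilon>32 z) x = blinfun_apply (\<Upsilon>12 z) (blinfun_apply (\<Upsilon>31 z) x)"
      using fac z by (metis blinfun_apply_blinfun_compose)
    then show "cinner x (blinfun_apply ((\<Upsilon>32 z)\<^sup>\<star>) u) = cinner x (blinfun_apply ((\<Upsilon>31 z)\<^sup>\<star>) (blinfun_apply ((\<Upsilon>12 z)\<^sup>\<star>) u))"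
      using z \<Upsilon>12 \<Upsilon>32 B31 by (simp flip: cinner_cadjoint)
  qed
  have kpos: "pos_on (pentablock \<times> UNIV) (\<lambda>x y. cinner (blinfun_apply (k (fst x) (fst y)) (snd y)) (snd x))"
    using k kB by (intro psd_on_pos_on) (auto simp: admissible_kernel_def op_kernel_def weak_kernel_def)
  have kpos': "pos_on (pentablock \<times> UNIV) (\<lambda>x y. (1 - Phi \<alpha> (snd (fst x)) * cnj (Phi \<alpha> (snd (fst y)))) * cinner (blinfun_apply (k (fst x) (fst y)) (snd y)) (snd x))"
    if "cmod \<alpha> = 1" for \<alpha>
  proof -
    have "psd_on pentablock (\<lambda>z w. (1 - Phi \<alpha> (snd z) * cnj (Phi \<alpha> (snd w))) *\<^sub>C k z w)"
      using k that by (simp add: admissible_kernel_def)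
    from psd_on_pos_on[OF this scaleC_in_B[OF kB]] show ?thesis
      by (simp add: scaleC_blinfun.rep_eq cinner_scaleC_left)
  qed
  have span_case: "0 \<le> (\<Sum>z\<in>F. \<Sum>w\<in>F. cinner (blinfun_apply (M z w \<otimes>\<^sub>o k z w) (x w)) (x z))"
    if x: "\<And>z. x z \<in> span (range (\<lambda>(u, v). u \<otimes>\<^sub>h v))" for x :: "complex \<times> complex \<times> complex \<Rightarrow> ('l2, 'm) htensor"
  proof -
    \<comment> \<open>The summands are indexed by the tensors themselves, so one index type serves
      all z.\<close>
    have "\<exists>(t :: ('l2, 'm) htensor set) u v. finite t \<and> x z = (\<Sum>q\<in>t. u q \<otimes>\<^sub>h v q)" for z
    proof -
      obtain t r where t: "finite t" "t \<subseteq> range (\<lambda>(u, v). u \<otimes>\<^sub>h v :: ('l2, 'm) htensor)" "x z = (\<Sum>q\<in>t. r q *\<^sub>R q)"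
        using x[of z] unfolding span_explicit by blast
      have "\<exists>uv. q = fst uv \<otimes>\<^sub>h snd uv" if "q \<in> t" for q using t(2) that by fastforce
      then obtain g where g: "\<And>q. q \<in> t \<Longrightarrow> q = fst (g q) \<otimes>\<^sub>h snd (g q)" by metis
      have "x z = (\<Sum>q\<in>t. (complex_of_real (r q) *\<^sub>C fst (g q)) \<otimes>\<^sub>h snd (g q))"
        unfolding t(3) by (intro sum.cong refl) (simp add: otimes_scaleC_left scaleR_scaleC flip: g)
      then show ?thesis using t(1)
        by (intro exI[of _ t] exI[of _ "\<lambda>q. complex_of_real (r q) *\<^sub>C fst (g q)"] exI[of _ "\<lambda>q. snd (g q)"]) simp
    qed
    then obtain t :: "_ \<Rightarrow> ('l2, 'm) htensor set" and u v where t: "\<And>z. finite (t z)" and xt: "\<And>z. x z = (\<Sum>q\<in>t z. u z q \<otimes>\<^sub>h v z q)" by metis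
    define I where "I = Sigma F t"
    have I: "finite I" using F(1) t by (simp add: I_def)
    have sig: "(\<Sum>i\<in>I. g i) = (\<Sum>z\<in>F. \<Sum>q\<in>t z. g (z, q))" for g :: "_ \<Rightarrow> complex"
      unfolding I_def using sum.Sigma[of F t "\<lambda>z q. g (z, q)"] F(1) t by simp
    define \<kappa> where "\<kappa> i j = cinner (blinfun_apply (k (fst i) (fst j)) (v (fst j) (snd j))) (v (fst i) (snd i))" for i j
    define a where "a i = blinfun_apply ((\<Upsilon>12 (snd (fst i)))\<^sup>\<star>) (u (fst i) (snd i))" for i
    have IF: "fst i \<in> F" if "i \<in> I" for i using that by (auto simp: I_def)
    have re: "pos_on I \<kappa>"
      unfolding \<kappa>_def
      using pos_on_reindex[OF kpos, of I "\<lambda>i. (fst i, v (fst i) (snd i))"] IF F(2) by (auto simp: subset_iff)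
    have re': "pos_on I (\<lambda>i j. (1 - Phi \<alpha> (fst (snd (fst i)), snd (snd (fst i))) * cnj (Phi \<alpha> (fst (snd (fst j)), snd (snd (fst j))))) * \<kappa> i j)"
      if "cmod \<alpha> = 1" for \<alpha>
      unfolding \<kappa>_def
      using pos_on_reindex[OF kpos'[OF that], of I "\<lambda>i. (fst i, v (fst i) (snd i))"] IF F(2) by (auto simp: subset_iff)
    have "0 \<le> (\<Sum>i\<in>I. \<Sum>j\<in>I. (cinner (a j) (a i) - cinner (blinfun_apply ((\<Upsilon>31 (fst (snd (fst j)), snd (snd (fst j))))\<^sup>\<star>) (a j))
        (blinfun_apply ((\<Upsilon>31 (fst (snd (fst i)), snd (snd (fst i))))\<^sup>\<star>) (a i))) * \<kappa> i j)"
      by (rule von_Neumann[OF hol B31 contr I _ re re']) (use FG IF in auto)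
    also have "\<dots> = (\<Sum>i\<in>I. \<Sum>j\<in>I. cinner (blinfun_apply (M (fst i) (fst j)) (u (fst j) (snd j))) (u (fst i) (snd i)) * \<kappa> i j)"
    proof (intro sum.cong refl)
      fix i j assume "i \<in> I" "j \<in> I"
      then have G: "snd (fst i) \<in> G2" "snd (fst j) \<in> G2" using IF FG by auto
      then show "(cinner (a j) (a i) - cinner (blinfun_apply ((\<Upsilon>31 (fst (snd (fst j)), snd (snd (fst j))))\<^sup>\<star>) (a j))
        (blinfun_apply ((\<Upsilon>31 (fst (snd (fst i)), snd (snd (fst i))))\<^sup>\<star>) (a i))) * \<kappa> i j
        = cinner (blinfun_apply (M (fst i) (fst j)) (u (fst j) (snd j))) (u (fst i) (snd i)) * \<kappa> i j"
        using \<Upsilon>12 \<Upsilon>32 by (simp add: M_def cinner_defect a_def adj)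
    qed
    also have "\<dots> = (\<Sum>z\<in>F. \<Sum>q\<in>t z. \<Sum>w\<in>F. \<Sum>q'\<in>t w. cinner (blinfun_apply (M z w) (u w q')) (u z q) * cinner (blinfun_apply (k z w) (v w q')) (v z q))"
      by (simp only: sig \<kappa>_def fst_conv snd_conv)
    also have "\<dots> = (\<Sum>z\<in>F. \<Sum>w\<in>F. \<Sum>q\<in>t z. \<Sum>q'\<in>t w. cinner (blinfun_apply (M z w) (u w q')) (u z q) * cinner (blinfun_apply (k z w) (v w q')) (v z q))"
      by (intro sum.cong refl sum.swap)
    also have "\<dots> = (\<Sum>z\<in>F. \<Sum>w\<in>F. cinner (blinfun_apply (M z w \<otimes>\<^sub>o k z w) (x w)) (x z))"
    proof (intro sum.cong refl)
      fix z w assume zw: "z \<in> F" "w \<in> F"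
      have "M z w \<in> \<B>" by (rule MB[OF zw])
      moreover have "k z w \<in> \<B>" by (rule kB) (use zw F(2) in blast)+
      ultimately show "(\<Sum>q\<in>t z. \<Sum>q'\<in>t w. cinner (blinfun_apply (M z w) (u w q')) (u z q) * cinner (blinfun_apply (k z w) (v w q')) (v z q))
        = cinner (blinfun_apply (M z w \<otimes>\<^sub>o k z w) (x w)) (x z)"
        by (simp add: xt blinfun.sum_right op_tensor_otimes cinner_sum_left cinner_sum_right cinner_otimes)
    qed
    finally show ?thesis .
  qed
  show ?thesis
    unfolding block_psd_def M_def[symmetric]
  proof
    fix x :: "complex \<times> complex \<times> complex \<Rightarrow> ('l2, 'm) htensor"
    have "\<exists>X. (\<forall>n. X n \<in> span (range (\<lambda>(u, v). u \<otimes>\<^sub>h v))) \<and> X \<longlonglongrightarrow> x z" for z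
      using closure_span_otimes closure_sequential by (metis UNIV_I)
    then obtain X :: "complex \<times> complex \<times> complex \<Rightarrow> nat \<Rightarrow> ('l2, 'm) htensor" where X: "\<And>z n. X z n \<in> span (range (\<lambda>(u, v). u \<otimes>\<^sub>h v))" "\<And>z. X z \<longlonglongrightarrow> x z" by metis
    have "(\<lambda>n. \<Sum>z\<in>F. \<Sum>w\<in>F. cinner (blinfun_apply (M z w \<otimes>\<^sub>o k z w) (X w n)) (X z n))
      \<longlonglongrightarrow> (\<Sum>z\<in>F. \<Sum>w\<in>F. cinner (blinfun_apply (M z w \<otimes>\<^sub>o k z w) (x w)) (x z))"
      by (intro tendsto_sum tendsto_cinner blinfun.tendsto tendsto_const X(2))
    then show "0 \<le> (\<Sum>z\<in>F. \<Sum>w\<in>F. cinner (blinfun_apply (M z w \<otimes>\<^sub>o k z w) (x w)) (x z))"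
      by (rule complex_nonneg_limit) (rule span_case, rule X(1))
  qed
qed

section \<open>Inverses of operators and transfer functions\<close>

text \<open>R c is the fixed point of the contraction y -> c + X y; uniqueness of the fixed point
  gives linearity.\<close>

lemma neumann_inverse:
  fixes X :: "'h::chilbert_space \<Rightarrow>\<^sub>L 'h"
  assumes X: "norm X < 1" and B: "X \<in> \<B>"
  obtains R where "R \<in> \<B>" "R o\<^sub>L (id_blinfun - X) = id_blinfun" "(id_blinfun - X) o\<^sub>L R = id_blinfun"
proof -
  have "\<exists>!y. c + blinfun_apply X y = y" for c
  proof (rule banach_fix_type)
    show "0 \<le> norm X" "norm X < 1" using X by auto
    show "\<forall>x y. dist (c + blinfun_apply X x) (c + blinfun_apply X y) \<le> norm X * dist x y"
      by (simp add: dist_norm norm_blinfun flip: blinfun.diff_right)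
  qed
  then obtain r where r: "\<And>c. c + blinfun_apply X (r c) = r c" and u: "\<And>c y. c + blinfun_apply X y = y \<Longrightarrow> y = r c"
    by metis
  have lin: "r (x + y) = r x + r y" "r (a *\<^sub>C x) = a *\<^sub>C r x" for x y a
  proof -
    have "(x + y) + blinfun_apply X (r x + r y) = (x + blinfun_apply X (r x)) + (y + blinfun_apply X (r y))"
      by (simp add: blinfun.add_right algebra_simps)
    then show "r (x + y) = r x + r y" unfolding r by (rule u[symmetric])
    have "a *\<^sub>C x + blinfun_apply X (a *\<^sub>C r x) = a *\<^sub>C (x + blinfun_apply X (r x))"
      by (simp add: blinfun_cbounded_scaleC[OF B] scaleC_add_right)
    then show "r (a *\<^sub>C x) = a *\<^sub>C r x" unfolding r by (rule u[symmetric])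
  qed
  have bd: "norm (r x) \<le> norm x * (1 / (1 - norm X))" for x
  proof -
    have "norm (r x) \<le> norm x + norm X * norm (r x)"
      using norm_triangle_ineq[of x "blinfun_apply X (r x)"] norm_blinfun[of X "r x"] unfolding r by linarith
    then have "norm (r x) * (1 - norm X) \<le> norm x" by (simp add: algebra_simps)
    then show ?thesis using X by (simp add: field_simps)
  qed
  have bl: "bounded_linear r"
    by (rule bounded_linear_intro[OF _ _ bd]) (simp_all add: lin scaleR_scaleC)
  show ?thesis
  proof (rule that[of "Blinfun r"])
    show "Blinfun r \<in> \<B>" by (simp add: cbounded_def bounded_linear_Blinfun_apply[OF bl] lin)
    show "Blinfun r o\<^sub>L (id_blinfun - X) = id_blinfun"
    proof (rule blinfun_eqI)
      fix y
      have "(y - blinfun_apply X y) + blinfun_apply X y = y" by simp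
      from u[OF this] show "blinfun_apply (Blinfun r o\<^sub>L (id_blinfun - X)) y = blinfun_apply id_blinfun y"
        by (simp add: bounded_linear_Blinfun_apply[OF bl] blinfun.diff_left)
    qed
    show "(id_blinfun - X) o\<^sub>L Blinfun r = id_blinfun"
    proof (rule blinfun_eqI)
      fix y
      have "r y - blinfun_apply X (r y) = y" using r[of y] by (metis add_diff_cancel_right')
      then show "blinfun_apply ((id_blinfun - X) o\<^sub>L Blinfun r) y = blinfun_apply id_blinfun y"
        by (simp add: bounded_linear_Blinfun_apply[OF bl] blinfun.diff_left)
    qed
  qed
qed

definition is_inv :: "('h::chilbert_space \<Rightarrow>\<^sub>L 'h) \<Rightarrow> ('h \<Rightarrow>\<^sub>L 'h) \<Rightarrow> bool"
  where "is_inv L R \<longleftrightarrow> R \<in> \<B> \<and> R o\<^sub>L L = id_blinfun \<and> L o\<^sub>L R = id_blinfun"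

text \<open>A total function, so that inversion can be differentiated; at operators without inverse
  the value is arbitrary, and elsewhere a two-sided inverse is unique.\<close>

definition op_inv :: "('h::chilbert_space \<Rightarrow>\<^sub>L 'h) \<Rightarrow> ('h \<Rightarrow>\<^sub>L 'h)"
  where "op_inv L = (SOME R. is_inv L R)"

lemma is_inv_op_inv: "is_inv L R \<Longrightarrow> is_inv L (op_inv L)"
  unfolding op_inv_def by (rule someI)

lemma blinfun_compose_assoc: "(A o\<^sub>L B) o\<^sub>L C = A o\<^sub>L (B o\<^sub>L C)"
  by (rule blinfun_eqI) simp

lemma blinfun_compose_id [simp]: "id_blinfun o\<^sub>L A = A" "A o\<^sub>L id_blinfun = A"
  by (rule blinfun_eqI, simp)+

lemma is_inv_compose: "is_inv L R \<Longrightarrow> is_inv L' R' \<Longrightarrow> is_inv (L o\<^sub>L L') (R' o\<^sub>L R)"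
proof -
  assume a: "is_inv L R" "is_inv L' R'"
  have "R o\<^sub>L (L o\<^sub>L L') = L'" "L' o\<^sub>L (R' o\<^sub>L R) = R"
    using a unfolding is_inv_def blinfun_compose_assoc[symmetric] by simp_all
  then show "is_inv (L o\<^sub>L L') (R' o\<^sub>L R)"
    using a unfolding is_inv_def by (simp add: compose_in_B blinfun_compose_assoc)
qed

lemma bcompose_diff_left: "(A - B) o\<^sub>L C = (A o\<^sub>L C) - (B o\<^sub>L C)"
  by (rule bounded_bilinear.diff_left[OF bounded_bilinear_blinfun_compose])

lemma bcompose_diff_right: "A o\<^sub>L (B - C) = (A o\<^sub>L B) - (A o\<^sub>L C)"
  by (rule bounded_bilinear.diff_right[OF bounded_bilinear_blinfun_compose])

text \<open>L' = L (1 - R (L - L')), and the second factor is invertible by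
  \<open>neumann_inverse\<close>.\<close>

lemma is_inv_perturb:
  assumes LR: "is_inv L R" and L': "L' \<in> \<B>" "L \<in> \<B>" and small: "norm R * norm (L - L') < 1"
  shows "\<exists>R'. is_inv L' R'"
proof -
  let ?X = "R o\<^sub>L (L - L')"
  have RB: "R \<in> \<B>" "R o\<^sub>L L = id_blinfun" "L o\<^sub>L R = id_blinfun" using LR by (auto simp: is_inv_def)
  have "norm ?X < 1" using norm_blinfun_compose[of R "L - L'"] small by linarith
  moreover have "?X \<in> \<B>" using RB L' by (intro compose_in_B diff_in_B)
  ultimately obtain S where S: "S \<in> \<B>" "S o\<^sub>L (id_blinfun - ?X) = id_blinfun" "(id_blinfun - ?X) o\<^sub>L S = id_blinfun"
    by (rule neumann_inverse)
  have "L' = L o\<^sub>L (id_blinfun - ?X)"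
    by (simp add: bcompose_diff_right RB flip: blinfun_compose_assoc)
  moreover have "is_inv (id_blinfun - ?X) S" using S by (simp add: is_inv_def)
  ultimately show ?thesis using is_inv_compose[OF LR] by metis
qed

text \<open>Invertibility near \<open>z0\<close> comes from the Neumann series.\<close>

lemma op_inv_has_derivative:
  fixes f' :: "'z::real_normed_vector \<Rightarrow> ('h::chilbert_space \<Rightarrow>\<^sub>L 'h)"
  assumes f': "bounded_linear f'" and f: "\<And>z. f z = f0 + f' z" and B: "\<And>z. f z \<in> \<B>"
    and R: "is_inv (f z0) (op_inv (f z0))"
  shows "((\<lambda>z. op_inv (f z)) has_derivative (\<lambda>h. - (op_inv (f z0) o\<^sub>L f' h o\<^sub>L op_inv (f z0)))) (at z0)"
proof -
  let ?R = "op_inv (f z0)"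
  obtain K where K: "0 < K" "\<And>h. norm (f' h) \<le> norm h * K" using bounded_linear.pos_bounded[OF f'] by blast
  define r where "r = norm ?R + 1"
  have r: "1 \<le> r" "norm ?R \<le> r" by (auto simp: r_def)
  \<comment> \<open>Within this radius r |f' (z - z0)| <= 1/2, which yields invertibility and the
    bound 2 r for the inverse.\<close>
  define \<delta> where "\<delta> = 1 / (2 * r * K)"
  have \<delta>: "0 < \<delta>" using K r by (simp add: \<delta>_def)
  have dif: "f z - f z0 = f' (z - z0)" for z by (simp add: f linear_diff[OF bounded_linear.linear[OF f']])
  have est: "norm ((op_inv (f z) - ?R) - (- (?R o\<^sub>L f' (z - z0) o\<^sub>L ?R))) \<le> 2 * r ^ 3 * K\<^sup>2 * (norm (z - z0))\<^sup>2"
    if z: "norm (z - z0) < \<delta>" for z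
  proof -
    let ?D = "f' (z - z0)" and ?g = "op_inv (f z)"
    have nD: "norm ?D \<le> K * norm (z - z0)" using K(2)[of "z - z0"] by (simp add: mult.commute)
    have rD: "r * norm ?D \<le> 1/2"
    proof -
      have "r * norm ?D \<le> r * (K * \<delta>)"
        using r nD z K by (intro mult_left_mono order_trans[OF nD]) auto
      then show ?thesis using K r by (simp add: \<delta>_def)
    qed
    have "norm ?R * norm (f z0 - f z) \<le> r * norm ?D"
      using r by (simp add: dif[symmetric] norm_minus_commute mult_right_mono)
    then have "\<exists>R'. is_inv (f z) R'" using rD by (intro is_inv_perturb[OF R B B]) simp
    then have g: "is_inv (f z) ?g" using is_inv_op_inv by blast
    \<comment> \<open>The resolvent identity for the two inverses.\<close>
    have key: "?g - ?R = - (?g o\<^sub>L ?D o\<^sub>L ?R)"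
    proof -
      have "?g o\<^sub>L ?D o\<^sub>L ?R = (?g o\<^sub>L f z o\<^sub>L ?R) - (?g o\<^sub>L (f z0 o\<^sub>L ?R))"
        by (simp add: dif[symmetric] bcompose_diff_left bcompose_diff_right blinfun_compose_assoc)
      also have "\<dots> = ?R - ?g" using g R by (simp add: is_inv_def)
      finally show ?thesis by simp
    qed
    have ng: "norm ?g \<le> 2 * r"
    proof -
      have "?g = ?R - (?g o\<^sub>L ?D o\<^sub>L ?R)" using key by (simp add: algebra_simps)
      then have "norm ?g \<le> norm ?R + norm (?g o\<^sub>L ?D o\<^sub>L ?R)" by (metis norm_triangle_ineq4)
      also have "norm (?g o\<^sub>L ?D o\<^sub>L ?R) \<le> norm ?g * norm ?D * norm ?R"
        by (rule order_trans[OF norm_blinfun_compose mult_right_mono[OF norm_blinfun_compose]]) simp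
      also have "\<dots> \<le> norm ?g * (r * norm ?D)"
      proof -
        have "norm ?g * norm ?D * norm ?R \<le> norm ?g * norm ?D * r" using r by (intro mult_left_mono) auto
        then show ?thesis by (simp only: mult_ac)
      qed
      also have "\<dots> \<le> norm ?g * (1/2)" using rD by (intro mult_left_mono) auto
      finally show ?thesis using r by simp
    qed
    \<comment> \<open>The resolvent identity used twice: the remainder contains the increment two
      times, so it is of second order.\<close>
    have "(?g - ?R) - (- (?R o\<^sub>L ?D o\<^sub>L ?R)) = - ((?g - ?R) o\<^sub>L ?D o\<^sub>L ?R)"
    proof -
      have "(?g - ?R) + (?R o\<^sub>L ?D o\<^sub>L ?R) = - (?g o\<^sub>L ?D o\<^sub>L ?R) + (?R o\<^sub>L ?D o\<^sub>L ?R)"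
        by (simp only: key)
      then show ?thesis by (simp only: bcompose_diff_left minus_diff_eq diff_minus_eq_add) simp
    qed
    also have "\<dots> = (?g o\<^sub>L ?D o\<^sub>L ?R) o\<^sub>L ?D o\<^sub>L ?R"
      unfolding key using bcompose_diff_left[of 0 "?g o\<^sub>L ?D o\<^sub>L ?R"]
      by (simp add: bounded_bilinear.minus_left[OF bounded_bilinear_blinfun_compose])
    also have "norm \<dots> \<le> norm ?g * norm ?D * norm ?R * norm ?D * norm ?R"
      by (intro order_trans[OF norm_blinfun_compose] mult_right_mono norm_ge_zero order_refl norm_blinfun_compose)
    also have "\<dots> \<le> (2 * r) * (K * norm (z - z0)) * r * (K * norm (z - z0)) * r"
      using r nD ng K by (intro mult_mono mult_nonneg_nonneg) auto
    also have "\<dots> = 2 * r ^ 3 * K\<^sup>2 * (norm (z - z0))\<^sup>2"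
      by (simp add: power2_eq_square power3_eq_cube mult_ac)
    finally show ?thesis .
  qed
  show ?thesis
    unfolding has_derivative_iff_norm
  proof (intro conjI)
    show "bounded_linear (\<lambda>h. - (?R o\<^sub>L f' h o\<^sub>L ?R))"
      by (intro bounded_linear_minus bounded_linear_compose[OF bounded_bilinear.bounded_linear_left[OF bounded_bilinear_blinfun_compose]]
          bounded_linear_compose[OF bounded_bilinear.bounded_linear_right[OF bounded_bilinear_blinfun_compose]] f')
    have "((\<lambda>z. 2 * r ^ 3 * K\<^sup>2 * norm (z - z0)) \<longlongrightarrow> 2 * r ^ 3 * K\<^sup>2 * norm (z0 - z0)) (at z0)"
      by (intro tendsto_intros)
    then have lim: "((\<lambda>z. 2 * r ^ 3 * K\<^sup>2 * norm (z - z0)) \<longlongrightarrow> 0) (at z0)" by simp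
    show "((\<lambda>z. norm (op_inv (f z) - ?R - - (?R o\<^sub>L f' (z - z0) o\<^sub>L ?R)) / norm (z - z0)) \<longlongrightarrow> 0) (at z0)"
    proof (rule Lim_null_comparison[OF _ lim])
      show "\<forall>\<^sub>F z in at z0. norm (norm (op_inv (f z) - ?R - - (?R o\<^sub>L f' (z - z0) o\<^sub>L ?R)) / norm (z - z0)) \<le> 2 * r ^ 3 * K\<^sup>2 * norm (z - z0)"
        unfolding eventually_at
      proof (intro exI[of _ \<delta>] conjI ballI impI \<delta>)
        fix z assume "z \<noteq> z0 \<and> dist z z0 < \<delta>"
        then have "z \<noteq> z0" "norm (z - z0) < \<delta>" by (auto simp: dist_norm)
        then have "norm (op_inv (f z) - ?R - - (?R o\<^sub>L f' (z - z0) o\<^sub>L ?R)) / norm (z - z0) \<le> 2 * r ^ 3 * K\<^sup>2 * (norm (z - z0))\<^sup>2 / norm (z - z0)"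
          by (intro divide_right_mono est) auto
        then show "norm (norm (op_inv (f z) - ?R - - (?R o\<^sub>L f' (z - z0) o\<^sub>L ?R)) / norm (z - z0)) \<le> 2 * r ^ 3 * K\<^sup>2 * norm (z - z0)"
          using \<open>z \<noteq> z0\<close> by (simp add: power2_eq_square)
      qed
    qed
  qed
qed

text \<open>The solution is the transfer function \<open>W11 + W12 N (M - W22 N)\<^sup>-\<^sup>1 W21\<close> with \<open>M = 2 - s T\<close> and
  \<open>N = 2 p T - s\<close>, that is, the realization formula with \<open>\<Phi>\<close> written as the quotient \<open>N / M\<close>.\<close>

lemma realization:
  fixes s p :: "'x \<Rightarrow> complex" and a :: "'x \<Rightarrow> 'a::chilbert_space" and b :: "'x \<Rightarrow> 'c::chilbert_space"
    and e f :: "'x \<Rightarrow> 'h::chilbert_space" and T :: "'h \<Rightarrow>\<^sub>L 'h"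
  assumes G: "\<And>x. x \<in> S \<Longrightarrow> (s x, p x) \<in> G2" and T: "T \<in> \<B>" "norm T \<le> 1"
    and rel: "\<And>x y. x \<in> S \<Longrightarrow> cinner (2 *\<^sub>C y - s x *\<^sub>C blinfun_apply T y) (f x)
      = cinner ((2 * p x) *\<^sub>C blinfun_apply T y - s x *\<^sub>C y) (e x)"
    and gram: "\<And>F c. finite F \<Longrightarrow> F \<subseteq> S \<Longrightarrow>
      norm (\<Sum>x\<in>F. c x *\<^sub>C (b x, e x)) \<le> norm (\<Sum>x\<in>F. c x *\<^sub>C (a x, f x))"
  obtains Y :: "complex \<times> complex \<Rightarrow> ('c \<Rightarrow>\<^sub>L 'a)" where "Y \<in> Hinf G2" "\<And>z. z \<in> G2 \<Longrightarrow> norm (Y z) \<le> 1"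
    "\<And>x c. x \<in> S \<Longrightarrow> cinner (blinfun_apply (Y (s x, p x)) c) (a x) = cinner c (b x)"
proof -
  \<comment> \<open>W acts in the direction adjoint to the map (a x, f x) -> (b x, e x), so it is
    known through its pairings with (a x, f x).\<close>
  obtain W :: "('c \<times> 'h) \<Rightarrow>\<^sub>L ('a \<times> 'h)" where W: "W \<in> \<B>" "norm W \<le> 1"
    "\<And>x y. x \<in> S \<Longrightarrow> cinner (blinfun_apply W y) (a x, f x) = cinner y (b x, e x)"
    by (rule contraction_pairing[of S "\<lambda>x. (b x, e x)" "\<lambda>x. (a x, f x)"]) (use gram in auto)
  define i1 :: "'c \<Rightarrow>\<^sub>L ('c \<times> 'h)" where "i1 = Blinfun (\<lambda>x. (x, 0))"
  define i2 :: "'h \<Rightarrow>\<^sub>L ('c \<times> 'h)" where "i2 = Blinfun (\<lambda>x. (0, x))"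
  have i: "blinfun_apply i1 x = (x, 0)" "blinfun_apply i2 y = (0, y)" for x y
    unfolding i1_def i2_def
    by (subst bounded_linear_Blinfun_apply; auto intro!: bounded_linear_intros bounded_linear_Pair bounded_linear_zero bounded_linear_ident)+
  define W11 W12 W21 W22 where "W11 = fst_blinfun o\<^sub>L W o\<^sub>L i1" and "W12 = fst_blinfun o\<^sub>L W o\<^sub>L i2"
    and "W21 = snd_blinfun o\<^sub>L W o\<^sub>L i1" and "W22 = snd_blinfun o\<^sub>L W o\<^sub>L i2"
  have iB: "i1 \<in> \<B>" "i2 \<in> \<B>" "(fst_blinfun :: ('a \<times> 'h) \<Rightarrow>\<^sub>L 'a) \<in> \<B>" "(snd_blinfun :: ('a \<times> 'h) \<Rightarrow>\<^sub>L 'h) \<in> \<B>"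
    by (auto simp: cbounded_def i scaleC_prod_def)
  have WB: "W11 \<in> \<B>" "W12 \<in> \<B>" "W21 \<in> \<B>" "W22 \<in> \<B>"
    unfolding W11_def W12_def W21_def W22_def by (intro compose_in_B iB W(1))+
  have Wsplit: "blinfun_apply W (c, g) = (blinfun_apply W11 c + blinfun_apply W12 g, blinfun_apply W21 c + blinfun_apply W22 g)" for c g
  proof -
    have "blinfun_apply W (c, g) = blinfun_apply W ((c, 0) + (0, g))" by simp
    also have "\<dots> = blinfun_apply W (c, 0) + blinfun_apply W (0, g)" by (rule blinfun.add_right)
    finally show ?thesis by (simp add: W11_def W12_def W21_def W22_def i prod_eq_iff)
  qed
  have Wn: "norm (blinfun_apply W y) \<le> norm y" for y
    using norm_blinfun[of W y] mult_right_mono[OF W(2), of "norm y"] by simp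
  have Tn: "norm (blinfun_apply T y) \<le> norm y" for y
    using norm_blinfun[of T y] mult_right_mono[OF T(2), of "norm y"] by simp
  have W22n: "norm (blinfun_apply W22 g) \<le> norm g" for g
  proof -
    have "norm (snd (blinfun_apply W (0, g))) \<le> norm (blinfun_apply W (0, g))"
      by (metis norm_snd_le prod.collapse)
    also have "\<dots> \<le> norm (0::'c, g)" by (rule Wn)
    finally show ?thesis by (simp add: Wsplit)
  qed
  define N where "N z = (2 * snd z) *\<^sub>C T - fst z *\<^sub>C id_blinfun" for z :: "complex \<times> complex"
  define M where "M z = 2 *\<^sub>C id_blinfun - fst z *\<^sub>C T" for z :: "complex \<times> complex"
  define L where "L z = M z - (W22 o\<^sub>L N z)" for z
  have idB: "id_blinfun \<in> (\<B> :: ('h \<Rightarrow>\<^sub>L 'h) set)" by (simp add: cbounded_def)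
  have NB: "N z \<in> \<B>" and MB: "M z \<in> \<B>" for z
    unfolding N_def M_def by (intro diff_in_B scaleC_in_B T idB)+
  have LB: "L z \<in> \<B>" for z unfolding L_def by (intro diff_in_B compose_in_B MB NB WB)
  have Na: "blinfun_apply (N z) y = (2 * snd z) *\<^sub>C blinfun_apply T y - fst z *\<^sub>C y"
    and Ma: "blinfun_apply (M z) y = 2 *\<^sub>C y - fst z *\<^sub>C blinfun_apply T y" for z y
    by (simp_all add: N_def M_def blinfun.diff_left scaleC_blinfun.rep_eq)
  \<comment> \<open>The operator form of |\<Phi>| <= m < 1, from \<open>Phi_vector_bound\<close>
    with x = T y.\<close>
  have NM: "\<exists>m<1. \<forall>y. norm (blinfun_apply (N z) y) \<le> m * norm (blinfun_apply (M z) y)" if z: "z \<in> G2" for z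
  proof -
    obtain l1 l2 m where l: "fst z = l1 + l2" "snd z = l1 * l2" "cmod l1 \<le> m" "cmod l2 \<le> m" "0 \<le> m" "m < 1"
      by (rule G2_E[OF z])
    have "norm (blinfun_apply (N z) y) \<le> m * norm (blinfun_apply (M z) y)" for y
      unfolding Na Ma l(1,2) using Phi_vector_bound[OF l(3,4) _ Tn, of y] l(6) by (simp add: mult.assoc)
    then show ?thesis using l(6) by blast
  qed
  \<comment> \<open>L = (1 - W22 N M^(-1)) M. Here M is invertible since |s| < 2, and the first
    factor because W22 N M^(-1) has norm below 1 by \<open>NM\<close>.\<close>
  have Linv: "\<exists>R. is_inv (L z) R" if z: "z \<in> G2" for z
  proof -
    obtain m where m: "m < 1" "\<And>y. norm (blinfun_apply (N z) y) \<le> m * norm (blinfun_apply (M z) y)" using NM[OF z] by blast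
    obtain l1 l2 where "fst z = l1 + l2" "cmod l1 < 1" "cmod l2 < 1" using z by (auto simp: G2_def)
    then have s2: "cmod (fst z) < 2" using norm_triangle_ineq[of l1 l2] by simp
    have "norm ((fst z / 2) *\<^sub>C T) < 1"
    proof -
      have "cmod (fst z / 2) * norm T \<le> cmod (fst z / 2) * 1" using T(2) by (intro mult_left_mono) auto
      then show ?thesis using s2 by (simp add: norm_scaleC norm_divide)
    qed
    then obtain R1 where R1: "R1 \<in> \<B>" "R1 o\<^sub>L (id_blinfun - (fst z / 2) *\<^sub>C T) = id_blinfun" "(id_blinfun - (fst z / 2) *\<^sub>C T) o\<^sub>L R1 = id_blinfun"
      using neumann_inverse scaleC_in_B[OF T(1)] by metis
    have "is_inv (2 *\<^sub>C id_blinfun :: 'h \<Rightarrow>\<^sub>L 'h) ((1/2) *\<^sub>C id_blinfun)"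
      unfolding is_inv_def
      by (auto intro!: scaleC_in_B idB blinfun_eqI simp: scaleC_blinfun.rep_eq scaleC_scaleC scaleC_one)
    moreover have "is_inv (id_blinfun - (fst z / 2) *\<^sub>C T) R1" using R1 by (simp add: is_inv_def)
    ultimately have "is_inv ((2 *\<^sub>C id_blinfun) o\<^sub>L (id_blinfun - (fst z / 2) *\<^sub>C T)) (R1 o\<^sub>L (1/2) *\<^sub>C id_blinfun)"
      by (rule is_inv_compose)
    moreover have "(2 *\<^sub>C id_blinfun) o\<^sub>L (id_blinfun - (fst z / 2) *\<^sub>C T) = M z"
      by (rule blinfun_eqI) (simp add: Ma blinfun.diff_left scaleC_blinfun.rep_eq scaleC_diff_right scaleC_scaleC)
    ultimately obtain RM where RM: "is_inv (M z) RM" by auto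
    define X where "X = W22 o\<^sub>L N z o\<^sub>L RM"
    have RMB: "RM \<in> \<B>" "RM o\<^sub>L M z = id_blinfun" "M z o\<^sub>L RM = id_blinfun" using RM by (auto simp: is_inv_def)
    have MR: "blinfun_apply (M z) (blinfun_apply RM y) = y" for y
      using RMB(3) by (metis blinfun_apply_blinfun_compose blinfun_apply_id_blinfun id_apply)
    have "norm (blinfun_apply X y) \<le> max m 0 * norm y" for y
    proof -
      have "norm (blinfun_apply X y) \<le> norm (blinfun_apply (N z) (blinfun_apply RM y))"
        unfolding X_def by (simp add: W22n)
      also have "\<dots> \<le> m * norm (blinfun_apply (M z) (blinfun_apply RM y))" by (rule m(2))
      also have "\<dots> \<le> max m 0 * norm y" unfolding MR by (intro mult_right_mono) auto
      finally show ?thesis .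
    qed
    then have "norm X \<le> max m 0" by (intro norm_blinfun_bound) auto
    then have "norm X < 1" using m(1) by auto
    moreover have "X \<in> \<B>" unfolding X_def by (intro compose_in_B WB NB RMB)
    ultimately obtain R2 where "R2 \<in> \<B>" "R2 o\<^sub>L (id_blinfun - X) = id_blinfun" "(id_blinfun - X) o\<^sub>L R2 = id_blinfun"
      by (rule neumann_inverse)
    then have "is_inv (id_blinfun - X) R2" by (simp add: is_inv_def)
    from is_inv_compose[OF this RM] have "is_inv ((id_blinfun - X) o\<^sub>L M z) (RM o\<^sub>L R2)" .
    moreover have "(id_blinfun - X) o\<^sub>L M z = L z"
      by (simp add: L_def bcompose_diff_left X_def blinfun_compose_assoc RMB)
    ultimately show ?thesis by auto
  qed
  define R where "R z = op_inv (L z)" for z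
  have Rinv: "is_inv (L z) (R z)" if "z \<in> G2" for z
    unfolding R_def using Linv[OF that] is_inv_op_inv by blast
  have RB: "R z \<in> \<B>" if "z \<in> G2" for z using Rinv[OF that] by (simp add: is_inv_def)
  define Y where "Y z = W11 + (W12 o\<^sub>L N z o\<^sub>L R z o\<^sub>L W21)" for z
  have YB: "Y z \<in> \<B>" if "z \<in> G2" for z
    unfolding Y_def by (intro add_in_B compose_in_B WB NB RB that)
  \<comment> \<open>One identity for the whole transfer function: W sends (c, N y) to (Y c, M y),
    where y = L^(-1) W21 c is the internal state.\<close>
  have main: "blinfun_apply W (c, blinfun_apply (N z) (blinfun_apply (R z) (blinfun_apply W21 c)))
      = (blinfun_apply (Y z) c, blinfun_apply (M z) (blinfun_apply (R z) (blinfun_apply W21 c)))" if z: "z \<in> G2" for z c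
  proof -
    let ?y = "blinfun_apply (R z) (blinfun_apply W21 c)"
    have "blinfun_apply (L z) ?y = blinfun_apply W21 c"
      using Rinv[OF z] unfolding is_inv_def by (metis blinfun_apply_blinfun_compose blinfun_apply_id_blinfun id_apply)
    then have "blinfun_apply (M z) ?y = blinfun_apply W21 c + blinfun_apply W22 (blinfun_apply (N z) ?y)"
      by (simp add: L_def blinfun.diff_left algebra_simps)
    then show ?thesis by (simp add: Wsplit Y_def blinfun.add_left)
  qed
  show ?thesis
  proof (rule that)
    \<comment> \<open>Energy balance: |Y c|^2 + |M y|^2 <= |c|^2 + |N y|^2, and |N y| <= |M
      y|.\<close>
    have contr: "norm (blinfun_apply (Y z) c) \<le> norm c" if z: "z \<in> G2" for z c
    proof -
      let ?y = "blinfun_apply (R z) (blinfun_apply W21 c)"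
      obtain m where m: "m < 1" "norm (blinfun_apply (N z) ?y) \<le> m * norm (blinfun_apply (M z) ?y)" using NM[OF z] by blast
      have "norm (blinfun_apply (N z) ?y) \<le> 1 * norm (blinfun_apply (M z) ?y)"
        by (rule order_trans[OF m(2) mult_right_mono]) (use m(1) in auto)
      then have nm: "(norm (blinfun_apply (N z) ?y))\<^sup>2 \<le> (norm (blinfun_apply (M z) ?y))\<^sup>2" by (simp add: power_mono)
      have "(norm (blinfun_apply (Y z) c, blinfun_apply (M z) ?y))\<^sup>2 \<le> (norm (c, blinfun_apply (N z) ?y))\<^sup>2"
        unfolding main[OF z, symmetric] by (intro power_mono Wn norm_ge_zero)
      then have "(norm (blinfun_apply (Y z) c))\<^sup>2 + (norm (blinfun_apply (M z) ?y))\<^sup>2 \<le> (norm c)\<^sup>2 + (norm (blinfun_apply (N z) ?y))\<^sup>2"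
        by (simp add: norm_prod_def)
      then have "(norm (blinfun_apply (Y z) c))\<^sup>2 \<le> (norm c)\<^sup>2" using nm by linarith
      then show ?thesis by (rule power2_le_imp_le) simp
    qed
    show nY: "norm (Y z) \<le> 1" if "z \<in> G2" for z
      by (rule norm_blinfun_bound) (use contr[OF that] in auto)
    have hol: "holomorphic_on_C2 Y G2"
      unfolding holomorphic_on_C2_def
    proof
      fix z0 :: "complex \<times> complex" assume z0: "z0 \<in> G2"
      define N' where "N' h = (2 * snd h) *\<^sub>C T - fst h *\<^sub>C (id_blinfun :: 'h \<Rightarrow>\<^sub>L 'h)" for h :: "complex \<times> complex"
      define L' where "L' h = - (fst h *\<^sub>C T) - (W22 o\<^sub>L N' h)" for h
      have blC: "bounded_linear (\<lambda>c. c *\<^sub>C (A :: 'h \<Rightarrow>\<^sub>L 'h))" for A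
        by (rule bounded_linear_intro[of _ "norm A"]) (simp_all add: scaleC_add_left scaleR_scaleC scaleC_scaleC scaleR_conv_of_real norm_scaleC)
      have "bounded_linear (\<lambda>h::complex \<times> complex. 2 * snd h)"
        by (intro bounded_linear_compose[OF bounded_linear_mult_right bounded_linear_snd])
      then have N'bl: "bounded_linear N'"
        unfolding N'_def
        by (intro bounded_linear_sub bounded_linear_compose[OF blC] bounded_linear_fst)
      have L'bl: "bounded_linear L'"
        unfolding L'_def
        by (intro bounded_linear_sub bounded_linear_minus bounded_linear_compose[OF blC] bounded_linear_fst
            bounded_linear_compose[OF bounded_bilinear.bounded_linear_right[OF bounded_bilinear_blinfun_compose]] N'bl)
      have LL: "L z = 2 *\<^sub>C id_blinfun + L' z" for z by (simp add: L_def M_def L'_def N'_def N_def)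
      have NN: "N = N'" by (simp add: fun_eq_iff N_def N'_def)
      have dR: "(R has_derivative (\<lambda>h. - (R z0 o\<^sub>L L' h o\<^sub>L R z0))) (at z0)"
        unfolding R_def by (rule op_inv_has_derivative[OF L'bl LL LB]) (use Rinv[OF z0] in \<open>simp add: R_def\<close>)
      have dN: "(N has_derivative N') (at z0)" unfolding NN by (rule bounded_linear_imp_has_derivative[OF N'bl])
      define D where "D h = W12 o\<^sub>L ((N z0 o\<^sub>L (- (R z0 o\<^sub>L L' h o\<^sub>L R z0))) + (N' h o\<^sub>L R z0)) o\<^sub>L W21" for h
      have "((\<lambda>z. N z o\<^sub>L R z) has_derivative (\<lambda>h. (N z0 o\<^sub>L (- (R z0 o\<^sub>L L' h o\<^sub>L R z0))) + (N' h o\<^sub>L R z0))) (at z0)"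
        by (rule bounded_bilinear.FDERIV[OF bounded_bilinear_blinfun_compose dN dR])
      moreover have "bounded_linear (\<lambda>A. W12 o\<^sub>L A o\<^sub>L W21)"
        by (intro bounded_linear_compose[OF bounded_bilinear.bounded_linear_left[OF bounded_bilinear_blinfun_compose]]
            bounded_bilinear.bounded_linear_right[OF bounded_bilinear_blinfun_compose])
      ultimately have "((\<lambda>z. W12 o\<^sub>L (N z o\<^sub>L R z) o\<^sub>L W21) has_derivative D) (at z0)"
        unfolding D_def by (rule bounded_linear.has_derivative[rotated])
      then have "((\<lambda>z. W11 + (W12 o\<^sub>L (N z o\<^sub>L R z) o\<^sub>L W21)) has_derivative D) (at z0)"
        using has_derivative_add[OF has_derivative_const[of W11]] by fastforce
      moreover have "(\<lambda>z. W11 + (W12 o\<^sub>L (N z o\<^sub>L R z) o\<^sub>L W21)) = Y"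
        by (simp add: fun_eq_iff Y_def blinfun_compose_assoc)
      ultimately have "(Y has_derivative D) (at z0)" by simp
      moreover have "D (c *\<^sub>C h) = c *\<^sub>C D h" for c h
      proof -
        have N'h: "blinfun_apply (N' (c *\<^sub>C h)) y = c *\<^sub>C blinfun_apply (N' h) y" for y
          by (simp add: N'_def scaleC_prod_def blinfun.diff_left scaleC_blinfun.rep_eq scaleC_diff_right scaleC_scaleC mult_ac)
        have fs: "fst (c *\<^sub>C h) = c * fst h" by (simp add: scaleC_prod_def)
        have L'h: "blinfun_apply (L' (c *\<^sub>C h)) y = c *\<^sub>C blinfun_apply (L' h) y" for y
          by (simp add: L'_def N'h blinfun_cbounded_scaleC[OF WB(4)] blinfun.diff_left blinfun.minus_left fs
              scaleC_blinfun.rep_eq scaleC_diff_right scaleC_scaleC scaleC_minus_right)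
        show ?thesis
          by (rule blinfun_eqI)
            (simp add: D_def N'h L'h blinfun.add_left blinfun.minus_left blinfun.minus_right scaleC_blinfun.rep_eq
              blinfun_cbounded_scaleC[OF WB(2)] blinfun_cbounded_scaleC[OF NB] blinfun_cbounded_scaleC[OF RB[OF z0]] blinfun.add_right
              scaleC_add_right scaleC_minus_right scaleC_diff_right blinfun.diff_right)
      qed
      ultimately show "\<exists>D. (Y has_derivative D) (at z0) \<and> (\<forall>c h. D (c *\<^sub>C h) = c *\<^sub>C D h)" by blast
    qed
    show "Y \<in> Hinf G2"
      unfolding Hinf_def using YB hol nY by (auto intro!: boundedI[of _ 1])
    fix x c assume x: "x \<in> S"
    let ?z = "(s x, p x)"
    let ?y = "blinfun_apply (R ?z) (blinfun_apply W21 c)"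
    \<comment> \<open>Pairing \<open>main\<close> with (a x, f x); by \<open>rel\<close> the state
      terms cancel.\<close>
    have "cinner (blinfun_apply W (c, blinfun_apply (N ?z) ?y)) (a x, f x) = cinner (c, blinfun_apply (N ?z) ?y) (b x, e x)"
      by (rule W(3)[OF x])
    then have "cinner (blinfun_apply (Y ?z) c) (a x) + cinner (blinfun_apply (M ?z) ?y) (f x) = cinner c (b x) + cinner (blinfun_apply (N ?z) ?y) (e x)"
      unfolding main[OF G[OF x]] by (simp add: cinner_prod_def)
    moreover have "cinner (blinfun_apply (M ?z) ?y) (f x) = cinner (blinfun_apply (N ?z) ?y) (e x)"
      using rel[OF x, of ?y] by (simp add: Na Ma)
    ultimately show "cinner (blinfun_apply (Y (s x, p x)) c) (a x) = cinner c (b x)" by simp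
  qed
qed

section \<open>From the decomposition to the factorization\<close>

lemma cp_kernel_pos_on:
  fixes \<xi> :: "'z \<Rightarrow> 'z \<Rightarrow> (cdisc \<Rightarrow>\<^sub>C complex) \<Rightarrow>\<^sub>L ('l::chilbert_space \<Rightarrow>\<^sub>L 'l)"
  assumes \<xi>: "cp_kernel S \<xi>"
  shows "pos_on (S \<times> UNIV) (\<lambda>x y. cinner (blinfun_apply (blinfun_apply (\<xi> (fst x) (fst y))
    (times_cnj (snd (snd x)) (snd (snd y)))) (fst (snd y))) (fst (snd x)))"
proof (rule pos_onI_nat)
  fix n :: nat and x :: "nat \<Rightarrow> 'z \<times> 'l \<times> (cdisc \<Rightarrow>\<^sub>C complex)" and c
  assume x: "\<And>i. i < n \<Longrightarrow> x i \<in> S \<times> UNIV"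
  have xS: "fst (x i) \<in> S" if "i < n" for i using x[OF that] by auto
  have "0 \<le> (\<Sum>i<n. \<Sum>j<n. cinner (blinfun_apply (blinfun_apply (\<xi> (fst (x i)) (fst (x j))) (times_cnj (snd (snd (x i))) (snd (snd (x j)))))
      (c j *\<^sub>C fst (snd (x j)))) (c i *\<^sub>C fst (snd (x i))))"
    using \<xi>[unfolded cp_kernel_def, THEN conjunct2, THEN spec, THEN spec, THEN spec, THEN spec, THEN mp,
        of n "\<lambda>i. fst (x i)" "\<lambda>i. snd (snd (x i))" "\<lambda>i. c i *\<^sub>C fst (snd (x i))"] xS by simp
  also have "\<dots> = (\<Sum>i<n. \<Sum>j<n. cnj (c i) * c j * cinner (blinfun_apply (blinfun_apply (\<xi> (fst (x i)) (fst (x j)))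
    (times_cnj (snd (snd (x i))) (snd (snd (x j))))) (fst (snd (x j)))) (fst (snd (x i))))"
  proof (intro sum.cong refl)
    fix i j assume "i \<in> {..<n}" "j \<in> {..<n}"
    then have "blinfun_apply (\<xi> (fst (x i)) (fst (x j))) h \<in> \<B>" for h
      using \<xi> xS unfolding cp_kernel_def by blast
    from blinfun_cbounded_scaleC[OF this]
    show "cinner (blinfun_apply (blinfun_apply (\<xi> (fst (x i)) (fst (x j))) (times_cnj (snd (snd (x i))) (snd (snd (x j)))))
      (c j *\<^sub>C fst (snd (x j)))) (c i *\<^sub>C fst (snd (x i)))
      = cnj (c i) * c j * cinner (blinfun_apply (blinfun_apply (\<xi> (fst (x i)) (fst (x j)))
    (times_cnj (snd (snd (x i))) (snd (snd (x j))))) (fst (snd (x j)))) (fst (snd (x i)))"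
      by (simp add: cinner_scaleC_left cinner_scaleC_right)
  qed
  finally show "0 \<le> (\<Sum>i<n. \<Sum>j<n. cnj (c i) * c j * cinner (blinfun_apply (blinfun_apply (\<xi> (fst (x i)) (fst (x j)))
    (times_cnj (snd (snd (x i))) (snd (snd (x j))))) (fst (snd (x j)))) (fst (snd (x i))))" .
qed

text \<open>The identity \<open>1 = \<bar>\<alpha>\<bar>\<^sup>2 + (1 - \<bar>\<alpha>\<bar>\<^sup>2)\<close> turns multiplication by the coordinate
  into a contraction for every completely positive form.\<close>

definition cid :: "cdisc \<Rightarrow>\<^sub>C complex"
  where "cid = Bcontfun (\<lambda>\<alpha>. cnj (of_cdisc \<alpha>))"

definition cdefect :: "cdisc \<Rightarrow>\<^sub>C complex"
  where "cdefect = Bcontfun (\<lambda>\<alpha>. complex_of_real (sqrt (1 - (cmod (of_cdisc \<alpha>))\<^sup>2)))"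

lemma apply_cid: "apply_bcontfun cid \<alpha> = cnj (of_cdisc \<alpha>)"
  unfolding cid_def by (subst Bcontfun_inverse) (auto intro!: bcontfun_of_cdisc continuous_intros)

lemma apply_cdefect: "apply_bcontfun cdefect \<alpha> = complex_of_real (sqrt (1 - (cmod (of_cdisc \<alpha>))\<^sup>2))"
  unfolding cdefect_def by (subst Bcontfun_inverse) (auto intro!: bcontfun_of_cdisc continuous_intros)

lemma cmod_of_cdisc: "cmod (of_cdisc \<alpha>) \<le> 1"
  using of_cdisc[of \<alpha>] by simp

lemma apply_bcontfun_plus: "apply_bcontfun (f + g) x = apply_bcontfun f x + apply_bcontfun g x"
  by (simp add: plus_bcontfun.rep_eq)

lemma apply_bcontfun_minus: "apply_bcontfun (f - g) x = apply_bcontfun f x - apply_bcontfun g x"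
  by (simp add: minus_bcontfun.rep_eq)

lemma times_cnj_add_left: "times_cnj (f + g) h = times_cnj f h + times_cnj g h"
  by (rule bcontfun_eqI) (simp add: apply_times_cnj apply_bcontfun_plus distrib_right)

lemma times_cnj_add_right: "times_cnj h (f + g) = times_cnj h f + times_cnj h g"
  by (rule bcontfun_eqI) (simp add: apply_times_cnj apply_bcontfun_plus distrib_left)

lemma times_cnj_scaleC_left: "times_cnj (c *\<^sub>C f) h = c *\<^sub>C times_cnj f h"
  by (rule bcontfun_eqI) (simp add: apply_times_cnj apply_bcontfun_scaleC)

lemma times_cnj_scaleC_right: "times_cnj h (c *\<^sub>C f) = cnj c *\<^sub>C times_cnj h f"
  by (rule bcontfun_eqI) (simp add: apply_times_cnj apply_bcontfun_scaleC)

text \<open>\<open>cid\<close> is the conjugate coordinate, so \<open>times_cnj g cid\<close> is g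
  multiplied by \<alpha>; the two summands carry the weights |\<alpha>|^2 and 1 -
  |\<alpha>|^2.\<close>

lemma times_cnj_defect: "times_cnj g h = times_cnj (times_cnj g cid) (times_cnj h cid)
    + times_cnj (times_cnj g cdefect) (times_cnj h cdefect)"
proof (rule bcontfun_eqI)
  fix \<alpha>
  define r where "r = sqrt (1 - (cmod (of_cdisc \<alpha>))\<^sup>2)"
  have "complex_of_real r * complex_of_real r = 1 - of_cdisc \<alpha> * cnj (of_cdisc \<alpha>)"
    unfolding complex_norm_square[symmetric] of_real_mult[symmetric] r_def
    using cmod_of_cdisc[of \<alpha>] by (simp add: power_le_one)
  then have *: "of_cdisc \<alpha> * cnj (of_cdisc \<alpha>) + complex_of_real r * complex_of_real r = 1" by simp
  have "x * y = x * w * (y * cnj w) + x * t * (y * t)" if "w * cnj w + t * t = 1" for x y w t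
  proof -
    have "x * w * (y * cnj w) + x * t * (y * t) = (x * y) * (w * cnj w + t * t)" by (simp only: algebra_simps)
    then show ?thesis using that by simp
  qed
  from this[OF *, of "apply_bcontfun g \<alpha>" "cnj (apply_bcontfun h \<alpha>)"] show "apply_bcontfun (times_cnj g h) \<alpha> = apply_bcontfun (times_cnj (times_cnj g cid) (times_cnj h cid)
      + times_cnj (times_cnj g cdefect) (times_cnj h cdefect)) \<alpha>"
    by (simp only: apply_times_cnj apply_bcontfun_plus apply_cid apply_cdefect complex_cnj_mult complex_cnj_cnj
        complex_cnj_complex_of_real r_def[symmetric])
qed

lemma norm_gram_split:
  assumes "\<And>x y. x \<in> F \<Longrightarrow> y \<in> F \<Longrightarrow> cinner (a y) (a x) = cinner (b y) (b x) + k x y" and k: "pos_on F k" and F: "finite F"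
  shows "norm (\<Sum>x\<in>F. c x *\<^sub>C (b x :: 'b::complex_inner)) \<le> norm (\<Sum>x\<in>F. c x *\<^sub>C (a x :: 'a::complex_inner))"
proof -
  have "complex_of_real ((norm (\<Sum>x\<in>F. c x *\<^sub>C a x))\<^sup>2) = (\<Sum>x\<in>F. \<Sum>y\<in>F. cnj (c x) * c y * (cinner (b y) (b x) + k x y))"
    unfolding norm_sum_scaleC_sq[symmetric] by (intro sum.cong refl) (simp add: assms(1))
  also have "\<dots> = complex_of_real ((norm (\<Sum>x\<in>F. c x *\<^sub>C b x))\<^sup>2) + (\<Sum>x\<in>F. \<Sum>y\<in>F. cnj (c x) * c y * k x y)"
    unfolding norm_sum_scaleC_sq[symmetric] by (simp add: distrib_left sum.distrib)
  finally have "0 \<le> complex_of_real ((norm (\<Sum>x\<in>F. c x *\<^sub>C a x))\<^sup>2) - complex_of_real ((norm (\<Sum>x\<in>F. c x *\<^sub>C b x))\<^sup>2)"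
    using pos_onD[OF k F order_refl, of c] by simp
  then have "(norm (\<Sum>x\<in>F. c x *\<^sub>C b x))\<^sup>2 \<le> (norm (\<Sum>x\<in>F. c x *\<^sub>C a x))\<^sup>2"
    by (simp add: less_eq_complex_def)
  then show ?thesis by (rule power2_le_imp_le) simp
qed

text \<open>\<delta> is added to \<eta> as a point mass at \<alpha> = 0, where j(z) takes the value
  - s / 2, so a single positive form k remains. The \<xi> term, whose argument becomes 1 because J
  vanishes, is the positive surplus between the two Gram matrices.\<close>

lemma decomposition_imp_factorization:
  fixes \<Upsilon>12 :: "complex \<times> complex \<Rightarrow> ('l1::chilbert_space \<Rightarrow>\<^sub>L 'l2::chilbert_space)"
    and \<Upsilon>32 :: "complex \<times> complex \<Rightarrow> ('l3::chilbert_space \<Rightarrow>\<^sub>L 'l2)"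
  assumes \<Upsilon>12: "\<forall>z\<in>G2. \<Upsilon>12 z \<in> \<B>" and \<Upsilon>32: "\<forall>z\<in>G2. \<Upsilon>32 z \<in> \<B>"
    and \<xi>: "cp_kernel pentablock \<xi>" and \<eta>: "cp_kernel pentablock \<eta>" and \<delta>: "weak_kernel pentablock \<delta>"
    and eq: "\<And>z w. z \<in> pentablock \<Longrightarrow> w \<in> pentablock \<Longrightarrow>
      (\<Upsilon>12 (snd z) o\<^sub>L (\<Upsilon>12 (snd w))\<^sup>\<star>) - (\<Upsilon>32 (snd z) o\<^sub>L (\<Upsilon>32 (snd w))\<^sup>\<star>) =
        blinfun_apply (\<xi> z w) (const_bcontfun 1 - times_cnj (bigJ z) (bigJ w))
        + blinfun_apply (\<eta> z w) (const_bcontfun 1 - times_cnj (smallj z) (smallj w))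
        + (1 - fst (snd z) * cnj (fst (snd w)) / 4) *\<^sub>C \<delta> z w"
  obtains \<Upsilon>31 :: "complex \<times> complex \<Rightarrow> ('l3 \<Rightarrow>\<^sub>L 'l1)" where "\<Upsilon>31 \<in> Hinf G2" "\<And>z. z \<in> G2 \<Longrightarrow> norm (\<Upsilon>31 z) \<le> 1"
    "\<And>z. z \<in> G2 \<Longrightarrow> \<Upsilon>12 z o\<^sub>L \<Upsilon>31 z = \<Upsilon>32 z"
proof -
  define P :: "complex \<times> complex \<Rightarrow> complex \<times> complex \<times> complex" where "P z = (0, z)" for z
  have P: "P z \<in> pentablock" if "z \<in> G2" for z
    using zero_in_pentablock[of "fst z" "snd z"] that by (simp add: P_def)
  have sP: "snd (P z) = z" for z by (simp add: P_def)
  define o0 where "o0 = Abs_cdisc 0"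
  have o0: "of_cdisc o0 = 0" unfolding o0_def by (rule Abs_cdisc_inverse) simp
  define k :: "complex \<times> complex \<Rightarrow> complex \<times> complex \<Rightarrow> (cdisc \<Rightarrow>\<^sub>C complex) \<Rightarrow> 'l2 \<Rightarrow> 'l2 \<Rightarrow> complex"
    where "k z w h v u = cinner (blinfun_apply (blinfun_apply (\<eta> (P z) (P w)) h) v) u
      + apply_bcontfun h o0 * cinner (blinfun_apply (\<delta> (P z) (P w)) v) u" for z w h v u
  have \<eta>B: "\<eta> z w \<in> \<B>" "blinfun_apply (\<eta> z w) h \<in> \<B>" if "z \<in> pentablock" "w \<in> pentablock" for z w h
    using \<eta> that unfolding cp_kernel_def by auto
  have k_add: "k z w (g + h) v u = k z w g v u + k z w h v u" for z w g h v u
    by (simp add: k_def blinfun.add_right blinfun.add_left cinner_add_left apply_bcontfun_plus algebra_simps)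
  have k_minus: "k z w (g - h) v u = k z w g v u - k z w h v u" for z w g h v u
    by (simp add: k_def blinfun.diff_right blinfun.diff_left cinner_diff_left apply_bcontfun_minus algebra_simps)
  have k_sc: "k z w (c *\<^sub>C h) v u = c * k z w h v u" if "z \<in> G2" "w \<in> G2" for z w c h v u
    by (simp add: k_def blinfun_cbounded_scaleC[OF \<eta>B(1)[OF P P], OF that] scaleC_blinfun.rep_eq cinner_scaleC_left
        apply_bcontfun_scaleC algebra_simps)
  define K where "K x y = k (fst x) (fst y) (times_cnj (snd (snd x)) (snd (snd y))) (fst (snd y)) (fst (snd x))"
    for x y :: "(complex \<times> complex) \<times> 'l2 \<times> (cdisc \<Rightarrow>\<^sub>C complex)"
  let ?S = "G2 \<times> (UNIV :: ('l2 \<times> (cdisc \<Rightarrow>\<^sub>C complex)) set)"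
  have K: "pos_on ?S K"
  proof -
    have 1: "pos_on ?S (\<lambda>x y. cinner (blinfun_apply (blinfun_apply (\<eta> (P (fst x)) (P (fst y)))
      (times_cnj (snd (snd x)) (snd (snd y)))) (fst (snd y))) (fst (snd x)))"
      using pos_on_reindex[OF cp_kernel_pos_on[OF \<eta>], of ?S "\<lambda>x. (P (fst x), snd x)"] P by auto
    have "pos_on (pentablock \<times> UNIV) (\<lambda>x y. cinner (blinfun_apply (\<delta> (fst x) (fst y)) (snd y)) (snd x))"
      using \<delta> by (intro psd_on_pos_on) (auto simp: weak_kernel_def)
    from pos_on_reindex[OF this, of ?S "\<lambda>x. (P (fst x), fst (snd x))"]
    have 2: "pos_on ?S (\<lambda>x y. cinner (blinfun_apply (\<delta> (P (fst x)) (P (fst y))) (fst (snd y))) (fst (snd x)))"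
      using P by auto
    from pos_on_add[OF 1 pos_on_congruence[OF this, of "\<lambda>x. apply_bcontfun (snd (snd x)) o0"]]
    show ?thesis by (rule pos_on_cong[rotated]) (simp add: K_def k_def apply_times_cnj)
  qed
  obtain e :: "(complex \<times> complex) \<times> 'l2 \<times> (cdisc \<Rightarrow>\<^sub>C complex) \<Rightarrow> ((complex \<times> complex) \<times> 'l2 \<times> (cdisc \<Rightarrow>\<^sub>C complex)) ell2"
    where e: "\<And>x y. x \<in> ?S \<Longrightarrow> y \<in> ?S \<Longrightarrow> K x y = cinner (e y) (e x)"
    using kolmogorov[OF K] by blast
  have ee: "cinner (e (z, v, h)) (e (w, u, g)) = k w z (times_cnj g h) v u" if "z \<in> G2" "w \<in> G2" for z w v u g h
    using e[of "(w, u, g)" "(z, v, h)"] that by (simp add: K_def)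
  \<comment> \<open>The Gram vectors are additive, and by the next step antilinear, in the function:
    the difference of the two sides has norm 0 because k is linear in its function argument.\<close>
  have e_add: "e (z, v, g + h) = e (z, v, g) + e (z, v, h)" if z: "z \<in> G2" for z v g h
  proof -
    have "cinner (e (z, v, g + h) - (e (z, v, g) + e (z, v, h))) (e (z, v, g + h) - (e (z, v, g) + e (z, v, h))) = 0"
      by (simp only: cinner_diff_left cinner_diff_right cinner_add_left cinner_add_right ee[OF z z]
          times_cnj_add_left times_cnj_add_right k_add) simp
    then show ?thesis by simp
  qed
  have e_sc: "e (z, v, c *\<^sub>C h) = cnj c *\<^sub>C e (z, v, h)" if z: "z \<in> G2" for z v c h
  proof -
    have "cinner (e (z, v, c *\<^sub>C h) - cnj c *\<^sub>C e (z, v, h)) (e (z, v, c *\<^sub>C h) - cnj c *\<^sub>C e (z, v, h)) = 0"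
      by (simp only: cinner_diff_left cinner_diff_right cinner_scaleC_left cinner_scaleC_right ee[OF z z]
          times_cnj_scaleC_left times_cnj_scaleC_right k_sc[OF z z]) simp
    then show ?thesis by simp
  qed
  \<comment> \<open>\<open>sh\<close> multiplies the function in a label by \<alpha>,
    \<open>sq\<close> by the defect function; \<open>times_cnj_defect\<close> splits the Gram kernel
    accordingly.\<close>
  define sh where "sh x = (fst x, fst (snd x), times_cnj (snd (snd x)) cid)" for x :: "(complex \<times> complex) \<times> 'l2 \<times> (cdisc \<Rightarrow>\<^sub>C complex)"
  define sq where "sq x = (fst x, fst (snd x), times_cnj (snd (snd x)) cdefect)" for x :: "(complex \<times> complex) \<times> 'l2 \<times> (cdisc \<Rightarrow>\<^sub>C complex)"
  have con: "norm (\<Sum>x\<in>F. c x *\<^sub>C e (sh x)) \<le> norm (\<Sum>x\<in>F. c x *\<^sub>C e x)" if F: "finite F" "F \<subseteq> ?S" for F c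
  proof (rule norm_gram_split[OF _ _ F(1)])
    show "pos_on F (\<lambda>x y. K (sq x) (sq y))"
      by (rule pos_on_reindex[OF K]) (use F(2) in \<open>auto simp: sq_def\<close>)
    fix x y assume "x \<in> F" "y \<in> F"
    then have xy: "x \<in> ?S" "y \<in> ?S" using F(2) by auto
    then have "sh x \<in> ?S" "sh y \<in> ?S" by (auto simp: sh_def)
    then show "cinner (e y) (e x) = cinner (e (sh y)) (e (sh x)) + K (sq x) (sq y)"
      using xy by (simp only: e[symmetric]) (simp add: K_def sh_def sq_def times_cnj_defect[of "snd (snd x)" "snd (snd y)"] k_add)
  qed
  \<comment> \<open>The adjoint of T multiplies the Gram vectors by \<alpha>, in the sense of these
    pairings.\<close>
  obtain T where T: "T \<in> \<B>" "norm T \<le> 1" "\<And>x y. x \<in> ?S \<Longrightarrow> cinner (blinfun_apply T y) (e x) = cinner y (e (sh x))"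
    by (rule contraction_pairing[of ?S "\<lambda>x. e (sh x)" e]) (use con in auto)
  let ?X = "G2 \<times> (UNIV :: 'l2 set)"
  define e1 where "e1 x = e (fst x, snd x, const_bcontfun 1)" for x
  define f where "f x = e (fst x, snd x, smallj (P (fst x)))" for x
  define a where "a x = blinfun_apply ((\<Upsilon>12 (fst x))\<^sup>\<star>) (snd x)" for x
  define b where "b x = blinfun_apply ((\<Upsilon>32 (fst x))\<^sup>\<star>) (snd x)" for x
  have rel: "cinner (2 *\<^sub>C y - fst (fst x) *\<^sub>C blinfun_apply T y) (f x)
      = cinner ((2 * snd (fst x)) *\<^sub>C blinfun_apply T y - fst (fst x) *\<^sub>C y) (e1 x)" if x: "x \<in> ?X" for x y
  proof -
    obtain s p v where xs: "x = ((s, p), v)" by (metis prod.collapse)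
    have z: "(s, p) \<in> G2" using x xs by auto
    let ?j = "smallj (P (s, p))"
    \<comment> \<open>(2 - \<alpha> s) j = 2 \<alpha> p - s as an identity between continuous
      functions on the closed disc. Its image under the antilinear map h -> e (z, v, h) is the
      relation between f, e1 and the adjoint of T.\<close>
    have "2 *\<^sub>C ?j + ((- s) *\<^sub>C times_cnj ?j cid + ((- 2 * p) *\<^sub>C times_cnj (const_bcontfun 1) cid + s *\<^sub>C const_bcontfun 1)) = 0"
    proof (rule bcontfun_eqI)
      fix \<alpha>
      have "2 - of_cdisc \<alpha> * s \<noteq> 0" using G2_denominators(2)[OF z cmod_of_cdisc] by blast
      then have "(2 - of_cdisc \<alpha> * s) * Phi (of_cdisc \<alpha>) (s, p) = 2 * of_cdisc \<alpha> * p - s" by (simp add: Phi_def)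
      then show "apply_bcontfun (2 *\<^sub>C ?j + ((- s) *\<^sub>C times_cnj ?j cid + ((- 2 * p) *\<^sub>C times_cnj (const_bcontfun 1) cid + s *\<^sub>C const_bcontfun 1))) \<alpha> = apply_bcontfun 0 \<alpha>"
        by (simp add: apply_bcontfun_plus apply_bcontfun_scaleC apply_times_cnj apply_cid apply_smallj[OF P[OF z]] sP
            const_bcontfun.rep_eq zero_bcontfun.rep_eq algebra_simps)
    qed
    then have "e ((s, p), v, 2 *\<^sub>C ?j + ((- s) *\<^sub>C times_cnj ?j cid + ((- 2 * p) *\<^sub>C times_cnj (const_bcontfun 1) cid + s *\<^sub>C const_bcontfun 1))) = 0"
      using e_sc[OF z, of v 0 0] by simp
    then have rel0: "2 *\<^sub>C e ((s, p), v, ?j) + (cnj (- s) *\<^sub>C e ((s, p), v, times_cnj ?j cid)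
        + (cnj (- 2 * p) *\<^sub>C e ((s, p), v, times_cnj (const_bcontfun 1) cid) + cnj s *\<^sub>C e ((s, p), v, const_bcontfun 1))) = 0"
      unfolding e_add[OF z] e_sc[OF z] by simp
    have Tj: "cinner (blinfun_apply T y) (e ((s, p), v, h)) = cinner y (e ((s, p), v, times_cnj h cid))" for h
      using T(3)[of "((s, p), v, h)" y] z by (simp add: sh_def)
    have "cinner (2 *\<^sub>C y - s *\<^sub>C blinfun_apply T y) (f x) - cinner ((2 * p) *\<^sub>C blinfun_apply T y - s *\<^sub>C y) (e1 x)
      = cinner y (2 *\<^sub>C e ((s, p), v, ?j) + (cnj (- s) *\<^sub>C e ((s, p), v, times_cnj ?j cid)
        + (cnj (- 2 * p) *\<^sub>C e ((s, p), v, times_cnj (const_bcontfun 1) cid) + cnj s *\<^sub>C e ((s, p), v, const_bcontfun 1))))"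
      by (simp add: xs f_def e1_def cinner_diff_left cinner_scaleC_left cinner_add_right cinner_diff_right cinner_scaleC_right Tj)
    then show ?thesis unfolding rel0 by (simp add: xs)
  qed
  \<comment> \<open>The decomposition with the negative terms moved across: <a, a> + <f, f> = <b, b>
    + <e1, e1> + \<xi>(1).\<close>
  have gram: "norm (\<Sum>x\<in>F. c x *\<^sub>C (b x, e1 x)) \<le> norm (\<Sum>x\<in>F. c x *\<^sub>C (a x, f x))" if F: "finite F" "F \<subseteq> ?X" for F c
  proof (rule norm_gram_split[OF _ _ F(1)])
    show "pos_on F (\<lambda>x y. cinner (blinfun_apply (blinfun_apply (\<xi> (P (fst x)) (P (fst y))) (const_bcontfun 1)) (snd y)) (snd x))"
    proof -
      have "times_cnj (const_bcontfun 1) (const_bcontfun 1) = (const_bcontfun 1 :: cdisc \<Rightarrow>\<^sub>C complex)"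
        by (rule bcontfun_eqI) (simp add: apply_times_cnj const_bcontfun.rep_eq)
      moreover have "pos_on F (\<lambda>x y. cinner (blinfun_apply (blinfun_apply (\<xi> (fst (P (fst x), snd x, c1)) (fst (P (fst y), snd y, c1)))
        (times_cnj (snd (snd (P (fst x), snd x, c1))) (snd (snd (P (fst y), snd y, c1))))) (fst (snd (P (fst y), snd y, c1)))) (fst (snd (P (fst x), snd x, c1))))" for c1
        by (rule pos_on_reindex[OF cp_kernel_pos_on[OF \<xi>], of F "\<lambda>x. (P (fst x), snd x, c1)"]) (use F(2) P in auto)
      from this[of "const_bcontfun 1"] calculation show ?thesis by simp
    qed
    fix x y assume "x \<in> F" "y \<in> F"
    then have G: "fst x \<in> G2" "fst y \<in> G2" using F(2) by auto
    have J0: "bigJ (P z) = 0" if "z \<in> G2" for z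
      by (rule bcontfun_eqI, subst apply_bigJ[OF P[OF that]]) (simp add: P_def psi_zero)
    have tJ: "times_cnj (bigJ (P (fst x))) (bigJ (P (fst y))) = 0"
      by (rule bcontfun_eqI) (simp add: apply_times_cnj J0[OF G(1)] zero_bcontfun.rep_eq)
    have t1: "times_cnj (const_bcontfun 1) (const_bcontfun 1) = (const_bcontfun 1 :: cdisc \<Rightarrow>\<^sub>C complex)"
      by (rule bcontfun_eqI) (simp add: apply_times_cnj const_bcontfun.rep_eq)
    have j0: "apply_bcontfun (smallj (P z)) o0 = - fst z / 2" if "z \<in> G2" for z
      by (simp add: apply_smallj[OF P[OF that]] o0 sP Phi_0)
    have "cinner (a y) (a x) - cinner (b y) (b x)
      = cinner (blinfun_apply ((\<Upsilon>12 (fst x) o\<^sub>L (\<Upsilon>12 (fst y))\<^sup>\<star>) - (\<Upsilon>32 (fst x) o\<^sub>L (\<Upsilon>32 (fst y))\<^sup>\<star>)) (snd y)) (snd x)"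
      using \<Upsilon>12 \<Upsilon>32 G by (simp add: cinner_defect a_def b_def)
    also have "\<dots> = cinner (blinfun_apply (blinfun_apply (\<xi> (P (fst x)) (P (fst y))) (const_bcontfun 1)) (snd y)) (snd x)
        + k (fst x) (fst y) (const_bcontfun 1 - times_cnj (smallj (P (fst x))) (smallj (P (fst y)))) (snd y) (snd x)"
      using eq[OF P[OF G(1)] P[OF G(2)]]
      by (simp add: sP tJ k_def blinfun.add_left cinner_add_left scaleC_blinfun.rep_eq cinner_scaleC_left
          apply_bcontfun_minus const_bcontfun.rep_eq apply_times_cnj j0[OF G(1)] j0[OF G(2)])
    finally have "cinner (a y) (a x) - cinner (b y) (b x)
      = cinner (blinfun_apply (blinfun_apply (\<xi> (P (fst x)) (P (fst y))) (const_bcontfun 1)) (snd y)) (snd x)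
        + cinner (e1 y) (e1 x) - cinner (f y) (f x)"
      by (simp add: e1_def f_def ee G k_minus t1)
    then show "cinner (a y, f y) (a x, f x) = cinner (b y, e1 y) (b x, e1 x)
      + cinner (blinfun_apply (blinfun_apply (\<xi> (P (fst x)) (P (fst y))) (const_bcontfun 1)) (snd y)) (snd x)"
      by (simp add: cinner_prod_def algebra_simps)
  qed
  obtain Y :: "complex \<times> complex \<Rightarrow> ('l3 \<Rightarrow>\<^sub>L 'l1)" where Y: "Y \<in> Hinf G2" "\<And>z. z \<in> G2 \<Longrightarrow> norm (Y z) \<le> 1"
    "\<And>x c. x \<in> ?X \<Longrightarrow> cinner (blinfun_apply (Y (fst (fst x), snd (fst x))) c) (a x) = cinner c (b x)"
    by (rule realization[of ?X "\<lambda>x. fst (fst x)" "\<lambda>x. snd (fst x)" T f e1 b a]) (use T rel gram in auto)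
  show ?thesis
  proof (rule that[OF Y(1,2)])
    fix z :: "complex \<times> complex" assume z: "z \<in> G2"
    show "\<Upsilon>12 z o\<^sub>L Y z = \<Upsilon>32 z"
    proof (rule blinfun_eqI)
      fix c
      have eq': "cinner (blinfun_apply (\<Upsilon>12 z o\<^sub>L Y z) c) v = cinner (blinfun_apply (\<Upsilon>32 z) c) v" for v
        using Y(3)[of "(z, v)" c] z \<Upsilon>12 \<Upsilon>32 by (simp add: a_def b_def cinner_cadjoint)
      have "cinner (blinfun_apply (\<Upsilon>12 z o\<^sub>L Y z) c - blinfun_apply (\<Upsilon>32 z) c)
          (blinfun_apply (\<Upsilon>12 z o\<^sub>L Y z) c - blinfun_apply (\<Upsilon>32 z) c) = 0"
        unfolding cinner_diff_left eq' by simp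
      then show "blinfun_apply (\<Upsilon>12 z o\<^sub>L Y z) c = blinfun_apply (\<Upsilon>32 z) c" by simp
    qed
  qed
qed

section \<open>Completely positive forms on function spaces\<close>

text \<open>A completely positive kernel with scalar values; the vectors of the Hilbert space are
  meant to be part of the points. Boundedness in h is a consequence, see
  \<open>cp_form_bound\<close>.\<close>

definition cp_form :: "('x \<Rightarrow> 'x \<Rightarrow> (cdisc \<Rightarrow>\<^sub>C complex) \<Rightarrow> complex) \<Rightarrow> bool"
  where "cp_form \<mu> \<longleftrightarrow> (\<forall>x y g h. \<mu> x y (g + h) = \<mu> x y g + \<mu> x y h) \<and> (\<forall>x y c h. \<mu> x y (c *\<^sub>C h) = c * \<mu> x y h) \<and>
    pos_on UNIV (\<lambda>p q. \<mu> (fst p) (fst q) (times_cnj (snd p) (snd q)))"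

abbreviation (input) defect :: "(cdisc \<Rightarrow>\<^sub>C complex) \<Rightarrow> (cdisc \<Rightarrow>\<^sub>C complex) \<Rightarrow> (cdisc \<Rightarrow>\<^sub>C complex)"
  where "defect g h \<equiv> const_bcontfun 1 - times_cnj g h"

section \<open>Positive functionals on spaces of continuous functions\<close>

lemma cmod_apply_bcontfun_le: "cmod (apply_bcontfun f \<alpha>) \<le> norm f"
  by (rule norm_bounded)

lemma times_cnj_one_right: "times_cnj h (const_bcontfun 1) = h"
  by (rule bcontfun_eqI) (simp add: apply_times_cnj)

lemma times_cnj_complement:
  assumes f: "\<And>\<alpha>. cmod (apply_bcontfun f \<alpha>) \<le> r"
  obtains k where "times_cnj k k = complex_of_real (r\<^sup>2) *\<^sub>C const_bcontfun 1 - times_cnj f f"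
proof -
  define k where "k = Bcontfun (\<lambda>\<alpha>. complex_of_real (sqrt (r\<^sup>2 - (cmod (apply_bcontfun f \<alpha>))\<^sup>2)))"
  have le: "(cmod (apply_bcontfun f \<alpha>))\<^sup>2 \<le> r\<^sup>2" for \<alpha> by (rule power_mono[OF f]) simp
  have "norm (complex_of_real (sqrt (r\<^sup>2 - (cmod (apply_bcontfun f \<alpha>))\<^sup>2))) \<le> \<bar>r\<bar>" for \<alpha>
    using le[of \<alpha>] by (simp add: real_sqrt_le_iff flip: real_sqrt_abs)
  moreover have "continuous_on UNIV (\<lambda>\<alpha>. complex_of_real (sqrt (r\<^sup>2 - (cmod (apply_bcontfun f \<alpha>))\<^sup>2)))"
    by (intro continuous_on_of_real continuous_on_real_sqrt continuous_on_diff continuous_on_const continuous_on_power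
        continuous_on_norm continuous_on_apply_bcontfun)
  ultimately have "(\<lambda>\<alpha>. complex_of_real (sqrt (r\<^sup>2 - (cmod (apply_bcontfun f \<alpha>))\<^sup>2))) \<in> bcontfun"
    by (intro bcontfun_normI)
  from Bcontfun_inverse[OF this]
  have ak: "apply_bcontfun k \<alpha> = complex_of_real (sqrt (r\<^sup>2 - (cmod (apply_bcontfun f \<alpha>))\<^sup>2))" for \<alpha>
    by (simp add: k_def)
  have "times_cnj k k = complex_of_real (r\<^sup>2) *\<^sub>C const_bcontfun 1 - times_cnj f f"
  proof (rule bcontfun_eqI)
    fix \<alpha>
    have "apply_bcontfun (times_cnj k k) \<alpha> = complex_of_real (r\<^sup>2 - (cmod (apply_bcontfun f \<alpha>))\<^sup>2)"
      unfolding apply_times_cnj ak complex_cnj_complex_of_real of_real_mult[symmetric] using le[of \<alpha>] by simp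
    also have "\<dots> = apply_bcontfun (complex_of_real (r\<^sup>2) *\<^sub>C const_bcontfun 1 - times_cnj f f) \<alpha>"
      by (simp add: apply_bcontfun_minus apply_bcontfun_scaleC apply_times_cnj complex_norm_square[symmetric])
    finally show "apply_bcontfun (times_cnj k k) \<alpha> = apply_bcontfun (complex_of_real (r\<^sup>2) *\<^sub>C const_bcontfun 1 - times_cnj f f) \<alpha>" .
  qed
  then show ?thesis by (rule that)
qed

text \<open>r^2 - |f|^2 has the form k conj k, so the functional is nonnegative on it.\<close>

lemma positive_functional_le:
  fixes \<phi> :: "('t::topological_space \<Rightarrow>\<^sub>C complex) \<Rightarrow> complex"
  assumes add: "\<And>g h. \<phi> (g + h) = \<phi> g + \<phi> h" and sc: "\<And>c h. \<phi> (c *\<^sub>C h) = c * \<phi> h"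
    and pos: "\<And>k. 0 \<le> \<phi> (times_cnj k k)" and f: "\<And>\<alpha>. cmod (apply_bcontfun f \<alpha>) \<le> r"
  shows "\<phi> (times_cnj f f) \<le> complex_of_real (r\<^sup>2) * \<phi> (const_bcontfun 1)"
proof -
  obtain k where "times_cnj k k = complex_of_real (r\<^sup>2) *\<^sub>C const_bcontfun 1 - times_cnj f f"
    by (rule times_cnj_complement[OF f])
  then have "times_cnj k k + times_cnj f f = complex_of_real (r\<^sup>2) *\<^sub>C const_bcontfun 1" by simp
  then have "\<phi> (times_cnj k k) + \<phi> (times_cnj f f) = complex_of_real (r\<^sup>2) * \<phi> (const_bcontfun 1)"
    unfolding add[symmetric] sc[symmetric] by (rule arg_cong)
  then show ?thesis using pos[of k] by (simp add: less_eq_complex_def complex_eq_iff)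
qed

text \<open>As |j|^2 <= m^2, the value on |j|^2 is at most the share m^2 of the mass \<phi>(1), so
  the value on the defect controls the mass.\<close>

lemma positive_functional_one_le:
  fixes \<phi> :: "('t::topological_space \<Rightarrow>\<^sub>C complex) \<Rightarrow> complex"
  assumes add: "\<And>g h. \<phi> (g + h) = \<phi> g + \<phi> h" and sc: "\<And>c h. \<phi> (c *\<^sub>C h) = c * \<phi> h"
    and pos: "\<And>k. 0 \<le> \<phi> (times_cnj k k)" and j: "\<And>\<alpha>. cmod (apply_bcontfun j \<alpha>) \<le> m" and m: "0 \<le> m" "m < 1"
  shows "Re (\<phi> (const_bcontfun 1)) \<le> Re (\<phi> (const_bcontfun 1 - times_cnj j j)) / (1 - m\<^sup>2)"
proof -
  have "\<phi> (const_bcontfun 1 - times_cnj j j) + \<phi> (times_cnj j j) = \<phi> (const_bcontfun 1)"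
    unfolding add[symmetric] by simp
  moreover have "Re (\<phi> (times_cnj j j)) \<le> m\<^sup>2 * Re (\<phi> (const_bcontfun 1))"
    using positive_functional_le[of \<phi>, OF add sc pos j] by (simp add: less_eq_complex_def)
  ultimately have "(1 - m\<^sup>2) * Re (\<phi> (const_bcontfun 1)) \<le> Re (\<phi> (const_bcontfun 1 - times_cnj j j))"
    by (simp add: left_diff_distrib complex_eq_iff)
  moreover have "0 < 1 - m\<^sup>2" using m by (simp add: power_less_one_iff abs_square_less_1)
  ultimately show ?thesis by (simp add: pos_le_divide_eq mult.commute)
qed

lemma cp_formD:
  assumes "cp_form \<mu>"
  shows "\<mu> x y (g + h) = \<mu> x y g + \<mu> x y h" "\<mu> x y (c *\<^sub>C h) = c * \<mu> x y h"
    "pos_on UNIV (\<lambda>p q. \<mu> (fst p) (fst q) (times_cnj (snd p) (snd q)))"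
  using assms unfolding cp_form_def by auto

lemma cp_form_diag: "cp_form \<mu> \<Longrightarrow> 0 \<le> \<mu> x x (times_cnj k k)"
  using pos_on_diag[OF cp_formD(3), of \<mu> "(x, k)"] by simp

text \<open>Cauchy-Schwarz between the Gram vectors at (x, h) and (y, 1). All values are thus
  controlled by the diagonal masses, as compactness requires.\<close>

lemma cp_form_bound:
  assumes \<mu>: "cp_form \<mu>"
  shows "cmod (\<mu> x y h) \<le> norm h * sqrt (Re (\<mu> x x (const_bcontfun 1))) * sqrt (Re (\<mu> y y (const_bcontfun 1)))"
proof -
  obtain e :: "'a \<times> (cdisc \<Rightarrow>\<^sub>C complex) \<Rightarrow> ('a \<times> (cdisc \<Rightarrow>\<^sub>C complex)) ell2"
    where e: "\<And>p q. p \<in> UNIV \<Longrightarrow> q \<in> UNIV \<Longrightarrow> \<mu> (fst p) (fst q) (times_cnj (snd p) (snd q)) = cinner (e q) (e p)"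
    using kolmogorov[OF cp_formD(3)[OF \<mu>]] by blast
  have n: "(norm (e (z, g)))\<^sup>2 = Re (\<mu> z z (times_cnj g g))" for z g
    using e[of "(z, g)" "(z, g)"] by (simp add: cinner_self)
  have "Re (\<mu> x x (times_cnj h h)) \<le> (norm h)\<^sup>2 * Re (\<mu> x x (const_bcontfun 1))"
    using positive_functional_le[of "\<mu> x x" h "norm h", OF cp_formD(1,2)[OF \<mu>] cp_form_diag[OF \<mu>] cmod_apply_bcontfun_le]
    by (simp add: less_eq_complex_def)
  then have "norm (e (x, h)) \<le> sqrt ((norm h)\<^sup>2 * Re (\<mu> x x (const_bcontfun 1)))"
    unfolding n[symmetric] by (rule real_le_rsqrt)
  then have nx: "norm (e (x, h)) \<le> norm h * sqrt (Re (\<mu> x x (const_bcontfun 1)))" by (simp add: real_sqrt_mult)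
  have ny: "norm (e (y, const_bcontfun 1)) \<le> sqrt (Re (\<mu> y y (const_bcontfun 1)))"
    using n[of y "const_bcontfun 1"] unfolding times_cnj_one_right by (intro real_le_rsqrt) simp
  have "cmod (\<mu> x y h) = cmod (cinner (e (y, const_bcontfun 1)) (e (x, h)))"
    using e[of "(x, h)" "(y, const_bcontfun 1)"] by (simp add: times_cnj_one_right)
  also have "\<dots> \<le> norm (e (y, const_bcontfun 1)) * norm (e (x, h))" by (rule cinner_Cauchy_Schwarz)
  also have "\<dots> \<le> sqrt (Re (\<mu> y y (const_bcontfun 1))) * (norm h * sqrt (Re (\<mu> x x (const_bcontfun 1))))"
    by (rule mult_mono[OF ny nx]) (use order_trans[OF norm_ge_zero ny] in auto)
  finally show ?thesis by (simp add: mult_ac)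
qed

text \<open>Separation gives information on real parts only, and the matrix of its functional may
  fail to be hermitian. Against a hermitian P the hermitian average of q yields the same real part,
  and the sum becomes real.\<close>

lemma hermitian_average:
  assumes P: "\<And>x y. x \<in> I \<Longrightarrow> y \<in> I \<Longrightarrow> P y x = cnj (P x y)"
  shows "(\<Sum>x\<in>I. \<Sum>y\<in>I. P x y * ((q x y + cnj (q y x)) / 2)) = complex_of_real (Re (\<Sum>x\<in>I. \<Sum>y\<in>I. P x y * q x y))"
proof -
  have "(\<Sum>x\<in>I. \<Sum>y\<in>I. P x y * cnj (q y x)) = (\<Sum>x\<in>I. \<Sum>y\<in>I. cnj (P y x * q y x))"
  proof (intro sum.cong refl)
    fix x y assume "x \<in> I" "y \<in> I"
    then show "P x y * cnj (q y x) = cnj (P y x * q y x)" unfolding P[OF \<open>x \<in> I\<close> \<open>y \<in> I\<close>] by simp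
  qed
  also have "\<dots> = cnj (\<Sum>x\<in>I. \<Sum>y\<in>I. P x y * q x y)" by (subst sum.swap) (simp add: cnj_sum)
  finally have *: "(\<Sum>x\<in>I. \<Sum>y\<in>I. P x y * cnj (q y x)) = cnj (\<Sum>x\<in>I. \<Sum>y\<in>I. P x y * q x y)" .
  have "(\<Sum>x\<in>I. \<Sum>y\<in>I. P x y * ((q x y + cnj (q y x)) / 2)) =
    ((\<Sum>x\<in>I. \<Sum>y\<in>I. P x y * q x y) + (\<Sum>x\<in>I. \<Sum>y\<in>I. P x y * cnj (q y x))) / 2"
    by (simp add: sum.distrib[symmetric] sum_divide_distrib distrib_left add_divide_distrib)
  then show ?thesis unfolding * complex_add_cnj by simp
qed

lemma cp_form_evaluation:
  "cp_form (\<lambda>x y h. a x * cnj (a y) * apply_bcontfun h \<alpha>)"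
  unfolding cp_form_def
proof (intro conjI allI)
  have "pos_on UNIV (\<lambda>p q. cinner (cnj (a (fst q) * apply_bcontfun (snd q) \<alpha>)) (cnj (a (fst p) * apply_bcontfun (snd p) \<alpha>)))"
    by (rule pos_on_gram)
  then show "pos_on UNIV (\<lambda>p q. a (fst p) * cnj (a (fst q)) * apply_bcontfun (times_cnj (snd p) (snd q)) \<alpha>)"
    by (rule pos_on_cong[rotated]) (simp add: cinner_complex_def apply_times_cnj)
qed (simp_all add: apply_bcontfun_plus apply_bcontfun_scaleC distrib_left)

lemma cp_form_congruence:
  assumes \<mu>: "cp_form \<mu>"
  shows "cp_form (\<lambda>x y h. a x * cnj (a y) * \<mu> x y h)"
  unfolding cp_form_def using pos_on_congruence[OF cp_formD(3)[OF \<mu>], of "\<lambda>p. a (fst p)"]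
  by (simp add: cp_formD(1,2)[OF \<mu>] distrib_left)

lemma cp_form_add: "cp_form \<mu> \<Longrightarrow> cp_form \<nu> \<Longrightarrow> cp_form (\<lambda>x y h. \<mu> x y h + \<nu> x y h)"
  unfolding cp_form_def by (auto simp: distrib_left intro: pos_on_add)

lemma cp_form_zero: "cp_form (\<lambda>x y h. 0)"
  unfolding cp_form_def pos_on_def by simp

lemma cp_form_scaleR: "cp_form \<mu> \<Longrightarrow> 0 \<le> r \<Longrightarrow> cp_form (\<lambda>x y h. complex_of_real r * \<mu> x y h)"
  unfolding cp_form_def by (auto simp: distrib_left intro: pos_on_scaleR)

text \<open>The separating functional is tested against the evaluations at the points of the disc.\<close>

lemma cp_form_approximation:
  fixes D :: "'x \<Rightarrow> 'x \<Rightarrow> complex" and J :: "'x \<Rightarrow> cdisc \<Rightarrow>\<^sub>C complex"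
  assumes I: "finite I" and D: "\<And>x y. x \<in> I \<Longrightarrow> y \<in> I \<Longrightarrow> D y x = cnj (D x y)"
    and dual: "\<And>K. (\<And>\<alpha>. pos_on I (\<lambda>x y. apply_bcontfun (defect (J x) (J y)) \<alpha> * K x y)) \<Longrightarrow>
      0 \<le> Re (\<Sum>x\<in>I. \<Sum>y\<in>I. D x y * K x y)" and \<epsilon>: "0 < \<epsilon>"
  obtains \<mu> where "cp_form \<mu>" "\<And>x y h. x \<notin> I \<or> y \<notin> I \<Longrightarrow> \<mu> x y h = 0"
    "\<And>x y. x \<in> I \<Longrightarrow> y \<in> I \<Longrightarrow> cmod (D x y - \<mu> x y (defect (J x) (J y))) \<le> \<epsilon>"
proof -
  \<comment> \<open>Matrices over I as vectors of a Hilbert space, where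
    \<open>cone_separation\<close> applies.\<close>
  define M :: "('x \<Rightarrow> 'x \<Rightarrow> complex) \<Rightarrow> ('x \<times> 'x) ell2"
    where "M f = (\<Sum>p\<in>I \<times> I. f (fst p) (snd p) *\<^sub>C edelta p)" for f
  have cM: "cinner (M f) k = (\<Sum>x\<in>I. \<Sum>y\<in>I. f x y * cinner (edelta (x, y)) k)" for f k
    by (simp add: M_def cinner_sum_left cinner_scaleC_left sum.cartesian_product case_prod_unfold)
  have entry: "cmod (f x y) \<le> norm (M f)" if "x \<in> I" "y \<in> I" for f x y
  proof -
    have "cinner (M f) (edelta (x, y)) = (\<Sum>p\<in>I \<times> I. if p = (x, y) then f x y else 0)"
      unfolding M_def cinner_sum_left cinner_scaleC_left
      by (intro sum.cong refl) (auto simp: cinner_edelta edelta.rep_eq)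
    then have "cinner (M f) (edelta (x, y)) = f x y" using that I by simp
    moreover have "norm (edelta (x, y)) = 1"
    proof -
      have "complex_of_real ((norm (edelta (x, y)))\<^sup>2) = complex_of_real 1"
        unfolding cinner_self[symmetric] by (simp add: cinner_edelta edelta.rep_eq)
      then have "(norm (edelta (x, y)))\<^sup>2 = 1" unfolding of_real_eq_iff .
      then show ?thesis using norm_ge_zero[of "edelta (x, y)"] by (simp add: power2_eq_1_iff)
    qed
    ultimately show ?thesis using cinner_Cauchy_Schwarz[of "M f" "edelta (x, y)"] by simp
  qed
  have M_add: "M (\<lambda>x y. f x y + g x y) = M f + M g" for f g
    by (simp add: M_def scaleC_add_left sum.distrib)
  have M_diff: "M (\<lambda>x y. f x y - g x y) = M f - M g" for f g
    using M_add[of "\<lambda>x y. f x y - g x y" g] by simp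
  have M_sc: "M (\<lambda>x y. complex_of_real r * f x y) = r *\<^sub>R M f" for r f
    by (simp add: M_def scaleC_sum_right scaleR_scaleC scaleC_scaleC)
  have M_0: "M (\<lambda>x y. 0) = 0" by (simp add: M_def)
  define C where "C = {M (\<lambda>x y. \<mu> x y (defect (J x) (J y))) | \<mu>. cp_form \<mu>}"
  have "\<exists>\<mu>. cp_form \<mu> \<and> norm (M D - M (\<lambda>x y. \<mu> x y (defect (J x) (J y)))) < \<epsilon>"
  proof (rule ccontr)
    assume no: "\<not> ?thesis"
    obtain \<kappa> where \<kappa>: "\<And>X. X \<in> C \<Longrightarrow> 0 \<le> Re (cinner X \<kappa>)" "Re (cinner (M D) \<kappa>) < 0"
    proof (rule cone_separation[of C \<epsilon> "M D"])
      fix X Y assume "X \<in> C" "Y \<in> C"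
      then obtain \<mu> \<nu> where "cp_form \<mu>" "cp_form \<nu>" "X = M (\<lambda>x y. \<mu> x y (defect (J x) (J y)))"
        "Y = M (\<lambda>x y. \<nu> x y (defect (J x) (J y)))" unfolding C_def by blast
      then show "X + Y \<in> C" unfolding C_def
        by (intro CollectI exI[of _ "\<lambda>x y h. \<mu> x y h + \<nu> x y h"]) (simp add: M_add cp_form_add)
    next
      fix r :: real and X assume "0 \<le> r" "X \<in> C"
      then obtain \<mu> where "cp_form \<mu>" "X = M (\<lambda>x y. \<mu> x y (defect (J x) (J y)))" unfolding C_def by blast
      then show "r *\<^sub>R X \<in> C" unfolding C_def
        by (intro CollectI exI[of _ "\<lambda>x y h. complex_of_real r * \<mu> x y h"]) (simp add: M_sc cp_form_scaleR \<open>0 \<le> r\<close>)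
    next
      show "0 \<in> C" unfolding C_def
        by (intro CollectI exI[of _ "\<lambda>x y h. 0"]) (simp add: M_0 cp_form_zero)
    next
      fix X assume "X \<in> C"
      then show "\<epsilon> \<le> norm (M D - X)" using no unfolding C_def by (auto simp: not_less)
    qed (use \<epsilon> in auto)
    \<comment> \<open>q is the matrix of the separating functional, K its hermitian part.\<close>
    define q where "q x y = cinner (edelta (x, y)) \<kappa>" for x y
    define K where "K x y = (q x y + cnj (q y x)) / 2" for x y
    have "0 \<le> Re (\<Sum>x\<in>I. \<Sum>y\<in>I. D x y * K x y)"
    proof (rule dual)
      fix \<alpha>
      show "pos_on I (\<lambda>x y. apply_bcontfun (defect (J x) (J y)) \<alpha> * K x y)"
        unfolding pos_on_def
      proof (intro allI impI, elim conjE)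
        fix F c assume F: "finite F" "F \<subseteq> I"
        \<comment> \<open>The evaluation at \<alpha>, weighted by a, is the element of the cone that
          tests positivity on the coefficients c.\<close>
        define a where "a x = (if x \<in> F then cnj (c x) else 0)" for x
        define P where "P x y = a x * cnj (a y) * apply_bcontfun (defect (J x) (J y)) \<alpha>" for x y
        have "M P \<in> C" unfolding C_def P_def
          by (intro CollectI exI[of _ "\<lambda>x y h. a x * cnj (a y) * apply_bcontfun h \<alpha>"]) (simp add: cp_form_evaluation)
        from \<kappa>(1)[OF this] have "0 \<le> Re (\<Sum>x\<in>I. \<Sum>y\<in>I. P x y * q x y)"
          unfolding cM q_def .
        then have "0 \<le> (\<Sum>x\<in>I. \<Sum>y\<in>I. P x y * K x y)"
          unfolding K_def
          by (subst hermitian_average) (simp add: P_def apply_bcontfun_minus apply_times_cnj, simp add: less_eq_complex_def del: Re_sum)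
        also have "(\<Sum>x\<in>I. \<Sum>y\<in>I. P x y * K x y) = (\<Sum>x\<in>F. \<Sum>y\<in>F. P x y * K x y)"
          using F(2) I by (intro sum.mono_neutral_cong_right ballI) (auto simp: P_def a_def)
        also have "\<dots> = (\<Sum>x\<in>F. \<Sum>y\<in>F. cnj (c x) * c y * (apply_bcontfun (defect (J x) (J y)) \<alpha> * K x y))"
          by (intro sum.cong refl) (simp add: P_def a_def)
        finally show "0 \<le> (\<Sum>x\<in>F. \<Sum>y\<in>F. cnj (c x) * c y * (apply_bcontfun (defect (J x) (J y)) \<alpha> * K x y))" .
      qed
    qed
    also have "\<dots> = Re (cinner (M D) \<kappa>)"
      unfolding K_def cM q_def by (subst hermitian_average) (rule D, assumption+, rule Re_complex_of_real)
    finally show False using \<kappa>(2) by simp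
  qed
  then obtain \<mu> where \<mu>: "cp_form \<mu>" "norm (M D - M (\<lambda>x y. \<mu> x y (defect (J x) (J y)))) < \<epsilon>" by blast
  \<comment> \<open>Cutting off by the indicator of I is a congruence: it keeps complete positivity
    and the values on I.\<close>
  let ?a = "\<lambda>x. if x \<in> I then 1 else 0 :: complex"
  show ?thesis
  proof (rule that[OF cp_form_congruence[OF \<mu>(1), of ?a]])
    fix x y assume xy: "x \<in> I" "y \<in> I"
    show "cmod (D x y - ?a x * cnj (?a y) * \<mu> x y (defect (J x) (J y))) \<le> \<epsilon>"
      using entry[OF xy, of "\<lambda>x y. D x y - \<mu> x y (defect (J x) (J y))"] \<mu>(2) xy by (simp add: M_diff)
  qed auto
qed

text \<open>Tychonoff for a product of discs over all (x, y, h). The sets \<open>G\<close> are cut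
  out by closed conditions on finitely many coordinates each; the radii come from the bound on the
  masses, which is uniform for errors up to 1, and the approximants fit everywhere since they vanish
  off I.\<close>

lemma cp_form_compactness:
  fixes D :: "'x \<Rightarrow> 'x \<Rightarrow> complex" and J :: "'x \<Rightarrow> cdisc \<Rightarrow>\<^sub>C complex"
  assumes approx: "\<And>I \<epsilon>. finite I \<Longrightarrow> I \<subseteq> S \<Longrightarrow> 0 < \<epsilon> \<Longrightarrow>
      \<exists>\<mu>. cp_form \<mu> \<and> (\<forall>x y h. x \<notin> I \<or> y \<notin> I \<longrightarrow> \<mu> x y h = 0) \<and>
        (\<forall>x\<in>I. \<forall>y\<in>I. cmod (D x y - \<mu> x y (defect (J x) (J y))) \<le> \<epsilon>)"
    and m: "\<And>x. x \<in> S \<Longrightarrow> \<exists>m. 0 \<le> m \<and> m < 1 \<and> (\<forall>\<alpha>. cmod (apply_bcontfun (J x) \<alpha>) \<le> m)"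
  obtains \<mu> where "cp_form \<mu>" "\<And>x y. x \<in> S \<Longrightarrow> y \<in> S \<Longrightarrow> \<mu> x y (defect (J x) (J y)) = D x y"
proof -
  obtain m where m: "\<And>x. x \<in> S \<Longrightarrow> 0 \<le> m x" "\<And>x. x \<in> S \<Longrightarrow> m x < 1"
    "\<And>x \<alpha>. x \<in> S \<Longrightarrow> cmod (apply_bcontfun (J x) \<alpha>) \<le> m x"
    using m by metis
  \<comment> \<open>The summand 1 majorizes the approximation error; the absolute value keeps b
    nonnegative at points outside S, where m is unconstrained.\<close>
  define b where "b x = sqrt \<bar>(cmod (D x x) + 1) / (1 - (m x)\<^sup>2)\<bar>" for x
  have b0: "0 \<le> b x" for x by (simp add: b_def)
  define B :: "('x \<times> 'x \<times> (cdisc \<Rightarrow>\<^sub>C complex) \<Rightarrow> complex) set" where "B = (\<Pi>\<^sub>E p\<in>UNIV. cball (0::complex) (norm (snd (snd p)) * b (fst p) * b (fst (snd p)) ))"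
  define G where "G = (\<lambda>(I, n::nat). {\<nu> :: 'x \<times> 'x \<times> (cdisc \<Rightarrow>\<^sub>C complex) \<Rightarrow> complex. cp_form (\<lambda>x y h. \<nu> (x, y, h)) \<and>
    (\<forall>x\<in>I. \<forall>y\<in>I. cmod (D x y - \<nu> (x, y, defect (J x) (J y))) \<le> 1 / Suc n)})"
  have "compactin (product_topology (\<lambda>p. euclidean) UNIV) B"
    unfolding B_def compactin_PiE by simp
  then have B: "compact B" by (simp add: euclidean_product_topology)
  have clo: "closed (G p)" for p
  proof -
    have "closed {\<nu> :: 'x \<times> 'x \<times> (cdisc \<Rightarrow>\<^sub>C complex) \<Rightarrow> complex. cp_form (\<lambda>x y h. \<nu> (x, y, h))}"
      unfolding cp_form_def pos_on_def less_eq_complex_def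
      by (intro closed_Collect_conj closed_Collect_all closed_Collect_imp open_Collect_const closed_Collect_eq closed_Collect_le
          continuous_intros continuous_on_product_coordinates)
    moreover have "closed {\<nu> :: 'x \<times> 'x \<times> (cdisc \<Rightarrow>\<^sub>C complex) \<Rightarrow> complex. cmod (D x y - \<nu> (x, y, defect (J x) (J y))) \<le> r}" for x y r
      by (intro closed_Collect_le continuous_intros continuous_on_product_coordinates)
    ultimately show ?thesis
      unfolding G_def case_prod_unfold Ball_def
      by (intro closed_Collect_conj closed_Collect_all closed_Collect_imp open_Collect_const) auto
  qed
  have ne: "B \<inter> (\<Inter>p\<in>P. G p) \<noteq> {}" if P: "finite P" "P \<subseteq> {I. finite I \<and> I \<subseteq> S} \<times> UNIV" for P
  proof -
    \<comment> \<open>The union of the point sets and the sum of the accuracy indices dominate all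
      conditions in P at once.\<close>
    define I where "I = (\<Union>p\<in>P. fst p)"
    define N where "N = (\<Sum>p\<in>P. snd p)"
    have PS: "finite (fst p)" "fst p \<subseteq> S" if "p \<in> P" for p using subsetD[OF P(2) that] by auto
    have I: "finite I" "I \<subseteq> S" using P(1) PS unfolding I_def by blast+
    obtain \<mu> where \<mu>: "cp_form \<mu>" "\<And>x y h. x \<notin> I \<or> y \<notin> I \<Longrightarrow> \<mu> x y h = 0"
      "\<And>x y. x \<in> I \<Longrightarrow> y \<in> I \<Longrightarrow> cmod (D x y - \<mu> x y (defect (J x) (J y))) \<le> 1 / Suc N"
      using approx[OF I, of "1 / Suc N"] by auto
    define \<nu> where "\<nu> = (\<lambda>p. \<mu> (fst p) (fst (snd p)) (snd (snd p)))"
    have bx: "sqrt (Re (\<mu> x x (const_bcontfun 1))) \<le> b x" if x: "x \<in> I" for x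
    proof -
      have xS: "x \<in> S" using x I(2) by blast
      have "Re (\<mu> x x (defect (J x) (J x))) \<le> cmod (D x x) + cmod (D x x - \<mu> x x (defect (J x) (J x)))"
        using complex_Re_le_cmod[of "\<mu> x x (defect (J x) (J x))"]
          norm_triangle_ineq4[of "D x x" "D x x - \<mu> x x (defect (J x) (J x))"] by simp
      moreover have "1 / real (Suc N) \<le> 1" by simp
      ultimately have "Re (\<mu> x x (defect (J x) (J x))) \<le> cmod (D x x) + 1"
        using \<mu>(3)[OF x x] by linarith
      moreover have "0 < 1 - (m x)\<^sup>2" using m(1,2)[OF xS] by (simp add: abs_square_less_1)
      ultimately have "Re (\<mu> x x (const_bcontfun 1)) \<le> (cmod (D x x) + 1) / (1 - (m x)\<^sup>2)"
        using positive_functional_one_le[of "\<mu> x x" "J x" "m x", OF cp_formD(1,2)[OF \<mu>(1)] cp_form_diag[OF \<mu>(1)] m(3)[OF xS] m(1,2)[OF xS]]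
        by (meson divide_right_mono less_imp_le order_trans)
      then show ?thesis unfolding b_def by (intro real_sqrt_le_mono) (erule order_trans[OF _ abs_ge_self])
    qed
    have "\<nu> \<in> B"
      unfolding B_def
    proof (rule PiE_I)
      fix p :: "'x \<times> 'x \<times> (cdisc \<Rightarrow>\<^sub>C complex)"
      obtain x y h where p: "p = (x, y, h)" by (metis prod.collapse)
      show "\<nu> p \<in> cball 0 (norm (snd (snd p)) * b (fst p) * b (fst (snd p)))"
      proof (cases "x \<in> I \<and> y \<in> I")
        case True
        have "cmod (\<mu> x y h) \<le> norm h * sqrt (Re (\<mu> x x (const_bcontfun 1))) * sqrt (Re (\<mu> y y (const_bcontfun 1)))"
          by (rule cp_form_bound[OF \<mu>(1)])
        also have "\<dots> \<le> norm h * b x * b y"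
          using True bx b0 cp_form_diag[OF \<mu>(1), of y "const_bcontfun 1"]
          by (intro mult_mono mult_left_mono mult_nonneg_nonneg) (auto simp: times_cnj_one_right less_eq_complex_def)
        finally show ?thesis by (simp add: p \<nu>_def)
      next
        case False
        then show ?thesis using \<mu>(2)[of x y h] b0 by (simp add: p \<nu>_def)
      qed
    qed simp
    moreover have "\<nu> \<in> G p" if p: "p \<in> P" for p
    proof -
      have "fst p \<subseteq> I" using p by (auto simp: I_def)
      moreover have "snd p \<le> N" unfolding N_def using p P(1) by (intro member_le_sum) auto
      then have le: "1 / real (Suc N) \<le> 1 / Suc (snd p)" by (intro divide_left_mono) auto
      ultimately have "cmod (D x y - \<mu> x y (defect (J x) (J y))) \<le> 1 / Suc (snd p)" if "x \<in> fst p" "y \<in> fst p" for x y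
        using that by (intro order_trans[OF \<mu>(3) le]) auto
      then show ?thesis unfolding G_def \<nu>_def case_prod_unfold using \<mu>(1) by simp
    qed
    ultimately show ?thesis by blast
  qed
  have "B \<inter> (\<Inter>p\<in>{I. finite I \<and> I \<subseteq> S} \<times> UNIV. G p) \<noteq> {}"
    by (rule compact_imp_fip_image[OF B clo ne])
  then obtain \<nu> where \<nu>: "\<And>I n. finite I \<Longrightarrow> I \<subseteq> S \<Longrightarrow> \<nu> \<in> G (I, n)" by blast
  show ?thesis
  proof (rule that[of "\<lambda>x y h. \<nu> (x, y, h)"])
    show "cp_form (\<lambda>x y h. \<nu> (x, y, h))" using \<nu>[of "{}"] by (simp add: G_def)
    fix x y assume xy: "x \<in> S" "y \<in> S"
    have "cmod (D x y - \<nu> (x, y, defect (J x) (J y))) \<le> 1 / Suc n" for n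
      using \<nu>[of "{x, y}" n] xy by (simp add: G_def)
    then have "cmod (D x y - \<nu> (x, y, defect (J x) (J y))) \<le> 0"
      by (intro LIMSEQ_le_const[OF LIMSEQ_inverse_real_of_nat]) (auto simp: inverse_eq_divide)
    then show "\<nu> (x, y, defect (J x) (J y)) = D x y" by simp
  qed
qed

section \<open>From positivity to the decomposition\<close>

lemma psd_onI:
  assumes "pos_on (S \<times> UNIV) (\<lambda>p q. cinner (blinfun_apply (k (fst p) (fst q)) (snd q)) (snd p))"
  shows "psd_on S k"
  unfolding psd_on_def
proof (intro allI impI)
  fix n :: nat and z v assume z: "\<forall>i<n. z i \<in> S"
  show "0 \<le> (\<Sum>i<n. \<Sum>j<n. cinner (blinfun_apply (k (z i) (z j)) (v j)) (v i))"
    using pos_on_family[OF assms, of "{..<n}" "\<lambda>i. (z i, v i)" "\<lambda>_. 1"] z by simp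
qed

text \<open>K is spread over operators: the kernel at (0, z), (0, w) is the sum of K x y <., c> b
  over x = (z, b) and y = (w, c) in I. Tested on sums of b \<otimes> b, the block form returns the
  entries of M times those of K. The \<epsilon> term makes the kernel nonzero on the whole
  diagonal.\<close>

lemma positivity_imp_dual:
  fixes M :: "complex \<times> complex \<Rightarrow> complex \<times> complex \<Rightarrow> ('l::chilbert_space \<Rightarrow>\<^sub>L 'l)"
    and K :: "(complex \<times> complex) \<times> 'l \<Rightarrow> (complex \<times> complex) \<times> 'l \<Rightarrow> complex"
  assumes M: "\<And>z w. z \<in> G2 \<Longrightarrow> w \<in> G2 \<Longrightarrow> M z w \<in> \<B>"
    and pos: "\<And>F (k :: _ \<Rightarrow> _ \<Rightarrow> ('l \<Rightarrow>\<^sub>L 'l)). finite F \<Longrightarrow> F \<subseteq> pentablock \<Longrightarrow> admissible_kernel k \<Longrightarrow>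
      block_psd F (\<lambda>z w. M (snd z) (snd w) \<otimes>\<^sub>o k z w)"
    and I: "finite I" "I \<subseteq> G2 \<times> onb"
    and K: "\<And>\<alpha>. pos_on I (\<lambda>x y. apply_bcontfun (defect (smallj (0, fst x)) (smallj (0, fst y))) \<alpha> * K x y)"
  shows "0 \<le> Re (\<Sum>x\<in>I. \<Sum>y\<in>I. cinner (blinfun_apply (M (fst x) (fst y)) (snd y)) (snd x) * K x y)"
proof (cases "I = {}")
  case False
  then obtain b0 :: 'l where b0: "norm b0 = 1" using I(2) orthonormal_onb unfolding orthonormal_def by fastforce
  have IG: "fst x \<in> G2" "snd x \<in> onb" if "x \<in> I" for x using I(2) that by auto
  have P: "(0, fst x) \<in> pentablock" if "x \<in> I" for x
    using zero_in_pentablock[of "fst (fst x)" "snd (fst x)"] IG(1)[OF that] by simp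
  have n1: "norm (snd x) = 1" if "x \<in> I" for x using IG(2)[OF that] orthonormal_onb unfolding orthonormal_def by blast
  have KPhi: "pos_on I (\<lambda>x y. (1 - Phi \<alpha> (fst x) * cnj (Phi \<alpha> (fst y))) * K x y)" if \<alpha>: "cmod \<alpha> \<le> 1" for \<alpha>
  proof -
    have "of_cdisc (Abs_cdisc \<alpha>) = \<alpha>" by (rule Abs_cdisc_inverse) (use \<alpha> in simp)
    then show ?thesis
      by (intro pos_on_cong[OF _ K[of "Abs_cdisc \<alpha>"]]) (simp add: apply_bcontfun_minus apply_times_cnj apply_smallj[OF P])
  qed
  \<comment> \<open>Division by the defect at \<alpha> = 0, where |\<Phi>| < 1, recovers positivity
    of K.\<close>
  have K0: "pos_on I K"
  proof (rule pos_on_cong[OF _ pos_on_divide[OF KPhi[of 0], of "\<lambda>x. Phi 0 (fst x)"]])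
    fix x y assume "x \<in> I" "y \<in> I"
    then have "cmod (Phi 0 (fst x)) < 1" "cmod (Phi 0 (fst y)) < 1" by (auto intro: cmod_Phi_less_1 IG)
    then have "cmod (Phi 0 (fst x)) * cmod (Phi 0 (fst y)) < 1 * 1" by (intro mult_strict_mono) auto
    then have "cmod (Phi 0 (fst x) * cnj (Phi 0 (fst y))) < 1" by (simp add: norm_mult)
    then have "1 - Phi 0 (fst x) * cnj (Phi 0 (fst y)) \<noteq> 0" by auto
    then show "(1 - Phi 0 (fst x) * cnj (Phi 0 (fst y))) * K x y / (1 - Phi 0 (fst x) * cnj (Phi 0 (fst y))) = K x y"
      by simp
  qed (auto intro: cmod_Phi_less_1 IG)
  define a :: "complex \<times> complex \<times> complex \<Rightarrow> (complex \<times> complex) \<times> 'l \<Rightarrow> complex"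
    where "a Z x = (if Z = (0, fst x) then 1 else 0)" for Z x
  define m1 where "m1 Z W v u = (\<Sum>x\<in>I. \<Sum>y\<in>I. a Z x * a W y * K x y * cinner v (snd y) * cinner (snd x) u)"
    for Z W :: "complex \<times> complex \<times> complex" and v u :: 'l
  \<comment> \<open>\<phi> stands for each function in the definition of admissibility, and for 0;
    as \<open>m1\<close> lives on the points (0, z), only the values of \<phi> there matter.\<close>
  have m1_pos: "pos_on UNIV (\<lambda>p q. (1 - \<phi> (fst p) * cnj (\<phi> (fst q))) * m1 (fst p) (fst q) (snd q) (snd p))"
    if \<phi>K: "pos_on I (\<lambda>x y. (1 - \<phi> (0, fst x) * cnj (\<phi> (0, fst y))) * K x y)" for \<phi>
  proof -
    obtain e :: "(complex \<times> complex) \<times> 'l \<Rightarrow> ((complex \<times> complex) \<times> 'l) ell2"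
      where e: "\<And>x y. x \<in> I \<Longrightarrow> y \<in> I \<Longrightarrow> (1 - \<phi> (0, fst x) * cnj (\<phi> (0, fst y))) * K x y = cinner (e y) (e x)"
      using kolmogorov[OF \<phi>K] by blast
    define vec where "vec p = (\<Sum>x\<in>I. (a (fst p) x * cinner (snd p) (snd x)) *\<^sub>C e x)" for p
    have ca: "cnj (a Z x) = a Z x" for Z x by (simp add: a_def)
    have cc: "cnj (cinner u v) = cinner v u" for u v :: 'l by (rule cinner_commute[symmetric])
    show ?thesis
    proof (rule pos_on_cong[OF _ pos_on_gram[of _ vec]])
      fix p q
      have "cinner (vec q) (vec p) = (\<Sum>x\<in>I. \<Sum>y\<in>I. a (fst p) x * a (fst q) y * cinner (e y) (e x) * cinner (snd q) (snd y) * cinner (snd x) (snd p))"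
        unfolding vec_def cinner_sum_left cinner_sum_right cinner_scaleC_left cinner_scaleC_right
        by (simp add: cc ca sum_distrib_left mult_ac)
      also have "\<dots> = (\<Sum>x\<in>I. \<Sum>y\<in>I. (1 - \<phi> (fst p) * cnj (\<phi> (fst q))) * (a (fst p) x * a (fst q) y * K x y * cinner (snd q) (snd y) * cinner (snd x) (snd p)))"
        by (intro sum.cong refl) (simp add: a_def e[symmetric])
      finally show "cinner (vec q) (vec p) = (1 - \<phi> (fst p) * cnj (\<phi> (fst q))) * m1 (fst p) (fst q) (snd q) (snd p)"
        by (simp add: m1_def sum_distrib_left)
    qed
  qed
  \<comment> \<open>The identity kernel with respect to points. Multiplied by 1 - \<phi> conj \<phi>
    it keeps only the diagonal factors 1 - |\<phi>|^2, nonnegative as soon as |\<phi>| <= 1.\<close>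
  define m2 where "m2 Z W v u = (if Z = W then cinner v u else 0)"
    for Z W :: "complex \<times> complex \<times> complex" and v u :: 'l
  define R where "R = Re (\<Sum>x\<in>I. cinner (blinfun_apply (M (fst x) (fst x)) (snd x)) (snd x))"
  define s where "s = Re (\<Sum>x\<in>I. \<Sum>y\<in>I. cinner (blinfun_apply (M (fst x) (fst y)) (snd y)) (snd x) * K x y)"
  have main: "0 \<le> s + \<epsilon> * R" if \<epsilon>: "0 < \<epsilon>" for \<epsilon>
  proof -
    let ?m = "\<lambda>Z W v u. m1 Z W v u + complex_of_real \<epsilon> * m2 Z W v u"
    have "\<exists>T :: 'l \<Rightarrow>\<^sub>L 'l. T \<in> \<B> \<and> (\<forall>v u. cinner (blinfun_apply T v) u = ?m Z W v u)" for Z W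
    proof -
      have bd: "cmod (?m Z W v u) \<le> ((\<Sum>x\<in>I. \<Sum>y\<in>I. cmod (K x y)) + \<epsilon>) * norm v * norm u" for v u
      proof -
        have "cmod (a Z x * a W y * K x y * cinner v (snd y) * cinner (snd x) u) \<le> cmod (K x y) * (norm v * norm u)"
          if "x \<in> I" "y \<in> I" for x y
        proof -
          have "cmod (cinner v (snd y)) * cmod (cinner (snd x) u) \<le> norm v * norm u"
            using cinner_Cauchy_Schwarz[of v "snd y"] cinner_Cauchy_Schwarz[of "snd x" u] n1 that
            by (intro mult_mono) auto
          then have "cmod (K x y) * (cmod (cinner v (snd y)) * cmod (cinner (snd x) u)) \<le> cmod (K x y) * (norm v * norm u)"
            by (rule mult_left_mono) simp
          then show ?thesis by (simp add: a_def norm_mult mult.assoc)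
        qed
        then have "cmod (m1 Z W v u) \<le> (\<Sum>x\<in>I. \<Sum>y\<in>I. cmod (K x y) * (norm v * norm u))"
          unfolding m1_def by (intro sum_norm_le) auto
        moreover have "cmod (complex_of_real \<epsilon> * m2 Z W v u) \<le> \<epsilon> * (norm v * norm u)"
          using cinner_Cauchy_Schwarz[of v u] \<epsilon> by (auto simp: m2_def norm_mult intro!: mult_left_mono)
        ultimately have "cmod (?m Z W v u) \<le> (\<Sum>x\<in>I. \<Sum>y\<in>I. cmod (K x y) * (norm v * norm u)) + \<epsilon> * (norm v * norm u)"
          by (intro norm_triangle_mono)
        then show ?thesis by (simp add: sum_distrib_right distrib_right mult.assoc)
      qed
      have nn: "0 \<le> (\<Sum>x\<in>I. \<Sum>y\<in>I. cmod (K x y)) + \<epsilon>" using \<epsilon> by (intro add_nonneg_nonneg sum_nonneg) auto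
      obtain T :: "'l \<Rightarrow>\<^sub>L 'l" where "T \<in> \<B>" "\<And>v u. cinner (blinfun_apply T v) u = ?m Z W v u"
      proof (rule form_operator[OF nn bd])
        fix c v v' u u'
        show "?m Z W (v + v') u = ?m Z W v u + ?m Z W v' u" "?m Z W v (u + u') = ?m Z W v u + ?m Z W v u'"
          by (simp_all add: m1_def m2_def cinner_add_left cinner_add_right sum.distrib distrib_left distrib_right)
        show "?m Z W (c *\<^sub>C v) u = c * ?m Z W v u" "?m Z W v (c *\<^sub>C u) = cnj c * ?m Z W v u"
          by (simp_all add: m1_def m2_def cinner_scaleC_left cinner_scaleC_right sum_distrib_left distrib_left mult_ac)
      qed blast
      then show ?thesis by blast
    qed
    then obtain k :: "complex \<times> complex \<times> complex \<Rightarrow> complex \<times> complex \<times> complex \<Rightarrow> ('l \<Rightarrow>\<^sub>L 'l)"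
      where k: "\<And>Z W. k Z W \<in> \<B>" "\<And>Z W v u. cinner (blinfun_apply (k Z W) v) u = ?m Z W v u" by metis
    have family: "psd_on pentablock (\<lambda>Z W. (1 - \<phi> Z * cnj (\<phi> W)) *\<^sub>C k Z W)"
      if \<phi>: "\<And>Z. Z \<in> pentablock \<Longrightarrow> cmod (\<phi> Z) \<le> 1"
        and \<phi>K: "pos_on I (\<lambda>x y. (1 - \<phi> (0, fst x) * cnj (\<phi> (0, fst y))) * K x y)" for \<phi>
    proof (rule psd_onI)
      let ?S = "pentablock \<times> (UNIV :: 'l set)"
      have "pos_on ?S (\<lambda>p q. (1 - \<phi> (fst p) * cnj (\<phi> (fst q))) * m1 (fst p) (fst q) (snd q) (snd p))"
        by (rule pos_on_subset[OF m1_pos[OF \<phi>K]]) simp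
      moreover have "pos_on ?S (\<lambda>p q. (1 - \<phi> (fst p) * cnj (\<phi> (fst q))) * (complex_of_real \<epsilon> * m2 (fst p) (fst q) (snd q) (snd p)))"
      proof -
        define r where "r p = complex_of_real (sqrt (1 - (cmod (\<phi> (fst p)))\<^sup>2))" for p :: "(complex \<times> complex \<times> complex) \<times> 'l"
        \<comment> \<open>The tensors of \<open>edelta z\<close> with v are Gram vectors of
          \<open>m2\<close>; the congruence by r inserts the factor 1 - |\<phi>|^2.\<close>
        have "pos_on ?S (\<lambda>p q. r p * cnj (r q) * cinner (edelta (fst q) \<otimes>\<^sub>h snd q) (edelta (fst p) \<otimes>\<^sub>h snd p))"
          by (rule pos_on_congruence) (rule pos_on_gram)
        from pos_on_scaleR[OF this, of \<epsilon>]
        have A: "pos_on ?S (\<lambda>p q. complex_of_real \<epsilon> * (r p * cnj (r q) * cinner (edelta (fst q) \<otimes>\<^sub>h snd q) (edelta (fst p) \<otimes>\<^sub>h snd p)))"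
          using \<epsilon> by simp
        show ?thesis
        proof (rule pos_on_cong[OF _ A])
          fix p q assume p: "p \<in> ?S" "q \<in> ?S"
          have "r p * r p = 1 - \<phi> (fst p) * cnj (\<phi> (fst p))"
            unfolding complex_norm_square[symmetric] of_real_mult[symmetric] r_def
            using \<phi>[of "fst p"] p by (simp add: power_le_one mem_Times_iff)
          moreover have "cnj (r p) = r p" by (simp add: r_def)
          moreover have "r q = r p" if "fst p = fst q" using that by (simp add: r_def)
          ultimately show "complex_of_real \<epsilon> * (r p * cnj (r q) * cinner (edelta (fst q) \<otimes>\<^sub>h snd q) (edelta (fst p) \<otimes>\<^sub>h snd p))
            = (1 - \<phi> (fst p) * cnj (\<phi> (fst q))) * (complex_of_real \<epsilon> * m2 (fst p) (fst q) (snd q) (snd p))"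
            by (cases "fst p = fst q") (auto simp: cinner_otimes cinner_edelta edelta.rep_eq m2_def)
        qed
      qed
      ultimately have "pos_on ?S (\<lambda>p q. (1 - \<phi> (fst p) * cnj (\<phi> (fst q))) * m1 (fst p) (fst q) (snd q) (snd p)
          + (1 - \<phi> (fst p) * cnj (\<phi> (fst q))) * (complex_of_real \<epsilon> * m2 (fst p) (fst q) (snd q) (snd p)))" by (rule pos_on_add)
      then show "pos_on ?S (\<lambda>p q. cinner (blinfun_apply ((1 - \<phi> (fst p) * cnj (\<phi> (fst q))) *\<^sub>C k (fst p) (fst q)) (snd q)) (snd p))"
        by (simp add: scaleC_blinfun.rep_eq cinner_scaleC_left k(2) distrib_left)
    qed
    have "admissible_kernel k"
      unfolding admissible_kernel_def op_kernel_def weak_kernel_def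
    proof (intro conjI ballI)
      \<comment> \<open>The constant \<phi> = 0 gives the kernel itself.\<close>
      show "psd_on pentablock k"
        using family[of "\<lambda>_. 0"] K0 by (simp add: scaleC_one)
    next
      fix Z :: "complex \<times> complex \<times> complex"
      have "0 \<le> m1 Z Z b0 b0" using pos_on_diag[OF m1_pos[of "\<lambda>_. 0"], of "(Z, b0)"] K0 by simp
      then have "m1 Z Z b0 b0 + complex_of_real \<epsilon> * m2 Z Z b0 b0 \<noteq> 0"
        using \<epsilon> by (auto simp: m2_def cinner_self b0 less_eq_complex_def complex_eq_iff)
      then show "k Z Z \<noteq> 0" using k(2)[of Z Z b0 b0] by auto
    next
      fix \<alpha> :: complex assume "\<alpha> \<in> cball 0 1"
      then have \<alpha>: "cmod \<alpha> \<le> 1" by simp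
      show "psd_on pentablock (\<lambda>z w. (1 - fst (snd z) * cnj (fst (snd w)) / 4) *\<^sub>C k z w)"
        using family[of "\<lambda>z. Phi 0 (snd z)"] KPhi[of 0] cmod_Phi_less_1[OF snd_pentablock, of _ 0]
        by (simp add: Phi_0 less_imp_le)
      show "psd_on pentablock (\<lambda>z w. (1 - Phi \<alpha> (snd z) * cnj (Phi \<alpha> (snd w))) *\<^sub>C k z w)"
        using family[of "\<lambda>z. Phi \<alpha> (snd z)"] KPhi[OF \<alpha>] cmod_Phi_less_1[OF snd_pentablock \<alpha>] by (simp add: less_imp_le)
      show "psd_on pentablock (\<lambda>z w. (1 - psi \<alpha> z * cnj (psi \<alpha> w)) *\<^sub>C k z w)"
        using family[of "psi \<alpha>"] K0 cmod_psi_le_1[OF _ \<alpha>] by (simp add: psi_zero)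
    qed (rule k(1))
    define g where "g x = (0 :: complex, fst x)" for x :: "(complex \<times> complex) \<times> 'l"
    have entry: "cinner (blinfun_apply (k (g x') (g y')) (snd y')) (snd x') = K x' y' + complex_of_real \<epsilon> * (if x' = y' then 1 else 0)"
      if xy: "x' \<in> I" "y' \<in> I" for x' y'
    proof -
      have ort: "cinner (snd x) (snd y) = (if snd x = snd y then 1 else 0)" if "x \<in> I" "y \<in> I" for x y
        by (rule orthonormal_cinner[OF orthonormal_onb]) (use IG that in auto)
      have "m1 (g x') (g y') (snd y') (snd x') = (\<Sum>x\<in>I. \<Sum>y\<in>I. (if x = x' then 1 else 0) * (if y = y' then 1 else 0) * K x y)"
        unfolding m1_def by (intro sum.cong refl) (auto simp: a_def g_def ort xy prod_eq_iff)
      also have "\<dots> = (\<Sum>x\<in>I. if x = x' then (\<Sum>y\<in>I. if y = y' then K x y else 0) else 0)"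
        by (intro sum.cong refl) (auto intro: sum.cong)
      also have "\<dots> = K x' y'" using xy I(1) by simp
      finally have "m1 (g x') (g y') (snd y') (snd x') = K x' y'" .
      moreover have "m2 (g x') (g y') (snd y') (snd x') = (if x' = y' then 1 else 0)"
        by (auto simp: m2_def g_def ort xy prod_eq_iff)
      ultimately show ?thesis by (simp add: k(2))
    qed
    define t where "t x y = cinner (blinfun_apply (M (fst x) (fst y)) (snd y)) (snd x) * cinner (blinfun_apply (k (g x) (g y)) (snd y)) (snd x)" for x y
    let ?F = "g ` I"
    \<comment> \<open>Several x may share a point, so the vector at Z collects all b \<otimes> b
      over it; the first factor extracts the entry of M, the second that of k.\<close>
    define X where "X Z = (\<Sum>x\<in>{x \<in> I. g x = Z}. snd x \<otimes>\<^sub>h snd x)" for Z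
    have gP: "?F \<subseteq> pentablock" using P by (auto simp: g_def)
    have "block_psd ?F (\<lambda>z w. M (snd z) (snd w) \<otimes>\<^sub>o k z w)"
      by (rule pos) (use I(1) gP \<open>admissible_kernel k\<close> in auto)
    then have "0 \<le> (\<Sum>Z\<in>?F. \<Sum>W\<in>?F. cinner (blinfun_apply (M (snd Z) (snd W) \<otimes>\<^sub>o k Z W) (X W)) (X Z))"
      unfolding block_psd_def by blast
    also have "\<dots> = (\<Sum>Z\<in>?F. \<Sum>W\<in>?F. \<Sum>x\<in>{x \<in> I. g x = Z}. \<Sum>y\<in>{y \<in> I. g y = W}. t x y)"
    proof (intro sum.cong refl)
      fix Z W assume Z: "Z \<in> ?F" "W \<in> ?F"
      have "M (snd Z) (snd W) \<in> \<B>" using Z IG by (intro M) (auto simp: g_def)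
      note ot = op_tensor_otimes[OF this k(1)]
      show "cinner (blinfun_apply (M (snd Z) (snd W) \<otimes>\<^sub>o k Z W) (X W)) (X Z)
        = (\<Sum>x\<in>{x \<in> I. g x = Z}. \<Sum>y\<in>{y \<in> I. g y = W}. t x y)"
        unfolding X_def blinfun.sum_right cinner_sum_left cinner_sum_right ot cinner_otimes t_def
        by (intro sum.cong refl) (auto simp: g_def)
    qed
    also have "\<dots> = (\<Sum>Z\<in>?F. \<Sum>x\<in>{x \<in> I. g x = Z}. \<Sum>W\<in>?F. \<Sum>y\<in>{y \<in> I. g y = W}. t x y)"
      by (intro sum.cong refl sum.swap)
    also have "\<dots> = (\<Sum>x\<in>I. \<Sum>y\<in>I. t x y)"
      using I(1) by (simp add: sum.group)
    also have "\<dots> = (\<Sum>x\<in>I. \<Sum>y\<in>I. cinner (blinfun_apply (M (fst x) (fst y)) (snd y)) (snd x) * K x y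
      + (if x = y then complex_of_real \<epsilon> * cinner (blinfun_apply (M (fst x) (fst x)) (snd x)) (snd x) else 0))"
      by (intro sum.cong refl) (simp add: t_def entry distrib_left)
    also have "\<dots> = (\<Sum>x\<in>I. \<Sum>y\<in>I. cinner (blinfun_apply (M (fst x) (fst y)) (snd y)) (snd x) * K x y)
      + complex_of_real \<epsilon> * (\<Sum>x\<in>I. cinner (blinfun_apply (M (fst x) (fst x)) (snd x)) (snd x))"
      using I(1) by (simp add: sum.distrib sum_distrib_left)
    finally have "0 \<le> Re \<dots>" by (simp add: less_eq_complex_def del: Re_sum)
    then show ?thesis by (simp add: s_def R_def del: Re_sum)
  qed
  have "0 \<le> s"
  proof (rule ccontr)
    assume "\<not> 0 \<le> s"
    then have s: "s < 0" by simp
    \<comment> \<open>Small enough that \<epsilon> R <= - s / 2, which contradicts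
      \<open>main\<close> for negative s.\<close>
    define \<epsilon> where "\<epsilon> = - s / (2 * (\<bar>R\<bar> + 1))"
    have "0 < \<epsilon>" unfolding \<epsilon>_def by (rule divide_pos_pos) (use s in auto)
    moreover have "\<epsilon> * R \<le> \<epsilon> * (\<bar>R\<bar> + 1)" using \<open>0 < \<epsilon>\<close> by (intro mult_left_mono) auto
    moreover have "\<epsilon> * (\<bar>R\<bar> + 1) = - s / 2" by (simp add: \<epsilon>_def field_simps)
    ultimately show False using main[of \<epsilon>] s by linarith
  qed
  then show ?thesis by (simp only: s_def)
qed simp

section \<open>Operators from their entries in an orthonormal basis\<close>

lemma onb_eqI:
  fixes x y :: "'l::chilbert_space"
  assumes "\<And>b. b \<in> onb \<Longrightarrow> cinner x b = cinner y b"
  shows "x = y"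
proof -
  have "\<forall>b\<in>onb. cinner (x - y) b = 0" using assms by (simp add: cinner_diff_left)
  then have "x - y = 0" using is_onb_onb[where 'a = 'l] unfolding is_onb_def by blast
  then show ?thesis by simp
qed

lemma operator_onb_eqI:
  fixes A B :: "'l::chilbert_space \<Rightarrow>\<^sub>L 'l"
  assumes AB: "A \<in> \<B>" "B \<in> \<B>"
    and eq: "\<And>b c. b \<in> onb \<Longrightarrow> c \<in> onb \<Longrightarrow> cinner (blinfun_apply A c) b = cinner (blinfun_apply B c) b"
  shows "A = B"
proof (rule blinfun_eqI)
  fix x
  have on: "blinfun_apply A c = blinfun_apply B c" if "c \<in> onb" for c by (rule onb_eqI) (rule eq[OF _ that])
  have "blinfun_apply (A\<^sup>\<star>) y = blinfun_apply (B\<^sup>\<star>) y" for y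
    by (rule onb_eqI) (simp add: cinner_cadjoint' AB on)
  then have h: "cinner (blinfun_apply A x) y = cinner (blinfun_apply B x) y" for y
    by (simp add: cinner_cadjoint AB)
  have "cinner (blinfun_apply A x - blinfun_apply B x) (blinfun_apply A x - blinfun_apply B x) = 0"
    unfolding cinner_diff_left h by simp
  then show "blinfun_apply A x = blinfun_apply B x" by simp
qed

text \<open>\<open>contraction_pairing\<close> with the vectors a x scaled by r; for r = 0 all b x
  vanish and T = 0 serves.\<close>

lemma bounded_pairing:
  fixes a :: "'i \<Rightarrow> 'h::chilbert_space" and b :: "'i \<Rightarrow> 'k::chilbert_space"
  assumes r: "0 \<le> r" and ab: "\<And>F c. finite F \<Longrightarrow> F \<subseteq> S \<Longrightarrow> norm (\<Sum>x\<in>F. c x *\<^sub>C b x) \<le> r * norm (\<Sum>x\<in>F. c x *\<^sub>C a x)"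
  shows "\<exists>T :: 'k \<Rightarrow>\<^sub>L 'h. T \<in> \<B> \<and> norm T \<le> r \<and> (\<forall>x\<in>S. \<forall>y. cinner (blinfun_apply T y) (a x) = cinner y (b x))"
proof (cases "r = 0")
  case True
  have "b x = 0" if "x \<in> S" for x using ab[of "{x}" "\<lambda>_. 1"] that True by (simp add: scaleC_one)
  then show ?thesis using r by (intro exI[of _ 0]) (simp add: cbounded_def)
next
  case False
  then have r: "0 < r" using r by simp
  obtain T :: "'k \<Rightarrow>\<^sub>L 'h" where T: "T \<in> \<B>" "norm T \<le> 1"
    "\<And>x y. x \<in> S \<Longrightarrow> cinner (blinfun_apply T y) (complex_of_real r *\<^sub>C a x) = cinner y (b x)"
  proof (rule contraction_pairing[of S b "\<lambda>x. complex_of_real r *\<^sub>C a x"])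
    fix F c assume F: "finite F" "F \<subseteq> S"
    have "(\<Sum>x\<in>F. c x *\<^sub>C complex_of_real r *\<^sub>C a x) = complex_of_real r *\<^sub>C (\<Sum>x\<in>F. c x *\<^sub>C a x)"
      by (simp add: scaleC_sum_right scaleC_scaleC mult.commute)
    then show "norm (\<Sum>x\<in>F. c x *\<^sub>C b x) \<le> norm (\<Sum>x\<in>F. c x *\<^sub>C complex_of_real r *\<^sub>C a x)"
      using ab[OF F, of c] r by (simp add: norm_scaleC)
  qed blast
  show ?thesis
  proof (intro exI[of _ "complex_of_real r *\<^sub>C T"] conjI ballI allI)
    show "complex_of_real r *\<^sub>C T \<in> \<B>" by (rule scaleC_in_B[OF T(1)])
    show "norm (complex_of_real r *\<^sub>C T) \<le> r" using T(2) r by (simp add: norm_scaleC)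
    fix x y assume "x \<in> S"
    then show "cinner (blinfun_apply (complex_of_real r *\<^sub>C T) y) (a x) = cinner y (b x)"
      using T(3)[of x y] by (simp add: scaleC_blinfun.rep_eq cinner_scaleC_left cinner_scaleC_right)
  qed
qed

text \<open>Only entries with respect to \<open>onb\<close> are available. The mass bound makes b ->
  e ((z, b), h) extend to a bounded operator, whose adjoint is T z h. The product of T z g with the
  adjoint of T w h then has the entries of \<mu> at g conj h, which gives boundedness and complete
  positivity together.\<close>

lemma cp_form_kernel:
  fixes \<mu> :: "'z \<times> 'l::chilbert_space \<Rightarrow> 'z \<times> 'l \<Rightarrow> (cdisc \<Rightarrow>\<^sub>C complex) \<Rightarrow> complex"
  assumes \<mu>: "cp_form \<mu>"
    and bd: "\<And>z. z \<in> Z \<Longrightarrow> \<exists>C\<ge>0. \<forall>F c. finite F \<and> F \<subseteq> onb \<longrightarrow>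
      Re (\<Sum>b\<in>F. \<Sum>b'\<in>F. cnj (c b) * c b' * \<mu> (z, b) (z, b') (const_bcontfun 1)) \<le> (C * norm (\<Sum>b\<in>F. c b *\<^sub>C b))\<^sup>2"
  obtains \<eta> where "cp_kernel Z \<eta>"
    "\<And>z w b c h. z \<in> Z \<Longrightarrow> w \<in> Z \<Longrightarrow> b \<in> onb \<Longrightarrow> c \<in> onb \<Longrightarrow>
      cinner (blinfun_apply (blinfun_apply (\<eta> z w) h) c) b = \<mu> (z, b) (w, c) h"
proof -
  let ?one = "const_bcontfun 1 :: cdisc \<Rightarrow>\<^sub>C complex"
  obtain C where C: "\<And>z. z \<in> Z \<Longrightarrow> 0 \<le> C z"
    "\<And>z F c. z \<in> Z \<Longrightarrow> finite F \<Longrightarrow> F \<subseteq> onb \<Longrightarrow>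
      Re (\<Sum>b\<in>F. \<Sum>b'\<in>F. cnj (c b) * c b' * \<mu> (z, b) (z, b') ?one) \<le> (C z * norm (\<Sum>b\<in>F. c b *\<^sub>C b))\<^sup>2"
  proof -
    define C where "C z = (SOME C. 0 \<le> C \<and> (\<forall>F c. finite F \<and> F \<subseteq> onb \<longrightarrow>
      Re (\<Sum>b\<in>F. \<Sum>b'\<in>F. cnj (c b) * c b' * \<mu> (z, b) (z, b') ?one) \<le> (C * norm (\<Sum>b\<in>F. c b *\<^sub>C b))\<^sup>2))" for z
    have "0 \<le> C z \<and> (\<forall>F c. finite F \<and> F \<subseteq> onb \<longrightarrow>
      Re (\<Sum>b\<in>F. \<Sum>b'\<in>F. cnj (c b) * c b' * \<mu> (z, b) (z, b') ?one) \<le> (C z * norm (\<Sum>b\<in>F. c b *\<^sub>C b))\<^sup>2)" if "z \<in> Z" for z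
      unfolding C_def by (rule someI_ex) (rule bd[OF that])
    then show ?thesis by (intro that[of C]) blast+
  qed
  obtain e :: "('z \<times> 'l) \<times> (cdisc \<Rightarrow>\<^sub>C complex) \<Rightarrow> (('z \<times> 'l) \<times> (cdisc \<Rightarrow>\<^sub>C complex)) ell2"
    where e: "\<And>p q. p \<in> UNIV \<Longrightarrow> q \<in> UNIV \<Longrightarrow> \<mu> (fst p) (fst q) (times_cnj (snd p) (snd q)) = cinner (e q) (e p)"
    using kolmogorov[OF cp_formD(3)[OF \<mu>]] by blast
  have ee: "cinner (e (y, h)) (e (x, g)) = \<mu> x y (times_cnj g h)" for x y g h
    using e[of "(x, g)" "(y, h)"] by simp
  have ext: "\<exists>T :: _ \<Rightarrow>\<^sub>L 'l. T \<in> \<B> \<and> norm T \<le> C z * norm h \<and> (\<forall>b\<in>onb. \<forall>y. cinner (blinfun_apply T y) b = cinner y (e ((z, b), h)))"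
    if z: "z \<in> Z" for z h
  proof (rule bounded_pairing[of "C z * norm h" onb "\<lambda>b. e ((z, b), h)" "\<lambda>b. b"])
    fix F :: "'l set" and c assume F: "finite F" "F \<subseteq> onb"
    \<comment> \<open>For fixed coefficients the quadratic form is a positive functional of the
      function, so its value at h conj h is at most |h|^2 times its value at 1.\<close>
    define \<phi> where "\<phi> g = (\<Sum>b\<in>F. \<Sum>b'\<in>F. cnj (c b) * c b' * \<mu> (z, b) (z, b') g)" for g
    have ne: "\<phi> (times_cnj g g) = complex_of_real ((norm (\<Sum>b\<in>F. c b *\<^sub>C e ((z, b), g)))\<^sup>2)" for g
      unfolding \<phi>_def norm_sum_scaleC_sq[symmetric] ee by simp
    have "\<phi> (times_cnj h h) \<le> complex_of_real ((norm h)\<^sup>2) * \<phi> ?one"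
    proof (rule positive_functional_le)
      show "0 \<le> \<phi> (times_cnj k k)" for k unfolding ne by (simp add: less_eq_complex_def)
    qed (simp_all add: \<phi>_def cp_formD(1,2)[OF \<mu>] distrib_left sum.distrib sum_distrib_left mult_ac cmod_apply_bcontfun_le)
    then have "(norm (\<Sum>b\<in>F. c b *\<^sub>C e ((z, b), h)))\<^sup>2 \<le> (norm h)\<^sup>2 * Re (\<phi> ?one)"
      unfolding ne by (simp add: less_eq_complex_def)
    also have "\<dots> \<le> (norm h)\<^sup>2 * (C z * norm (\<Sum>b\<in>F. c b *\<^sub>C b))\<^sup>2"
      using C(2)[OF z F, of c] by (intro mult_left_mono) (simp_all add: \<phi>_def del: Re_sum)
    also have "\<dots> = (C z * norm h * norm (\<Sum>b\<in>F. c b *\<^sub>C b))\<^sup>2" by (simp add: power_mult_distrib mult_ac)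
    finally show "norm (\<Sum>b\<in>F. c b *\<^sub>C e ((z, b), h)) \<le> C z * norm h * norm (\<Sum>b\<in>F. c b *\<^sub>C b)"
      by (rule power2_le_imp_le) (use C(1)[OF z] in simp)
  qed (use C(1)[OF z] in simp)
  define T where "T z h = (SOME T :: _ \<Rightarrow>\<^sub>L 'l. T \<in> \<B> \<and> norm T \<le> C z * norm h \<and>
    (\<forall>b\<in>onb. \<forall>y. cinner (blinfun_apply T y) b = cinner y (e ((z, b), h))))" for z h
  have "T z h \<in> \<B> \<and> norm (T z h) \<le> C z * norm h \<and>
    (\<forall>b\<in>onb. \<forall>y. cinner (blinfun_apply (T z h) y) b = cinner y (e ((z, b), h)))" if "z \<in> Z" for z h
    unfolding T_def by (rule someI_ex) (rule ext[OF that])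
  then have T: "T z h \<in> \<B>" "norm (T z h) \<le> C z * norm h"
    "\<And>b y. b \<in> onb \<Longrightarrow> cinner (blinfun_apply (T z h) y) b = cinner y (e ((z, b), h))" if "z \<in> Z" for z h
    using that by blast+
  have Tadj: "blinfun_apply ((T z h)\<^sup>\<star>) c = e ((z, c), h)" if "z \<in> Z" "c \<in> onb" for z h c
    by (rule cinner_eqI) (simp add: cinner_cadjoint[symmetric] T that)
  have prod_entry: "cinner (blinfun_apply (T z g o\<^sub>L (T w h)\<^sup>\<star>) c) b = \<mu> (z, b) (w, c) (times_cnj g h)"
    if "z \<in> Z" "w \<in> Z" "b \<in> onb" "c \<in> onb" for z w g h b c
    by (simp add: T(3) Tadj that ee)
  \<comment> \<open>h is read as h times the conjugate of 1; with h in the left factor E is linear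
    in h.\<close>
  define E where "E z w h = T z h o\<^sub>L (T w ?one)\<^sup>\<star>" for z w h
  have EB: "E z w h \<in> \<B>" if "z \<in> Z" "w \<in> Z" for z w h
    unfolding E_def by (intro compose_in_B cadjoint_cbounded T that)
  have E_entry: "cinner (blinfun_apply (E z w h) c) b = \<mu> (z, b) (w, c) h"
    if "z \<in> Z" "w \<in> Z" "b \<in> onb" "c \<in> onb" for z w h b c
    unfolding E_def prod_entry[OF that] times_cnj_one_right ..
  have E_add: "E z w (g + h) = E z w g + E z w h" if "z \<in> Z" "w \<in> Z" for z w g h
    by (rule operator_onb_eqI)
      (simp_all add: EB that add_in_B E_entry blinfun.add_left cinner_add_left cp_formD(1)[OF \<mu>])
  have E_sc: "E z w (c *\<^sub>C h) = c *\<^sub>C E z w h" if "z \<in> Z" "w \<in> Z" for z w c h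
    by (rule operator_onb_eqI)
      (simp_all add: EB that scaleC_in_B E_entry scaleC_blinfun.rep_eq cinner_scaleC_left cp_formD(2)[OF \<mu>])
  have E_bl: "bounded_linear (E z w)" if zw: "z \<in> Z" "w \<in> Z" for z w
  proof (rule bounded_linear_intro[of _ "C z * norm ((T w ?one)\<^sup>\<star>)"])
    fix h
    have "norm (E z w h) \<le> norm (T z h) * norm ((T w ?one)\<^sup>\<star>)" unfolding E_def by (rule norm_blinfun_compose)
    also have "\<dots> \<le> C z * norm h * norm ((T w ?one)\<^sup>\<star>)" by (intro mult_right_mono T zw) simp
    finally show "norm (E z w h) \<le> norm h * (C z * norm ((T w ?one)\<^sup>\<star>))" by (simp add: mult_ac)
  qed (simp_all add: E_add E_sc zw scaleR_scaleC)
  define \<eta> where "\<eta> z w = Blinfun (E z w)" for z w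
  have \<eta>: "blinfun_apply (\<eta> z w) = E z w" if "z \<in> Z" "w \<in> Z" for z w
    unfolding \<eta>_def by (rule bounded_linear_Blinfun_apply[OF E_bl[OF that]])
  show ?thesis
  proof (rule that[of \<eta>])
    show "cp_kernel Z \<eta>"
      unfolding cp_kernel_def
    proof (intro conjI ballI allI impI)
      fix z w h assume "z \<in> Z" "w \<in> Z"
      then show "blinfun_apply (\<eta> z w) h \<in> \<B>" by (simp add: \<eta> EB)
    next
      fix z w assume "z \<in> Z" "w \<in> Z"
      then show "\<eta> z w \<in> \<B>" unfolding cbounded_def by (simp add: \<eta> E_sc)
    next
      fix n :: nat and z h and v :: "nat \<Rightarrow> 'l" assume z: "\<forall>i<n. z i \<in> Z"
      define f where "f i = blinfun_apply ((T (z i) (h i))\<^sup>\<star>) (v i)" for i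
      have "(\<Sum>i<n. \<Sum>j<n. cinner (blinfun_apply (blinfun_apply (\<eta> (z i) (z j)) (times_cnj (h i) (h j))) (v j)) (v i))
        = (\<Sum>i<n. \<Sum>j<n. cinner (f j) (f i))"
      proof (intro sum.cong refl)
        fix i j assume "i \<in> {..<n}" "j \<in> {..<n}"
        then have zz: "z i \<in> Z" "z j \<in> Z" using z by auto
        have "E (z i) (z j) (times_cnj (h i) (h j)) = T (z i) (h i) o\<^sub>L (T (z j) (h j))\<^sup>\<star>"
          by (rule operator_onb_eqI[OF EB[OF zz] compose_in_B[OF T(1)[OF zz(1)] cadjoint_cbounded[OF T(1)[OF zz(2)]]]])
            (simp only: E_entry prod_entry zz)
        then show "cinner (blinfun_apply (blinfun_apply (\<eta> (z i) (z j)) (times_cnj (h i) (h j))) (v j)) (v i) = cinner (f j) (f i)"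
          by (simp add: \<eta> zz f_def cinner_cadjoint T)
      qed
      also have "\<dots> = cinner (\<Sum>j<n. f j) (\<Sum>i<n. f i)"
        unfolding cinner_sum_left cinner_sum_right ..
      finally show "0 \<le> (\<Sum>i<n. \<Sum>j<n. cinner (blinfun_apply (blinfun_apply (\<eta> (z i) (z j)) (times_cnj (h i) (h j))) (v j)) (v i))"
        by (simp add: cinner_self less_eq_complex_def)
    qed
    fix z w h and b c :: 'l assume "z \<in> Z" "w \<in> Z" "b \<in> onb" "c \<in> onb"
    then show "cinner (blinfun_apply (blinfun_apply (\<eta> z w) h) c) b = \<mu> (z, b) (w, c) h"
      by (simp add: \<eta> E_entry)
  qed
qed

text \<open>The mass bound for \<open>cp_form_kernel\<close> comes from the identity itself: the
  mass at z is at most the defect value divided by 1 - m^2, and the defect value is at most the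
  squared norm of the adjoint of \<open>\<Upsilon>12 z\<close> applied to the vector, the
  \<open>\<Upsilon>32\<close> term being subtracted.\<close>

lemma positivity_imp_decomposition:
  fixes \<Upsilon>12 :: "complex \<times> complex \<Rightarrow> ('l1::chilbert_space \<Rightarrow>\<^sub>L 'l2::chilbert_space)"
    and \<Upsilon>32 :: "complex \<times> complex \<Rightarrow> ('l3::chilbert_space \<Rightarrow>\<^sub>L 'l2)"
  assumes \<Upsilon>12: "\<forall>z\<in>G2. \<Upsilon>12 z \<in> \<B>" and \<Upsilon>32: "\<forall>z\<in>G2. \<Upsilon>32 z \<in> \<B>"
    and pos: "\<And>F (k :: _ \<Rightarrow> _ \<Rightarrow> ('l2 \<Rightarrow>\<^sub>L 'l2)). finite F \<Longrightarrow> F \<subseteq> pentablock \<Longrightarrow> admissible_kernel k \<Longrightarrow>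
      block_psd F (\<lambda>z w. ((\<Upsilon>12 (snd z) o\<^sub>L (\<Upsilon>12 (snd w))\<^sup>\<star>) - (\<Upsilon>32 (snd z) o\<^sub>L (\<Upsilon>32 (snd w))\<^sup>\<star>)) \<otimes>\<^sub>o k z w)"
  obtains \<eta> where "cp_kernel pentablock \<eta>"
    "\<And>z w. z \<in> pentablock \<Longrightarrow> w \<in> pentablock \<Longrightarrow>
      (\<Upsilon>12 (snd z) o\<^sub>L (\<Upsilon>12 (snd w))\<^sup>\<star>) - (\<Upsilon>32 (snd z) o\<^sub>L (\<Upsilon>32 (snd w))\<^sup>\<star>)
        = blinfun_apply (\<eta> z w) (defect (smallj z) (smallj w))"
proof -
  define M where "M z w = (\<Upsilon>12 z o\<^sub>L (\<Upsilon>12 w)\<^sup>\<star>) - (\<Upsilon>32 z o\<^sub>L (\<Upsilon>32 w)\<^sup>\<star>)" for z w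
  have MB: "M z w \<in> \<B>" if "z \<in> G2" "w \<in> G2" for z w
    unfolding M_def using \<Upsilon>12 \<Upsilon>32 that by (intro diff_in_B compose_in_B cadjoint_cbounded) auto
  define a where "a z v = blinfun_apply ((\<Upsilon>12 z)\<^sup>\<star>) v" for z v
  define b where "b z v = blinfun_apply ((\<Upsilon>32 z)\<^sup>\<star>) v" for z v
  have Mab: "cinner (blinfun_apply (M z w) v) u = cinner (a w v) (a z u) - cinner (b w v) (b z u)" if "z \<in> G2" "w \<in> G2" for z w u v
    unfolding M_def a_def b_def by (rule cinner_defect) (use \<Upsilon>12 \<Upsilon>32 that in auto)
  define D where "D x y = cinner (blinfun_apply (M (fst x) (fst y)) (snd y)) (snd x)" for x y :: "(complex \<times> complex) \<times> 'l2"
  \<comment> \<open>\<open>smallj\<close> takes points of the pentablock, and (0, z) represents z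
    there.\<close>
  define J where "J x = smallj (0, fst x)" for x :: "(complex \<times> complex) \<times> 'l2"
  let ?S = "G2 \<times> (onb :: 'l2 set)"
  have P: "(0, z) \<in> pentablock" if "z \<in> G2" for z using zero_in_pentablock[of "fst z" "snd z"] that by simp
  have jm: "\<exists>m. 0 \<le> m \<and> m < 1 \<and> (\<forall>\<alpha>. cmod (apply_bcontfun (smallj (0, z)) \<alpha>) \<le> m)" if z: "z \<in> G2" for z
  proof -
    obtain l1 l2 m where l: "fst z = l1 + l2" "snd z = l1 * l2" "cmod l1 \<le> m" "cmod l2 \<le> m" "0 \<le> m" "m < 1"
      by (rule G2_E[OF z])
    have "cmod (apply_bcontfun (smallj (0, z)) \<alpha>) \<le> m" for \<alpha>
      unfolding apply_smallj[OF P[OF z]] using cmod_Phi_le[OF l(3,4,6) cmod_of_cdisc, of \<alpha>] l(1,2)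
      by (metis prod.collapse snd_conv)
    then show ?thesis using l by blast
  qed
  obtain \<mu> where \<mu>: "cp_form \<mu>" "\<And>x y. x \<in> ?S \<Longrightarrow> y \<in> ?S \<Longrightarrow> \<mu> x y (defect (J x) (J y)) = D x y"
  proof (rule cp_form_compactness[of ?S D J])
    fix I :: "((complex \<times> complex) \<times> 'l2) set" and \<epsilon> :: real assume I: "finite I" "I \<subseteq> ?S" and \<epsilon>: "0 < \<epsilon>"
    show "\<exists>\<mu>. cp_form \<mu> \<and> (\<forall>x y h. x \<notin> I \<or> y \<notin> I \<longrightarrow> \<mu> x y h = 0) \<and>
      (\<forall>x\<in>I. \<forall>y\<in>I. cmod (D x y - \<mu> x y (defect (J x) (J y))) \<le> \<epsilon>)"
    proof (rule cp_form_approximation[OF I(1), of D J \<epsilon>])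
      fix x y assume "x \<in> I" "y \<in> I"
      then have "fst x \<in> G2" "fst y \<in> G2" using I(2) by auto
      then show "D y x = cnj (D x y)"
        unfolding D_def by (simp add: Mab) (metis cinner_commute)
    next
      fix K assume "\<And>\<alpha>. pos_on I (\<lambda>x y. apply_bcontfun (defect (J x) (J y)) \<alpha> * K x y)"
      then show "0 \<le> Re (\<Sum>x\<in>I. \<Sum>y\<in>I. D x y * K x y)"
        unfolding D_def J_def by (intro positivity_imp_dual[OF MB _ I] pos[folded M_def])
    qed (use \<epsilon> in auto)
  next
    show "\<exists>m. 0 \<le> m \<and> m < 1 \<and> (\<forall>\<alpha>. cmod (apply_bcontfun (J x) \<alpha>) \<le> m)" if "x \<in> ?S" for x
      unfolding J_def by (rule jm) (use that in auto)
  qed blast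
  obtain \<eta> where \<eta>: "cp_kernel G2 \<eta>"
    "\<And>z w b c h. z \<in> G2 \<Longrightarrow> w \<in> G2 \<Longrightarrow> b \<in> onb \<Longrightarrow> c \<in> onb \<Longrightarrow>
      cinner (blinfun_apply (blinfun_apply (\<eta> z w) h) c) b = \<mu> (z, b) (w, c) h"
  proof (rule cp_form_kernel[OF \<mu>(1), of G2])
    fix z assume z: "z \<in> G2"
    obtain m where m: "0 \<le> m" "m < 1" "\<And>\<alpha>. cmod (apply_bcontfun (smallj (0, z)) \<alpha>) \<le> m" using jm[OF z] by blast
    have m2: "0 < 1 - m\<^sup>2" using m by (simp add: abs_square_less_1)
    define C where "C = norm ((\<Upsilon>12 z)\<^sup>\<star>) / sqrt (1 - m\<^sup>2)"
    have "Re (\<Sum>b\<in>F. \<Sum>b'\<in>F. cnj (c b) * c b' * \<mu> (z, b) (z, b') (const_bcontfun 1)) \<le> (C * norm (\<Sum>b\<in>F. c b *\<^sub>C b))\<^sup>2"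
      if F: "finite F" "F \<subseteq> onb" for F c
    proof -
      define \<phi> where "\<phi> g = (\<Sum>b\<in>F. \<Sum>b'\<in>F. cnj (c b) * c b' * \<mu> (z, b) (z, b') g)" for g
      have a_sum: "(\<Sum>v\<in>F. c v *\<^sub>C a z v) = a z (\<Sum>v\<in>F. c v *\<^sub>C v)"
        unfolding a_def blinfun.sum_right using \<Upsilon>12 z by (simp add: blinfun_cbounded_scaleC[OF cadjoint_cbounded])
      have "\<phi> (defect (smallj (0, z)) (smallj (0, z))) = (\<Sum>v\<in>F. \<Sum>v'\<in>F. cnj (c v) * c v' * (cinner (a z v') (a z v) - cinner (b z v') (b z v)))"
        unfolding \<phi>_def
      proof (intro sum.cong refl)
        fix v v' assume "v \<in> F" "v' \<in> F"
        then have "(z, v) \<in> ?S" "(z, v') \<in> ?S" using F(2) z by auto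
        from \<mu>(2)[OF this] show "cnj (c v) * c v' * \<mu> (z, v) (z, v') (defect (smallj (0, z)) (smallj (0, z)))
          = cnj (c v) * c v' * (cinner (a z v') (a z v) - cinner (b z v') (b z v))"
          by (simp add: J_def D_def Mab z)
      qed
      also have "\<dots> = complex_of_real ((norm (a z (\<Sum>v\<in>F. c v *\<^sub>C v)))\<^sup>2) - complex_of_real ((norm (\<Sum>v\<in>F. c v *\<^sub>C b z v))\<^sup>2)"
        unfolding right_diff_distrib sum_subtractf norm_sum_scaleC_sq a_sum ..
      finally have "Re (\<phi> (defect (smallj (0, z)) (smallj (0, z)))) \<le> (norm (a z (\<Sum>v\<in>F. c v *\<^sub>C v)))\<^sup>2" by simp
      also have "\<dots> \<le> (norm ((\<Upsilon>12 z)\<^sup>\<star>) * norm (\<Sum>v\<in>F. c v *\<^sub>C v))\<^sup>2"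
        unfolding a_def by (intro power_mono norm_blinfun) simp
      finally have le: "Re (\<phi> (defect (smallj (0, z)) (smallj (0, z)))) \<le> (norm ((\<Upsilon>12 z)\<^sup>\<star>) * norm (\<Sum>v\<in>F. c v *\<^sub>C v))\<^sup>2" .
      have "Re (\<phi> (const_bcontfun 1)) \<le> Re (\<phi> (defect (smallj (0, z)) (smallj (0, z)))) / (1 - m\<^sup>2)"
      proof (rule positive_functional_one_le[OF _ _ _ m(3) m(1,2)])
        show "0 \<le> \<phi> (times_cnj k k)" for k
          using pos_on_family[OF cp_formD(3)[OF \<mu>(1)], of F "\<lambda>v. ((z, v), k)" c] unfolding \<phi>_def by simp
      qed (simp_all add: \<phi>_def cp_formD(1,2)[OF \<mu>(1)] distrib_left sum.distrib sum_distrib_left mult_ac)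
      also have "\<dots> \<le> (norm ((\<Upsilon>12 z)\<^sup>\<star>) * norm (\<Sum>v\<in>F. c v *\<^sub>C v))\<^sup>2 / (1 - m\<^sup>2)"
        using le m2 by (intro divide_right_mono) auto
      also have "\<dots> = (C * norm (\<Sum>v\<in>F. c v *\<^sub>C v))\<^sup>2"
        using m2 by (simp add: C_def power_mult_distrib power_divide)
      finally show ?thesis by (simp only: \<phi>_def)
    qed
    moreover have "0 \<le> C" using m2 by (simp add: C_def)
    ultimately show "\<exists>C\<ge>0. \<forall>F c. finite F \<and> F \<subseteq> onb \<longrightarrow>
      Re (\<Sum>b\<in>F. \<Sum>b'\<in>F. cnj (c b) * c b' * \<mu> (z, b) (z, b') (const_bcontfun 1)) \<le> (C * norm (\<Sum>b\<in>F. c b *\<^sub>C b))\<^sup>2" by blast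
  qed blast
  show ?thesis
  proof (rule that[of "\<lambda>z w. \<eta> (snd z) (snd w)"])
    show "cp_kernel pentablock (\<lambda>z w. \<eta> (snd z) (snd w))"
      unfolding cp_kernel_def
    proof (intro conjI ballI allI impI)
      fix z w h assume "z \<in> pentablock" "w \<in> pentablock"
      then show "\<eta> (snd z) (snd w) \<in> \<B>" "blinfun_apply (\<eta> (snd z) (snd w)) h \<in> \<B>"
        using \<eta>(1) snd_pentablock unfolding cp_kernel_def by blast+
    next
      fix n :: nat and z h and v :: "nat \<Rightarrow> 'l2" assume "\<forall>i<n. z i \<in> pentablock"
      then have "\<forall>i<n. snd (z i) \<in> G2" using snd_pentablock by blast
      then show "0 \<le> (\<Sum>i<n. \<Sum>j<n. cinner (blinfun_apply (blinfun_apply (\<eta> (snd (z i)) (snd (z j))) (times_cnj (h i) (h j))) (v j)) (v i))"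
        using \<eta>(1)[unfolded cp_kernel_def, THEN conjunct2, THEN spec, THEN spec, THEN spec, THEN spec, THEN mp,
          of n "\<lambda>i. snd (z i)" h v] by simp
    qed
    fix z w assume z: "z \<in> pentablock" "w \<in> pentablock"
    have G: "snd z \<in> G2" "snd w \<in> G2" using z snd_pentablock by auto
    have s: "smallj z = smallj (0, snd z)" for z by (simp add: smallj_def)
    have "M (snd z) (snd w) = blinfun_apply (\<eta> (snd z) (snd w)) (defect (smallj z) (smallj w))"
    proof (rule operator_onb_eqI[OF MB[OF G]])
      show "blinfun_apply (\<eta> (snd z) (snd w)) (defect (smallj z) (smallj w)) \<in> \<B>"
        using \<eta>(1) G unfolding cp_kernel_def by blast
      fix b c :: 'l2 assume bc: "b \<in> onb" "c \<in> onb"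
      have "D (snd z, b) (snd w, c) = \<mu> (snd z, b) (snd w, c) (defect (smallj (0, snd z)) (smallj (0, snd w)))"
        using \<mu>(2)[of "(snd z, b)" "(snd w, c)"] G bc by (simp add: J_def)
      then show "cinner (blinfun_apply (M (snd z) (snd w)) c) b
        = cinner (blinfun_apply (blinfun_apply (\<eta> (snd z) (snd w)) (defect (smallj z) (smallj w))) c) b"
        unfolding \<eta>(2)[OF G bc] s[of z] s[of w] by (simp add: D_def)
    qed
    then show "(\<Upsilon>12 (snd z) o\<^sub>L (\<Upsilon>12 (snd w))\<^sup>\<star>) - (\<Upsilon>32 (snd z) o\<^sub>L (\<Upsilon>32 (snd w))\<^sup>\<star>)
        = blinfun_apply (\<eta> (snd z) (snd w)) (defect (smallj z) (smallj w))"
      unfolding M_def .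
  qed
qed

theorem theorem3p5:
  fixes \<Upsilon>12 :: "complex \<times> complex \<Rightarrow> ('l1::chilbert_space \<Rightarrow>\<^sub>L 'l2::chilbert_space)"
    and \<Upsilon>32 :: "complex \<times> complex \<Rightarrow> ('l3::chilbert_space \<Rightarrow>\<^sub>L 'l2)"
  assumes sep: "separable_space (euclidean :: 'l1 topology)"
      "separable_space (euclidean :: 'l2 topology)"
      "separable_space (euclidean :: 'l3 topology)"
    and \<Upsilon>12: "\<forall>z\<in>G2. \<Upsilon>12 z \<in> \<B>"
    and \<Upsilon>32: "\<forall>z\<in>G2. \<Upsilon>32 z \<in> \<B>"
  shows "let
      factorization = (\<exists>\<Upsilon>31 :: complex \<times> complex \<Rightarrow> ('l3 \<Rightarrow>\<^sub>L 'l1).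
        \<Upsilon>31 \<in> Hinf G2 \<and> sup_norm_on G2 \<Upsilon>31 \<le> 1 \<and>
        (\<forall>z\<in>G2. \<Upsilon>12 z o\<^sub>L \<Upsilon>31 z = \<Upsilon>32 z));
      positivity = (\<forall>F (k :: _ \<Rightarrow> _ \<Rightarrow> ('l2 \<Rightarrow>\<^sub>L 'l2)).
        finite F \<and> F \<subseteq> pentablock \<and> admissible_kernel k \<longrightarrow>
        block_psd F (\<lambda>z w.
          ((\<Upsilon>12 (snd z) o\<^sub>L (\<Upsilon>12 (snd w))\<^sup>\<star>) - (\<Upsilon>32 (snd z) o\<^sub>L (\<Upsilon>32 (snd w))\<^sup>\<star>)) \<otimes>\<^sub>o k z w));
      decomposition = (\<exists>\<xi> \<eta> (\<delta> :: _ \<Rightarrow> _ \<Rightarrow> ('l2 \<Rightarrow>\<^sub>L 'l2)).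
        cp_kernel pentablock \<xi> \<and> cp_kernel pentablock \<eta> \<and> weak_kernel pentablock \<delta> \<and>
        (\<forall>z\<in>pentablock. \<forall>w\<in>pentablock.
          (\<Upsilon>12 (snd z) o\<^sub>L (\<Upsilon>12 (snd w))\<^sup>\<star>) - (\<Upsilon>32 (snd z) o\<^sub>L (\<Upsilon>32 (snd w))\<^sup>\<star>) =
            blinfun_apply (\<xi> z w) (const_bcontfun 1 - times_cnj (bigJ z) (bigJ w))
            + blinfun_apply (\<eta> z w) (const_bcontfun 1 - times_cnj (smallj z) (smallj w))
            + (1 - fst (snd z) * cnj (fst (snd w)) / 4) *\<^sub>C \<delta> z w))
    in (factorization \<longleftrightarrow> positivity) \<and> (positivity \<longleftrightarrow> decomposition)"
proof -
  let ?fac = "\<exists>\<Upsilon>31 :: complex \<times> complex \<Rightarrow> ('l3 \<Rightarrow>\<^sub>L 'l1).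
    \<Upsilon>31 \<in> Hinf G2 \<and> sup_norm_on G2 \<Upsilon>31 \<le> 1 \<and> (\<forall>z\<in>G2. \<Upsilon>12 z o\<^sub>L \<Upsilon>31 z = \<Upsilon>32 z)"
  let ?pos = "\<forall>F (k :: _ \<Rightarrow> _ \<Rightarrow> ('l2 \<Rightarrow>\<^sub>L 'l2)). finite F \<and> F \<subseteq> pentablock \<and> admissible_kernel k \<longrightarrow>
    block_psd F (\<lambda>z w. ((\<Upsilon>12 (snd z) o\<^sub>L (\<Upsilon>12 (snd w))\<^sup>\<star>) - (\<Upsilon>32 (snd z) o\<^sub>L (\<Upsilon>32 (snd w))\<^sup>\<star>)) \<otimes>\<^sub>o k z w)"
  let ?dec = "\<exists>\<xi> \<eta> (\<delta> :: _ \<Rightarrow> _ \<Rightarrow> ('l2 \<Rightarrow>\<^sub>L 'l2)).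
    cp_kernel pentablock \<xi> \<and> cp_kernel pentablock \<eta> \<and> weak_kernel pentablock \<delta> \<and>
    (\<forall>z\<in>pentablock. \<forall>w\<in>pentablock.
      (\<Upsilon>12 (snd z) o\<^sub>L (\<Upsilon>12 (snd w))\<^sup>\<star>) - (\<Upsilon>32 (snd z) o\<^sub>L (\<Upsilon>32 (snd w))\<^sup>\<star>) =
        blinfun_apply (\<xi> z w) (defect (bigJ z) (bigJ w)) + blinfun_apply (\<eta> z w) (defect (smallj z) (smallj w))
        + (1 - fst (snd z) * cnj (fst (snd w)) / 4) *\<^sub>C \<delta> z w)"
  have "?pos" if ?fac
  proof (intro allI impI, elim conjE)
    fix F and k :: "_ \<Rightarrow> _ \<Rightarrow> ('l2 \<Rightarrow>\<^sub>L 'l2)" assume F: "finite F" "F \<subseteq> pentablock" "admissible_kernel k"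
    obtain \<Upsilon>31 :: "complex \<times> complex \<Rightarrow> ('l3 \<Rightarrow>\<^sub>L 'l1)" where H: "\<Upsilon>31 \<in> Hinf G2" "sup_norm_on G2 \<Upsilon>31 \<le> 1"
      "\<forall>z\<in>G2. \<Upsilon>12 z o\<^sub>L \<Upsilon>31 z = \<Upsilon>32 z" using \<open>?fac\<close> by blast
    \<comment> \<open>Boundedness, part of \<open>Hinf\<close>, makes the supremum an actual upper
      bound.\<close>
    obtain m where "\<forall>x\<in>\<Upsilon>31 ` G2. norm x \<le> m" using H(1) unfolding Hinf_def bounded_iff by blast
    then have "bdd_above ((\<lambda>z. norm (\<Upsilon>31 z)) ` G2)" by (intro bdd_aboveI2[of _ _ m]) auto
    then have "norm (\<Upsilon>31 z) \<le> sup_norm_on G2 \<Upsilon>31" if "z \<in> G2" for z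
      unfolding sup_norm_on_def by (rule cSUP_upper[OF that])
    then have "norm (\<Upsilon>31 z) \<le> 1" if "z \<in> G2" for z using H(2) that order_trans by blast
    then show "block_psd F (\<lambda>z w. ((\<Upsilon>12 (snd z) o\<^sub>L (\<Upsilon>12 (snd w))\<^sup>\<star>) - (\<Upsilon>32 (snd z) o\<^sub>L (\<Upsilon>32 (snd w))\<^sup>\<star>)) \<otimes>\<^sub>o k z w)"
      by (rule factorization_imp_positivity[OF \<Upsilon>12 \<Upsilon>32 H(1) _ H(3) F])
  qed
  moreover have "?dec" if ?pos
  proof (rule positivity_imp_decomposition[OF \<Upsilon>12 \<Upsilon>32])
    fix \<eta> assume "cp_kernel pentablock \<eta>" "\<And>z w. z \<in> pentablock \<Longrightarrow> w \<in> pentablock \<Longrightarrow>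
      (\<Upsilon>12 (snd z) o\<^sub>L (\<Upsilon>12 (snd w))\<^sup>\<star>) - (\<Upsilon>32 (snd z) o\<^sub>L (\<Upsilon>32 (snd w))\<^sup>\<star>)
        = blinfun_apply (\<eta> z w) (defect (smallj z) (smallj w))"
    then show ?dec
      by (intro exI[of _ "\<lambda>_ _. 0"] exI[of _ \<eta>])
        (simp add: cp_kernel_def[of _ "\<lambda>_ _. 0"] weak_kernel_def psd_on_def cbounded_def)
  qed (use \<open>?pos\<close> in blast)
  moreover have "?fac" if ?dec
  proof -
    obtain \<xi> \<eta> and \<delta> :: "_ \<Rightarrow> _ \<Rightarrow> ('l2 \<Rightarrow>\<^sub>L 'l2)" where d: "cp_kernel pentablock \<xi>" "cp_kernel pentablock \<eta>" "weak_kernel pentablock \<delta>"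
      "\<And>z w. z \<in> pentablock \<Longrightarrow> w \<in> pentablock \<Longrightarrow>
        (\<Upsilon>12 (snd z) o\<^sub>L (\<Upsilon>12 (snd w))\<^sup>\<star>) - (\<Upsilon>32 (snd z) o\<^sub>L (\<Upsilon>32 (snd w))\<^sup>\<star>) =
        blinfun_apply (\<xi> z w) (defect (bigJ z) (bigJ w)) + blinfun_apply (\<eta> z w) (defect (smallj z) (smallj w))
        + (1 - fst (snd z) * cnj (fst (snd w)) / 4) *\<^sub>C \<delta> z w" using \<open>?dec\<close> by blast
    show ?thesis
    proof (rule decomposition_imp_factorization[OF \<Upsilon>12 \<Upsilon>32 d])
      fix \<Upsilon>31 :: "complex \<times> complex \<Rightarrow> ('l3 \<Rightarrow>\<^sub>L 'l1)"
      assume H: "\<Upsilon>31 \<in> Hinf G2" "\<And>z. z \<in> G2 \<Longrightarrow> norm (\<Upsilon>31 z) \<le> 1" "\<And>z. z \<in> G2 \<Longrightarrow> \<Upsilon>12 z o\<^sub>L \<Upsilon>31 z = \<Upsilon>32 z"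
      \<comment> \<open>A least-upper-bound argument for the supremum requires a point of
        \<open>G2\<close>; the origin is one.\<close>
      have "(0 + 0, 0 * 0) \<in> G2" unfolding G2_def by (intro CollectI exI[of _ 0] conjI) auto
      then have "sup_norm_on G2 \<Upsilon>31 \<le> 1" unfolding sup_norm_on_def using H(2) by (intro cSUP_least) auto
      then show ?fac using H by blast
    qed
  qed
  ultimately show ?thesis unfolding Let_def by blast
qed

end
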